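(* Let $V=\mathbb{C}^{2n}$ be a symplectic vector space with symplectic form $\omega$, let $\mathfrak{g}=\mathfrak{sp}(V)=\mathfrak{sp}_{2n}$, and let $X^{nil}$ be the reduced subscheme $$X^{nil}:=\{(x,y,i)\in \mathfrak{g}\times\mathfrak{g}\times V:\ [x,y]+i^2=0 \text{ and } y \text{ is nilpotent}\}$$ of the almost commuting scheme $X\subseteq\mathfrak{g}\times\mathfrak{g}\times V$. (a) The scheme $X^{nil}$ is a complete intersection in $\mathfrak{g}\times\mathfrak{g}\times V$ of dimension $2n^2+2n$. The irreducible components of $X^{nil}$ are exactly given by the closures $\overline{X_\lambda}$ for $\lambda\in\mathcal{P}_n$. (b) With the natural symplectic structure on $\mathfrak{g}\times\mathfrak{g}\times V$, $X^{nil}$ is a Lagrangian subscheme of $\mathfrak{g}\times\mathfrak{g}\times V$.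
   Context: $\mathrm{Sym}^2(V)$ is identified with $\mathfrak{sp}(V)$, and for $i\in V$, $i^2$ is viewed in this way as an element of $\mathfrak{sp}(V)$; explicitly, it is the endomorphism $w\mapsto\frac12\,\omega(i,w)\,i$ of $V$. The almost commuting scheme $X$ is the closed subscheme of $\mathfrak{g}\times\mathfrak{g}\times V$ defined by the ideal generated by the matrix entries of $[x,y]+i^2$, i.e. by all functions $(x,y,i)\mapsto\lambda([x,y]+i^2)$ for $\lambda\in\mathfrak{g}^*$. The natural symplectic structure on $\mathfrak{g}\times\mathfrak{g}\times V$ is $\omega_1+\omega_2$, where $\omega_1$ is the symplectic form on $\mathfrak{g}\times\mathfrak{g}$ obtained by identifying it with $T^*\mathfrak{g}$ using the trace form on $\mathfrak{g}$ (explicitly, $\omega_1((x,y),(x',y'))=\mathrm{Tr}(yx')-\mathrm{Tr}(y'x)$), and $\omega_2=\omega$ is the symplectic form on $V$. Nilpotent conjugacy classes in $\mathfrak{g}$ are parametrized by the set $P_n$ of partitions $\lambda$ of $2n$ in which every odd part appears an even number of times; $\mathcal{N}_\lambda$ denotes the class corresponding to $\lambda\in P_n$. $\mathcal{P}_n\subseteq P_n$ is the subset of those partitions in which all the parts are even. For $\lambda\in P_n$, $X_\lambda:=\{(x,y,i)\in X^{nil}: y\in\mathcal{N}_\lambda\}$, and $\overline{X_\lambda}$ is the closure of $X_\lambda$ in $X^{nil}$. A (possibly singular) subscheme $Z$ of a symplectic variety $\mathcal{X}$ is said to be Lagrangian if at any smooth point $p$ of $Z$ the tangent space $T_pZ$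 is a Lagrangian subspace of $T_p\mathcal{X}$.
   Formalization: "Complete intersection" is proved for the scheme cut out by the equations [x,y]+i²=0 and charpoly(y)=t^{2n}, whose underlying set is X^nil; for the reduced structure the claim is false (for n=1 the radical ideal needs at least 7 generators in codimension 4). *)

theory Defs
  imports
    "HOL-Analysis.Analysis"
    "HOL-Computational_Algebra.Polynomial"
    "HOL-Algebra.Ideal"
begin

section \<open>Affine algebraic geometry in a complex vector space\<close>

text \<open>
  The ambient affine space \<open>W\<close> is a linear subspace of a complex vector space given by a type
  together with its scalar multiplication \<open>sc\<close>. Linear functionals on \<open>W\<close> extend to the whole
  type, so the regular functions on \<open>W\<close> are the restrictions of the polynomial functions below.
\<close>

inductive polyfun :: "(complex \<Rightarrow> 'p::ab_group_add \<Rightarrow> 'p) \<Rightarrow> ('p \<Rightarrow> complex) \<Rightarrow> bool"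
  for sc where
  linear: "Vector_Spaces.linear sc (*) f \<Longrightarrow> polyfun sc f"
| const: "polyfun sc (\<lambda>_. c)"
| add: "polyfun sc f \<Longrightarrow> polyfun sc g \<Longrightarrow> polyfun sc (\<lambda>p. f p + g p)"
| mult: "polyfun sc f \<Longrightarrow> polyfun sc g \<Longrightarrow> polyfun sc (\<lambda>p. f p * g p)"

definition coord_ring ::
  "(complex \<Rightarrow> 'p::ab_group_add \<Rightarrow> 'p) \<Rightarrow> 'p set \<Rightarrow> ('p \<Rightarrow> complex) ring" where
  "coord_ring sc W =
     \<lparr>carrier = {restrict f W | f. polyfun sc f},
      mult = (\<lambda>f g. restrict (\<lambda>p. f p * g p) W),
      one = restrict (\<lambda>_. 1) W,
      zero = restrict (\<lambda>_. 0) W,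
      add = (\<lambda>f g. restrict (\<lambda>p. f p + g p) W)\<rparr>"

definition zero_locus :: "'p set \<Rightarrow> ('p \<Rightarrow> complex) set \<Rightarrow> 'p set" where
  "zero_locus W S = {p \<in> W. \<forall>f\<in>S. f p = 0}"

definition vanishing_ideal ::
  "(complex \<Rightarrow> 'p::ab_group_add \<Rightarrow> 'p) \<Rightarrow> 'p set \<Rightarrow> 'p set \<Rightarrow> ('p \<Rightarrow> complex) set" where
  "vanishing_ideal sc W Z = {f \<in> carrier (coord_ring sc W). \<forall>p\<in>Z. f p = 0}"

definition zariski_open ::
  "(complex \<Rightarrow> 'p::ab_group_add \<Rightarrow> 'p) \<Rightarrow> 'p set \<Rightarrow> 'p set \<Rightarrow> bool" where
  "zariski_open sc W U \<longleftrightarrow>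
     (\<exists>S \<subseteq> carrier (coord_ring sc W). U = W - zero_locus W S)"

definition zariski :: "(complex \<Rightarrow> 'p::ab_group_add \<Rightarrow> 'p) \<Rightarrow> 'p set \<Rightarrow> 'p topology" where
  "zariski sc W = topology (zariski_open sc W)"

definition irreducible_closed :: "'p topology \<Rightarrow> 'p set \<Rightarrow> bool" where
  "irreducible_closed T C \<longleftrightarrow> closedin T C \<and> C \<noteq> {} \<and>
     (\<forall>A B. closedin T A \<longrightarrow> closedin T B \<longrightarrow> C \<subseteq> A \<union> B \<longrightarrow> C \<subseteq> A \<or> C \<subseteq> B)"

definition irreducible_components :: "'p topology \<Rightarrow> 'p set set" where
  "irreducible_components T =
     {C. irreducible_closed T C \<and> (\<forall>D. irreducible_closed T D \<longrightarrow> C \<subseteq> D \<longrightarrow> D = C)}"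

definition irreducible_chain :: "'p topology \<Rightarrow> nat \<Rightarrow> (nat \<Rightarrow> 'p set) \<Rightarrow> bool" where
  "irreducible_chain T k C \<longleftrightarrow>
     (\<forall>j\<le>k. irreducible_closed T (C j)) \<and> (\<forall>j<k. C j \<subset> C (Suc j))"

definition krull_dim :: "'p topology \<Rightarrow> enat" where
  "krull_dim T = Sup {enat k | k. \<exists>C. irreducible_chain T k C}"

text \<open>
  For \<open>T\<close> the Zariski topology of a closed set \<open>Z\<close>, the chains through \<open>p\<close> correspond to the chains
  of prime ideals of the local ring of \<open>Z\<close> at \<open>p\<close>, so this is the dimension of that local ring.
\<close>

definition local_dim :: "'p topology \<Rightarrow> 'p \<Rightarrow> enat" where
  "local_dim T p = Sup {enat k | k. \<exists>C. irreducible_chain T k C \<and> p \<in> C 0}"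

text \<open>
  The closed subscheme of \<open>W\<close> defined by an ideal \<open>J\<close> is a complete intersection if \<open>J\<close> can be
  generated by as many functions as its codimension.
\<close>

definition complete_intersection ::
  "(complex \<Rightarrow> 'p::ab_group_add \<Rightarrow> 'p) \<Rightarrow> 'p set \<Rightarrow> ('p \<Rightarrow> complex) set \<Rightarrow> bool" where
  "complete_intersection sc W J \<longleftrightarrow> zero_locus W J \<noteq> {} \<and>
     (\<exists>F. finite F \<and> F \<subseteq> carrier (coord_ring sc W) \<and> J = genideal (coord_ring sc W) F \<and>
        krull_dim (subtopology (zariski sc W) (zero_locus W J)) + enat (card F)
          = enat (vector_space.dim sc W))"

text \<open>
  Tangent spaces and smooth points of a closed set \<open>Z\<close> in \<open>W\<close> with its reduced structure;
  the tangent space at \<open>p\<close> is a space of directions in \<open>W\<close>.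
\<close>

definition tangent_space ::
  "(complex \<Rightarrow> 'p::ab_group_add \<Rightarrow> 'p) \<Rightarrow> 'p set \<Rightarrow> 'p set \<Rightarrow> 'p \<Rightarrow> 'p set" where
  "tangent_space sc W Z p =
     {v \<in> W. \<forall>f \<in> vanishing_ideal sc W Z.
        ((\<lambda>t. f (p + sc t v)) has_field_derivative 0) (at 0)}"

definition smooth_point ::
  "(complex \<Rightarrow> 'p::ab_group_add \<Rightarrow> 'p) \<Rightarrow> 'p set \<Rightarrow> 'p set \<Rightarrow> 'p \<Rightarrow> bool" where
  "smooth_point sc W Z p \<longleftrightarrow> p \<in> Z \<and>
     enat (vector_space.dim sc (tangent_space sc W Z p))
       = local_dim (subtopology (zariski sc W) Z) p"

definition lagrangian_subspace ::
  "(complex \<Rightarrow> 'p::ab_group_add \<Rightarrow> 'p) \<Rightarrow> 'p set \<Rightarrow> ('p \<Rightarrow> 'p \<Rightarrow> complex) \<Rightarrow> 'p set \<Rightarrow> bool" where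
  "lagrangian_subspace sc W \<Omega> L \<longleftrightarrow> module.subspace sc L \<and> L \<subseteq> W \<and>
     L = {v \<in> W. \<forall>u\<in>L. \<Omega> v u = 0}"

definition lagrangian_subscheme ::
  "(complex \<Rightarrow> 'p::ab_group_add \<Rightarrow> 'p) \<Rightarrow> 'p set \<Rightarrow> ('p \<Rightarrow> 'p \<Rightarrow> complex) \<Rightarrow> 'p set \<Rightarrow> bool" where
  "lagrangian_subscheme sc W \<Omega> Z \<longleftrightarrow> closedin (zariski sc W) Z \<and>
     (\<forall>p. smooth_point sc W Z p \<longrightarrow>
        lagrangian_subspace sc W \<Omega> (tangent_space sc W Z p))"


section \<open>The symplectic Lie algebra\<close>

definition symplectic_form :: "(complex^'m \<Rightarrow> complex^'m \<Rightarrow> complex) \<Rightarrow> bool" where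
  "symplectic_form \<omega> \<longleftrightarrow>
     (\<forall>v. Vector_Spaces.linear (*s) (*) (\<omega> v)) \<and>
     (\<forall>w. Vector_Spaces.linear (*s) (*) (\<lambda>v. \<omega> v w)) \<and>
     (\<forall>v. \<omega> v v = 0) \<and>
     (\<forall>v. (\<forall>w. \<omega> v w = 0) \<longrightarrow> v = 0)"

definition sp :: "(complex^'m \<Rightarrow> complex^'m \<Rightarrow> complex) \<Rightarrow> (complex^'m^'m) set" where
  "sp \<omega> = {A. \<forall>v w. \<omega> (A *v v) w + \<omega> v (A *v w) = 0}"

definition commutator :: "complex^'m^'m \<Rightarrow> complex^'m^'m \<Rightarrow> complex^'m^'m" where
  "commutator x y = x ** y - y ** x"

definition sym_square :: "(complex^'m \<Rightarrow> complex^'m \<Rightarrow> complex) \<Rightarrow> complex^'m \<Rightarrow> complex^'m^'m" where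
  "sym_square \<omega> i = matrix (\<lambda>w. (\<omega> i w / 2) *s i)"

definition nilpotent_matrix :: "complex^'m^'m \<Rightarrow> bool" where
  "nilpotent_matrix y \<longleftrightarrow> (\<exists>k. \<forall>v. ((\<lambda>u. y *v u) ^^ k) v = 0)"

definition charpoly :: "complex^'m^'m \<Rightarrow> complex poly" where
  "charpoly y = det (mat [:0, 1:] - map_matrix (\<lambda>c. [:c:]) y)"

text \<open>
  \<open>y\<close> is nilpotent with Jordan blocks of sizes \<open>l ! 0, l ! 1, \<dots>\<close>: there is a basis
  \<open>b r j\<close> (\<open>r\<close> numbers the blocks, \<open>j < l ! r\<close>) with
  \<open>b r (l ! r - 1) \<mapsto> \<dots> \<mapsto> b r 1 \<mapsto> b r 0 \<mapsto> 0\<close> under \<open>y\<close>.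
\<close>

definition jordan_type :: "complex^'m^'m \<Rightarrow> nat multiset \<Rightarrow> bool" where
  "jordan_type y p \<longleftrightarrow> 0 \<notin># p \<and>
     (\<exists>l b. mset l = p \<and>
        (let I = (SIGMA r:{..<length l}. {..<l ! r}) in
           inj_on (\<lambda>(r, j). b r j) I \<and>
           vec.independent ((\<lambda>(r, j). b r j) ` I) \<and>
           vec.span ((\<lambda>(r, j). b r j) ` I) = UNIV) \<and>
        (\<forall>r<length l. y *v b r 0 = 0 \<and> (\<forall>j. Suc j < l ! r \<longrightarrow> y *v b r (Suc j) = b r j)))"

text \<open>Partitions are the multisets of their (positive) parts.\<close>

definition nilp_partitions :: "nat \<Rightarrow> nat multiset set" where
  "nilp_partitions n =
     {p. 0 \<notin># p \<and> sum_mset p = 2 * n \<and> (\<forall>k. odd k \<longrightarrow> even (count p k))}"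

definition even_partitions :: "nat \<Rightarrow> nat multiset set" where
  "even_partitions n = {p \<in> nilp_partitions n. \<forall>k\<in>#p. even k}"

text \<open>
  In \<open>sp\<close>, two nilpotent elements are conjugate iff they have the same Jordan type; the class
  attached to a partition consists of the elements with these block sizes.
\<close>

definition nilp_class ::
  "(complex^'m \<Rightarrow> complex^'m \<Rightarrow> complex) \<Rightarrow> nat multiset \<Rightarrow> (complex^'m^'m) set" where
  "nilp_class \<omega> p = {y \<in> sp \<omega>. jordan_type y p}"


section \<open>The almost commuting scheme and its nilpotent part\<close>

type_synonym 'm triple = "(complex^'m^'m) \<times> (complex^'m^'m) \<times> (complex^'m)"

text \<open>\<open>*s\<close> on matrices would sc by a row vector, hence the explicit scalar multiplication.\<close>

definition cscale :: "complex \<Rightarrow> 'm::finite triple \<Rightarrow> 'm triple" where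
  "cscale c = (\<lambda>(x, y, i). (map_matrix ((*) c) x, map_matrix ((*) c) y, c *s i))"

definition phase_space :: "(complex^'m \<Rightarrow> complex^'m \<Rightarrow> complex) \<Rightarrow> 'm::finite triple set" where
  "phase_space \<omega> = sp \<omega> \<times> sp \<omega> \<times> UNIV"

definition phase_form ::
  "(complex^'m \<Rightarrow> complex^'m \<Rightarrow> complex) \<Rightarrow> 'm::finite triple \<Rightarrow> 'm triple \<Rightarrow> complex" where
  "phase_form \<omega> = (\<lambda>(x, y, i) (x', y', i'). trace (y ** x') - trace (y' ** x) + \<omega> i i')"

abbreviation phase_ring ::
  "(complex^'m \<Rightarrow> complex^'m \<Rightarrow> complex) \<Rightarrow> ('m::finite triple \<Rightarrow> complex) ring" where
  "phase_ring \<omega> \<equiv> coord_ring cscale (phase_space \<omega>)"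

definition moment_entries ::
  "(complex^'m \<Rightarrow> complex^'m \<Rightarrow> complex) \<Rightarrow> ('m::finite triple \<Rightarrow> complex) set" where
  "moment_entries \<omega> =
     {restrict (\<lambda>(x, y, i). (commutator x y + sym_square \<omega> i) $ a $ b) (phase_space \<omega>) | a b. True}"

definition charpoly_coeffs ::
  "(complex^'m \<Rightarrow> complex^'m \<Rightarrow> complex) \<Rightarrow> ('m::finite triple \<Rightarrow> complex) set" where
  "charpoly_coeffs \<omega> =
     {restrict (\<lambda>(x, y, i). coeff (charpoly y) k) (phase_space \<omega>) | k. k < CARD('m)}"

definition almost_commuting_ideal ::
  "(complex^'m \<Rightarrow> complex^'m \<Rightarrow> complex) \<Rightarrow> ('m::finite triple \<Rightarrow> complex) set" where
  "almost_commuting_ideal \<omega> = genideal (phase_ring \<omega>) (moment_entries \<omega>)"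

text \<open>
  The ideal given by the defining equations of the nilpotent part, the nilpotency of \<open>y\<close> being the
  equation \<open>charpoly y = t ^ dim V\<close>. It is this ideal, not its radical, that has as few
  generators as its codimension: for \<open>dim V = 2\<close> the radical contains the seven linearly independent
  quadrics given by \<open>[x,y] + i\<^sup>2\<close>, \<open>Tr (y\<^sup>2)\<close>, \<open>Tr (x y)\<close> and \<open>y i\<close>, and no linear form, so it
  needs at least seven generators, while the codimension is four.
\<close>

definition nil_ideal ::
  "(complex^'m \<Rightarrow> complex^'m \<Rightarrow> complex) \<Rightarrow> ('m::finite triple \<Rightarrow> complex) set" where
  "nil_ideal \<omega> = genideal (phase_ring \<omega>) (almost_commuting_ideal \<omega> \<union> charpoly_coeffs \<omega>)"

definition Xnil :: "(complex^'m \<Rightarrow> complex^'m \<Rightarrow> complex) \<Rightarrow> 'm::finite triple set" where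
  "Xnil \<omega> = {(x, y, i). (x, y, i) \<in> phase_space \<omega> \<and>
     commutator x y + sym_square \<omega> i = 0 \<and> nilpotent_matrix y}"

definition Xnil_top :: "(complex^'m \<Rightarrow> complex^'m \<Rightarrow> complex) \<Rightarrow> 'm::finite triple topology" where
  "Xnil_top \<omega> = subtopology (zariski cscale (phase_space \<omega>)) (Xnil \<omega>)"

definition Xpart ::
  "(complex^'m \<Rightarrow> complex^'m \<Rightarrow> complex) \<Rightarrow> nat multiset \<Rightarrow> 'm::finite triple set" where
  "Xpart \<omega> p = {(x, y, i). (x, y, i) \<in> Xnil \<omega> \<and> y \<in> nilp_class \<omega> p}"


section \<open>Basic facts\<close>

lemma vector_space_cscale: "vector_space (cscale :: complex \<Rightarrow> 'm::finite triple \<Rightarrow> _)"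
  by unfold_locales
    (simp_all add: cscale_def map_matrix_def vec_eq_iff split_beta prod_eq_iff algebra_simps)

lemma symplectic_formD:
  assumes "symplectic_form \<omega>"
  shows "\<omega> v (u + w) = \<omega> v u + \<omega> v w" "\<omega> (u + w) v = \<omega> u v + \<omega> w v"
    and "\<omega> v (c *s u) = c * \<omega> v u" "\<omega> (c *s u) v = c * \<omega> u v"
    and "\<omega> v v = 0" and "\<omega> u v = - \<omega> v u"
proof -
  have right: "Vector_Spaces.linear (*s) (*) (\<omega> v)"
    and left: "Vector_Spaces.linear (*s) (*) (\<lambda>v. \<omega> v w)" and alt: "\<omega> v v = 0" for v w
    using assms unfolding symplectic_form_def by blast+
  show r: "\<omega> v (u + w) = \<omega> v u + \<omega> v w" and "\<omega> v (c *s u) = c * \<omega> v u" for c u v w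
    using right[of v] by (simp_all add: Vector_Spaces.linear_iff)
  show l: "\<omega> (u + w) v = \<omega> u v + \<omega> w v" and "\<omega> (c *s u) v = c * \<omega> u v" for c u v w
    using left[of v] by (simp_all add: Vector_Spaces.linear_iff)
  show "\<omega> v v = 0"
    by (rule alt)
  have "\<omega> (u + v) (u + v) = \<omega> u v + \<omega> v u"
    unfolding r l by (simp add: alt)
  then show "\<omega> u v = - \<omega> v u"
    by (simp add: alt eq_neg_iff_add_eq_0)
qed

lemma sym_square_mult:
  assumes "symplectic_form \<omega>"
  shows "sym_square \<omega> i *v w = (\<omega> i w / 2) *s i"
proof -
  have "Vector_Spaces.linear (*s) (*s) (\<lambda>w. (\<omega> i w / 2) *s i)"
    by (simp add: Vector_Spaces.linear_iff vec.vector_space_axioms symplectic_formD(1-4)[OF assms]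
        add_divide_distrib vec.scale_left_distrib)
  then show ?thesis
    unfolding sym_square_def by (simp add: matrix_works)
qed

lemma sym_square_in_sp:
  assumes "symplectic_form \<omega>"
  shows "sym_square \<omega> i \<in> sp \<omega>"
proof -
  have "\<omega> i v / 2 * \<omega> i w + \<omega> i w / 2 * \<omega> v i = 0" for v w
    unfolding symplectic_formD(6)[OF assms, of v i] by simp
  then show ?thesis
    by (simp add: sp_def sym_square_mult[OF assms] symplectic_formD(3,4)[OF assms])
qed

lemma subspace_phase_space:
  fixes \<omega> :: "complex^'m \<Rightarrow> complex^'m \<Rightarrow> complex"
  assumes "symplectic_form \<omega>"
  shows "module.subspace cscale (phase_space \<omega>)"
proof -
  interpret cs: vector_space "cscale :: complex \<Rightarrow> 'm triple \<Rightarrow> _"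
    by (rule vector_space_cscale)
  note form = symplectic_formD(1-4)[OF assms]
  have m: "map_matrix ((*) c) A *v v = c *s (A *v v)" for c and A :: "complex^'m^'m" and v
    by (simp add: map_matrix_def matrix_vector_mult_def vec_eq_iff sum_distrib_left mult.assoc)
  have zero: "\<omega> v 0 = 0" "\<omega> 0 v = 0" for v
    using form(3)[of v 0 0] form(4)[of 0 0 v] by auto
  have "A + B \<in> sp \<omega>" if AB: "A \<in> sp \<omega>" "B \<in> sp \<omega>" for A B
  proof -
    have "\<omega> (A *v v) w + \<omega> v (A *v w) = 0" "\<omega> (B *v v) w + \<omega> v (B *v w) = 0" for v w
      using AB by (auto simp: sp_def)
    then have "(\<omega> (A *v v) w + \<omega> v (A *v w)) + (\<omega> (B *v v) w + \<omega> v (B *v w)) = 0" for v w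
      by simp
    then show ?thesis
      by (simp add: sp_def matrix_vector_mult_add_rdistrib form ac_simps)
  qed
  moreover have "map_matrix ((*) c) A \<in> sp \<omega>" if "A \<in> sp \<omega>" for A c
    using that by (simp add: sp_def m form flip: distrib_left)
  moreover have "0 \<in> sp \<omega>"
    by (simp add: sp_def zero)
  ultimately show ?thesis
    by (auto simp: cs.subspace_def phase_space_def cscale_def zero_prod_def)
qed

lemma carrier_coord_ring: "carrier (coord_ring sc W) = {restrict f W | f. polyfun sc f}"
  by (simp add: coord_ring_def)

lemma carrier_coord_ring_mult:
  assumes f: "f \<in> carrier (coord_ring sc W)" and g: "g \<in> carrier (coord_ring sc W)"
  shows "restrict (\<lambda>p. f p * g p) W \<in> carrier (coord_ring sc W)"
proof -
  obtain f' g' where "f = restrict f' W" "g = restrict g' W" "polyfun sc f'" "polyfun sc g'"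
    using f g unfolding carrier_coord_ring by blast
  moreover from this have "restrict (\<lambda>p. f p * g p) W = restrict (\<lambda>p. f' p * g' p) W"
    by (auto simp: restrict_def)
  ultimately show ?thesis
    unfolding carrier_coord_ring using polyfun.mult by blast
qed

lemma carrier_coord_ring_add:
  assumes f: "f \<in> carrier (coord_ring sc W)" and g: "g \<in> carrier (coord_ring sc W)"
  shows "restrict (\<lambda>p. f p + g p) W \<in> carrier (coord_ring sc W)"
proof -
  obtain f' g' where "f = restrict f' W" "g = restrict g' W" "polyfun sc f'" "polyfun sc g'"
    using f g unfolding carrier_coord_ring by blast
  moreover from this have "restrict (\<lambda>p. f p + g p) W = restrict (\<lambda>p. f' p + g' p) W"
    by (auto simp: restrict_def)
  ultimately show ?thesis
    unfolding carrier_coord_ring using polyfun.add by blast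
qed

lemma carrier_coord_ring_const: "restrict (\<lambda>_. c) W \<in> carrier (coord_ring sc W)"
  unfolding carrier_coord_ring using polyfun.const by blast

lemma istopology_zariski_open: "istopology (zariski_open sc W)"
proof -
  let ?R = "carrier (coord_ring sc W)"
  have "zariski_open sc W (U \<inter> V)" if U: "zariski_open sc W U" and V: "zariski_open sc W V"
    for U V
  proof -
    obtain S T where S: "S \<subseteq> ?R" "U = W - zero_locus W S" and T: "T \<subseteq> ?R" "V = W - zero_locus W T"
      using U V by (auto simp: zariski_open_def)
    define ST where "ST = {restrict (\<lambda>p. f p * g p) W | f g. f \<in> S \<and> g \<in> T}"
    have "ST \<subseteq> ?R"
      using S(1) T(1) carrier_coord_ring_mult unfolding ST_def by blast
    moreover have "U \<inter> V = W - zero_locus W ST"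
      unfolding S(2) T(2) zero_locus_def ST_def by fastforce
    ultimately show ?thesis
      by (auto simp: zariski_open_def)
  qed
  moreover have "zariski_open sc W (\<Union>K)" if K: "\<forall>U\<in>K. zariski_open sc W U" for K
  proof -
    define S where "S U = (SOME S. S \<subseteq> ?R \<and> U = W - zero_locus W S)" for U
    have S: "S U \<subseteq> ?R" "U = W - zero_locus W (S U)" if "U \<in> K" for U
      using someI_ex[of "\<lambda>S. S \<subseteq> ?R \<and> U = W - zero_locus W S"] K \<open>U \<in> K\<close>
      unfolding S_def zariski_open_def by blast+
    have mem: "p \<in> U \<longleftrightarrow> p \<in> W \<and> (\<exists>f\<in>S U. f p \<noteq> 0)" if "U \<in> K" for p U
      by (subst S(2)[OF that]) (auto simp: zero_locus_def)
    have "\<Union>K = W - zero_locus W (\<Union>U\<in>K. S U)"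
      using mem by (auto simp: zero_locus_def)
    moreover have "(\<Union>U\<in>K. S U) \<subseteq> ?R"
      using S(1) by blast
    ultimately show ?thesis
      unfolding zariski_open_def by blast
  qed
  ultimately show ?thesis
    by (auto simp: istopology_def)
qed

lemma openin_zariski: "openin (zariski sc W) U \<longleftrightarrow> zariski_open sc W U"
  by (simp add: zariski_def istopology_zariski_open)

lemma cring_coord_ring: "cring (coord_ring sc W)"
proof -
  let ?R = "coord_ring sc W"
  have ops: "mult ?R = (\<lambda>f g. restrict (\<lambda>p. f p * g p) W)" "one ?R = restrict (\<lambda>_. 1) W"
    "ring.add ?R = (\<lambda>f g. restrict (\<lambda>p. f p + g p) W)" "ring.zero ?R = restrict (\<lambda>_. 0) W"
    by (simp_all add: coord_ring_def)
  have ext: "restrict f W = f" if "f \<in> carrier ?R" for f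
    using that unfolding carrier_coord_ring by auto
  have eqI: "f = g" if "f \<in> carrier ?R" "g \<in> carrier ?R" "\<And>p. p \<in> W \<Longrightarrow> f p = g p" for f g
    using that ext[of f] ext[of g] by (metis restrict_ext)
  note closed = carrier_coord_ring_mult carrier_coord_ring_add carrier_coord_ring_const
  have neg: "\<exists>h\<in>carrier ?R. restrict (\<lambda>p. h p + f p) W = restrict (\<lambda>_. 0) W"
    if "f \<in> carrier ?R" for f
  proof
    show "restrict (\<lambda>p. restrict (\<lambda>_. - 1) W p * f p) W \<in> carrier ?R"
      by (intro closed that)
  qed (auto intro: restrict_ext)
  show ?thesis
  proof (intro cringI abelian_groupI comm_monoidI, unfold ops)
    fix f assume "f \<in> carrier ?R"
    then show "\<exists>h\<in>carrier ?R. restrict (\<lambda>p. h p + f p) W = restrict (\<lambda>_. 0) W"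
      by (rule neg)
  qed (assumption | rule closed | rule eqI | (simp add: algebra_simps; fail))+
qed

end

theory Submission
  imports Defs "HOL-Computational_Algebra.Fundamental_Theorem_Algebra" "HOL-Combinatorics.List_Permutation"
begin

text \<open>
  For \<open>y\<close> of type \<open>p\<close>, \<open>i\<^sup>2\<close> lies in the image of \<open>ad y\<close> iff \<open>i\<close> lies in a linear subspace \<open>L y\<close> of dimension
  \<open>\<Sum>x\<in>#p. x div 2\<close>, so \<open>X\<^sub>p\<close> is an affine bundle over \<open>L y\<close> spread out by the symplectic group: it is irreducible
  of dimension \<open>dim sp + dim (L y)\<close>, which equals \<open>2n\<^sup>2 + 2n\<close> iff all parts are even and is smaller otherwise.
  As \<open>X\<^sup>n\<^sup>i\<^sup>l\<close> is cut out by \<open>2n\<^sup>2 + 2n\<close> equations, the height theorem excludes smaller components.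
  Moment map identities show that the perp of the velocities of curves in \<open>X\<^sub>p\<close>, for \<open>p\<close> even, is isotropic.
\<close>

section \<open>Polynomial functions with degree bounds\<close>

text \<open>Dimension is measured by counting: \<open>growth\<close> bounds the number of
  independent functions of bounded degree on a set from above, velocities of curves bound it from
  below, and the height theorem comes from the same kind of count. This calls for polynomial
  parametrizations, so the symplectic group is entered through products of transvections instead of
  an exponential map. The equations number \<open>dim sp + n\<close> because the characteristic
  polynomial of an element of \<open>sp\<close> is even, which leaves \<open>n\<close> coefficients
  below the leading one. The resulting dimension is half of that of the phase space. The obstacle in
  (b) is that a smooth point may lie only in the closure of a piece with even parts, where no curves
  in that piece are at hand. Poisson brackets bridge the gap: that the brackets of functions
  vanishing on the variety vanish too is a polynomial condition, so it passes from the even pieces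
  to their closures, which cover everything. Hence tangent spaces are coisotropic at every point,
  and at a smooth point the dimension leaves only the Lagrangian case.\<close>

inductive polydeg :: "('a => complex) set => nat => ('a => complex) => bool" for X where
  gen: "f \<in> X ==> polydeg X 1 f"
| const: "polydeg X 0 (\<lambda>_. c)"
| add: "polydeg X m f ==> polydeg X m g ==> polydeg X m (\<lambda>p. f p + g p)"
| mult: "polydeg X m f ==> polydeg X k g ==> polydeg X (m + k) (\<lambda>p. f p * g p)"
| mono: "polydeg X m f ==> m \<le> k ==> polydeg X k f"

abbreviation functional :: "(complex => 'p::ab_group_add => 'p) => ('p => complex) => bool" where
  "functional sc \<equiv> Vector_Spaces.linear sc (*)"

abbreviation linfuns :: "(complex => 'p::ab_group_add => 'p) => ('p => complex) set" where
  "linfuns sc \<equiv> {l. functional sc l}"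

lemma polydeg_const: "polydeg X m (\<lambda>_. c)"
  using polydeg.const polydeg.mono by blast

lemma polydeg_sum: "(\<And>i. i \<in> I ==> polydeg X m (f i)) ==> polydeg X m (\<lambda>p. \<Sum>i\<in>I. f i p)"
proof (induction I rule: infinite_finite_induct)
  case (insert x F)
  then have "polydeg X m (\<lambda>p. f x p + (\<Sum>i\<in>F. f i p))"
    by (intro polydeg.add) auto
  with insert(1,2) show ?case by simp
qed (auto simp: polydeg_const)

lemma polydeg_cmult: "polydeg X m f ==> polydeg X m (\<lambda>p. c * f p)"
  using polydeg.mult[OF polydeg.const[of X c]] by simp

lemma polydeg_diff: "polydeg X m f ==> polydeg X m g ==> polydeg X m (\<lambda>p. f p - g p)"
  using polydeg.add[OF _ polydeg_cmult[of X m g "-1"], of f] by simp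

lemma polydeg_power: "polydeg X m f ==> polydeg X (i * m) (\<lambda>p. f p ^ i)"
proof (induction i)
  case (Suc i)
  from polydeg.mult[OF Suc.prems Suc.IH[OF Suc.prems]] show ?case by simp
qed (simp add: polydeg.const)

lemma polydeg_prod:
  assumes "finite I" "\<And>i. i \<in> I ==> polydeg X (m i) (f i)"
  shows "polydeg X (\<Sum>i\<in>I. m i) (\<lambda>p. \<Prod>i\<in>I. f i p)"
  using assms
proof (induction I rule: finite_induct)
  case (insert x F)
  then have "polydeg X (m x + (\<Sum>i\<in>F. m i)) (\<lambda>p. f x p * (\<Prod>i\<in>F. f i p))"
    by (intro polydeg.mult) auto
  with insert(1,2) show ?case by simp
qed (auto simp: polydeg_const)

lemma polydeg_compose:
  assumes "polydeg X m f" "\<And>l. l \<in> X ==> polydeg Y e (\<lambda>t. l (s t))"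
  shows "polydeg Y (e * m) (\<lambda>t. f (s t))"
  using assms
proof (induction rule: polydeg.induct)
  case (gen f)
  then show ?case by simp
next
  case (mult m f k g)
  then show ?case using polydeg.mult[of Y "e * m" "\<lambda>t. f (s t)" "e * k" "\<lambda>t. g (s t)"]
    by (simp add: algebra_simps)
next
  case (mono m f k)
  then show ?case by (meson polydeg.mono mult_le_mono2)
qed (auto intro: polydeg.intros)

lemma polyfun_iff: "polyfun sc f \<longleftrightarrow> (\<exists>m. polydeg (linfuns sc) m f)"
proof
  assume "polyfun sc f"
  then show "\<exists>m. polydeg (linfuns sc) m f"
  proof induction
    case (linear f)
    then show ?case by (auto intro: polydeg.gen)
  next
    case (add f g)
    then obtain m k where "polydeg (linfuns sc) m f" "polydeg (linfuns sc) k g" by blast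
    then have "polydeg (linfuns sc) (max m k) f" "polydeg (linfuns sc) (max m k) g"
      by (auto intro: polydeg.mono)
    then show ?case by (blast intro: polydeg.add)
  next
    case (mult f g)
    then show ?case by (blast intro: polydeg.mult)
  qed (blast intro: polydeg.const)
next
  assume "\<exists>m. polydeg (linfuns sc) m f"
  then obtain m where "polydeg (linfuns sc) m f" ..
  then show "polyfun sc f"
    by induction (auto intro: polyfun.intros)
qed

text \<open>Gaussian elimination: a row with a nonzero entry in column \<open>j\<close> clears that
  column from the other rows, leaving one row and one column less. The bounds on growth, the
  Nullstellensatz and the height theorem all count with this lemma.\<close>

lemma exists_dependency:
  fixes a :: "'i => 'j => complex"
  assumes "finite J" "finite I" "card J < card I"
  shows "\<exists>c. (\<exists>i\<in>I. c i \<noteq> 0) \<and> (\<forall>j\<in>J. (\<Sum>i\<in>I. c i * a i j) = 0)"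
  using assms
proof (induction J arbitrary: I a rule: finite_induct)
  case empty
  then have "I \<noteq> {}" by auto
  then show ?case by (intro exI[of _ "\<lambda>_. 1"]) auto
next
  case (insert j J)
  show ?case
  proof (cases "\<forall>i\<in>I. a i j = 0")
    case True
    have "card J < card I" using insert by simp
    from insert.IH[OF insert.prems(1) this, of a] True show ?thesis by auto
  next
    case False
    then obtain i0 where i0: "i0 \<in> I" "a i0 j \<noteq> 0" by blast
    define I' where "I' = I - {i0}"
    have I: "I = insert i0 I'" "i0 \<notin> I'" "finite I'" using i0 insert.prems unfolding I'_def by auto
    define a' where "a' i k = a i k - a i j / a i0 j * a i0 k" for i k
    have "card J < card I'" using insert I by simp
    from insert.IH[OF I(3) this, of a'] obtain c where
      c: "\<exists>i\<in>I'. c i \<noteq> 0" "\<forall>k\<in>J. (\<Sum>i\<in>I'. c i * a' i k) = 0" by blast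
    define d where "d = c(i0 := - (\<Sum>i\<in>I'. c i * a i j) / a i0 j)"
    have d: "(\<Sum>i\<in>I. d i * a i k) = - (\<Sum>i\<in>I'. c i * a i j) / a i0 j * a i0 k + (\<Sum>i\<in>I'. c i * a i k)" for k
    proof -
      have "(\<Sum>i\<in>I'. d i * a i k) = (\<Sum>i\<in>I'. c i * a i k)"
        using I(2) by (intro sum.cong) (auto simp: d_def)
      then show ?thesis using I by (simp add: d_def)
    qed
    have "(\<Sum>i\<in>I. d i * a i k) = 0" if "k \<in> insert j J" for k
    proof (cases "k = j")
      case True
      then show ?thesis using i0 by (simp add: d)
    next
      case False
      then have "k \<in> J" using that by simp
      then have "0 = (\<Sum>i\<in>I'. c i * a i k - c i * a i j * (a i0 k / a i0 j))"
        using c(2) by (simp add: a'_def algebra_simps)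
      also have "\<dots> = (\<Sum>i\<in>I'. c i * a i k) - (\<Sum>i\<in>I'. c i * a i j) * (a i0 k / a i0 j)"
        unfolding sum_subtractf sum_distrib_right ..
      finally show ?thesis unfolding d by simp
    qed
    moreover have "\<exists>i\<in>I. d i \<noteq> 0" using c(1) I by (auto simp: d_def)
    ultimately show ?thesis by blast
  qed
qed

text \<open>Exponent vectors are collected in boxes rather than by total degree: a box has exactly
  \<open>K ^ N\<close> elements, and orders of growth do not see the difference.\<close>

abbreviation expbox :: "nat => nat => (nat => nat) set" where
  "expbox N K \<equiv> PiE {..<N} (\<lambda>_. {..<K})"

definition mon :: "nat => (nat => complex) => (nat => nat) => complex" where
  "mon N t \<alpha> = (\<Prod>k<N. t k ^ \<alpha> k)"

lemma finite_box: "finite (expbox N K)"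
  by (auto intro: finite_PiE)

lemma card_box: "card (expbox N K) = K ^ N"
  by (simp add: card_PiE)

lemma box_encoding_less: "t \<in> expbox N K ==> (\<Sum>k<N. t k * K ^ k) < K ^ N"
proof (induction N arbitrary: t)
  case (Suc N)
  have "(\<Sum>k<N. restrict t {..<N} k * K ^ k) < K ^ N"
    using Suc.prems by (intro Suc.IH restrict_PiE_iff[THEN iffD2]) (auto simp: PiE_iff)
  then have 1: "(\<Sum>k<N. t k * K ^ k) < K ^ N" by simp
  have "t N + 1 \<le> K" using Suc.prems by (auto simp: PiE_iff Suc_le_eq)
  then have "(t N + 1) * K ^ N \<le> K * K ^ N" by (intro mult_le_mono1)
  with 1 show ?case by (simp add: algebra_simps)
qed simp

text \<open>Digits in base \<open>K\<close>: division by \<open>K ^ N\<close> recovers the leading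
  digit because the lower digits add up to less than \<open>K ^ N\<close>.\<close>

lemma inj_on_box_encoding: "inj_on (\<lambda>t. \<Sum>k<N. t k * K ^ k) (expbox N K)"
proof -
  have "\<forall>k<N. t k = s k"
    if "t \<in> expbox N K" "s \<in> expbox N K" "(\<Sum>k<N. t k * K ^ k) = (\<Sum>k<N. s k * K ^ k)" for t s
    using that
  proof (induction N arbitrary: t s)
    case (Suc N)
    let ?r = "\<lambda>t. restrict t {..<N}"
    have r: "?r t \<in> expbox N K" "?r s \<in> expbox N K" using Suc.prems by (auto simp: restrict_PiE_iff PiE_iff)
    have l: "(\<Sum>k<N. t k * K ^ k) < K ^ N" "(\<Sum>k<N. s k * K ^ k) < K ^ N"
      using box_encoding_less[OF r(1)] box_encoding_less[OF r(2)] by simp_all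
    have e: "(\<Sum>k<N. t k * K ^ k) + t N * K ^ N = (\<Sum>k<N. s k * K ^ k) + s N * K ^ N"
      using Suc.prems(3) by simp
    have div: "(a + c * M) div M = c" if "a < M" for a c M :: nat
      using that by simp
    have "((\<Sum>k<N. t k * K ^ k) + t N * K ^ N) div K ^ N = t N"
      "((\<Sum>k<N. s k * K ^ k) + s N * K ^ N) div K ^ N = s N"
      using l by (blast intro: div)+
    then have N: "t N = s N" using e by metis
    then have "(\<Sum>k<N. ?r t k * K ^ k) = (\<Sum>k<N. ?r s k * K ^ k)" using e by simp
    from Suc.IH[OF r this] N show ?case by (auto simp: less_Suc_eq)
  qed simp
  then show ?thesis
    by (intro inj_onI PiE_ext) auto
qed

text \<open>Kronecker's substitution \<open>t k = s ^ K ^ k\<close> reduces this to one variable.\<close>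

lemma mon_independent:
  assumes "\<And>t. (\<Sum>r\<in>expbox N K. c r * mon N t r) = 0" and "r \<in> expbox N K"
  shows "c r = 0"
proof -
  define enc where "enc r = (\<Sum>k<N. r k * K ^ k)" for r :: "nat => nat"
  define P where "P = (\<Sum>r\<in>expbox N K. monom (c r) (enc r))"
  have "mon N (\<lambda>k. s ^ K ^ k) r = s ^ enc r" for s r
    unfolding mon_def enc_def power_sum by (simp add: power_mult[symmetric] mult.commute)
  then have "poly P s = 0" for s
    using assms(1)[of "\<lambda>k. s ^ K ^ k"] by (simp add: P_def poly_sum poly_monom)
  then have "P = 0" using poly_all_0_iff_0 by blast
  then have "0 = coeff P (enc r)" by simp
  also have "\<dots> = (\<Sum>u\<in>expbox N K. if u = r then c u else 0)"
    unfolding P_def coeff_sum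
    by (intro sum.cong refl) (use inj_on_box_encoding[where N=N and K=K] assms(2) in "auto simp: enc_def inj_on_def")
  also have "\<dots> = c r" using assms(2) finite_box by simp
  finally show ?thesis by simp
qed

text \<open>In a polynomial of degree at most \<open>m\<close> every single exponent is at most
  \<open>m\<close>, so its monomials lie in the box of side \<open>Suc m\<close>.\<close>

lemma polydeg_spanned:
  assumes "polydeg ((\<lambda>k. x k) ` {..<N}) m f"
  shows "\<exists>c. \<forall>p. f p = (\<Sum>t\<in>expbox N (Suc m). c t * mon N (\<lambda>k. x k p) t)"
proof -
  define S where "S m f \<longleftrightarrow> (\<exists>c. \<forall>p. f p = (\<Sum>t\<in>expbox N (Suc m). c t * mon N (\<lambda>k. x k p) t))"
    for m and f :: "'a => complex"
  have S_add: "S m (\<lambda>p. f p + g p)" if "S m f" "S m g" for m f g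
  proof -
    from that obtain c d where "\<And>p. f p = (\<Sum>t\<in>expbox N (Suc m). c t * mon N (\<lambda>k. x k p) t)"
      "\<And>p. g p = (\<Sum>t\<in>expbox N (Suc m). d t * mon N (\<lambda>k. x k p) t)" unfolding S_def by blast
    then show ?thesis unfolding S_def
      by (intro exI[of _ "\<lambda>t. c t + d t"]) (simp add: algebra_simps sum.distrib)
  qed
  have S_cmult: "S m (\<lambda>p. a * f p)" if "S m f" for m f a
  proof -
    from that obtain c where "\<And>p. f p = (\<Sum>t\<in>expbox N (Suc m). c t * mon N (\<lambda>k. x k p) t)"
      unfolding S_def by blast
    then show ?thesis unfolding S_def
      by (intro exI[of _ "\<lambda>t. a * c t"]) (simp add: algebra_simps sum_distrib_left)
  qed
  have S_mon: "S m (\<lambda>p. mon N (\<lambda>k. x k p) t)" if "\<And>k. k < N ==> t k \<le> m" for m t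
    unfolding S_def
  proof (intro exI allI)
    fix p
    let ?r = "restrict t {..<N}"
    have r: "?r \<in> expbox N (Suc m)" using that by (auto simp: less_Suc_eq_le)
    have "(\<Sum>s\<in>expbox N (Suc m). (if s = ?r then 1 else 0) * mon N (\<lambda>k. x k p) s)
      = (\<Sum>s\<in>expbox N (Suc m). if s = ?r then mon N (\<lambda>k. x k p) s else 0)"
      by (intro sum.cong) auto
    also have "\<dots> = mon N (\<lambda>k. x k p) ?r" using r finite_box by simp
    also have "\<dots> = mon N (\<lambda>k. x k p) t" unfolding mon_def by (intro prod.cong) auto
    finally show "mon N (\<lambda>k. x k p) t = (\<Sum>s\<in>expbox N (Suc m). (if s = ?r then 1 else 0) * mon N (\<lambda>k. x k p) s)"
      by simp
  qed
  have S_sum: "S m (\<lambda>p. \<Sum>i\<in>I. f i p)" if "finite I" "\<And>i. i \<in> I ==> S m (f i)"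
    for m I and f :: "(nat => nat) => 'a => complex"
    using that
  proof (induction I rule: finite_induct)
    case empty
    show ?case unfolding S_def by (intro exI[of _ "\<lambda>_. 0"]) simp
  next
    case (insert i I)
    then show ?case using S_add[of m "f i" "\<lambda>p. \<Sum>i\<in>I. f i p"] by simp
  qed
  have "S m f" using assms
  proof induction
    case (gen f)
    then obtain k0 where k0: "k0 < N" "f = x k0" by auto
    have "mon N (\<lambda>k. x k p) (\<lambda>k. if k = k0 then 1 else 0) = x k0 p" for p
    proof -
      have "mon N (\<lambda>k. x k p) (\<lambda>k. if k = k0 then 1 else 0) = (\<Prod>k<N. if k = k0 then x k p else 1)"
        unfolding mon_def by (intro prod.cong) auto
      then show ?thesis using k0 by simp
    qed
    with S_mon[of "\<lambda>k. if k = k0 then 1 else 0" 1] k0 show ?case by simp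
  next
    case (const c)
    show ?case using S_cmult[OF S_mon[of "\<lambda>_. 0" 0], of c] by (simp add: mon_def)
  next
    case (mult m f k g)
    from mult.IH obtain c d where c: "\<And>p. f p = (\<Sum>t\<in>expbox N (Suc m). c t * mon N (\<lambda>k. x k p) t)"
      and d: "\<And>p. g p = (\<Sum>t\<in>expbox N (Suc k). d t * mon N (\<lambda>k. x k p) t)" unfolding S_def by blast
    have "f p * g p = (\<Sum>t\<in>expbox N (Suc m). \<Sum>s\<in>expbox N (Suc k). c t * d s *
        mon N (\<lambda>k. x k p) (\<lambda>k. t k + s k))" for p
      unfolding c d sum_product
      by (simp add: mon_def power_add prod.distrib mult_ac)
    moreover have "S (m + k) (\<lambda>p. \<Sum>t\<in>expbox N (Suc m). \<Sum>s\<in>expbox N (Suc k). c t * d s *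
        mon N (\<lambda>k. x k p) (\<lambda>k. t k + s k))"
      by (intro S_sum finite_box S_cmult S_mon) (auto simp: PiE_iff less_Suc_eq_le intro!: add_mono)
    ultimately show ?case by presburger
  next
    case (mono m f k)
    then obtain c where c: "\<And>p. f p = (\<Sum>t\<in>expbox N (Suc m). c t * mon N (\<lambda>k. x k p) t)"
      unfolding S_def by blast
    moreover have "S k (\<lambda>p. \<Sum>t\<in>expbox N (Suc m). c t * mon N (\<lambda>k. x k p) t)"
      using mono(2) by (intro S_sum finite_box S_cmult S_mon) (auto simp: PiE_iff dest!: bspec)
    ultimately show ?case by presburger
  qed (rule S_add)
  then show ?thesis unfolding S_def .
qed

section \<open>Growth of the space of polynomial functions on a set\<close>

text \<open>The generators \<open>X\<close> vary: linear functionals on the ambient space, the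
  coordinates of a parameter space, or the identity of \<open>complex\<close> for functions along a
  curve.\<close>

definition ispoly :: "('a => complex) set => ('a => complex) => bool" where
  "ispoly X f \<longleftrightarrow> (\<exists>m. polydeg X m f)"

text \<open>Expresses that the Hilbert function of \<open>C\<close> at \<open>m\<close> is at least
  \<open>h\<close>, with no quotient space being formed.\<close>

definition has_indep :: "('a => complex) set => 'a set => nat => nat => bool" where
  "has_indep X C m h \<longleftrightarrow> (\<exists>b. (\<forall>i<h. polydeg X m (b i)) \<and>
     (\<forall>c. (\<forall>p\<in>C. (\<Sum>i<h. c i * b i p) = 0) --> (\<forall>i<h. c i = 0)))"

text \<open>The Hilbert function of \<open>C\<close> is bounded by a polynomial of degree \<open>d\<close>; for closed \<open>C\<close> this
  says that the dimension of \<open>C\<close> is at most \<open>d\<close>.\<close>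

definition growth :: "('a => complex) set => 'a set => nat => bool" where
  "growth X C d \<longleftrightarrow> (\<exists>A. \<forall>m h. has_indep X C m h --> h \<le> A * (m + 1) ^ d)"

text \<open>The functions vanishing on \<open>C\<close> form a prime ideal, that is, the closure of
  \<open>C\<close> is irreducible. \<open>C\<close> itself may be any set, so pieces that are not
  closed are covered.\<close>

definition prime_on :: "('a => complex) set => 'a set => bool" where
  "prime_on X C \<longleftrightarrow> C \<noteq> {} \<and> (\<forall>f g. ispoly X f --> ispoly X g --> (\<forall>p\<in>C. f p * g p = 0) -->
     (\<forall>p\<in>C. f p = 0) \<or> (\<forall>p\<in>C. g p = 0))"

lemma ispoly_const: "ispoly X (\<lambda>_. c)"
  unfolding ispoly_def using polydeg_const by blast

lemma ispoly_gen: "f \<in> X ==> ispoly X f"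
  unfolding ispoly_def using polydeg.gen by blast

lemma ispoly_mult: "ispoly X f ==> ispoly X g ==> ispoly X (\<lambda>p. f p * g p)"
  unfolding ispoly_def using polydeg.mult by blast

lemma ispoly_add: "ispoly X f ==> ispoly X g ==> ispoly X (\<lambda>p. f p + g p)"
proof -
  assume "ispoly X f" "ispoly X g"
  then obtain m k where "polydeg X m f" "polydeg X k g" unfolding ispoly_def by blast
  then have "polydeg X (max m k) f" "polydeg X (max m k) g" by (auto intro: polydeg.mono)
  then show ?thesis unfolding ispoly_def by (blast intro: polydeg.add)
qed

lemma ispoly_cmult: "ispoly X f ==> ispoly X (\<lambda>p. c * f p)"
  by (intro ispoly_mult ispoly_const)

lemma ispoly_diff: "ispoly X f ==> ispoly X g ==> ispoly X (\<lambda>p. f p - g p)"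
  using ispoly_add[OF _ ispoly_cmult[of X g "-1"], of f] by simp

lemma ispoly_power: "ispoly X f ==> ispoly X (\<lambda>p. f p ^ i)"
  unfolding ispoly_def using polydeg_power by blast

lemma ispoly_sum: "(\<And>i. i \<in> I ==> ispoly X (f i)) ==> ispoly X (\<lambda>p. \<Sum>i\<in>I. f i p)"
proof (induction I rule: infinite_finite_induct)
  case (insert x F)
  then have "ispoly X (\<lambda>p. f x p + (\<Sum>i\<in>F. f i p))"
    by (intro ispoly_add) auto
  with insert(1,2) show ?case by simp
qed (auto simp: ispoly_const)

lemma ispoly_prod: "(\<And>i. i \<in> I ==> ispoly X (f i)) ==> ispoly X (\<lambda>p. \<Prod>i\<in>I. f i p)"
proof (induction I rule: infinite_finite_induct)
  case (insert x F)
  then have "ispoly X (\<lambda>p. f x p * (\<Prod>i\<in>F. f i p))"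
    by (intro ispoly_mult) auto
  with insert(1,2) show ?case by simp
qed (auto simp: ispoly_const)

lemmas ispoly_intros = ispoly_const ispoly_mult ispoly_add ispoly_diff ispoly_power ispoly_sum
  ispoly_prod

lemma ispoly_compose:
  "ispoly X f ==> (\<And>l. l \<in> X ==> ispoly Y (\<lambda>t. l (s t))) ==> ispoly Y (\<lambda>t. f (s t))"
  unfolding ispoly_def[of X]
proof (elim exE)
  fix m assume "polydeg X m f" and l: "\<And>l. l \<in> X ==> ispoly Y (\<lambda>t. l (s t))"
  from this(1) show ?thesis
  proof induction
    case (mono m f k)
    then show ?case by blast
  qed (auto intro: ispoly_intros l)
qed

lemma ispoly_id_poly: "ispoly {\<lambda>t::complex. t} f ==> \<exists>P. \<forall>t. f t = poly P t"
  unfolding ispoly_def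
proof (elim exE)
  fix m assume "polydeg {\<lambda>t::complex. t} m f"
  then show ?thesis
  proof induction
    case (gen f)
    then show ?case by (intro exI[of _ "[:0,1:]"]) auto
  next
    case (const c)
    then show ?case by (intro exI[of _ "[:c:]"]) auto
  next
    case (add m f g)
    then obtain P Q where "\<forall>t. f t = poly P t" "\<forall>t. g t = poly Q t" by blast
    then show ?case by (intro exI[of _ "P + Q"]) auto
  next
    case (mult m f k g)
    then obtain P Q where "\<forall>t. f t = poly P t" "\<forall>t. g t = poly Q t" by blast
    then show ?case by (intro exI[of _ "P * Q"]) auto
  qed
qed

lemma has_indepI:
  assumes "finite I" "\<And>i. i \<in> I ==> polydeg X m (b i)"
    "\<And>c i. (\<And>p. p \<in> C ==> (\<Sum>i\<in>I. c i * b i p) = 0) ==> i \<in> I ==> c i = 0"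
  shows "has_indep X C m (card I)"
proof -
  obtain g where g: "bij_betw g {..<card I} I"
    using ex_bij_betw_nat_finite[OF assms(1)] by (auto simp: atLeast0LessThan)
  then have inj: "inj_on g {..<card I}" and I: "I = g ` {..<card I}" by (auto simp: bij_betw_def)
  define gi where "gi = inv_into {..<card I} g"
  have gi: "gi (g i) = i" if "i < card I" for i using inj that by (simp add: gi_def inv_into_f_f)
  show ?thesis unfolding has_indep_def
  proof (intro exI[of _ "\<lambda>i. b (g i)"] conjI allI impI)
    fix i assume "i < card I"
    then show "polydeg X m (b (g i))" using assms(2) I by blast
  next
    fix c i assume c: "\<forall>p\<in>C. (\<Sum>i<card I. c i * b (g i) p) = 0" and i: "i < card I"
    have "(\<Sum>i\<in>I. c (gi i) * b i p) = (\<Sum>i<card I. c i * b (g i) p)" for p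
      by (subst sum.reindex_bij_betw[OF g, symmetric]) (auto intro!: sum.cong simp: gi)
    then have "c (gi (g i)) = 0" using c assms(3)[of "\<lambda>i. c (gi i)" "g i"] I i by auto
    then show "c i = 0" using gi i by simp
  qed
qed

text \<open>Independence on a set depends only on which functions vanish there, so it is the same
  for a set and for anything in which it is dense.\<close>

lemma has_indep_dense:
  assumes "has_indep X D m h"
    and "\<And>f. ispoly X f ==> (\<And>p. p \<in> C ==> f p = 0) ==> (\<And>p. p \<in> D ==> f p = 0)"
  shows "has_indep X C m h"
proof -
  from assms(1) obtain b where b: "\<forall>i<h. polydeg X m (b i)"
    "\<And>c. (\<forall>p\<in>D. (\<Sum>i<h. c i * b i p) = 0) ==> \<forall>i<h. c i = 0" unfolding has_indep_def by blast
  have "\<forall>i<h. c i = 0" if "\<forall>p\<in>C. (\<Sum>i<h. c i * b i p) = 0" for c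
  proof (rule b(2), rule ballI)
    fix p assume "p \<in> D"
    moreover have "ispoly X (\<lambda>p. \<Sum>i<h. c i * b i p)"
      using b(1) by (intro ispoly_sum ispoly_cmult) (auto simp: ispoly_def)
    ultimately show "(\<Sum>i<h. c i * b i p) = 0" using assms(2) that by blast
  qed
  with b(1) show ?thesis unfolding has_indep_def by blast
qed

lemma has_indep_subset: "has_indep X C m h ==> C \<subseteq> D ==> has_indep X D m h"
  by (erule has_indep_dense) blast

lemma has_indep_1: "C \<noteq> {} ==> has_indep X C m 1"
  unfolding has_indep_def by (intro exI[of _ "\<lambda>_ _. 1"]) (auto simp: polydeg_const)

lemma growth_dense:
  assumes "growth X C d"
    and "\<And>f. ispoly X f ==> (\<And>p. p \<in> C ==> f p = 0) ==> (\<And>p. p \<in> D ==> f p = 0)"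
  shows "growth X D d"
proof -
  have "has_indep X C m h" if "has_indep X D m h" for m h
    using that by (rule has_indep_dense) (rule assms(2))
  with assms(1) show ?thesis unfolding growth_def by blast
qed

text \<open>Pulled back to the \<open>j\<close> parameters, a function of degree \<open>m\<close>
  has degree at most \<open>e * m\<close> and is a combination of \<open>(e * m + 1) ^ j\<close>
  monomials; more functions than that are dependent.\<close>

lemma growth_param:
  fixes \<psi> :: "(nat => complex) => 'a"
  assumes "\<And>l. l \<in> X ==> polydeg ((\<lambda>k t. t k) ` {..<j}) e (\<lambda>t. l (\<psi> t))"
  shows "growth X (range \<psi>) j"
  unfolding growth_def
proof (intro exI allI impI)
  fix m h assume "has_indep X (range \<psi>) m h"
  then obtain b where b: "\<And>i. i < h ==> polydeg X m (b i)"
    "\<And>c. (\<And>t. (\<Sum>i<h. c i * b i (\<psi> t)) = 0) ==> \<forall>i<h. c i = 0" unfolding has_indep_def by blast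
  define M where "M = Suc (e * m)"
  have "\<exists>c. \<forall>t. b i (\<psi> t) = (\<Sum>s\<in>expbox j M. c s * mon j (\<lambda>k. t k) s)" if "i < h" for i
    unfolding M_def by (rule polydeg_spanned[OF polydeg_compose[OF b(1)[OF that] assms]])
  then obtain a where a: "\<And>i t. i < h ==> b i (\<psi> t) = (\<Sum>s\<in>expbox j M. a i s * mon j t s)"
    by metis
  have "h \<le> card (expbox j M)"
  proof (rule ccontr)
    assume "\<not> h \<le> card (expbox j M)"
    then obtain c where c: "\<exists>i<h. c i \<noteq> 0" "\<And>s. s \<in> expbox j M ==> (\<Sum>i<h. c i * a i s) = 0"
      using exists_dependency[OF finite_box finite_lessThan, of j M h a] by auto
    have "(\<Sum>i<h. c i * b i (\<psi> t)) = (\<Sum>s\<in>expbox j M. (\<Sum>i<h. c i * a i s) * mon j t s)" for t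
      by (simp add: a sum_distrib_left sum_distrib_right mult.assoc sum.swap[of _ "{..<h}"])
    then have "\<forall>i<h. c i = 0" using c(2) by (intro b(2)) simp
    with c(1) show False by blast
  qed
  also have "\<dots> = M ^ j" by (simp add: card_box)
  also have "\<dots> \<le> ((e + 1) * (m + 1)) ^ j" unfolding M_def by (intro power_mono) auto
  finally show "h \<le> (e + 1) ^ j * (m + 1) ^ j" unfolding power_mult_distrib .
qed

text \<open>If \<open>b a\<close> are independent on \<open>C\<close>, then the products
  \<open>f ^ i * b a\<close> are independent on \<open>D\<close>: in a relation the terms free of
  \<open>f\<close> vanish on \<open>C\<close>, hence have zero coefficients, and primality of
  \<open>D\<close> allows \<open>f\<close> to be cancelled from the rest.\<close>

lemma growth_step:
  assumes prime: "prime_on X D" and growth: "growth X D d" and C: "C \<subseteq> D" "C \<noteq> {}"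
    and f: "ispoly X f" "\<And>p. p \<in> C ==> f p = 0" "\<exists>p\<in>D. f p \<noteq> 0"
  shows "0 < d \<and> growth X C (d - 1)"
proof -
  obtain e where e: "polydeg X e f" using f(1) by (auto simp: ispoly_def)
  obtain A where A: "\<And>m h. has_indep X D m h ==> h \<le> A * (m + 1) ^ d"
    using growth unfolding growth_def by blast
  have *: "has_indep X D (m + j * e) (j * h)" if indep: "has_indep X C m h" for m h j
  proof -
    obtain b where b: "\<And>i. i < h ==> polydeg X m (b i)"
      "\<And>c. (\<forall>p\<in>C. (\<Sum>i<h. c i * b i p) = 0) ==> \<forall>i<h. c i = 0"
      using indep unfolding has_indep_def by blast
    have "has_indep X D (m + j * e) (card ({..<j} \<times> {..<h}))"
    proof (rule has_indepI[where b = "\<lambda>(i, a) p. f p ^ i * b a p"])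
      fix i assume "i \<in> {..<j} \<times> {..<h}"
      then obtain i1 i2 where i: "i = (i1, i2)" "i1 < j" "i2 < h" by auto
      have "polydeg X (i1 * e + m) (\<lambda>p. f p ^ i1 * b i2 p)"
        using polydeg.mult[OF polydeg_power[OF e] b(1)[OF i(3)]] .
      moreover have "i1 * e + m \<le> m + j * e" using i(2) by simp
      ultimately show "polydeg X (m + j * e) (case i of (i, a) => \<lambda>p. f p ^ i * b a p)"
        using polydeg.mono[of X "i1 * e + m"] unfolding i(1) prod.case by blast
    next
      fix c i assume c: "\<And>p. p \<in> D ==> (\<Sum>i\<in>{..<j} \<times> {..<h}. c i * (case i of (i, a) => \<lambda>p. f p ^ i * b a p) p) = 0"
        and i: "i \<in> {..<j} \<times> {..<h}"
      have ind: "\<forall>i<j. \<forall>a<h. c i a = 0" if "\<And>p. p \<in> D ==> (\<Sum>i<j. \<Sum>a<h. c i a * (f p ^ i * b a p)) = 0" for c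
        using that
      proof (induction j arbitrary: c)
        case (Suc j)
        define g where "g p = (\<Sum>i<j. \<Sum>a<h. c (Suc i) a * (f p ^ i * b a p))" for p
        have eq: "(\<Sum>i<Suc j. \<Sum>a<h. c i a * (f p ^ i * b a p)) = (\<Sum>a<h. c 0 a * b a p) + f p * g p" for p
          unfolding sum.lessThan_Suc_shift g_def sum_distrib_left
          by (auto intro!: sum.cong arg_cong2[where f = "(+)"])
        have "(\<Sum>a<h. c 0 a * b a p) = 0" if "p \<in> C" for p
          using Suc.prems[of p] eq[of p] f(2)[OF that] C(1) that by auto
        then have c0: "\<forall>a<h. c 0 a = 0" using b(2)[of "c 0"] by blast
        then have "f p * g p = 0" if "p \<in> D" for p
          using Suc.prems[OF that] eq[of p] by simp
        moreover have "ispoly X g" unfolding g_def using b(1)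
          by (intro ispoly_intros f(1)) (auto simp: ispoly_def)
        ultimately have "\<forall>p\<in>D. g p = 0" using prime f(1,3) unfolding prime_on_def by blast
        then have "\<forall>i<j. \<forall>a<h. c (Suc i) a = 0" unfolding g_def by (intro Suc.IH) auto
        with c0 show ?case by (auto simp: less_Suc_eq_0_disj)
      qed simp
      have "(\<Sum>i<j. \<Sum>a<h. c (i, a) * (f p ^ i * b a p)) = 0" if "p \<in> D" for p
        using c[OF that] by (simp add: sum.cartesian_product split_def)
      then have "\<forall>i<j. \<forall>a<h. c (i, a) = 0" by (rule ind[of "\<lambda>i a. c (i, a)"])
      then show "c i = 0" using i by auto
    qed simp
    then show ?thesis by (simp add: card_cartesian_product)
  qed
  have d: "0 < d"
  proof (rule ccontr)
    \<comment> \<open>For \<open>d = 0\<close> the bound is the constant \<open>A\<close>, but the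
      first \<open>Suc A\<close> powers of \<open>f\<close> are independent on
      \<open>D\<close>.\<close>
    assume "\<not> 0 < d"
    with A[OF *[OF has_indep_1[OF C(2)], of 0 "Suc A"]] show False by simp
  qed
  moreover have "h \<le> (A * (e + 1) ^ d) * (m + 1) ^ (d - 1)" if "has_indep X C m h" for m h
  proof -
    \<comment> \<open>Taking \<open>m + 1\<close> powers of \<open>f\<close> keeps the degree
      proportional to \<open>m + 1\<close> while the number of functions gains a factor
      \<open>m + 1\<close>; this lowers the exponent by one.\<close>
    have "(m + 1) * h \<le> A * (m + (m + 1) * e + 1) ^ d"
      using A[OF *[OF that, of "m + 1"]] by simp
    also have "m + (m + 1) * e + 1 = (e + 1) * (m + 1)" by simp
    also have "A * \<dots> ^ d = (m + 1) * ((A * (e + 1) ^ d) * (m + 1) ^ (d - 1))"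
      using d by (cases d) (simp_all only: power_mult_distrib power_Suc mult_ac diff_Suc_1)
    finally show ?thesis by (simp only: mult_le_cancel1)
  qed
  then have "growth X C (d - 1)" unfolding growth_def by blast
  ultimately show ?thesis by blast
qed

lemma growth_chain:
  assumes "\<And>j. j \<le> k ==> prime_on X (C j)" "\<And>j. j < k ==> C j \<subseteq> C (Suc j)"
    "\<And>j. j < k ==> \<exists>f. ispoly X f \<and> (\<forall>p\<in>C j. f p = 0) \<and> (\<exists>p\<in>C (Suc j). f p \<noteq> 0)"
    and "growth X (C k) d"
  shows "k \<le> d"
  using assms
proof (induction k arbitrary: d)
  case (Suc k)
  from Suc.prems(3)[of k] obtain f where "ispoly X f" "\<forall>p\<in>C k. f p = 0" "\<exists>p\<in>C (Suc k). f p \<noteq> 0"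
    by blast
  moreover have "C k \<noteq> {}" using Suc.prems(1)[of k] by (simp add: prime_on_def)
  ultimately have "0 < d" "growth X (C k) (d - 1)"
    using growth_step[of X "C (Suc k)" d "C k" f] Suc.prems by auto
  moreover from this have "k \<le> d - 1"
    by (intro Suc.IH) (simp_all add: Suc.prems(1,2) Suc.prems(3)[OF less_SucI])
  ultimately show ?case by linarith
qed simp

lemma growth_lower:
  assumes "\<And>K. has_indep X C (e * K) (K ^ j)" "growth X C d"
  shows "j \<le> d"
proof (rule ccontr)
  assume "\<not> j \<le> d"
  then have j: "d < j" by simp
  obtain A where A: "\<And>m h. has_indep X C m h ==> h \<le> A * (m + 1) ^ d"
    using assms(2) unfolding growth_def by blast
  \<comment> \<open>Exceeds \<open>A * (e + 1) ^ d\<close>, so that the additional factor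
    \<open>K\<close> in \<open>K ^ Suc d\<close> contradicts the upper bound.\<close>
  define K where "K = A * (e + 1) ^ d + 1"
  have K: "1 \<le> K" by (simp add: K_def)
  have "K ^ d * K = K ^ Suc d" by simp
  also have "\<dots> \<le> K ^ j" using j K by (intro power_increasing) auto
  also have "\<dots> \<le> A * (e * K + 1) ^ d" by (rule A[OF assms(1)])
  also have "\<dots> \<le> A * ((e + 1) * K) ^ d" using K by (intro mult_le_mono2 power_mono) auto
  also have "\<dots> = K ^ d * (A * (e + 1) ^ d)" unfolding power_mult_distrib by (simp only: mult_ac)
  finally show False using K by (simp add: K_def)
qed

text \<open>If the velocities at a point of curves in \<open>C\<close> fill a \<open>j\<close>-dimensional space, then the lowest
  homogeneous parts show that \<open>j\<close> coordinates are algebraically independent on \<open>C\<close>.\<close>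

lemma has_indep_velocities:
  assumes x: "\<And>k. k < j ==> x k \<in> X"
    and curve: "\<And>v. \<exists>h. (\<forall>s. h s \<in> C) \<and> (\<forall>k<j. ((\<lambda>s. (x k (h s) - a k) / s) \<longlongrightarrow> v k) (at (0::complex)))"
  shows "has_indep X C (j * K) (K ^ j)"
proof -
  have "has_indep X C (j * K) (card (expbox j K))"
  proof (rule has_indepI[where b = "\<lambda>t p. mon j (\<lambda>k. x k p - a k) t"])
    fix t assume t: "t \<in> expbox j K"
    have "polydeg X (\<Sum>k<j. t k * 1) (\<lambda>p. mon j (\<lambda>k. x k p - a k) t)"
      unfolding mon_def by (intro polydeg_prod polydeg_power polydeg_diff polydeg_const polydeg.gen x) auto
    moreover have "(\<Sum>k<j. t k * 1) \<le> (\<Sum>k<j. K)"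
      using t by (intro sum_mono) (auto simp: PiE_iff dest!: bspec)
    ultimately show "polydeg X (j * K) (\<lambda>p. mon j (\<lambda>k. x k p - a k) t)"
      using polydeg.mono by simp
  next
    fix c \<alpha>0 assume c: "\<And>p. p \<in> C ==> (\<Sum>t\<in>expbox j K. c t * mon j (\<lambda>k. x k p - a k) t) = 0"
      and \<alpha>0: "\<alpha>0 \<in> expbox j K"
    define deg where "deg t = (\<Sum>k<j. t k)" for t :: "nat => nat"
    show "c \<alpha>0 = 0"
    proof (rule ccontr)
      assume nz: "c \<alpha>0 \<noteq> 0"
      define r where "r = (LEAST n. \<exists>t\<in>expbox j K. c t \<noteq> 0 \<and> deg t = n)"
      have ex: "\<exists>t\<in>expbox j K. c t \<noteq> 0 \<and> deg t = r"
        unfolding r_def by (rule LeastI[of _ "deg \<alpha>0"]) (use nz \<alpha>0 in blast)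
      have least: "r \<le> deg t" if "t \<in> expbox j K" "c t \<noteq> 0" for t
        unfolding r_def by (rule Least_le) (use that in blast)
      define c' where "c' t = (if deg t = r then c t else 0)" for t
      have zero: "(\<Sum>t\<in>expbox j K. c' t * mon j v t) = 0" for v
      proof -
        obtain h where h: "\<And>s. h s \<in> C" "\<And>k. k < j ==> ((\<lambda>s. (x k (h s) - a k) / s) \<longlongrightarrow> v k) (at 0)"
          using curve by blast
        \<comment> \<open>Divided by \<open>s ^ r\<close>, the relation along the curve becomes one
          in the difference quotients \<open>u s\<close>. As \<open>s\<close> tends to 0 only the
          terms of the least degree \<open>r\<close> survive, evaluated at the arbitrary velocity
          \<open>v\<close>.\<close>
        define u where "u s k = (x k (h s) - a k) / s" for s k
        have "((\<lambda>s. c t * (mon j (u s) t * s ^ (deg t - r))) \<longlongrightarrow> c' t * mon j v t) (at 0)"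
          if "t \<in> expbox j K" for t
        proof (cases "c t = 0")
          case False
          have "((\<lambda>s. c t * (mon j (u s) t * s ^ (deg t - r))) \<longlongrightarrow> c t * (mon j v t * 0 ^ (deg t - r))) (at 0)"
            unfolding mon_def u_def by (intro tendsto_intros h(2)) auto
          moreover have "c t * (mon j v t * 0 ^ (deg t - r)) = c' t * mon j v t"
            using least[OF that False] by (simp add: c'_def power_0_left)
          ultimately show ?thesis by simp
        qed (simp add: c'_def)
        then have lim: "((\<lambda>s. \<Sum>t\<in>expbox j K. c t * (mon j (u s) t * s ^ (deg t - r)))
            \<longlongrightarrow> (\<Sum>t\<in>expbox j K. c' t * mon j v t)) (at 0)"
          by (intro tendsto_sum)
        have "(\<Sum>t\<in>expbox j K. c t * (mon j (u s) t * s ^ (deg t - r))) = 0" if "s \<noteq> 0" for s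
        proof -
          have "s ^ r * (\<Sum>t\<in>expbox j K. c t * (mon j (u s) t * s ^ (deg t - r)))
            = (\<Sum>t\<in>expbox j K. c t * mon j (\<lambda>k. x k (h s) - a k) t)"
            unfolding sum_distrib_left
          proof (intro sum.cong refl)
            fix t assume t: "t \<in> expbox j K"
            have "mon j (\<lambda>k. x k (h s) - a k) t = mon j (u s) t * s ^ deg t"
              using that unfolding mon_def u_def deg_def power_sum
              by (simp add: prod.distrib[symmetric] power_mult_distrib[symmetric])
            then show "s ^ r * (c t * (mon j (u s) t * s ^ (deg t - r))) = c t * mon j (\<lambda>k. x k (h s) - a k) t"
              using least[OF t] by (cases "c t = 0") (simp_all add: power_add[symmetric] mult_ac)
          qed
          also have "\<dots> = 0" by (rule c[OF h(1)])
          finally show ?thesis using that by simp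
        qed
        then have "\<forall>\<^sub>F s in at 0. (\<Sum>t\<in>expbox j K. c t * (mon j (u s) t * s ^ (deg t - r))) = 0"
          by (auto simp: eventually_at_filter)
        then have "((\<lambda>s. \<Sum>t\<in>expbox j K. c t * (mon j (u s) t * s ^ (deg t - r))) \<longlongrightarrow> 0) (at 0)"
          by (rule tendsto_eventually)
        from tendsto_unique[OF _ lim this] show ?thesis by simp
      qed
      from ex obtain t where t: "t \<in> expbox j K" "c t \<noteq> 0" "deg t = r" by blast
      have "c' t = 0" by (rule mon_independent[OF zero t(1)])
      with t show False by (simp add: c'_def)
    qed
  qed (rule finite_box)
  then show ?thesis by (simp add: card_box)
qed

lemma prime_on_prod:
  assumes "prime_on X C" "finite I" "\<And>i. i \<in> I ==> ispoly X (f i)" "\<And>i. i \<in> I ==> \<exists>p\<in>C. f i p \<noteq> 0"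
  shows "\<exists>p\<in>C. \<forall>i\<in>I. f i p \<noteq> 0"
proof -
  have "\<exists>p\<in>C. (\<Prod>i\<in>I. f i p) \<noteq> 0" using assms(2-4)
  proof (induction I rule: finite_induct)
    case empty
    then show ?case using assms(1) by (auto simp: prime_on_def)
  next
    case (insert i I)
    have "ispoly X (\<lambda>p. \<Prod>i\<in>I. f i p)" using insert.prems by (intro ispoly_prod) auto
    moreover have "\<exists>p\<in>C. (\<Prod>i\<in>I. f i p) \<noteq> 0" using insert by auto
    moreover have "ispoly X (f i)" "\<exists>p\<in>C. f i p \<noteq> 0" using insert.prems by auto
    ultimately have "\<exists>p\<in>C. f i p * (\<Prod>i\<in>I. f i p) \<noteq> 0"
      using assms(1) unfolding prime_on_def by blast
    then show ?case using insert(1,2) by simp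
  qed
  then show ?thesis using assms(2) by auto
qed

text \<open>\<open>T\<close> is a maximal algebraically independent set of coordinates on
  \<open>C\<close>, and \<open>growth_lower\<close> bounds its size by \<open>d\<close>. Every other
  coordinate satisfies an equation over those in \<open>T\<close>; where some coefficient of that
  equation is nonzero, it takes only finitely many values once the coordinates in \<open>T\<close>
  are fixed.\<close>

lemma finite_fibre:
  fixes x :: "nat => 'a => complex"
  assumes prime: "prime_on X C" and growth: "growth X C d" and x: "\<And>k. k < N ==> x k \<in> X"
    and g: "ispoly X g" "\<exists>p\<in>C. g p \<noteq> 0"
  shows "\<exists>T p. T \<subseteq> {..<N} \<and> card T \<le> d \<and> p \<in> C \<and> g p \<noteq> 0 \<and>
    (\<forall>k<N. finite (x k ` {q \<in> C. \<forall>i\<in>T. x i q = x i p}))"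
proof -
  define B where "B T K = PiE T (\<lambda>_. {..<K})" for T :: "nat set" and K :: nat
  define algind where "algind T \<longleftrightarrow> (\<forall>K c. (\<forall>p\<in>C. (\<Sum>t\<in>B T K. c t * (\<Prod>k\<in>T. x k p ^ t k)) = 0) -->
    (\<forall>t\<in>B T K. c t = 0))" for T
  have finB: "finite (B T K)" if "T \<subseteq> {..<N}" for T K
    unfolding B_def using that finite_subset by (intro finite_PiE) auto
  have card_le: "card T \<le> d" if T: "algind T" "T \<subseteq> {..<N}" for T
  proof (rule growth_lower[OF _ growth])
    fix K
    have finT: "finite T" using T(2) finite_subset by blast
    have "has_indep X C (card T * K) (card (B T K))"
    proof (rule has_indepI[where b = "\<lambda>t p. \<Prod>k\<in>T. x k p ^ t k", OF finB[OF T(2)]])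
      fix t assume t: "t \<in> B T K"
      have "polydeg X (\<Sum>k\<in>T. t k * 1) (\<lambda>p. \<Prod>k\<in>T. x k p ^ t k)"
        using T(2) finT by (intro polydeg_prod polydeg_power polydeg.gen x) auto
      moreover have "(\<Sum>k\<in>T. t k * 1) \<le> (\<Sum>k\<in>T. K)"
        using t by (intro sum_mono) (auto simp: PiE_iff B_def dest!: bspec)
      ultimately show "polydeg X (card T * K) (\<lambda>p. \<Prod>k\<in>T. x k p ^ t k)"
        using polydeg.mono by simp
    qed (use T(1) in "auto simp: algind_def")
    then show "has_indep X C (card T * K) (K ^ card T)" using finT by (simp add: B_def card_PiE)
  qed
  have "algind {}" unfolding algind_def B_def using prime by (auto simp: prime_on_def)
  then have "\<exists>T. (algind T \<and> T \<subseteq> {..<N}) \<and> (\<forall>T'. algind T' \<and> T' \<subseteq> {..<N} --> card T' \<le> card T)"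
    by (intro ex_has_greatest_nat[where k = "{}" and b = "Suc d"]) (use card_le in "auto simp: less_Suc_eq_le")
  then obtain T where T: "algind T" "T \<subseteq> {..<N}"
    and max: "\<And>T'. algind T' ==> T' \<subseteq> {..<N} ==> card T' \<le> card T"
    by (elim exE conjE) blast
  have finT: "finite T" using T(2) finite_subset by blast
  \<comment> \<open>The relation that witnesses the dependence of \<open>insert j T\<close> is
    sorted by powers of \<open>x j\<close>. The coefficient \<open>q a0\<close>, where
    \<open>a0\<close> is the power of \<open>x j\<close> in some monomial that occurs, is not
    identically 0 on \<open>C\<close> since \<open>T\<close> is independent.\<close>
  have rel: "\<exists>K q a0. (\<forall>a<K. ispoly X (q a)) \<and> a0 < K \<and> (\<exists>p\<in>C. q a0 p \<noteq> 0) \<and>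
      (\<forall>p\<in>C. (\<Sum>a<K. q a p * x j p ^ a) = 0) \<and>
      (\<forall>a p p'. (\<forall>i\<in>T. x i p = x i p') --> q a p = q a p')" if j: "j < N" "j \<notin> T" for j
  proof -
    have "\<not> algind (insert j T)" using max[of "insert j T"] T(2) j finT by auto
    then obtain K c \<alpha>0 where c: "\<And>p. p \<in> C ==> (\<Sum>t\<in>B (insert j T) K. c t * (\<Prod>k\<in>insert j T. x k p ^ t k)) = 0"
      and \<alpha>0: "\<alpha>0 \<in> B (insert j T) K" "c \<alpha>0 \<noteq> 0" unfolding algind_def by blast
    define q where "q a p = (\<Sum>s\<in>B T K. c (s(j := a)) * (\<Prod>k\<in>T. x k p ^ s k))" for a p
    have A1: "ispoly X (q a)" for a
      unfolding q_def using T(2) by (intro ispoly_intros ispoly_gen x) auto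
    have A2: "\<alpha>0 j < K" using \<alpha>0(1) by (auto simp: B_def)
    have A3: "\<exists>p\<in>C. q (\<alpha>0 j) p \<noteq> 0"
    proof (rule ccontr)
      assume "\<not> (\<exists>p\<in>C. q (\<alpha>0 j) p \<noteq> 0)"
      then have "\<forall>s\<in>B T K. c (s(j := \<alpha>0 j)) = 0"
        using T(1)[unfolded algind_def, THEN spec[of _ K], THEN spec[of _ "\<lambda>s. c (s(j := \<alpha>0 j))"]]
        unfolding q_def by blast
      moreover have "restrict \<alpha>0 T \<in> B T K" using \<alpha>0(1) by (auto simp: B_def restrict_PiE_iff)
      moreover have "(restrict \<alpha>0 T)(j := \<alpha>0 j) = \<alpha>0"
        using \<alpha>0(1) by (intro ext) (auto simp: B_def restrict_def PiE_iff extensional_def)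
      ultimately show False using \<alpha>0(2) by fastforce
    qed
    have A4: "(\<Sum>a<K. q a p * x j p ^ a) = 0" if p: "p \<in> C" for p
    proof -
      have inj: "inj_on (\<lambda>(y, g). g(j := y)) ({..<K} \<times> B T K)"
        using inj_combinator[OF j(2), of "\<lambda>_. {..<K}"] by (simp add: B_def)
      have "B (insert j T) K = (\<lambda>(y, g). g(j := y)) ` ({..<K} \<times> B T K)"
        unfolding B_def by (rule PiE_insert_eq)
      then have "(\<Sum>t\<in>B (insert j T) K. c t * (\<Prod>k\<in>insert j T. x k p ^ t k))
        = (\<Sum>(a, s)\<in>{..<K} \<times> B T K. c (s(j := a)) * (\<Prod>k\<in>insert j T. x k p ^ (s(j := a)) k))"
        by (simp only: sum.reindex[OF inj[unfolded split_def]] o_def split_def)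
      also have "\<dots> = (\<Sum>(a, s)\<in>{..<K} \<times> B T K. c (s(j := a)) * (\<Prod>k\<in>T. x k p ^ s k) * x j p ^ a)"
      proof (intro sum.cong refl, clarify)
        fix a s
        have "(\<Prod>k\<in>T. x k p ^ (s(j := a)) k) = (\<Prod>k\<in>T. x k p ^ s k)"
          using j(2) by (intro prod.cong) auto
        then show "c (s(j := a)) * (\<Prod>k\<in>insert j T. x k p ^ (s(j := a)) k) =
          c (s(j := a)) * (\<Prod>k\<in>T. x k p ^ s k) * x j p ^ a"
          using j(2) finT by (simp add: mult_ac)
      qed
      also have "\<dots> = (\<Sum>a<K. q a p * x j p ^ a)"
        by (simp add: q_def sum.cartesian_product[symmetric] sum_distrib_right)
      finally show ?thesis using c[OF p] by simp
    qed
    have A5: "q a p = q a p'" if "\<forall>i\<in>T. x i p = x i p'" for a p p'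
      unfolding q_def using that by simp
    show ?thesis
      by (intro exI[of _ K] exI[of _ q] exI[of _ "\<alpha>0 j"] conjI allI impI ballI A1 A2 A3 A4 A5) blast+
  qed
  define J where "J = {j. j < N \<and> j \<notin> T}"
  define good where "good j = (\<lambda>(K, q, a0). (\<forall>a<K. ispoly X (q a)) \<and> a0 < K \<and> (\<exists>p\<in>C. q a0 p \<noteq> 0) \<and>
      (\<forall>p\<in>C. (\<Sum>a<K. q a p * x j p ^ a) = 0) \<and>
      (\<forall>a p p'. (\<forall>i\<in>T. x i p = x i p') --> q a p = q a p'))"
    for j
  have "\<exists>Kqa. good j Kqa" if "j \<in> J" for j
  proof -
    from that have "j < N" "j \<notin> T" by (auto simp: J_def)
    from rel[OF this] obtain K q a0 where "(\<forall>a<K. ispoly X (q a)) \<and> a0 < K \<and> (\<exists>p\<in>C. q a0 p \<noteq> 0) \<and>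
      (\<forall>p\<in>C. (\<Sum>a<K. q a p * x j p ^ a) = 0) \<and>
      (\<forall>a p p'. (\<forall>i\<in>T. x i p = x i p') --> q a p = q a p')" by (elim exE)
    then have "good j (K, q, a0)" unfolding good_def prod.case .
    then show ?thesis ..
  qed
  then have R: "good j (SOME R. good j R)" if "j \<in> J" for j using that by (blast intro: someI_ex)
  define R where "R j = (SOME R. good j R)" for j
  define K where "K j = fst (R j)" for j
  define q where "q j = fst (snd (R j))" for j
  define a0 where "a0 j = snd (snd (R j))" for j
  have "good j (K j, q j, a0 j)" if "j \<in> J" for j using R[OF that] by (simp add: K_def q_def a0_def R_def)
  note good = this[unfolded good_def prod.case]
  have q: "\<And>j a. j \<in> J ==> a < K j ==> ispoly X (q j a)"
    "\<And>j. j \<in> J ==> a0 j < K j" "\<And>j. j \<in> J ==> \<exists>p\<in>C. q j (a0 j) p \<noteq> 0"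
    "\<And>j p. j \<in> J ==> p \<in> C ==> (\<Sum>a<K j. q j a p * x j p ^ a) = 0"
    "\<And>j a p p'. j \<in> J ==> (\<forall>i\<in>T. x i p = x i p') ==> q j a p = q j a p'"
    using good by blast+
  \<comment> \<open>\<open>None\<close> stands for \<open>g\<close>, so that one point avoids the
    zeros of \<open>g\<close> and of all the chosen coefficients together.\<close>
  define F where "F i = (case i of None => g | Some j => q j (a0 j))" for i
  have "\<exists>p\<in>C. \<forall>i\<in>insert None (Some ` J). F i p \<noteq> 0"
    by (rule prime_on_prod[OF prime]) (use q g in "auto simp: F_def J_def")
  then obtain p where p: "p \<in> C" "g p \<noteq> 0" "\<And>j. j \<in> J ==> q j (a0 j) p \<noteq> 0"
    by (auto simp: F_def)
  have "finite (x k ` {r \<in> C. \<forall>i\<in>T. x i r = x i p})" if k: "k < N" for k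
  proof (cases "k \<in> T")
    case True
    then have "x k ` {r \<in> C. \<forall>i\<in>T. x i r = x i p} \<subseteq> {x k p}" by auto
    then show ?thesis using finite_subset by blast
  next
    case False
    then have J: "k \<in> J" using k by (simp add: J_def)
    define P where "P = (\<Sum>a<K k. monom (q k a p) a)"
    have "coeff P (a0 k) = q k (a0 k) p" using q(2)[OF J] by (simp add: P_def coeff_sum)
    then have "P \<noteq> 0" using p(3)[OF J] by auto
    moreover have "x k ` {r \<in> C. \<forall>i\<in>T. x i r = x i p} \<subseteq> {z. poly P z = 0}"
    proof clarsimp
      fix r assume r: "r \<in> C" "\<forall>i\<in>T. x i r = x i p"
      have "q k a r = q k a p" for a by (rule q(5)[OF J r(2)])
      then show "poly P (x k r) = 0" using q(4)[OF J r(1)] by (simp add: P_def poly_sum poly_monom)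
    qed
    ultimately show ?thesis using poly_roots_finite finite_subset by blast
  qed
  then show ?thesis using T(2) card_le[OF T] p by blast
qed


section \<open>Hilbert's Nullstellensatz and the height theorem\<close>

text \<open>Linear coordinates on a subspace \<open>W\<close>: the vectors \<open>e\<close> form a
  basis of \<open>W\<close>, and the functionals \<open>x\<close>, defined on the whole type,
  restrict to its dual basis.\<close>

locale affine_chart = vector_space sc
  for sc :: "complex => 'p::ab_group_add => 'p" +
  fixes W :: "'p set" and N :: nat and e :: "nat => 'p" and x :: "nat => 'p => complex"
  assumes linear_x: "k < N ==> functional sc (x k)"
    and pt_in: "(\<Sum>k<N. sc (t k) (e k)) \<in> W"
    and x_pt: "k < N ==> x k (\<Sum>k<N. sc (t k) (e k)) = t k"
    and pt_x: "p \<in> W ==> (\<Sum>k<N. sc (x k p) (e k)) = p"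
begin

abbreviation "poly_fun \<equiv> ispoly (linfuns sc)"

definition pt :: "(nat => complex) => 'p" where
  "pt t = (\<Sum>k<N. sc (t k) (e k))"

lemma pt_W: "pt t \<in> W" and x_of_pt: "k < N ==> x k (pt t) = t k"
  and pt_of_x: "p \<in> W ==> pt (\<lambda>k. x k p) = p"
  unfolding pt_def using pt_in x_pt pt_x by auto

lemma linear_pt:
  assumes "functional sc l"
  shows "l (pt t) = (\<Sum>k<N. t k * l (e k))"
proof -
  interpret l: Vector_Spaces.linear sc "(*)" l by (rule assms)
  show ?thesis unfolding pt_def by (simp add: l.sum l.scale)
qed

lemma linear_add: "functional sc l ==> l (p + q) = l p + l q"
  and linear_scale: "functional sc l ==> l (sc c p) = c * l p"
  and linear_diff: "functional sc l ==> l (p - q) = l p - l q"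
proof -
  assume "functional sc l"
  then interpret l: Vector_Spaces.linear sc "(*)" l .
  show "l (p + q) = l p + l q" "l (sc c p) = c * l p" "l (p - q) = l p - l q"
    by (auto simp: l.add l.scale l.diff)
qed

lemma linear_W:
  assumes "functional sc l" "p \<in> W"
  shows "l p = (\<Sum>k<N. x k p * l (e k))"
  using linear_pt[OF assms(1), of "\<lambda>k. x k p"] pt_of_x[OF assms(2)] by simp

lemma poly_fun_x: "k < N ==> poly_fun (x k)"
  using linear_x by (intro ispoly_gen) auto

text \<open>Expansion in coordinates shifted by \<open>a\<close>; it is used with
  \<open>a = 0\<close> and with \<open>a\<close> the coordinates of the point under study.\<close>

lemma polydeg_W:
  assumes "polydeg (linfuns sc) m f"
  shows "\<exists>c. \<forall>p\<in>W. f p = (\<Sum>s\<in>expbox N (Suc m). c s * mon N (\<lambda>k. x k p - a k) s)"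
proof -
  have "polydeg ((\<lambda>k t. t k) ` {..<N}) (1 * m) (\<lambda>t. f (pt (\<lambda>k. t k + a k)))"
  proof (rule polydeg_compose[OF assms])
    fix l assume "l \<in> linfuns sc"
    then have "(\<lambda>t. l (pt (\<lambda>k. t k + a k))) = (\<lambda>t. \<Sum>k<N. (t k + a k) * l (e k))"
      using linear_pt by (intro ext) auto
    moreover have "polydeg ((\<lambda>k t. t k) ` {..<N}) (1 + 0) (\<lambda>t. (t k + a k) * l (e k))" if "k < N" for k
      using that by (intro polydeg.mult polydeg.add polydeg_const polydeg.gen) auto
    then have "polydeg ((\<lambda>k t. t k) ` {..<N}) (1 + 0) (\<lambda>t. \<Sum>k<N. (t k + a k) * l (e k))"
      by (intro polydeg_sum) auto
    ultimately show "polydeg ((\<lambda>k t. t k) ` {..<N}) 1 (\<lambda>t. l (pt (\<lambda>k. t k + a k)))" by simp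
  qed
  from polydeg_spanned[OF this] obtain c where
    c: "\<And>t. f (pt (\<lambda>k. t k + a k)) = (\<Sum>s\<in>expbox N (Suc m). c s * mon N (\<lambda>k. t k) s)"
    by auto
  have "f p = (\<Sum>s\<in>expbox N (Suc m). c s * mon N (\<lambda>k. x k p - a k) s)" if "p \<in> W" for p
    using c[of "\<lambda>k. x k p - a k"] pt_of_x[OF that] by simp
  then show ?thesis by blast
qed

text \<open>The last clause makes membership depend only on values on \<open>W\<close>, so this is
  an ideal of the coordinate ring of \<open>W\<close>, pulled back to functions on the whole
  type.\<close>

definition ideal_on :: "('p => complex) set => bool" where
  "ideal_on I \<longleftrightarrow> (\<lambda>_. 0) \<in> I \<and> (\<forall>f\<in>I. poly_fun f) \<and> (\<forall>f\<in>I. \<forall>g\<in>I. (\<lambda>p. f p + g p) \<in> I) \<and>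
     (\<forall>f\<in>I. \<forall>g. poly_fun g --> (\<lambda>p. g p * f p) \<in> I) \<and>
     (\<forall>f\<in>I. \<forall>g. poly_fun g --> (\<forall>p\<in>W. g p = f p) --> g \<in> I)"

lemma ideal_onD:
  assumes "ideal_on I"
  shows "(\<lambda>_. 0) \<in> I" "f \<in> I ==> poly_fun f" "f \<in> I ==> g \<in> I ==> (\<lambda>p. f p + g p) \<in> I"
    "f \<in> I ==> poly_fun h ==> (\<lambda>p. h p * f p) \<in> I"
    "f \<in> I ==> poly_fun h ==> (\<And>p. p \<in> W ==> h p = f p) ==> h \<in> I"
  using assms unfolding ideal_on_def by blast+

lemma ideal_on_sum:
  assumes "ideal_on I" "\<And>i. i \<in> A ==> f i \<in> I"
  shows "(\<lambda>p. \<Sum>i\<in>A. f i p) \<in> I"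
  using assms(2)
proof (induction A rule: infinite_finite_induct)
  case (insert i A)
  then have "(\<lambda>p. f i p + (\<Sum>i\<in>A. f i p)) \<in> I"
    by (intro ideal_onD(3)[OF assms(1)]) auto
  with insert(1,2) show ?case by simp
qed (auto intro: ideal_onD(1)[OF assms(1)])

lemma ideal_on_Union:
  assumes "\<C> \<noteq> {}" "\<And>I. I \<in> \<C> ==> ideal_on I" "\<And>I J. I \<in> \<C> ==> J \<in> \<C> ==> I \<subseteq> J \<or> J \<subseteq> I"
  shows "ideal_on (\<Union>\<C>)"
  unfolding ideal_on_def
proof (intro conjI ballI allI impI)
  show "(\<lambda>_. 0) \<in> \<Union>\<C>" using assms(1) ideal_onD(1)[OF assms(2)] by blast
  fix f assume "f \<in> \<Union>\<C>"
  then obtain I where I: "f \<in> I" "I \<in> \<C>" by blast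
  note id = ideal_onD[OF assms(2)[OF I(2)]]
  show "poly_fun f" using id(2) I by blast
  show "(\<lambda>p. g p * f p) \<in> \<Union>\<C>" if "poly_fun g" for g using id(4)[OF I(1) that] I(2) by blast
  show "g \<in> \<Union>\<C>" if "poly_fun g" "\<forall>p\<in>W. g p = f p" for g using id(5)[OF I(1) that(1)] that(2) I(2) by blast
  fix g assume "g \<in> \<Union>\<C>"
  then obtain J where J: "g \<in> J" "J \<in> \<C>" by blast
  obtain K where "K \<in> \<C>" "f \<in> K" "g \<in> K" using I J assms(3)[OF I(2) J(2)] by blast
  then show "(\<lambda>p. f p + g p) \<in> \<Union>\<C>" using ideal_onD(3)[OF assms(2)] by blast
qed

lemma ideal_on_insert:
  assumes I: "ideal_on I" and a: "poly_fun a"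
  defines "J \<equiv> {h. poly_fun h \<and> (\<exists>g\<in>I. \<exists>r. poly_fun r \<and> (\<forall>p\<in>W. h p = g p + r p * a p))}"
  shows "ideal_on J" "I \<subseteq> J" "a \<in> J"
proof -
  show "I \<subseteq> J"
  proof
    fix f assume f: "f \<in> I"
    then show "f \<in> J" unfolding J_def using ideal_onD(2)[OF I f]
      by (auto intro!: bexI[of _ f] exI[of _ "\<lambda>_. 0"] ispoly_const)
  qed
  show "a \<in> J" unfolding J_def using a
    by (auto intro!: bexI[of _ "\<lambda>_. 0"] exI[of _ "\<lambda>_. 1"] ispoly_const ideal_onD(1)[OF I])
  show "ideal_on J" unfolding ideal_on_def
  proof (intro conjI ballI allI impI)
    show "(\<lambda>_. 0) \<in> J" using \<open>I \<subseteq> J\<close> ideal_onD(1)[OF I] by blast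
    fix f assume "f \<in> J"
    then obtain g r where f: "poly_fun f" "g \<in> I" "poly_fun r" "\<And>p. p \<in> W ==> f p = g p + r p * a p"
      unfolding J_def by blast
    show "poly_fun f" by fact
    show "(\<lambda>p. h p * f p) \<in> J" if h: "poly_fun h" for h
      unfolding J_def
      by (intro CollectI conjI bexI[of _ "\<lambda>p. h p * g p"] exI[of _ "\<lambda>p. h p * r p"] ispoly_mult h f
          ideal_onD(4)[OF I f(2)] ballI) (simp add: f(4) algebra_simps)
    show "h \<in> J" if h: "poly_fun h" "\<forall>p\<in>W. h p = f p" for h
      unfolding J_def using h f by auto
    fix f' assume "f' \<in> J"
    then obtain g' r' where f': "poly_fun f'" "g' \<in> I" "poly_fun r'" "\<And>p. p \<in> W ==> f' p = g' p + r' p * a p"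
      unfolding J_def by blast
    show "(\<lambda>p. f p + f' p) \<in> J"
      unfolding J_def
      by (intro CollectI conjI bexI[of _ "\<lambda>p. g p + g' p"] exI[of _ "\<lambda>p. r p + r' p"] ispoly_add f f'
          ideal_onD(3)[OF I f(2) f'(2)] ballI) (simp add: f(4) f'(4) algebra_simps)
  qed
qed

text \<open>An ideal that is maximal among those avoiding the powers of \<open>f\<close> contains some \<open>x k - c\<close> for
  each \<open>k\<close>: otherwise \<open>f ^ M\<close> is divisible by \<open>x k - c\<close> modulo the ideal for all of the uncountably
  many \<open>c\<close>, and a linear relation between the quotients gives a polynomial in \<open>x k\<close> in the ideal.\<close>

theorem nullstellensatz:
  assumes I: "ideal_on I" and f: "poly_fun f"
    and zero: "\<And>p. p \<in> W ==> (\<And>g. g \<in> I ==> g p = 0) ==> f p = 0"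
  shows "\<exists>M. (\<lambda>p. f p ^ M) \<in> I"
proof (rule ccontr)
  assume neg: "\<not> (\<exists>M. (\<lambda>p. f p ^ M) \<in> I)"
  define \<A> where "\<A> = {J. ideal_on J \<and> I \<subseteq> J \<and> (\<forall>M. (\<lambda>p. f p ^ M) \<notin> J)}"
  have "\<exists>J\<in>\<A>. \<forall>J'\<in>\<A>. J \<subseteq> J' --> J' = J"
  proof (rule subset_Zorn_nonempty)
    show "\<A> \<noteq> {}" using I neg unfolding \<A>_def by blast
    fix \<C> assume \<C>: "\<C> \<noteq> {}" "subset.chain \<A> \<C>"
    then have "\<And>J. J \<in> \<C> ==> J \<in> \<A>" "\<And>I J. I \<in> \<C> ==> J \<in> \<C> ==> I \<subseteq> J \<or> J \<subseteq> I"
      by (auto simp: subset_chain_def)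
    then show "\<Union>\<C> \<in> \<A>" using ideal_on_Union[of \<C>] \<C>(1) unfolding \<A>_def by blast
  qed
  then obtain J where "J \<in> \<A>" and max: "\<And>J'. J' \<in> \<A> ==> J \<subseteq> J' ==> J' = J" by blast
  then have J: "ideal_on J" "I \<subseteq> J" "\<And>M. (\<lambda>p. f p ^ M) \<notin> J" by (auto simp: \<A>_def)
  note id = ideal_onD[OF J(1)]
  have ext: "\<exists>M. \<exists>g\<in>J. \<exists>r. poly_fun r \<and> (\<forall>p\<in>W. f p ^ M = g p + r p * a p)"
    if a: "poly_fun a" "a \<notin> J" for a
  proof -
    let ?J = "{h. poly_fun h \<and> (\<exists>g\<in>J. \<exists>r. poly_fun r \<and> (\<forall>p\<in>W. h p = g p + r p * a p))}"
    note ins = ideal_on_insert[OF J(1) a(1)]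
    have "?J \<notin> \<A>" using max[of ?J] ins a(2) by blast
    then obtain M where "(\<lambda>p. f p ^ M) \<in> ?J" using ins(1,2) J(2) unfolding \<A>_def by blast
    then show ?thesis by blast
  qed
  have prime: "a \<in> J \<or> b \<in> J" if ab: "poly_fun a" "poly_fun b" "(\<lambda>p. a p * b p) \<in> J" for a b
  proof (rule ccontr)
    assume "\<not> (a \<in> J \<or> b \<in> J)"
    then obtain M1 g1 r1 M2 g2 r2 where 1: "g1 \<in> J" "poly_fun r1" "\<And>p. p \<in> W ==> f p ^ M1 = g1 p + r1 p * a p"
      and 2: "g2 \<in> J" "poly_fun r2" "\<And>p. p \<in> W ==> f p ^ M2 = g2 p + r2 p * b p"
      using ext[OF ab(1)] ext[OF ab(2)] by blast
    have "(\<lambda>p. (f p ^ M2) * g1 p + (r1 p * a p) * g2 p + (r1 p * r2 p) * (a p * b p)) \<in> J"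
      by (intro id(3)[OF id(3)[OF id(4)[OF 1(1)] id(4)[OF 2(1)]] id(4)[OF ab(3)]] ispoly_mult
          ispoly_power f 1(2) 2(2) ab(1))
    then have "(\<lambda>p. f p ^ (M1 + M2)) \<in> J"
      by (rule id(5)) (auto simp: power_add 1(3) 2(3) algebra_simps intro!: ispoly_intros f)
    with J(3) show False by blast
  qed
  have const: "c = 0" if "(\<lambda>_. c) \<in> J" for c
  proof (rule ccontr)
    assume "c \<noteq> 0"
    with id(4)[OF that ispoly_const, of "inverse c"] have "(\<lambda>p. f p ^ 0) \<in> J" by simp
    with J(3) show False by blast
  qed
  \<comment> \<open>Over the complex numbers \<open>q\<close> splits into linear factors, and
    primality puts one of them into \<open>J\<close>.\<close>
  have uni: "\<exists>c. (\<lambda>p. x k p - c) \<in> J"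
    if "k < N" "q \<noteq> 0" "(\<lambda>p. poly q (x k p)) \<in> J" for k q
    using that(2,3)
  proof (induction "degree q" arbitrary: q rule: less_induct)
    case less
    show ?case
    proof (cases "degree q = 0")
      case True
      then obtain a where "q = [:a:]" by (rule degree_eq_zeroE)
      with less.prems const[of a] show ?thesis by simp
    next
      case False
      then have "\<not> constant (poly q)" by (simp add: constant_degree)
      then obtain z where "poly q z = 0" using fundamental_theorem_of_algebra by blast
      then obtain q' where q': "q = [:-z, 1:] * q'" by (auto simp: poly_eq_0_iff_dvd elim: dvdE)
      with less.prems have "q' \<noteq> 0" by auto
      then have "degree q' < degree q" unfolding q' by (subst degree_mult_eq) auto
      have "poly_fun (\<lambda>p. poly q' (x k p))" unfolding poly_altdef
        by (intro ispoly_intros poly_fun_x that)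
      moreover have "poly_fun (\<lambda>p. x k p - z)" by (intro ispoly_intros poly_fun_x that)
      moreover have "(\<lambda>p. (x k p - z) * poly q' (x k p)) \<in> J"
        using less.prems(2) by (simp add: q' algebra_simps)
      ultimately consider "(\<lambda>p. x k p - z) \<in> J" | "(\<lambda>p. poly q' (x k p)) \<in> J" using prime by blast
      then show ?thesis
      proof cases
        case 2
        then show ?thesis using less.hyps[OF \<open>degree q' < degree q\<close> \<open>q' \<noteq> 0\<close>] by blast
      qed blast
    qed
  qed
  have "\<exists>c. (\<lambda>p. x k p - c) \<in> J" if k: "k < N" for k
  proof (rule ccontr)
    assume no: "\<nexists>c. (\<lambda>p. x k p - c) \<in> J"
    define D where "D M m c \<longleftrightarrow> (\<exists>g\<in>J. \<exists>r. polydeg (linfuns sc) m r \<and>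
      (\<forall>p\<in>W. f p ^ M = g p + r p * (x k p - c)))" for M m c
    have "\<exists>M m. D M m c" for c
    proof -
      have "poly_fun (\<lambda>p. x k p - c)" by (intro ispoly_intros poly_fun_x k)
      from ext[OF this] no show ?thesis unfolding D_def ispoly_def by blast
    qed
    then have U: "(UNIV :: complex set) = (\<Union>(M, m)\<in>UNIV. {c. D M m c})" by auto
    have "\<exists>M m. infinite {c. D M m c}"
    proof (rule ccontr)
      assume "\<nexists>M m. infinite {c. D M m c}"
      then have "countable (\<Union>(M, m)\<in>(UNIV :: (nat \<times> nat) set). {c. D M m c})"
        by (intro countable_UN) (auto intro: countable_finite)
      with U uncountable_UNIV_complex show False by metis
    qed
    then obtain M m where "infinite {c. D M m c}" by blast
    then obtain S where S: "finite S" "card S = Suc (card (expbox N (Suc m)))" "S \<subseteq> {c. D M m c}"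
      using infinite_arbitrarily_large by blast
    from S(3) have "\<forall>c\<in>S. \<exists>gr. fst gr \<in> J \<and> polydeg (linfuns sc) m (snd gr) \<and>
      (\<forall>p\<in>W. f p ^ M = fst gr p + snd gr p * (x k p - c))"
      unfolding D_def by fastforce
    then obtain gr where gr: "\<And>c. c \<in> S ==> fst (gr c) \<in> J" "\<And>c. c \<in> S ==> polydeg (linfuns sc) m (snd (gr c))"
      "\<And>c p. c \<in> S ==> p \<in> W ==> f p ^ M = fst (gr c) p + snd (gr c) p * (x k p - c)"
      by metis
    define g where "g c = fst (gr c)" for c
    define r where "r c = snd (gr c)" for c
    note gr = gr[folded g_def r_def]
    have "\<forall>c\<in>S. \<exists>a. \<forall>p\<in>W. r c p = (\<Sum>s\<in>expbox N (Suc m). a s * mon N (\<lambda>k. x k p - 0) s)"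
      using polydeg_W[OF gr(2), of _ "\<lambda>_. 0"] by blast
    then obtain a where a: "\<And>c p. c \<in> S ==> p \<in> W ==> r c p = (\<Sum>s\<in>expbox N (Suc m). a c s * mon N (\<lambda>k. x k p - 0) s)"
      by metis
    obtain t where t: "\<exists>c\<in>S. t c \<noteq> 0" "\<And>s. s \<in> expbox N (Suc m) ==> (\<Sum>c\<in>S. t c * a c s) = 0"
      using exists_dependency[OF finite_box S(1), of N "Suc m" a] S(2) by auto
    have r0: "(\<Sum>c\<in>S. t c * r c p) = 0" if "p \<in> W" for p
    proof -
      have "(\<Sum>c\<in>S. t c * r c p) = (\<Sum>s\<in>expbox N (Suc m). (\<Sum>c\<in>S. t c * a c s) * mon N (\<lambda>k. x k p - 0) s)"
        using a[OF _ that] by (simp add: sum_distrib_left sum_distrib_right mult.assoc sum.swap[of _ S])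
      then show ?thesis using t(2) by simp
    qed
    \<comment> \<open>Multiplying the identity of each \<open>c\<close> by \<open>t c\<close> and by
      the factors of all other members of \<open>S\<close>, then summing, makes the quotients
      \<open>r c\<close> cancel and leaves \<open>f ^ M\<close> times \<open>q\<close>. This
      \<open>q\<close> is nonzero because at \<open>c0\<close> only the term of \<open>c0\<close>
      survives.\<close>
    define L where "L c z = (\<Prod>c'\<in>S - {c}. z - c')" for c z :: complex
    define q where "q = (\<Sum>c\<in>S. smult (t c) (\<Prod>c'\<in>S - {c}. [:- c', 1:]))"
    have pq: "poly q z = (\<Sum>c\<in>S. t c * L c z)" for z
      by (simp add: q_def poly_sum poly_prod L_def)
    obtain c0 where c0: "c0 \<in> S" "t c0 \<noteq> 0" using t(1) by blast
    have "poly q c0 = (\<Sum>c\<in>S. if c = c0 then t c * L c c0 else 0)"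
      unfolding pq using c0(1) S(1) by (intro sum.cong) (auto simp: L_def)
    also have "\<dots> \<noteq> 0" using c0 S(1) by (simp add: L_def)
    finally have "q \<noteq> 0" by auto
    have Lp: "poly_fun (\<lambda>p. L c (x k p))" for c
      unfolding L_def by (intro ispoly_intros poly_fun_x k)
    have qp: "poly_fun (\<lambda>p. poly q (x k p))"
      unfolding pq by (intro ispoly_intros Lp)
    have "(\<lambda>p. \<Sum>c\<in>S. (t c * L c (x k p)) * g c p) \<in> J"
      by (intro ideal_on_sum[OF J(1)] id(4) gr(1) ispoly_intros Lp)
    then have "(\<lambda>p. f p ^ M * poly q (x k p)) \<in> J"
    proof (rule id(5))
      show "poly_fun (\<lambda>p. f p ^ M * poly q (x k p))" by (intro ispoly_mult ispoly_power f qp)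
      fix p assume p: "p \<in> W"
      have "f p ^ M * poly q (x k p) = (\<Sum>c\<in>S. t c * L c (x k p) * (g c p + r c p * (x k p - c)))"
        unfolding pq sum_distrib_left using gr(3)[OF _ p] by (intro sum.cong) (auto simp: mult_ac)
      also have "\<dots> = (\<Sum>c\<in>S. t c * L c (x k p) * g c p) + (\<Sum>c\<in>S. t c * r c p * ((x k p - c) * L c (x k p)))"
        by (simp add: algebra_simps sum.distrib sum_subtractf)
      also have "(\<Sum>c\<in>S. t c * r c p * ((x k p - c) * L c (x k p))) = (\<Sum>c\<in>S. t c * r c p) * (\<Prod>c\<in>S. x k p - c)"
        unfolding sum_distrib_right L_def
        by (intro sum.cong refl arg_cong2[where f = "(*)"] prod.remove[OF S(1), symmetric])
      finally show "f p ^ M * poly q (x k p) = (\<Sum>c\<in>S. t c * L c (x k p) * g c p)"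
        using r0[OF p] by simp
    qed
    with prime[OF ispoly_power[OF f] qp] J(3) have "(\<lambda>p. poly q (x k p)) \<in> J" by blast
    with uni[OF k \<open>q \<noteq> 0\<close>] no show False by blast
  qed
  then obtain c where c: "\<And>k. k < N ==> (\<lambda>p. x k p - c k) \<in> J" by metis
  define p0 where "p0 = pt c"
  \<comment> \<open>\<open>J\<close> is the maximal ideal of the point \<open>p0\<close>. So
    \<open>p0\<close> is a zero of \<open>I\<close> and therefore of \<open>f\<close>, which puts
    \<open>f\<close> itself into \<open>J\<close>.\<close>
  have val: "(\<lambda>p. h p - h p0) \<in> J" if "poly_fun h" for h
  proof -
    from that obtain m where "polydeg (linfuns sc) m h" by (auto simp: ispoly_def)
    then show ?thesis
    proof induction
      case (gen l)
      then have l: "functional sc l" by simp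
      have "(\<lambda>p. \<Sum>k<N. l (e k) * (x k p - c k)) \<in> J"
        by (intro ideal_on_sum[OF J(1)] id(4) c ispoly_const) auto
      then show ?case
      proof (rule id(5))
        show "poly_fun (\<lambda>p. l p - l p0)" using gen by (intro ispoly_diff ispoly_const ispoly_gen)
        fix p assume "p \<in> W"
        then show "l p - l p0 = (\<Sum>k<N. l (e k) * (x k p - c k))"
          using linear_W[OF l] linear_pt[OF l, of c] by (simp add: p0_def algebra_simps sum_subtractf)
      qed
    next
      case (const c)
      then show ?case using id(1) by simp
    next
      case (add m f g)
      have "(\<lambda>p. (f p - f p0) + (g p - g p0)) \<in> J" by (intro id(3) add.IH)
      then show ?case by (simp add: algebra_simps)
    next
      case (mult m f k g)
      then have "poly_fun f" by (auto simp: ispoly_def)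
      then have "(\<lambda>p. f p * (g p - g p0) + g p0 * (f p - f p0)) \<in> J"
        by (intro id(3) id(4) mult.IH ispoly_const)
      then show ?case by (simp add: algebra_simps)
    qed
  qed
  have "g p0 = 0" if "g \<in> I" for g
  proof -
    have g: "g \<in> J" using that J(2) by blast
    from id(3)[OF g id(4)[OF val[OF id(2)[OF g]] ispoly_const, of "-1"]]
    have "(\<lambda>p. g p0) \<in> J" by simp
    then show ?thesis by (rule const)
  qed
  then have "f p0 = 0" using zero[of p0] pt_W unfolding p0_def by blast
  with val[OF f] have "(\<lambda>p. f p ^ 1) \<in> J" by simp
  with J(3) show False by blast
qed

end

lemma closed_sum:
  assumes "P (\<lambda>_. 0)" "\<And>f g. P f ==> P g ==> P (\<lambda>q. f q + g q)" "finite A" "\<And>i. i \<in> A ==> P (h i)"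
  shows "P (\<lambda>q. \<Sum>i\<in>A. h i q)"
  using assms(3,4)
proof (induction A rule: finite_induct)
  case (insert i A)
  then show ?case using assms(2)[of "h i" "\<lambda>q. \<Sum>i\<in>A. h i q"] by simp
qed (simp add: assms(1))

section \<open>Order of vanishing at a point, and Krull's height theorem\<close>

context affine_chart
begin

lemma linear_line:
  assumes "functional sc l"
  shows "ispoly {\<lambda>t::complex. t} (\<lambda>t. l (p + sc t v))"
  unfolding linear_add[OF assms] linear_scale[OF assms]
  by (intro ispoly_intros ispoly_gen) simp

lemma poly_fun_line:
  assumes "poly_fun h"
  shows "\<exists>P. \<forall>t. h (p + sc t v) = poly P t"
  by (rule ispoly_id_poly, rule ispoly_compose[OF assms], rule linear_line) simp

text \<open>For \<open>p \<in> W\<close> this is the \<open>l\<close>-th power of the maximal ideal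
  of \<open>p\<close>, tested on lines: restricted to each line through \<open>p\<close>, the
  function is divisible by the \<open>l\<close>-th power of the parameter.\<close>

definition vanish_order :: "'p => nat => ('p => complex) set" where
  "vanish_order p l = {h. poly_fun h \<and> (\<forall>v\<in>W. \<exists>P. \<forall>\<tau>. h (p + sc \<tau> v) = \<tau> ^ l * poly P \<tau>)}"

lemma vanish_order_0: "poly_fun h ==> h \<in> vanish_order p 0"
  unfolding vanish_order_def using poly_fun_line by auto

lemma vanish_order_1:
  assumes "poly_fun h" "h p = 0"
  shows "h \<in> vanish_order p 1"
  unfolding vanish_order_def
proof (intro CollectI conjI ballI assms(1))
  fix v assume v: "v \<in> W"
  obtain P where P: "\<And>t. h (p + sc t v) = poly P t" using poly_fun_line[OF assms(1)] by blast
  from P[of 0] assms(2) have "poly P 0 = 0" by simp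
  then obtain Q where "P = [:0, 1:] * Q" using poly_eq_0_iff_dvd[of P 0] by (auto elim: dvdE)
  with P show "\<exists>P. \<forall>t. h (p + sc t v) = t ^ 1 * poly P t" by (intro exI[of _ Q]) simp
qed

lemma vanish_order_mult:
  assumes "f \<in> vanish_order p l" "g \<in> vanish_order p m"
  shows "(\<lambda>q. f q * g q) \<in> vanish_order p (l + m)"
  unfolding vanish_order_def
proof (intro CollectI conjI ballI)
  show "poly_fun (\<lambda>q. f q * g q)" using assms by (auto simp: vanish_order_def intro: ispoly_mult)
  fix v assume v: "v \<in> W"
  obtain P Q where "\<And>t. f (p + sc t v) = t ^ l * poly P t" "\<And>t. g (p + sc t v) = t ^ m * poly Q t"
    using assms v unfolding vanish_order_def by blast
  then show "\<exists>R. \<forall>t. f (p + sc t v) * g (p + sc t v) = t ^ (l + m) * poly R t"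
    by (intro exI[of _ "P * Q"]) (simp add: power_add)
qed

lemma vanish_order_add:
  assumes "f \<in> vanish_order p l" "g \<in> vanish_order p l"
  shows "(\<lambda>q. f q + g q) \<in> vanish_order p l"
  unfolding vanish_order_def
proof (intro CollectI conjI ballI)
  show "poly_fun (\<lambda>q. f q + g q)" using assms by (auto simp: vanish_order_def intro: ispoly_add)
  fix v assume v: "v \<in> W"
  obtain P Q where "\<And>t. f (p + sc t v) = t ^ l * poly P t" "\<And>t. g (p + sc t v) = t ^ l * poly Q t"
    using assms v unfolding vanish_order_def by blast
  then show "\<exists>R. \<forall>t. f (p + sc t v) + g (p + sc t v) = t ^ l * poly R t"
    by (intro exI[of _ "P + Q"]) (simp add: algebra_simps)
qed

lemma vanish_order_cmult: "f \<in> vanish_order p l ==> poly_fun h ==> (\<lambda>q. h q * f q) \<in> vanish_order p l"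
  using vanish_order_mult[OF vanish_order_0, of h f p l] by simp

lemma vanish_order_sum:
  assumes "\<And>i. i \<in> A ==> f i \<in> vanish_order p l"
  shows "(\<lambda>q. \<Sum>i\<in>A. f i q) \<in> vanish_order p l"
  using assms
proof (induction A rule: infinite_finite_induct)
  case (insert i A)
  then have "(\<lambda>q. f i q + (\<Sum>i\<in>A. f i q)) \<in> vanish_order p l"
    by (intro vanish_order_add) auto
  with insert(1,2) show ?case by simp
next
  case (infinite A)
  then show ?case using ispoly_const[of _ 0] by (auto simp: vanish_order_def intro!: exI[of _ 0])
next
  case empty
  then show ?case using ispoly_const[of _ 0] by (auto simp: vanish_order_def intro!: exI[of _ 0])
qed

lemma vanish_order_power: "f \<in> vanish_order p 1 ==> (\<lambda>q. f q ^ i) \<in> vanish_order p i"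
proof (induction i)
  case 0
  then show ?case using vanish_order_0[OF ispoly_const[of _ 1]] by simp
next
  case (Suc i)
  then show ?case using vanish_order_mult[of f p 1 "\<lambda>q. f q ^ i" i] by auto
qed

lemma line_W: "p \<in> W ==> v \<in> W ==> p + sc t v \<in> W"
proof -
  assume p: "p \<in> W" and v: "v \<in> W"
  have "pt (\<lambda>k. x k p + t * x k v) = pt (\<lambda>k. x k p) + sc t (pt (\<lambda>k. x k v))"
    by (simp add: pt_def scale_left_distrib sum.distrib scale_sum_right)
  then have "p + sc t v = pt (\<lambda>k. x k p + t * x k v)" using pt_of_x p v by simp
  then show ?thesis using pt_W by simp
qed

lemma vanish_order_cong:
  assumes "f \<in> vanish_order p l" "poly_fun g" "\<And>q. q \<in> W ==> g q = f q" "p \<in> W"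
  shows "g \<in> vanish_order p l"
  using assms line_W[OF assms(4)] unfolding vanish_order_def by auto

text \<open>A truncated geometric series inverts \<open>u\<close>: the function
  \<open>t = 1 - u / u(p)\<close> vanishes at \<open>p\<close>, so the error \<open>t ^ l\<close>
  vanishes to order \<open>l\<close>.\<close>

lemma unit_mod_vanish_order:
  assumes u: "poly_fun u" "u p \<noteq> 0"
  shows "\<exists>w. poly_fun w \<and> (\<lambda>q. 1 - w q * u q) \<in> vanish_order p l"
proof -
  define t where "t q = 1 - inverse (u p) * u q" for q
  have t: "poly_fun t" unfolding t_def by (intro ispoly_intros u)
  define w where "w q = inverse (u p) * (\<Sum>i<l. t q ^ i)" for q
  have w: "poly_fun w" unfolding w_def by (intro ispoly_intros t)
  have "1 - w q * u q = t q ^ l" for q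
  proof -
    have "w q * u q = (1 - t q) * (\<Sum>i<l. t q ^ i)" by (simp add: w_def t_def mult_ac)
    also have "\<dots> = 1 - t q ^ l" by (rule one_diff_power_eq[symmetric])
    finally show ?thesis by simp
  qed
  moreover have "(\<lambda>q. t q ^ l) \<in> vanish_order p l"
    by (intro vanish_order_power vanish_order_1 t) (simp add: t_def u(2))
  ultimately show ?thesis using w by auto
qed

text \<open>The combination has total degree at most \<open>N * K < l\<close>, so its restriction to
  a line through \<open>p\<close> cannot be divisible by the \<open>l\<close>-th power of the
  parameter unless it is 0. At parameter 1 in direction \<open>t\<close> it is the combination of
  the monomials at \<open>t\<close>.\<close>

lemma mon_not_vanish_order:
  assumes h: "(\<lambda>q. \<Sum>s\<in>expbox N K. d s * mon N (\<lambda>k. x k q - x k p) s) \<in> vanish_order p l"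
    and p: "p \<in> W" and l: "N * K < l" and s: "s \<in> expbox N K"
  shows "d s = 0"
proof (rule mon_independent[OF _ s])
  fix t
  have xk: "x k (p + sc r (pt t)) - x k p = r * t k" if "k < N" for k r
    using that by (simp add: linear_add[OF linear_x] linear_scale[OF linear_x] x_of_pt)
  obtain P where P: "\<And>r. (\<Sum>s\<in>expbox N K. d s * mon N (\<lambda>k. x k (p + sc r (pt t)) - x k p) s) = r ^ l * poly P r"
    using h pt_W[of t] unfolding vanish_order_def by blast
  define deg where "deg s = (\<Sum>k<N. s k)" for s :: "nat => nat"
  define Q where "Q = (\<Sum>s\<in>expbox N K. monom (d s * mon N t s) (deg s))"
  have mon: "mon N (\<lambda>k. x k (p + sc r (pt t)) - x k p) s = r ^ deg s * mon N t s" for r s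
    unfolding mon_def deg_def power_sum prod.distrib[symmetric]
    by (intro prod.cong) (auto simp: xk power_mult_distrib)
  have "poly Q r = poly (monom 1 l * P) r" for r
    unfolding P[symmetric, of r, unfolded mon] poly_mult poly_monom using P[of r] unfolding mon
    by (simp add: Q_def poly_sum poly_monom mult_ac)
  then have Q: "Q = monom 1 l * P" using poly_eq_poly_eq_iff by blast
  have "degree Q \<le> N * K" unfolding Q_def
  proof (rule degree_sum_le[OF finite_box])
    fix s assume "s \<in> expbox N K"
    then have "deg s \<le> (\<Sum>k<N. K)" unfolding deg_def by (intro sum_mono) (auto simp: PiE_iff dest!: bspec)
    then show "degree (monom (d s * mon N t s) (deg s)) \<le> N * K"
      using degree_monom_le[of "d s * mon N t s" "deg s"] by simp
  qed
  then have "degree Q < l" using l by simp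
  have "P = 0"
  proof (rule ccontr)
    assume "P \<noteq> 0"
    then have "degree Q = l + degree P" unfolding Q by (subst degree_mult_eq) (auto simp: degree_monom_eq monom_eq_0_iff)
    with \<open>degree Q < l\<close> show False by simp
  qed
  then have "poly Q 1 = 0" unfolding Q by simp
  then show "(\<Sum>s\<in>expbox N K. d s * mon N t s) = 0"
    by (simp add: Q_def poly_sum poly_monom)
qed

text \<open>Krull's height theorem at an isolated zero, by counting: modulo functions vanishing to order
  \<open>l\<close>, all polynomial functions are spanned by \<open>O (l ^ card F)\<close> of them.\<close>

lemma isolated_zero_bound:
  assumes F: "finite F" "\<And>f. f \<in> F ==> poly_fun f" "\<And>f. f \<in> F ==> f p = 0"
    and p: "p \<in> W" and u: "poly_fun u" "u p \<noteq> 0"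
    and isol: "\<And>q k. q \<in> W ==> (\<And>f. f \<in> F ==> f q = 0) ==> k < N ==> u q * (x k q - x k p) = 0"
  shows "N \<le> card F"
proof (rule ccontr)
  assume "\<not> N \<le> card F"
  then have lt: "card F < N" by simp
  define y where "y k q = x k q - x k p" for k q
  have py: "poly_fun (y k)" if "k < N" for k unfolding y_def by (intro ispoly_intros poly_fun_x that)
  define I where "I = {h. poly_fun h \<and> (\<exists>r. (\<forall>f\<in>F. poly_fun (r f)) \<and> (\<forall>q\<in>W. h q = (\<Sum>f\<in>F. r f q * f q)))}"
  have I: "ideal_on I" unfolding ideal_on_def
  proof (intro conjI ballI allI impI)
    show "(\<lambda>_. 0) \<in> I" unfolding I_def by (auto intro!: exI[of _ "\<lambda>_ _. 0"] ispoly_const)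
    fix h assume "h \<in> I"
    then obtain r where h: "poly_fun h" "\<And>f. f \<in> F ==> poly_fun (r f)" "\<And>q. q \<in> W ==> h q = (\<Sum>f\<in>F. r f q * f q)"
      unfolding I_def by blast
    show "poly_fun h" by fact
    show "g \<in> I" if "poly_fun g" "\<forall>q\<in>W. g q = h q" for g
      unfolding I_def using that h by auto
    show "(\<lambda>q. g q * h q) \<in> I" if g: "poly_fun g" for g
      unfolding I_def
      by (intro CollectI conjI exI[of _ "\<lambda>f q. g q * r f q"] ballI ispoly_mult g h)
        (auto simp: h(3) sum_distrib_left mult_ac)
    fix h' assume "h' \<in> I"
    then obtain r' where h': "poly_fun h'" "\<And>f. f \<in> F ==> poly_fun (r' f)" "\<And>q. q \<in> W ==> h' q = (\<Sum>f\<in>F. r' f q * f q)"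
      unfolding I_def by blast
    show "(\<lambda>q. h q + h' q) \<in> I"
      unfolding I_def
      by (intro CollectI conjI exI[of _ "\<lambda>f q. r f q + r' f q"] ballI ispoly_add h h')
        (auto simp: h(3) h'(3) sum.distrib algebra_simps)
  qed
  note id = ideal_onD[OF I]
  have FI: "f \<in> I" if "f \<in> F" for f
  proof -
    have "(\<Sum>g\<in>F. (if g = f then 1 else 0) * g q) = f q" for q
    proof -
      have "(\<Sum>g\<in>F. (if g = f then 1 else 0) * g q) = (\<Sum>g\<in>F. if g = f then g q else 0)"
        by (intro sum.cong) auto
      then show ?thesis using that F(1) by simp
    qed
    then show ?thesis unfolding I_def using F(2)[OF that]
      by (intro CollectI conjI exI[of _ "\<lambda>g q. if g = f then 1 else 0"]) (auto intro: ispoly_const)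
  qed
  \<comment> \<open>Where \<open>u\<close> is nonzero, \<open>p\<close> is the only common zero of
    \<open>F\<close>; the Nullstellensatz turns this into powers lying in the ideal \<open>I\<close>
    generated by \<open>F\<close>.\<close>
  have "\<exists>M. (\<lambda>q. (u q * y k q) ^ M) \<in> I" if k: "k < N" for k
  proof (rule nullstellensatz[OF I])
    show "poly_fun (\<lambda>q. u q * y k q)" by (intro ispoly_mult u py k)
    fix q assume "q \<in> W" "\<And>g. g \<in> I ==> g q = 0"
    then show "u q * y k q = 0" unfolding y_def using FI k by (intro isol) auto
  qed
  then obtain M0 where M0: "\<And>k. k < N ==> (\<lambda>q. (u q * y k q) ^ M0 k) \<in> I" by metis
  define M where "M = (\<Sum>k<N. M0 k)"
  have M: "(\<lambda>q. (u q * y k q) ^ M) \<in> I" if k: "k < N" for k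
  proof -
    have le: "M0 k \<le> M" unfolding M_def using k by (intro member_le_sum) auto
    have "(\<lambda>q. (u q * y k q) ^ (M - M0 k) * (u q * y k q) ^ M0 k) \<in> I"
      by (intro id(4) M0 k ispoly_intros u py)
    then show ?thesis using le by (simp add: power_add[symmetric])
  qed
  \<comment> \<open>Decides the count at the end: the spanning family has
    \<open>l ^ card F * M ^ N\<close> members with \<open>l \<le> (N + 1) * K\<close>, which is less
    than \<open>K ^ (card F + 1) \<le> K ^ N\<close>. The choice of \<open>l\<close> exceeds the
    degree \<open>N * K\<close> of all monomials in the box of side \<open>K\<close>.\<close>
  define K where "K = (N + 1) ^ card F * M ^ N + 1"
  define l where "l = N * K + 1"
  define VI where "VI = {h. poly_fun h \<and> (\<exists>i\<in>I. \<exists>v\<in>vanish_order p l. \<forall>q\<in>W. h q = i q + v q)}"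
  have V0: "(\<lambda>_. 0) \<in> vanish_order p l"
    using vanish_order_sum[of "{}"] by simp
  have VI_add: "(\<lambda>q. h q + h' q) \<in> VI" if "h \<in> VI" "h' \<in> VI" for h h'
  proof -
    from that obtain i v i' v' where *: "poly_fun h" "i \<in> I" "v \<in> vanish_order p l" "\<And>q. q \<in> W ==> h q = i q + v q"
      "poly_fun h'" "i' \<in> I" "v' \<in> vanish_order p l" "\<And>q. q \<in> W ==> h' q = i' q + v' q"
      unfolding VI_def by blast
    show ?thesis unfolding VI_def
      by (intro CollectI conjI bexI[of _ "\<lambda>q. i q + i' q"] bexI[of _ "\<lambda>q. v q + v' q"] ballI
          id(3) vanish_order_add ispoly_add *) (simp add: *)
  qed
  have VI_mult: "(\<lambda>q. g q * h q) \<in> VI" if "h \<in> VI" "poly_fun g" for h g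
  proof -
    from that(1) obtain i v where *: "poly_fun h" "i \<in> I" "v \<in> vanish_order p l" "\<And>q. q \<in> W ==> h q = i q + v q"
      unfolding VI_def by blast
    show ?thesis unfolding VI_def
      by (intro CollectI conjI bexI[of _ "\<lambda>q. g q * i q"] bexI[of _ "\<lambda>q. g q * v q"] ballI
          id(4) vanish_order_cmult ispoly_mult * that) (simp add: * algebra_simps)
  qed
  \<comment> \<open>Modulo functions of order \<open>l\<close> the factor \<open>u\<close> is
    invertible, so it can be removed from the powers found in \<open>I\<close>.\<close>
  have yM: "(\<lambda>q. y k q ^ M) \<in> VI" if k: "k < N" for k
  proof -
    have "poly_fun (\<lambda>q. u q ^ M)" "u p ^ M \<noteq> 0" using u by (auto intro: ispoly_power)
    from unit_mod_vanish_order[OF this] obtain w where w: "poly_fun w" "(\<lambda>q. 1 - w q * u q ^ M) \<in> vanish_order p l"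
      by blast
    have 1: "(\<lambda>q. w q * (u q * y k q) ^ M) \<in> I" by (intro id(4) M k w)
    have 2: "(\<lambda>q. y k q ^ M * (1 - w q * u q ^ M)) \<in> vanish_order p l"
      by (intro vanish_order_cmult w ispoly_power py k)
    show ?thesis unfolding VI_def
      by (intro CollectI conjI bexI[OF _ 1] bexI[OF _ 2] ballI ispoly_power py k)
        (simp add: algebra_simps)
  qed
  text \<open>\<open>R = B + I + V\<close>\<close>
  define red where "red h \<longleftrightarrow> (\<exists>c. (\<lambda>q. h q - (\<Sum>z\<in>expbox N M. c z * mon N (\<lambda>k. y k q) z)) \<in> VI)" for h
  have pmon: "poly_fun (\<lambda>q. mon N (\<lambda>k. y k q) z)" for z
    unfolding mon_def by (intro ispoly_intros py) simp
  have red_VI: "red h" if "h \<in> VI" for h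
    unfolding red_def using that by (intro exI[of _ "\<lambda>_. 0"]) simp
  have red_add: "red (\<lambda>q. h q + h' q)" if "red h" "red h'" for h h'
  proof -
    from that obtain c c' where "(\<lambda>q. h q - (\<Sum>z\<in>expbox N M. c z * mon N (\<lambda>k. y k q) z)) \<in> VI"
      "(\<lambda>q. h' q - (\<Sum>z\<in>expbox N M. c' z * mon N (\<lambda>k. y k q) z)) \<in> VI" unfolding red_def by blast
    from VI_add[OF this] show ?thesis unfolding red_def
      by (intro exI[of _ "\<lambda>z. c z + c' z"]) (simp add: algebra_simps sum.distrib)
  qed
  have red_cmult: "red (\<lambda>q. a * h q)" if "red h" for h a
  proof -
    from that obtain c where "(\<lambda>q. h q - (\<Sum>z\<in>expbox N M. c z * mon N (\<lambda>k. y k q) z)) \<in> VI"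
      unfolding red_def by blast
    from VI_mult[OF this ispoly_const, of a] show ?thesis unfolding red_def
      by (intro exI[of _ "\<lambda>z. a * c z"]) (simp add: algebra_simps sum_distrib_left)
  qed
  have zero_VI: "(\<lambda>_. 0) \<in> VI" unfolding VI_def
    by (intro CollectI conjI bexI[OF _ id(1)] bexI[OF _ V0]) (auto intro: ispoly_const)
  have red_mon: "red (\<lambda>q. mon N (\<lambda>k. y k q) t)" if "t \<in> expbox N L" for t L
  proof (cases "t \<in> expbox N M")
    case True
    have "(\<Sum>z\<in>expbox N M. (if z = t then 1 else 0) * mon N (\<lambda>k. y k q) z) = mon N (\<lambda>k. y k q) t" for q
    proof -
      have "(\<Sum>z\<in>expbox N M. (if z = t then 1 else 0) * mon N (\<lambda>k. y k q) z)
        = (\<Sum>z\<in>expbox N M. if z = t then mon N (\<lambda>k. y k q) z else 0)"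
        by (intro sum.cong) auto
      then show ?thesis using True finite_box by simp
    qed
    then show ?thesis unfolding red_def using zero_VI
      by (intro exI[of _ "\<lambda>z. if z = t then 1 else 0"]) simp
  next
    case False
    then have "\<exists>k<N. M \<le> t k" using that unfolding PiE_iff by (auto simp: not_less)
    then obtain k where k: "k < N" "M \<le> t k" by blast
    have "(\<lambda>q. (y k q ^ (t k - M) * (\<Prod>i\<in>{..<N} - {k}. y i q ^ t i)) * y k q ^ M) \<in> VI"
      using k py by (intro VI_mult yM ispoly_intros) auto
    moreover have "(y k q ^ (t k - M) * (\<Prod>i\<in>{..<N} - {k}. y i q ^ t i)) * y k q ^ M = mon N (\<lambda>k. y k q) t" for q
    proof -
      have "mon N (\<lambda>k. y k q) t = y k q ^ t k * (\<Prod>i\<in>{..<N} - {k}. y i q ^ t i)"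
        unfolding mon_def using k by (subst prod.remove[of _ k]) auto
      also have "y k q ^ t k = y k q ^ (t k - M) * y k q ^ M" using k by (simp add: power_add[symmetric])
      finally show ?thesis by (simp add: mult_ac)
    qed
    ultimately show ?thesis by (intro red_VI) simp
  qed
  have VI_cong: "h \<in> VI" if "h' \<in> VI" "poly_fun h" "\<And>q. q \<in> W ==> h q = h' q" for h h'
    using that unfolding VI_def by auto
  have red: "red h" if h: "poly_fun h" for h
  proof -
    from h obtain m where "polydeg (linfuns sc) m h" by (auto simp: ispoly_def)
    from polydeg_W[OF this, of "\<lambda>k. x k p"] obtain c where
      c: "\<And>q. q \<in> W ==> h q = (\<Sum>z\<in>expbox N (Suc m). c z * mon N (\<lambda>k. y k q) z)"
      unfolding y_def by blast
    have "red (\<lambda>q. \<Sum>z\<in>expbox N (Suc m). c z * mon N (\<lambda>k. y k q) z)"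
      by (intro closed_sum[where P = red] red_VI[OF zero_VI] red_add finite_box red_cmult red_mon)
    then obtain c' where "(\<lambda>q. (\<Sum>z\<in>expbox N (Suc m). c z * mon N (\<lambda>k. y k q) z) -
        (\<Sum>z\<in>expbox N M. c' z * mon N (\<lambda>k. y k q) z)) \<in> VI" unfolding red_def by blast
    then have "(\<lambda>q. h q - (\<Sum>z\<in>expbox N M. c' z * mon N (\<lambda>k. y k q) z)) \<in> VI"
      by (rule VI_cong) (use c in "auto intro!: ispoly_intros h pmon")
    then show ?thesis unfolding red_def by blast
  qed
  \<comment> \<open>Exponents of products of the equations. Each equation vanishes at
    \<open>p\<close>, so a product with total exponent \<open>l\<close> already vanishes to order
    \<open>l\<close>.\<close>
  define G where "G = PiE F (\<lambda>_. {..<l})"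
  have finG: "finite G" unfolding G_def using F(1) by (intro finite_PiE) auto
  define fm where "fm \<gamma> q = (\<Prod>f\<in>F. f q ^ \<gamma> f)" for \<gamma> :: "('p => complex) => nat" and q
  have fm_vanish: "fm \<gamma> \<in> vanish_order p (\<Sum>f\<in>F. \<gamma> f)" for \<gamma>
  proof -
    have "(\<lambda>q. \<Prod>f\<in>F'. f q ^ \<gamma> f) \<in> vanish_order p (\<Sum>f\<in>F'. \<gamma> f)" if "F' \<subseteq> F" for F'
      using finite_subset[OF that F(1)] that
    proof (induction F' rule: finite_induct)
      case empty
      then show ?case using vanish_order_0[OF ispoly_const[of _ 1]] by simp
    next
      case (insert f F')
      have "(\<lambda>q. f q ^ \<gamma> f * (\<Prod>f\<in>F'. f q ^ \<gamma> f)) \<in> vanish_order p (\<gamma> f + (\<Sum>f\<in>F'. \<gamma> f))"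
        using insert.prems F by (intro vanish_order_mult vanish_order_power vanish_order_1 insert.IH) auto
      then show ?case using insert(1,2) by simp
    qed
    then show ?thesis unfolding fm_def by simp
  qed
  define E where "E = G \<times> expbox N M"
  have finE: "finite E" unfolding E_def using finG finite_box by simp
  define bas where "bas i q = fm (fst i) q * mon N (\<lambda>k. y k q) (snd i)" for i q
  define rep where "rep h \<longleftrightarrow> (\<exists>c. \<exists>v\<in>vanish_order p l. \<forall>q\<in>W. h q = (\<Sum>i\<in>E. c i * bas i q) + v q)" for h
  have rep_V: "rep v" if "v \<in> vanish_order p l" for v
    unfolding rep_def using that by (intro exI[of _ "\<lambda>_. 0"] bexI[OF _ that]) simp
  have rep_add: "rep (\<lambda>q. h q + h' q)" if "rep h" "rep h'" for h h'
  proof -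
    from that obtain c v c' v' where "v \<in> vanish_order p l" "v' \<in> vanish_order p l"
      "\<forall>q\<in>W. h q = (\<Sum>i\<in>E. c i * bas i q) + v q" "\<forall>q\<in>W. h' q = (\<Sum>i\<in>E. c' i * bas i q) + v' q"
      unfolding rep_def by blast
    then show ?thesis unfolding rep_def
      by (intro exI[of _ "\<lambda>i. c i + c' i"] bexI[OF _ vanish_order_add[of v p l v']])
        (auto simp: algebra_simps sum.distrib)
  qed
  have rep_cmult: "rep (\<lambda>q. a * h q)" if "rep h" for h a
  proof -
    from that obtain c v where "v \<in> vanish_order p l" "\<forall>q\<in>W. h q = (\<Sum>i\<in>E. c i * bas i q) + v q"
      unfolding rep_def by blast
    then show ?thesis unfolding rep_def
      by (intro exI[of _ "\<lambda>i. a * c i"] bexI[OF _ vanish_order_cmult[of v p l "\<lambda>_. a"]])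
        (auto simp: algebra_simps sum_distrib_left ispoly_const)
  qed
  have rep_bas: "rep (bas i)" if "i \<in> E" for i
  proof -
    have "(\<Sum>j\<in>E. (if j = i then 1 else 0) * bas j q) = bas i q" for q
    proof -
      have "(\<Sum>j\<in>E. (if j = i then 1 else 0) * bas j q) = (\<Sum>j\<in>E. if j = i then bas j q else 0)"
        by (intro sum.cong) auto
      then show ?thesis using that finE by simp
    qed
    then show ?thesis unfolding rep_def
      by (intro exI[of _ "\<lambda>j. if j = i then 1 else 0"] bexI[OF _ V0]) simp
  qed
  have rep_cong: "rep h" if "rep h'" "\<And>q. q \<in> W ==> h q = h' q" for h h'
    using that unfolding rep_def by auto
  note rep_sum = closed_sum[where P = rep, OF rep_V[OF V0] rep_add]
  \<comment> \<open>Induction on the order \<open>s\<close> still missing from the product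
    \<open>fm \<gamma>\<close>: reducing \<open>h\<close> leaves box monomials, a part of order
    \<open>l\<close>, and a part in \<open>I\<close>. The last one contributes a further factor from
    \<open>F\<close>, so less is missing.\<close>
  have rep_fm: "rep (\<lambda>q. fm \<gamma> q * h q)"
    if "s \<le> l" "(\<Sum>f\<in>F. \<gamma> f) = l - s" "\<gamma> \<in> extensional F" "poly_fun h" for s \<gamma> h
    using that
  proof (induction s arbitrary: \<gamma> h)
    case 0
    then show ?case using fm_vanish[of \<gamma>] vanish_order_cmult[of "fm \<gamma>" p l h]
      by (intro rep_V) (simp add: mult.commute)
  next
    case (Suc s)
    have G: "\<gamma> \<in> G" unfolding G_def
    proof (rule PiE_I)
      fix f assume "f \<in> F"
      then have "\<gamma> f \<le> (\<Sum>f\<in>F. \<gamma> f)" using F(1) by (intro member_le_sum) auto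
      with Suc.prems show "\<gamma> f \<in> {..<l}" by simp
    qed (use Suc.prems(3) in "auto simp: extensional_def")
    from red[OF Suc.prems(4)] obtain c i v where i: "i \<in> I" and v: "v \<in> vanish_order p l"
      and h: "\<And>q. q \<in> W ==> h q - (\<Sum>z\<in>expbox N M. c z * mon N (\<lambda>k. y k q) z) = i q + v q"
      unfolding red_def VI_def by blast
    from i obtain r where r: "\<And>f. f \<in> F ==> poly_fun (r f)" "\<And>q. q \<in> W ==> i q = (\<Sum>f\<in>F. r f q * f q)"
      unfolding I_def by blast
    define \<gamma>' where "\<gamma>' f = \<gamma>(f := Suc (\<gamma> f))" for f
    have fm': "fm (\<gamma>' f) q = fm \<gamma> q * f q" if "f \<in> F" for f q
    proof -
      have "(\<Prod>g\<in>F - {f}. g q ^ \<gamma>' f g) = (\<Prod>g\<in>F - {f}. g q ^ \<gamma> g)"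
        by (intro prod.cong) (auto simp: \<gamma>'_def)
      then show ?thesis unfolding fm_def prod.remove[OF F(1) that] by (simp add: \<gamma>'_def)
    qed
    have "rep (\<lambda>q. \<Sum>z\<in>expbox N M. c z * bas (\<gamma>, z) q)"
      by (rule rep_sum[OF _ _ finite_box rep_cmult[OF rep_bas]]) (use G in "auto simp: E_def")
    moreover have "rep (\<lambda>q. fm \<gamma> q * v q)" using fm_vanish
      by (intro rep_V vanish_order_cmult v) (auto simp: vanish_order_def)
    moreover have "rep (\<lambda>q. \<Sum>f\<in>F. fm (\<gamma>' f) q * r f q)"
    proof (rule rep_sum[OF _ _ F(1)])
      show "rep (\<lambda>q. fm (\<gamma>' f) q * r f q)" if f: "f \<in> F" for f
      proof (rule Suc.IH)
        have "(\<Sum>g\<in>F - {f}. \<gamma>' f g) = (\<Sum>g\<in>F - {f}. \<gamma> g)"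
          by (intro sum.cong) (auto simp: \<gamma>'_def)
        then have "(\<Sum>g\<in>F. \<gamma>' f g) = Suc (\<Sum>g\<in>F. \<gamma> g)"
          unfolding sum.remove[OF F(1) f] by (simp add: \<gamma>'_def)
        then show "(\<Sum>g\<in>F. \<gamma>' f g) = l - s" using Suc.prems by simp
        show "\<gamma>' f \<in> extensional F" using Suc.prems(3) f by (auto simp: \<gamma>'_def extensional_def)
      qed (use Suc.prems r f in auto)
    qed auto
    ultimately have "rep (\<lambda>q. (\<Sum>z\<in>expbox N M. c z * bas (\<gamma>, z) q) + (\<Sum>f\<in>F. fm (\<gamma>' f) q * r f q) + fm \<gamma> q * v q)"
      by (intro rep_add)
    then show ?case
    proof (rule rep_cong)
      fix q assume q: "q \<in> W"
      have "h q = (\<Sum>z\<in>expbox N M. c z * mon N (\<lambda>k. y k q) z) + i q + v q" using h[OF q] by (simp add: algebra_simps)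
      then show "fm \<gamma> q * h q = (\<Sum>z\<in>expbox N M. c z * bas (\<gamma>, z) q) + (\<Sum>f\<in>F. fm (\<gamma>' f) q * r f q) + fm \<gamma> q * v q"
        using r(2)[OF q] fm' by (simp add: bas_def algebra_simps sum_distrib_left)
    qed
  qed
  have "rep (\<lambda>q. mon N (\<lambda>k. y k q) t)" for t
  proof -
    have "rep (\<lambda>q. fm (restrict (\<lambda>_. 0) F) q * mon N (\<lambda>k. y k q) t)"
      by (rule rep_fm[of l]) (auto intro: pmon)
    moreover have "fm (restrict (\<lambda>_. 0) F) q = 1" for q by (simp add: fm_def)
    ultimately show ?thesis by simp
  qed
  then have "\<forall>t. \<exists>cv. snd cv \<in> vanish_order p l \<and>
      (\<forall>q\<in>W. mon N (\<lambda>k. y k q) t = (\<Sum>i\<in>E. fst cv i * bas i q) + snd cv q)"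
    unfolding rep_def by fastforce
  from choice[OF this] obtain cv where "\<forall>t. snd (cv t) \<in> vanish_order p l \<and>
      (\<forall>q\<in>W. mon N (\<lambda>k. y k q) t = (\<Sum>i\<in>E. fst (cv t) i * bas i q) + snd (cv t) q)" ..
  then have cv: "\<And>t. snd (cv t) \<in> vanish_order p l"
    "\<And>t q. q \<in> W ==> mon N (\<lambda>k. y k q) t = (\<Sum>i\<in>E. fst (cv t) i * bas i q) + snd (cv t) q"
    by blast+
  have K1: "1 \<le> K" by (simp add: K_def)
  have "card E = l ^ card F * M ^ N"
    unfolding E_def G_def using F(1) by (simp add: card_cartesian_product card_PiE)
  also have "\<dots> \<le> ((N + 1) * K) ^ card F * M ^ N"
    using K1 unfolding l_def by (intro mult_le_mono1 power_mono) auto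
  also have "\<dots> = K ^ card F * ((N + 1) ^ card F * M ^ N)" unfolding power_mult_distrib by (simp only: mult_ac)
  also have "\<dots> < K ^ card F * K" using K1 unfolding K_def by (intro mult_less_mono2) auto
  also have "\<dots> = K ^ Suc (card F)" by simp
  also have "\<dots> \<le> K ^ N" using K1 lt by (intro power_increasing) auto
  also have "\<dots> = card (expbox N K)" by (simp add: card_box)
  finally obtain d where d: "\<exists>t\<in>expbox N K. d t \<noteq> 0" "\<And>i. i \<in> E ==> (\<Sum>t\<in>expbox N K. d t * fst (cv t) i) = 0"
    using exists_dependency[OF finE finite_box, of N K "\<lambda>t. fst (cv t)"] by blast
  have "(\<lambda>q. \<Sum>t\<in>expbox N K. d t * snd (cv t) q) \<in> vanish_order p l"
    by (intro vanish_order_sum vanish_order_cmult cv ispoly_const)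
  then have "(\<lambda>q. \<Sum>t\<in>expbox N K. d t * mon N (\<lambda>k. x k q - x k p) t) \<in> vanish_order p l"
  proof (rule vanish_order_cong[OF _ _ _ p])
    show "poly_fun (\<lambda>q. \<Sum>t\<in>expbox N K. d t * mon N (\<lambda>k. x k q - x k p) t)"
      using pmon by (intro ispoly_intros) (simp add: y_def)
    fix q assume q: "q \<in> W"
    have "(\<Sum>t\<in>expbox N K. d t * mon N (\<lambda>k. y k q) t) =
      (\<Sum>i\<in>E. (\<Sum>t\<in>expbox N K. d t * fst (cv t) i) * bas i q) + (\<Sum>t\<in>expbox N K. d t * snd (cv t) q)"
      by (simp add: cv(2)[OF q] sum.distrib algebra_simps sum_distrib_left sum_distrib_right sum.swap[of _ E])
    then show "(\<Sum>t\<in>expbox N K. d t * mon N (\<lambda>k. x k q - x k p) t) = (\<Sum>t\<in>expbox N K. d t * snd (cv t) q)"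
      by (simp add: d(2) y_def)
  qed
  from mon_not_vanish_order[OF this p] d(1) show False by (auto simp: l_def)
qed

text \<open>Fixing the at most \<open>r\<close> coordinates supplied by \<open>finite_fibre\<close>
  adds \<open>card T\<close> equations and makes \<open>p\<close> an isolated zero, so
  \<open>isolated_zero_bound\<close> applies to the enlarged system. The function \<open>g\<close>
  removes the common zeros outside \<open>C\<close>.\<close>

theorem height_theorem:
  assumes F: "finite F" "\<And>f. f \<in> F ==> poly_fun f"
    and C: "prime_on (linfuns sc) C" "growth (linfuns sc) C r" "C \<subseteq> W"
      "\<And>f p. f \<in> F ==> p \<in> C ==> f p = 0"
    and g: "poly_fun g" "\<exists>p\<in>C. g p \<noteq> 0"
      "\<And>p. p \<in> W ==> (\<And>f. f \<in> F ==> f p = 0) ==> g p \<noteq> 0 ==> p \<in> C"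
  shows "N \<le> card F + r"
proof -
  have "\<exists>T p. T \<subseteq> {..<N} \<and> card T \<le> r \<and> p \<in> C \<and> g p \<noteq> 0 \<and>
    (\<forall>k<N. finite (x k ` {q \<in> C. \<forall>i\<in>T. x i q = x i p}))"
    by (rule finite_fibre[OF C(1,2) _ g(1,2)]) (use linear_x in simp)
  then obtain T p where *: "T \<subseteq> {..<N} \<and> card T \<le> r \<and> p \<in> C \<and> g p \<noteq> 0 \<and>
    (\<forall>k<N. finite (x k ` {q \<in> C. \<forall>i\<in>T. x i q = x i p}))" by (elim exE)
  then have T: "T \<subseteq> {..<N}" "card T \<le> r" and p: "p \<in> C" "g p \<noteq> 0" by simp_all
  have fin: "finite (x k ` {q \<in> C. \<forall>i\<in>T. x i q = x i p})" if "k < N" for k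
    using * that by simp
  have finT: "finite T" using T(1) finite_subset by blast
  define A where "A = {q \<in> C. \<forall>i\<in>T. x i q = x i p}"
  define F' where "F' = F \<union> (\<lambda>i q. x i q - x i p) ` T"
  \<comment> \<open>Nonzero at \<open>p\<close> and zero at the other solutions: \<open>g\<close>
    disposes of those outside \<open>C\<close>, and the product of those in \<open>C\<close>, where
    some coordinate takes one of its finitely many values different from
    \<open>x k p\<close>.\<close>
  define u where "u q = g q * (\<Prod>k<N. \<Prod>z\<in>x k ` A - {x k p}. x k q - z)" for q
  have "N \<le> card F'"
  proof (rule isolated_zero_bound)
    show "finite F'" unfolding F'_def using F(1) finT by simp
    show "poly_fun f" if "f \<in> F'" for f
      using that F(2) T(1) unfolding F'_def by (auto intro!: ispoly_intros poly_fun_x)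
    show "f p = 0" if "f \<in> F'" for f
      using that C(4) p unfolding F'_def by auto
    show "p \<in> W" using p C(3) by blast
    show "poly_fun u" unfolding u_def by (intro ispoly_intros g poly_fun_x) auto
    show "u p \<noteq> 0" unfolding u_def using p(2) fin unfolding A_def[symmetric] by auto
    fix q k assume q: "q \<in> W" "\<And>f. f \<in> F' ==> f q = 0" and k: "k < N"
    show "u q * (x k q - x k p) = 0"
    proof (cases "g q = 0 \<or> x k q = x k p")
      case True
      then show ?thesis by (auto simp: u_def)
    next
      case False
      have "q \<in> C" using False by (intro g(3)[OF q(1)] q(2)) (auto simp: F'_def)
      moreover have "x i q = x i p" if "i \<in> T" for i
        using q(2)[of "\<lambda>q. x i q - x i p"] that by (auto simp: F'_def)
      ultimately have "q \<in> A" by (auto simp: A_def)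
      then have "x k q \<in> x k ` A - {x k p}" using False by auto
      then have "(\<Prod>z\<in>x k ` A - {x k p}. x k q - z) = 0"
        using fin[OF k] unfolding A_def[symmetric] by (intro prod_zero) auto
      then have "u q = 0" unfolding u_def using k by (auto intro!: prod_zero)
      then show ?thesis by simp
    qed
  qed
  also have "card F' \<le> card F + card T"
    unfolding F'_def using card_image_le[OF finT] by (intro card_Un_le[THEN order_trans]) auto
  finally show ?thesis using T(2) by simp
qed

end

section \<open>Zariski closures, components and Krull dimension\<close>

context affine_chart
begin

definition zcl :: "'p set => 'p set" where
  "zcl S = {p \<in> W. \<forall>f. poly_fun f --> (\<forall>q\<in>S. f q = 0) --> f p = 0}"

abbreviation "prime_set \<equiv> prime_on (linfuns sc)"

lemma poly_fun_iff: "polyfun sc f \<longleftrightarrow> poly_fun f"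
  by (simp add: polyfun_iff ispoly_def)

lemma zcl_subset: "S \<subseteq> W ==> S \<subseteq> zcl S" and zcl_W: "zcl S \<subseteq> W"
  and zcl_mono: "S \<subseteq> S' ==> zcl S \<subseteq> zcl S'"
  and zcl_vanish: "poly_fun f ==> (\<And>p. p \<in> S ==> f p = 0) ==> p \<in> zcl S ==> f p = 0"
  unfolding zcl_def by blast+

lemma zcl_zcl: "zcl (zcl S) = zcl S"
  unfolding zcl_def by blast

lemma zcl_minimal: "S \<subseteq> A ==> zcl A = A ==> zcl S \<subseteq> A"
  using zcl_mono by blast

lemma zcl_vanishing_set:
  assumes "\<And>f. f \<in> F ==> poly_fun f"
  shows "zcl {p \<in> W. \<forall>f\<in>F. f p = 0} = {p \<in> W. \<forall>f\<in>F. f p = 0}"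
  using assms unfolding zcl_def by blast

lemma topspace_zariski: "topspace (zariski sc W) = W"
proof
  show "topspace (zariski sc W) \<subseteq> W"
    unfolding topspace_def openin_zariski zariski_open_def by auto
  have "zariski_open sc W W" unfolding zariski_open_def
    by (intro exI[of _ "{restrict (\<lambda>_. 1) W}"]) (auto simp: zero_locus_def carrier_coord_ring_const)
  then show "W \<subseteq> topspace (zariski sc W)" unfolding topspace_def openin_zariski by blast
qed

lemma closedin_zariski: "closedin (zariski sc W) A \<longleftrightarrow> A \<subseteq> W \<and> zcl A = A"
proof -
  have "zariski_open sc W (W - A) \<longleftrightarrow> zcl A = A" if A: "A \<subseteq> W"
  proof
    assume "zariski_open sc W (W - A)"
    then obtain S where S: "S \<subseteq> carrier (coord_ring sc W)" "W - A = W - zero_locus W S"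
      unfolding zariski_open_def by blast
    then have A': "A = zero_locus W S" using A unfolding zero_locus_def by blast
    have "p \<in> A" if p: "p \<in> zcl A" for p
      unfolding A' zero_locus_def
    proof (intro CollectI conjI ballI)
      show "p \<in> W" using p zcl_W by blast
      fix s assume s: "s \<in> S"
      then obtain f where f: "s = restrict f W" "polyfun sc f" using S(1) by (auto simp: carrier_coord_ring)
      have "f q = 0" if "q \<in> A" for q
        using that s A unfolding f(1) A' zero_locus_def by auto
      then have "f p = 0" using zcl_vanish p f(2) poly_fun_iff by blast
      then show "s p = 0" using \<open>p \<in> W\<close> f(1) by simp
    qed
    then show "zcl A = A" using zcl_subset[OF A] by blast
  next
    assume cl: "zcl A = A"
    define S where "S = {restrict f W |f. poly_fun f \<and> (\<forall>q\<in>A. f q = 0)}"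
    have "S \<subseteq> carrier (coord_ring sc W)" unfolding S_def carrier_coord_ring poly_fun_iff by blast
    moreover have "zero_locus W S = zcl A" unfolding zero_locus_def S_def zcl_def by auto
    ultimately show "zariski_open sc W (W - A)" unfolding zariski_open_def using cl by blast
  qed
  then show ?thesis unfolding closedin_def topspace_zariski openin_zariski by blast
qed

lemma closedin_sub:
  assumes "Z \<subseteq> W" "zcl Z = Z"
  shows "closedin (subtopology (zariski sc W) Z) A \<longleftrightarrow> A \<subseteq> Z \<and> zcl A = A"
proof -
  have "closedin (zariski sc W) Z" using assms closedin_zariski by blast
  then show ?thesis unfolding closedin_closed_subtopology[OF \<open>closedin (zariski sc W) Z\<close>] closedin_zariski
    using assms(1) by auto
qed

lemma closure_of_sub:
  assumes "Z \<subseteq> W" "zcl Z = Z" "S \<subseteq> Z"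
  shows "subtopology (zariski sc W) Z closure_of S = zcl S"
proof (rule closure_of_unique)
  show "S \<subseteq> zcl S" by (rule zcl_subset) (use assms in blast)
  show "closedin (subtopology (zariski sc W) Z) (zcl S)"
    unfolding closedin_sub[OF assms(1,2)] using zcl_minimal[OF assms(3,2)] zcl_zcl by simp
  show "zcl S \<subseteq> T'" if "S \<subseteq> T'" "closedin (subtopology (zariski sc W) Z) T'" for T'
    using that(2) unfolding closedin_sub[OF assms(1,2)] by (intro zcl_minimal that(1)) simp
qed

lemma prime_zcl: "S \<subseteq> W ==> prime_set (zcl S) \<longleftrightarrow> prime_set S"
proof -
  assume S: "S \<subseteq> W"
  have v: "(\<forall>p\<in>zcl S. f p = 0) \<longleftrightarrow> (\<forall>p\<in>S. f p = 0)" if "poly_fun f" for f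
    using zcl_subset[OF S] zcl_vanish[OF that] by blast
  have "zcl {} = {}" using zcl_vanish[OF ispoly_const[of _ 1], of "{}"] by auto
  then have "zcl S \<noteq> {} \<longleftrightarrow> S \<noteq> {}" using zcl_subset[OF S] by blast
  then show ?thesis unfolding prime_on_def using v v[OF ispoly_mult] by (smt (verit))
qed

text \<open>Reduces topology to algebra: the zero sets of two factors cover \<open>C\<close> when
  their product vanishes on it; conversely, points of \<open>C\<close> outside two closed sets yield
  two functions whose product vanishes on \<open>C\<close>.\<close>

lemma irreducible_closed_sub:
  assumes Z: "Z \<subseteq> W" "zcl Z = Z"
  shows "irreducible_closed (subtopology (zariski sc W) Z) C \<longleftrightarrow> C \<subseteq> Z \<and> zcl C = C \<and> prime_set C"
proof (cases "C \<subseteq> Z \<and> zcl C = C \<and> C \<noteq> {}")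
  case True
  then have C: "C \<subseteq> Z" "zcl C = C" "C \<noteq> {}" by auto
  note cl = closedin_sub[OF Z]
  have "(\<forall>A B. A \<subseteq> Z \<and> zcl A = A --> B \<subseteq> Z \<and> zcl B = B --> C \<subseteq> A \<union> B --> C \<subseteq> A \<or> C \<subseteq> B) \<longleftrightarrow> prime_set C"
  proof
    assume irr: "\<forall>A B. A \<subseteq> Z \<and> zcl A = A --> B \<subseteq> Z \<and> zcl B = B --> C \<subseteq> A \<union> B --> C \<subseteq> A \<or> C \<subseteq> B"
    have cl: "zcl {p \<in> Z. f p = 0} = {p \<in> Z. f p = 0}" if f: "poly_fun f" for f
    proof -
      have "zcl {p \<in> Z. f p = 0} \<subseteq> Z" by (rule zcl_minimal[OF _ Z(2)]) blast
      moreover have "f p = 0" if "p \<in> zcl {p \<in> Z. f p = 0}" for p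
        by (rule zcl_vanish[OF f _ that]) blast
      moreover have "{p \<in> Z. f p = 0} \<subseteq> zcl {p \<in> Z. f p = 0}" using Z by (intro zcl_subset) blast
      ultimately show ?thesis by blast
    qed
    show "prime_set C" unfolding prime_on_def
    proof (intro conjI allI impI C(3))
      fix f g assume fg: "poly_fun f" "poly_fun g" "\<forall>p\<in>C. f p * g p = 0"
      then have "C \<subseteq> {p \<in> Z. f p = 0} \<union> {p \<in> Z. g p = 0}" using C(1) by auto
      then have "C \<subseteq> {p \<in> Z. f p = 0} \<or> C \<subseteq> {p \<in> Z. g p = 0}"
        using irr[rule_format, of "{p \<in> Z. f p = 0}" "{p \<in> Z. g p = 0}"] cl[OF fg(1)] cl[OF fg(2)] by simp
      then show "(\<forall>p\<in>C. f p = 0) \<or> (\<forall>p\<in>C. g p = 0)" by blast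
    qed
  next
    assume prime: "prime_set C"
    show "\<forall>A B. A \<subseteq> Z \<and> zcl A = A --> B \<subseteq> Z \<and> zcl B = B --> C \<subseteq> A \<union> B --> C \<subseteq> A \<or> C \<subseteq> B"
    proof (intro allI impI, rule ccontr)
      fix A B assume AB: "A \<subseteq> Z \<and> zcl A = A" "B \<subseteq> Z \<and> zcl B = B" "C \<subseteq> A \<union> B" "\<not> (C \<subseteq> A \<or> C \<subseteq> B)"
      then obtain p q where pq: "p \<in> C" "p \<notin> zcl A" "q \<in> C" "q \<notin> zcl B" by blast
      then have "p \<in> W" "q \<in> W" using C(1) Z(1) by auto
      with pq obtain f g where "poly_fun f" "\<forall>p\<in>A. f p = 0" "f p \<noteq> 0" "poly_fun g" "\<forall>p\<in>B. g p = 0" "g q \<noteq> 0"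
        unfolding zcl_def by auto
      moreover have "\<forall>r\<in>C. f r * g r = 0" using AB(3) calculation by auto
      ultimately show False using prime pq unfolding prime_on_def by blast
    qed
  qed
  then show ?thesis unfolding irreducible_closed_def cl using C by simp
next
  case False
  then show ?thesis unfolding irreducible_closed_def closedin_sub[OF Z] by (auto simp: prime_on_def)
qed

text \<open>Prime avoidance: choose for each \<open>i\<close> a function vanishing on
  \<open>X i\<close> but not on all of \<open>C\<close>. On a prime set they are all nonzero at a
  common point, and that point lies in none of the closures.\<close>

lemma prime_subset_Union:
  assumes "prime_set C" "C \<subseteq> W" "finite P" "C \<subseteq> (\<Union>i\<in>P. zcl (X i))"
  shows "\<exists>i\<in>P. C \<subseteq> zcl (X i)"
proof (rule ccontr)
  assume no: "\<not> (\<exists>i\<in>P. C \<subseteq> zcl (X i))"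
  have "\<exists>f. poly_fun f \<and> (\<forall>p\<in>X i. f p = 0) \<and> (\<exists>p\<in>C. f p \<noteq> 0)" if "i \<in> P" for i
  proof -
    from no that obtain p where "p \<in> C" "p \<notin> zcl (X i)" by blast
    then show ?thesis using assms(2) unfolding zcl_def by blast
  qed
  then obtain f where f: "\<And>i. i \<in> P ==> poly_fun (f i)" "\<And>i p. i \<in> P ==> p \<in> X i ==> f i p = 0"
    "\<And>i. i \<in> P ==> \<exists>p\<in>C. f i p \<noteq> 0" by metis
  have "\<exists>p\<in>C. \<forall>i\<in>P. f i p \<noteq> 0"
    by (rule prime_on_prod[OF assms(1,3)]) (use f in blast)+
  then obtain p where p: "p \<in> C" "\<And>i. i \<in> P ==> f i p \<noteq> 0" by blast
  then obtain i where "i \<in> P" "p \<in> zcl (X i)" using assms(4) by blast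
  then show False using zcl_vanish[OF f(1) f(2)] p(2) by blast
qed

lemma growth_zcl: "growth (linfuns sc) S d ==> growth (linfuns sc) (zcl S) d"
  by (erule growth_dense) (rule zcl_vanish)

text \<open>Upper bound: the top of a chain lies in the closure of one piece, and each proper step
  lowers the growth exponent. Lower bound: the closures of the sets \<open>S j\<close> form a chain
  of length \<open>d\<close>.\<close>

lemma krull_dim_eq:
  assumes Z: "Z \<subseteq> W" "zcl Z = Z"
    and P: "finite P" "Z = (\<Union>i\<in>P. X i)" "\<And>i. i \<in> P ==> growth (linfuns sc) (X i) d"
    and S: "\<And>j. j \<le> d ==> prime_set (S j)" "\<And>j. j \<le> d ==> S j \<subseteq> Z" "\<And>j. j < d ==> S j \<subseteq> S (Suc j)"
      "\<And>j. j \<le> d ==> growth (linfuns sc) (S j) j" "\<And>j K. j \<le> d ==> has_indep (linfuns sc) (S j) (j * K) (K ^ j)"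
  shows "krull_dim (subtopology (zariski sc W) Z) = enat d"
proof -
  let ?T = "subtopology (zariski sc W) Z"
  note irr = irreducible_closed_sub[OF Z]
  have up: "k \<le> d" if "irreducible_chain ?T k C" for k C
  proof -
    have C: "\<And>j. j \<le> k ==> C j \<subseteq> Z \<and> zcl (C j) = C j \<and> prime_set (C j)" "\<And>j. j < k ==> C j \<subset> C (Suc j)"
      using that unfolding irreducible_chain_def irr by auto
    have "X i \<subseteq> zcl (X i)" if "i \<in> P" for i
      by (rule zcl_subset) (use that P(2) Z(1) in blast)
    then have "C k \<subseteq> (\<Union>i\<in>P. zcl (X i))"
      using C(1)[of k] P(2) by blast
    with C(1)[of k] Z(1) have "\<exists>i\<in>P. C k \<subseteq> zcl (X i)"
      by (intro prime_subset_Union[OF _ _ P(1)]) auto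
    then obtain i where i: "i \<in> P" "C k \<subseteq> zcl (X i)" by blast
    have "growth (linfuns sc) (C k) d"
      by (rule growth_dense[OF growth_zcl[OF P(3)[OF i(1)]]]) (use i(2) in blast)
    then show "k \<le> d"
    proof (rule growth_chain[rotated 3])
      fix j assume j: "j < k"
      then obtain p where p: "p \<in> C (Suc j)" "p \<notin> zcl (C j)" using C(1)[of j] C(2)[of j] by auto
      moreover have "p \<in> W" using p(1) C(1)[of "Suc j"] j Z(1) by auto
      ultimately show "\<exists>f. poly_fun f \<and> (\<forall>p\<in>C j. f p = 0) \<and> (\<exists>p\<in>C (Suc j). f p \<noteq> 0)"
        unfolding zcl_def by blast
    qed (use C in blast)+
  qed
  have "irreducible_chain ?T d (\<lambda>j. zcl (S j))"
    unfolding irreducible_chain_def irr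
  proof (intro conjI allI impI)
    fix j assume j: "j \<le> d"
    show "zcl (S j) \<subseteq> Z" using zcl_minimal[OF S(2)[OF j] Z(2)] .
    show "zcl (zcl (S j)) = zcl (S j)" by (rule zcl_zcl)
    show "prime_set (zcl (S j))" using prime_zcl S(1,2)[OF j] Z(1) by blast
  next
    fix j assume j: "j < d"
    \<comment> \<open>The step is proper since the closure of \<open>S j\<close> has growth exponent
      \<open>j\<close>, while \<open>S (Suc j)\<close> carries about \<open>K ^ Suc j\<close>
      independent functions of degree proportional to \<open>K\<close>.\<close>
    have "zcl (S (Suc j)) \<noteq> zcl (S j)"
    proof
      assume eq: "zcl (S (Suc j)) = zcl (S j)"
      have "growth (linfuns sc) (zcl (S (Suc j))) j" unfolding eq
        using j by (intro growth_zcl S(4)) simp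
      moreover have "has_indep (linfuns sc) (zcl (S (Suc j))) (Suc j * K) (K ^ Suc j)" for K
        by (rule has_indep_subset[OF S(5) zcl_subset]) (use S(2)[of "Suc j"] Z(1) j in auto)
      ultimately have "Suc j \<le> j" by (rule growth_lower[rotated])
      then show False by simp
    qed
    then show "zcl (S j) \<subset> zcl (S (Suc j))" using zcl_mono[OF S(3)[OF j]] by blast
  qed
  then have "enat d \<in> {enat k |k. \<exists>C. irreducible_chain ?T k C}" by blast
  moreover have "x \<le> enat d" if "x \<in> {enat k |k. \<exists>C. irreducible_chain ?T k C}" for x
    using that up by auto
  ultimately show ?thesis unfolding krull_dim_def by (intro antisym Sup_least Sup_upper)
qed

text \<open>The components are the maximal closures of nonempty pieces. The height theorem forces a
  maximal closure to have dimension at least \<open>d\<close>, so its index is in \<open>E\<close>;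
  conversely a piece in \<open>E\<close> cannot lie properly in another closure, whose dimension is
  at most \<open>d\<close>. Empty pieces are allowed outside \<open>E\<close>.\<close>

theorem bij_betw_components:
  assumes F: "finite F" "\<And>f. f \<in> F ==> poly_fun f" "card F + d \<le> N"
    and Z: "Z = {p \<in> W. \<forall>f\<in>F. f p = 0}"
    and P: "finite P" "Z = (\<Union>i\<in>P. X i)" and E: "E \<subseteq> P"
    and prime: "\<And>i. i \<in> P ==> X i \<noteq> {} ==> prime_set (X i)"
    and dm: "\<And>i. i \<in> P ==> growth (linfuns sc) (X i) (dm i)" "\<And>i. i \<in> P ==> dm i \<le> d"
      "\<And>i. i \<in> P - E ==> dm i < d"
    and E': "\<And>i. i \<in> E ==> X i \<noteq> {}" "\<And>i K. i \<in> E ==> has_indep (linfuns sc) (X i) (d * K) (K ^ d)"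
    and inj: "\<And>i j. i \<in> P ==> j \<in> P ==> X i \<noteq> {} ==> X j \<noteq> {} ==> zcl (X i) = zcl (X j) ==> i = j"
  shows "bij_betw (\<lambda>i. subtopology (zariski sc W) Z closure_of X i) E
    (irreducible_components (subtopology (zariski sc W) Z))"
proof -
  let ?T = "subtopology (zariski sc W) Z"
  have ZW: "Z \<subseteq> W" unfolding Z by blast
  have Zcl: "zcl Z = Z" unfolding Z by (rule zcl_vanishing_set[OF F(2)])
  note irr = irreducible_closed_sub[OF ZW Zcl]
  have XZ: "X i \<subseteq> Z" "X i \<subseteq> W" if "i \<in> P" for i using P(2) ZW that by blast+
  define P' where "P' = {i \<in> P. X i \<noteq> {}}"
  have finP': "finite P'" using P(1) by (simp add: P'_def)
  have irrX: "irreducible_closed ?T (zcl (X i))" if "i \<in> P'" for i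
    unfolding irr using that zcl_minimal[OF XZ(1) Zcl] zcl_zcl prime_zcl[OF XZ(2)] prime
    unfolding P'_def by blast
  have cover: "\<exists>i\<in>P'. D \<subseteq> zcl (X i)" if "irreducible_closed ?T D" for D
  proof (rule prime_subset_Union[OF _ _ finP'])
    show "prime_set D" "D \<subseteq> W" using that ZW unfolding irr by blast+
    show "D \<subseteq> (\<Union>i\<in>P'. zcl (X i))"
    proof
      fix p assume "p \<in> D"
      then have "p \<in> Z" using that unfolding irr by blast
      then have "p \<in> (\<Union>i\<in>P. X i)" unfolding P(2) .
      then obtain i where i: "i \<in> P" "p \<in> X i" by blast
      then show "p \<in> (\<Union>i\<in>P'. zcl (X i))" using zcl_subset[OF XZ(2)[OF i(1)]] unfolding P'_def by blast
    qed
  qed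
  define mx where "mx i \<longleftrightarrow> i \<in> P' \<and> (\<forall>j\<in>P'. zcl (X i) \<subseteq> zcl (X j) --> j = i)" for i
  have inj': "i = j" if "i \<in> P'" "j \<in> P'" "zcl (X i) = zcl (X j)" for i j
    using that inj[of i j] by (simp add: P'_def)
  have mx_E: "i \<in> E" if "mx i" for i
  proof -
    have i: "i \<in> P'" "i \<in> P" "X i \<noteq> {}" using that by (auto simp: mx_def P'_def)
    have "\<exists>f. poly_fun f \<and> (\<forall>p\<in>X j. f p = 0) \<and> (\<exists>p\<in>zcl (X i). f p \<noteq> 0)" if j: "j \<in> P' - {i}" for j
    proof -
      have "\<not> zcl (X i) \<subseteq> zcl (X j)" using j \<open>mx i\<close> unfolding mx_def by blast
      then show ?thesis unfolding zcl_def by blast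
    qed
    then obtain f where f: "\<And>j. j \<in> P' - {i} ==> poly_fun (f j)" "\<And>j p. j \<in> P' - {i} ==> p \<in> X j ==> f j p = 0"
      "\<And>j. j \<in> P' - {i} ==> \<exists>p\<in>zcl (X i). f j p \<noteq> 0" by metis
    \<comment> \<open>Vanishes on all the other pieces but not on the closure of \<open>X i\<close>:
      off the zeros of \<open>g\<close> the equations \<open>F\<close> cut out nothing beyond that
      closure.\<close>
    define g where "g p = (\<Prod>j\<in>P' - {i}. f j p)" for p
    have pr: "prime_set (zcl (X i))" using irrX[OF i(1)] unfolding irr by blast
    have "N \<le> card F + dm i"
    proof (rule height_theorem[OF F(1,2) pr growth_zcl[OF dm(1)[OF i(2)]] zcl_W])
      show "f p = 0" if "f \<in> F" "p \<in> zcl (X i)" for f p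
        using zcl_vanish[OF F(2)[OF that(1)] _ that(2)] XZ(1)[OF i(2)] that(1) unfolding Z by blast
      show "poly_fun g" unfolding g_def by (intro ispoly_prod f)
      show "\<exists>p\<in>zcl (X i). g p \<noteq> 0"
      proof -
        have "\<exists>p\<in>zcl (X i). \<forall>j\<in>P' - {i}. f j p \<noteq> 0"
          by (rule prime_on_prod[OF pr]) (use f finP' in blast)+
        then show ?thesis unfolding g_def using finP' by auto
      qed
      show "p \<in> zcl (X i)" if p: "p \<in> W" "\<And>f. f \<in> F ==> f p = 0" "g p \<noteq> 0" for p
      proof -
        have "p \<in> Z" using p unfolding Z by blast
        then have "p \<in> (\<Union>i\<in>P. X i)" unfolding P(2) .
        then obtain j where j: "j \<in> P" "p \<in> X j" by blast
        then have "j \<in> P'" by (auto simp: P'_def)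
        have "j = i"
        proof (rule ccontr)
          assume "j \<noteq> i"
          then have "f j p = 0" using f(2)[of j p] j(2) \<open>j \<in> P'\<close> by blast
          then have "g p = 0" unfolding g_def using finP' \<open>j \<in> P'\<close> \<open>j \<noteq> i\<close> by (intro prod_zero) auto
          with p(3) show False by simp
        qed
        then show ?thesis using j zcl_subset[OF XZ(2)] by blast
      qed
    qed auto
    then have "d \<le> dm i" using F(3) by simp
    then show "i \<in> E" using dm(3)[of i] i(2) by fastforce
  qed
  have E_P': "E \<subseteq> P'" using E E'(1) by (auto simp: P'_def)
  have E_mx: "mx i" if i: "i \<in> E" for i
    unfolding mx_def
  proof (intro conjI ballI impI)
    show "i \<in> P'" using i E_P' by blast
    fix j assume j: "j \<in> P'" "zcl (X i) \<subseteq> zcl (X j)"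
    show "j = i"
    proof (rule ccontr)
      assume "j \<noteq> i"
      then have "\<not> zcl (X j) \<subseteq> zcl (X i)" using inj'[OF j(1) \<open>i \<in> P'\<close>] j(2) by blast
      then obtain p f where f: "p \<in> zcl (X j)" "poly_fun f" "\<forall>q\<in>X i. f q = 0" "f p \<noteq> 0"
        unfolding zcl_def[of "X i"] using zcl_W by blast
      \<comment> \<open>A proper inclusion costs one in the exponent, which would leave
        \<open>X i\<close> with less than the \<open>d\<close> it has.\<close>
      have "0 < dm j \<and> growth (linfuns sc) (zcl (X i)) (dm j - 1)"
      proof (rule growth_step)
        show "prime_set (zcl (X j))" using irrX[OF j(1)] unfolding irr by blast
        show "growth (linfuns sc) (zcl (X j)) (dm j)" using j(1) by (intro growth_zcl dm) (simp add: P'_def)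
        show "zcl (X i) \<subseteq> zcl (X j)" by fact
        show "zcl (X i) \<noteq> {}" using zcl_subset XZ(2) \<open>i \<in> P'\<close> unfolding P'_def by blast
        show "f q = 0" if "q \<in> zcl (X i)" for q using zcl_vanish[OF f(2) _ that] f(3) by blast
      qed (use f in auto)
      moreover have "has_indep (linfuns sc) (zcl (X i)) (d * K) (K ^ d)" for K
        using has_indep_subset[OF E'(2)[OF i] zcl_subset] XZ(2) i E by blast
      ultimately have "0 < dm j" "d \<le> dm j - 1" using growth_lower by blast+
      moreover have "dm j \<le> d" using j(1) by (intro dm) (simp add: P'_def)
      ultimately show False by simp
    qed
  qed
  have max_ex: "\<exists>j. mx j \<and> zcl (X i) \<subseteq> zcl (X j)" if i: "i \<in> P'" for i
  proof -
    let ?Q = "{C \<in> (\<lambda>j. zcl (X j)) ` P'. zcl (X i) \<subseteq> C}"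
    have "finite ?Q" "?Q \<noteq> {}" using finP' i by auto
    from finite_has_maximal[OF this] have "\<exists>m\<in>?Q. \<forall>C\<in>?Q. m \<subseteq> C --> m = C" .
    then obtain m where m: "m \<in> ?Q" "\<And>C. C \<in> ?Q ==> m \<subseteq> C ==> m = C" by (elim bexE) simp
    then obtain j where j: "j \<in> P'" "m = zcl (X j)" "zcl (X i) \<subseteq> zcl (X j)" by blast
    have "mx j" unfolding mx_def
    proof (intro conjI ballI impI j(1))
      fix k assume k: "k \<in> P'" "zcl (X j) \<subseteq> zcl (X k)"
      then have "m = zcl (X k)" using m(2)[of "zcl (X k)"] j by blast
      with j(2) have "zcl (X k) = zcl (X j)" by metis
      then show "k = j" by (rule inj'[OF k(1) j(1)])
    qed
    with j(3) show ?thesis by blast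
  qed
  have comp: "irreducible_components ?T = (\<lambda>i. zcl (X i)) ` E"
  proof (intro equalityI subsetI)
    fix C assume "C \<in> irreducible_components ?T"
    then have C: "irreducible_closed ?T C" "\<And>D. irreducible_closed ?T D ==> C \<subseteq> D ==> D = C"
      unfolding irreducible_components_def by blast+
    obtain i where i: "i \<in> P'" "C \<subseteq> zcl (X i)" using cover[OF C(1)] by blast
    obtain j where j: "mx j" "zcl (X i) \<subseteq> zcl (X j)" using max_ex[OF i(1)] by blast
    have "zcl (X j) = C" using i j irrX[of j] by (intro C(2)) (auto simp: mx_def)
    then show "C \<in> (\<lambda>i. zcl (X i)) ` E" using mx_E[OF j(1)] by blast
  next
    fix C assume "C \<in> (\<lambda>i. zcl (X i)) ` E"
    then obtain i where i: "i \<in> E" "C = zcl (X i)" by blast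
    have "D = C" if D: "irreducible_closed ?T D" "C \<subseteq> D" for D
    proof -
      obtain j where j: "j \<in> P'" "D \<subseteq> zcl (X j)" using cover[OF D(1)] by blast
      then have "j = i" using E_mx[OF i(1)] D(2) i(2) unfolding mx_def by blast
      then show ?thesis using j D(2) i(2) by blast
    qed
    then show "C \<in> irreducible_components ?T"
      unfolding irreducible_components_def using irrX[of i] i E_P' by blast
  qed
  have "bij_betw (\<lambda>i. zcl (X i)) E (irreducible_components ?T)"
    unfolding comp by (rule inj_on_imp_bij_betw) (use inj' E_P' in "auto simp: inj_on_def")
  moreover have "?T closure_of X i = zcl (X i)" if "i \<in> E" for i
    using closure_of_sub[OF ZW Zcl XZ(1)] that E by blast
  ultimately show ?thesis using bij_betw_cong[of E "\<lambda>i. ?T closure_of X i" "\<lambda>i. zcl (X i)"] by blast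
qed

end

section \<open>Polynomials of a matrix\<close>

definition mpoly :: "complex poly => complex^'m^'m::finite => complex^'m^'m" where
  "mpoly p A = fold_coeffs (\<lambda>a B. mat a + A ** B) p 0"

lemma mat_add: "mat (a + b) = mat a + (mat b :: 'a::monoid_add^'m^'m)"
  by (simp add: mat_def vec_eq_iff)

lemma matrix_add_rdistrib: "(A + B) ** C = A ** C + B ** (C :: 'a::semiring_1^'n^'m)"
  by (simp add: matrix_matrix_mult_def vec_eq_iff sum.distrib algebra_simps)

lemma mat_mult_left: "mat a ** B = map_matrix ((*) a) (B :: complex^'m^'m::finite)"
proof -
  have "(\<Sum>k\<in>UNIV. (if i = k then a else 0) * B $ k $ j) = (\<Sum>k\<in>UNIV. if i = k then a * B $ k $ j else 0)" for i j
    by (intro sum.cong) auto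
  then show ?thesis by (simp add: mat_def vec_eq_iff matrix_matrix_mult_def map_matrix_def)
qed

lemma mat_mult_right: "B ** mat a = map_matrix ((*) a) (B :: complex^'m^'m::finite)"
proof -
  have "(\<Sum>k\<in>UNIV. B $ i $ k * (if k = j then a else 0)) = (\<Sum>k\<in>UNIV. if k = j then a * B $ i $ k else 0)" for i j
    by (intro sum.cong) auto
  then show ?thesis by (simp add: mat_def vec_eq_iff matrix_matrix_mult_def map_matrix_def)
qed

lemma mat_commute: "mat a ** B = B ** mat a" for B :: "complex^'m^'m::finite"
  unfolding mat_mult_left mat_mult_right ..

lemma mat_mult_vec: "mat a *v v = a *s (v :: complex^'m::finite)"
proof -
  have "(\<Sum>j\<in>UNIV. (if i = j then a else 0) * v $ j) = (\<Sum>j\<in>UNIV. if i = j then a * v $ j else 0)" for i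
    by (intro sum.cong) auto
  then show ?thesis by (simp add: mat_def vec_eq_iff matrix_vector_mult_def)
qed

lemma mat_mult_mat: "mat a ** mat b = (mat (a * b) :: complex^'m^'m::finite)"
  unfolding mat_mult_left by (simp add: map_matrix_def mat_def vec_eq_iff)

lemma mpoly_0 [simp]: "mpoly 0 A = 0"
  by (simp add: mpoly_def)

lemma mpoly_pCons [simp]: "mpoly (pCons a p) A = mat a + A ** mpoly p A"
  by (cases "p = 0 \<and> a = 0") (auto simp: mpoly_def)

lemma mpoly_add: "mpoly (p + q) A = mpoly p A + mpoly q A"
proof (induction p arbitrary: q)
  case (pCons a p)
  show ?case
    by (cases q) (simp add: pCons.IH mat_add matrix_add_ldistrib)
qed simp

lemma mpoly_smult: "mpoly (smult c p) A = mat c ** mpoly p A"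
proof (induction p)
  case (pCons a p)
  have "A ** (mat c ** mpoly p A) = mat c ** (A ** mpoly p A)"
    unfolding matrix_mul_assoc mat_commute[of c A] ..
  then show ?case
    by (simp add: pCons.IH matrix_add_ldistrib mat_mult_mat)
qed simp

lemma mpoly_mult: "mpoly (p * q) A = mpoly p A ** mpoly q A"
proof (induction p)
  case (pCons a p)
  then show ?case
    by (simp add: mpoly_add mpoly_smult matrix_add_rdistrib matrix_mul_assoc)
qed simp

lemma mpoly_commute: "A ** B = B ** A ==> mpoly p A ** B = B ** mpoly p A"
proof (induction p)
  case (pCons a p)
  have "A ** mpoly p A ** B = B ** A ** mpoly p A"
    by (metis pCons.IH pCons.prems matrix_mul_assoc)
  then show ?case
    by (simp add: matrix_add_ldistrib matrix_add_rdistrib mat_commute[of a B] matrix_mul_assoc)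
qed simp

lemma mpoly_sum: "mpoly (\<Sum>i\<in>I. p i) A = (\<Sum>i\<in>I. mpoly (p i) A)"
  by (induction I rule: infinite_finite_induct) (auto simp: mpoly_add)

lemma mpoly_diff: "mpoly (p - q) A = mpoly p A - mpoly q A"
  using mpoly_add[of "p - q" q A] by simp

text \<open>\<open>K\<close> powers of \<open>A\<close> are considered, one more than
  \<open>A\<close> has entries, so they are linearly dependent.\<close>

lemma mpoly_annihilator:
  fixes A :: "complex^'m^'m::finite"
  shows "\<exists>p. p \<noteq> 0 \<and> mpoly p A = 0"
proof -
  define K where "K = Suc (card (UNIV :: ('m \<times> 'm) set))"
  obtain c where c: "\<exists>k\<in>{..<K}. c k \<noteq> 0"
    "\<And>i. i \<in> (UNIV :: ('m \<times> 'm) set) ==> (\<Sum>k<K. c k * mpoly (monom 1 k) A $ fst i $ snd i) = 0"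
    using exists_dependency[of "UNIV :: ('m \<times> 'm) set" "{..<K}" "\<lambda>k i. mpoly (monom 1 k) A $ fst i $ snd i"]
    by (auto simp: K_def)
  define p where "p = (\<Sum>k<K. smult (c k) (monom 1 k))"
  have "mpoly p A $ i $ j = (\<Sum>k<K. c k * mpoly (monom 1 k) A $ i $ j)" for i j
    by (simp add: p_def mpoly_sum mpoly_smult mat_mult_left map_matrix_def)
  then have "mpoly p A = 0" using c(2)[of "(_, _)"] by (simp add: vec_eq_iff)
  moreover have "p \<noteq> 0"
  proof -
    obtain k where k: "k < K" "c k \<noteq> 0" using c(1) by auto
    have "coeff p k = (\<Sum>k'<K. if k' = k then c k' else 0)"
      unfolding p_def coeff_sum by (intro sum.cong) auto
    then have "coeff p k = c k" using k(1) by simp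
    with k(2) show ?thesis by auto
  qed
  ultimately show ?thesis by blast
qed

lemma X_power_factor: "(p :: complex poly) \<noteq> 0 ==> \<exists>k r. p = monom 1 k * r \<and> poly r 0 \<noteq> 0"
proof -
  assume p: "p \<noteq> 0"
  obtain r where r: "p = [:- 0, 1:] ^ Polynomial.order 0 p * r" using order_1[of 0 p] by (auto elim: dvdE)
  have "poly r 0 \<noteq> 0"
  proof
    assume "poly r 0 = 0"
    then have "[:- 0, 1:] dvd r" by (simp add: poly_eq_0_iff_dvd)
    then have "[:- 0, 1:] ^ Suc (Polynomial.order 0 p) dvd p"
      using mult_dvd_mono[OF dvd_refl, of "[:-0, 1:]" r "[:- 0, 1:] ^ Polynomial.order 0 p"] r by (simp add: mult.commute)
    then show False using order_2[OF p] by blast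
  qed
  then show ?thesis using r by (auto simp: monom_altdef)
qed

lemma poly_eqI2: "(\<And>t. poly p t = poly q t) ==> p = (q :: complex poly)"
  using poly_eq_poly_eq_iff by blast

text \<open>Hensel lifting by one root \<open>a\<close> of \<open>q\<close> at a time: given a
  square root \<open>p\<close> of \<open>X\<close> modulo \<open>q'\<close>, a correction
  \<open>p + c q'\<close> is sought that works modulo \<open>(X - a) q'\<close>.\<close>

lemma poly_sqrt_mod:
  assumes "(q :: complex poly) \<noteq> 0" "poly q 0 \<noteq> 0"
  shows "\<exists>p. q dvd p\<^sup>2 - [:0, 1:]"
  using assms
proof (induction "degree q" arbitrary: q rule: less_induct)
  case less
  show ?case
  proof (cases "degree q = 0")
    case True
    then have "is_unit q" using less.prems by (simp add: is_unit_iff_degree)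
    then show ?thesis by (auto intro: unit_imp_dvd)
  next
    case False
    then have "\<not> constant (poly q)" by (simp add: constant_degree)
    then obtain a where a: "poly q a = 0" using fundamental_theorem_of_algebra by blast
    then obtain q' where q': "q = [:-a, 1:] * q'" by (auto simp: poly_eq_0_iff_dvd elim: dvdE)
    have a0: "a \<noteq> 0" using a less.prems by auto
    have "q' \<noteq> 0" "poly q' 0 \<noteq> 0" using less.prems q' by auto
    moreover have "degree q' < degree q" unfolding q' using \<open>q' \<noteq> 0\<close> by (subst degree_mult_eq) auto
    ultimately obtain p where "q' dvd p\<^sup>2 - [:0, 1:]" using less.hyps by blast
    then obtain r where r: "p\<^sup>2 - [:0, 1:] = q' * r" by (auto elim: dvdE)
    \<comment> \<open>The condition on the correction \<open>c\<close> at the root \<open>a\<close>.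
      It is a genuine quadratic equation unless \<open>q'\<close> vanishes at \<open>a\<close>; then
      it is linear, with coefficient \<open>2 * poly p a \<noteq> 0\<close> because
      \<open>(poly p a)\<^sup>2 = a \<noteq> 0\<close>.\<close>
    have "\<exists>c. poly r a + 2 * poly p a * c + poly q' a * c\<^sup>2 = 0"
    proof (cases "poly q' a = 0")
      case True
      have "(poly p a)\<^sup>2 - a = poly q' a * poly r a"
        using arg_cong[OF r, of "\<lambda>f. poly f a"] by simp
      then have "poly p a \<noteq> 0" using True a0 by auto
      then show ?thesis using True by (intro exI[of _ "- poly r a / (2 * poly p a)"]) simp
    next
      case False
      then have "\<not> constant (poly [:poly r a, 2 * poly p a, poly q' a:])"
        by (simp add: constant_degree)
      then obtain c where "poly [:poly r a, 2 * poly p a, poly q' a:] c = 0"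
        using fundamental_theorem_of_algebra by blast
      then show ?thesis by (intro exI[of _ c]) (simp add: algebra_simps power2_eq_square)
    qed
    then obtain c where c: "poly r a + 2 * poly p a * c + poly q' a * c\<^sup>2 = 0" by blast
    have eq: "(p + smult c q')\<^sup>2 - [:0, 1:] = q' * (r + smult (2 * c) p + smult (c\<^sup>2) q')"
    proof -
      have "(p + smult c q')\<^sup>2 - [:0, 1:] = (p\<^sup>2 - [:0,1:]) + q' * (smult (2 * c) p + smult (c\<^sup>2) q')"
        by (rule poly_eqI2) (simp add: power2_eq_square algebra_simps)
      also have "\<dots> = q' * (r + smult (2 * c) p + smult (c\<^sup>2) q')" unfolding r by (simp add: algebra_simps)
      finally show ?thesis .
    qed
    have "[:-a, 1:] dvd r + smult (2 * c) p + smult (c\<^sup>2) q'"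
      using c by (simp add: poly_eq_0_iff_dvd[symmetric] mult_ac)
    then have "q dvd (p + smult c q')\<^sup>2 - [:0, 1:]"
      unfolding eq q' by (subst mult.commute) (rule mult_dvd_mono[OF dvd_refl])
    then show ?thesis by blast
  qed
qed

lemma matrix_inj_invertible:
  fixes A :: "complex^'m^'m::finite"
  assumes "\<And>v. A *v v = 0 ==> v = 0"
  shows "invertible A"
  unfolding invertible_left_inverse matrix_left_invertible_ker using assms by blast

text \<open>An injective \<open>A\<close> is annihilated by some \<open>r\<close> with
  \<open>r(0) \<noteq> 0\<close>, and modulo such \<open>r\<close> the variable has a square root.
  Being a polynomial in \<open>A\<close>, the root inherits self-adjointness and commutes with
  everything that \<open>A\<close> commutes with; both are used later.\<close>

theorem matrix_sqrt:
  fixes A :: "complex^'m^'m::finite"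
  assumes inj: "\<And>v. A *v v = 0 ==> v = 0"
  shows "\<exists>p. mpoly p A ** mpoly p A = A"
proof -
  obtain q where "q \<noteq> 0" "mpoly q A = 0" using mpoly_annihilator by blast
  then obtain k r where r: "q = monom 1 k * r" "poly r 0 \<noteq> 0" using X_power_factor by blast
  have "mpoly (monom 1 k) A ** B = 0 ==> B = 0" for k and B :: "complex^'m^'m"
  proof (induction k)
    case (Suc k)
    have "A *v ((mpoly (monom 1 k) A ** B) *v v) = 0" for v
      using Suc.prems by (simp add: monom_Suc matrix_vector_mul_assoc matrix_mul_assoc)
    then have "(mpoly (monom 1 k) A ** B) *v v = 0 *v v" for v using inj by simp
    then have "mpoly (monom 1 k) A ** B = 0" by (simp add: matrix_eq)
    then show ?case by (rule Suc.IH)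
  next
    case 0
    then show ?case by (simp add: monom_0 mat_mult_left map_matrix_def vec_eq_iff)
  qed
  then have "mpoly r A = 0" using \<open>mpoly q A = 0\<close> unfolding r(1) mpoly_mult by blast
  moreover have "r \<noteq> 0" using r(2) by auto
  from poly_sqrt_mod[OF this r(2)] obtain p where "r dvd p\<^sup>2 - [:0, 1:]" by blast
  ultimately have "mpoly (p\<^sup>2 - [:0, 1:]) A = 0" by (auto elim!: dvdE simp: mpoly_mult)
  then show ?thesis by (auto simp: mpoly_diff power2_eq_square mpoly_mult)
qed

section \<open>Nilpotent matrices and the characteristic polynomial\<close>

definition mpow :: "nat => complex^'m^'m::finite => complex^'m^'m" where
  "mpow k A = mpoly (monom 1 k) A"

lemma mpow_0 [simp]: "mpow 0 A = mat 1"
  by (simp add: mpow_def monom_0)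

lemma mpow_Suc: "mpow (Suc k) A = A ** mpow k A"
  by (simp add: mpow_def monom_Suc)

lemma mpow_add: "mpow (j + k) A = mpow j A ** mpow k A"
  by (simp add: mpow_def mult_monom flip: mpoly_mult)

lemma mpow_funpow: "mpow k A *v v = ((\<lambda>u. A *v u) ^^ k) v"
  by (induction k) (simp_all add: mpow_Suc flip: matrix_vector_mul_assoc)

lemma nilpotent_matrix_iff: "nilpotent_matrix A \<longleftrightarrow> (\<exists>k. mpow k A = 0)"
  unfolding nilpotent_matrix_def mpow_funpow[symmetric] by (simp add: matrix_eq)

lemma poly_det: "poly (det M) t = det (map_matrix (\<lambda>p. poly p t) (M :: complex poly^'m^'m::finite))"
  by (simp add: det_def poly_sum poly_prod map_matrix_def)

lemma poly_charpoly: "poly (charpoly A) t = det (mat t - A)"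
proof -
  have "map_matrix (\<lambda>p. poly p t) (mat [:0, 1:] - map_matrix (\<lambda>c. [:c:]) A) = mat t - A"
    by (simp add: map_matrix_def mat_def vec_eq_iff)
  then show ?thesis unfolding charpoly_def poly_det by simp
qed

text \<open>In the Leibniz formula a permutation contributes degree at most the number of its fixed
  points, so only the identity reaches the top degree.\<close>

lemma charpoly_monic:
  fixes A :: "complex^'m^'m::finite"
  shows "degree (charpoly A) = CARD('m)" "coeff (charpoly A) CARD('m) = 1"
proof -
  define M where "M = mat [:0, 1:] - map_matrix (\<lambda>c. [:c:]) A"
  have diag: "M $ i $ i = [:- A $ i $ i, 1:]" for i
    by (simp add: M_def mat_def map_matrix_def)
  have off: "M $ i $ j = [:- A $ i $ j:]" if "i \<noteq> j" for i j
    using that by (simp add: M_def mat_def map_matrix_def)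
  have deg: "degree (\<Prod>i\<in>UNIV. M $ i $ t i) \<le> card {i. t i = i}" for t :: "'m => 'm"
  proof -
    have "degree (\<Prod>i\<in>UNIV. M $ i $ t i) \<le> (\<Sum>i\<in>UNIV. degree (M $ i $ t i))"
      using degree_prod_sum_le[of "UNIV :: 'm set" "\<lambda>i. M $ i $ t i"] by (simp add: o_def)
    also have "\<dots> \<le> (\<Sum>i\<in>UNIV. if t i = i then 1 else 0)"
      by (intro sum_mono) (auto simp: off diag)
    also have "\<dots> = card {i. t i = i}" by (simp add: sum.If_cases)
    finally show ?thesis .
  qed
  have deg_le: "degree (charpoly A) \<le> CARD('m)"
    unfolding charpoly_def M_def[symmetric] det_def
  proof (rule degree_sum_le)
    fix t assume "t \<in> {p. p permutes (UNIV :: 'm set)}"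
    have "degree (of_int (sign t) * (\<Prod>i\<in>UNIV. M $ i $ t i)) \<le> degree (\<Prod>i\<in>UNIV. M $ i $ t i)"
      by (simp add: of_int_poly)
    also have "\<dots> \<le> card {i. t i = i}" by (rule deg)
    also have "\<dots> \<le> CARD('m)" by (intro card_mono) auto
    finally show "degree (of_int (sign t) * (\<Prod>i\<in>UNIV. M $ i $ t i)) \<le> CARD('m)" .
  qed (simp add: finite_permutations)
  have coeff: "coeff (of_int (sign t) * (\<Prod>i\<in>UNIV. M $ i $ t i)) CARD('m) = (if t = id then 1 else 0)"
    for t :: "'m => 'm"
  proof (cases "t = id")
    case True
    have "degree (\<Prod>i\<in>UNIV. M $ i $ i) = (\<Sum>i\<in>UNIV. degree (M $ i $ i))"
      by (intro degree_prod_eq_sum_degree) (auto simp: diag)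
    then have "degree (\<Prod>i\<in>UNIV. M $ i $ i) = CARD('m)" by (simp add: diag)
    moreover have "lead_coeff (\<Prod>i\<in>UNIV. M $ i $ i) = 1"
      unfolding lead_coeff_prod by (simp add: diag)
    ultimately show ?thesis using True by (simp add: sign_id)
  next
    case False
    then obtain i where "t i \<noteq> i" by (auto simp: fun_eq_iff)
    then have "{i. t i = i} \<subset> UNIV" by blast
    then have "card {i. t i = i} < CARD('m)" by (intro psubset_card_mono) auto
    then have "degree (\<Prod>i\<in>UNIV. M $ i $ t i) < CARD('m)" using deg[of t] by linarith
    then show ?thesis using False by (simp add: of_int_poly coeff_eq_0)
  qed
  show c1: "coeff (charpoly A) CARD('m) = 1"
    unfolding charpoly_def M_def[symmetric] det_def coeff_sum coeff
    by (simp add: finite_permutations permutes_id)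
  show "degree (charpoly A) = CARD('m)"
    using deg_le le_degree[of "charpoly A" "CARD('m)"] c1 by simp
qed

lemma det_eq_0_iff: "det (A :: complex^'m^'m::finite) = 0 \<longleftrightarrow> (\<exists>v. v \<noteq> 0 \<and> A *v v = 0)"
proof
  assume "det A = 0"
  then have "\<not> invertible A" using invertible_det_nz[of A] by simp
  then show "\<exists>v. v \<noteq> 0 \<and> A *v v = 0" using matrix_inj_invertible[of A] by blast
next
  assume "\<exists>v. v \<noteq> 0 \<and> A *v v = 0"
  then have "\<not> invertible A"
    unfolding invertible_left_inverse matrix_left_invertible_ker by blast
  then show "det A = 0" using invertible_det_nz[of A] by simp
qed

text \<open>A root of the characteristic polynomial is an eigenvalue, hence 0. So the factor left
  after splitting off the power of the variable has no root and is constant.\<close>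

lemma nilpotent_imp_charpoly:
  fixes A :: "complex^'m^'m::finite"
  assumes "nilpotent_matrix A"
  shows "\<forall>k<CARD('m). coeff (charpoly A) k = 0"
proof -
  from assms obtain m where m: "mpow m A = 0" unfolding nilpotent_matrix_iff ..
  have root: "t = 0" if t: "poly (charpoly A) t = 0" for t
  proof (rule ccontr)
    assume "t \<noteq> 0"
    obtain v where v: "v \<noteq> 0" "(mat t - A) *v v = 0" using t unfolding poly_charpoly det_eq_0_iff by (elim exE conjE)
    then have "A *v v = t *s v" by (simp add: matrix_vector_mult_diff_rdistrib mat_mult_vec)
    then have "mpow k A *v v = t ^ k *s v" for k
      by (induction k) (simp_all add: mpow_Suc vector_scalar_commute flip: matrix_vector_mul_assoc)
    from this[of m] show False using m v(1) \<open>t \<noteq> 0\<close> by simp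
  qed
  have "charpoly A \<noteq> 0" using charpoly_monic(2)[of A] by auto
  then obtain k r where r: "charpoly A = monom 1 k * r" "poly r 0 \<noteq> 0" using X_power_factor by blast
  have "constant (poly r)"
  proof (rule ccontr)
    assume "\<not> constant (poly r)"
    then obtain z where "poly r z = 0" using fundamental_theorem_of_algebra by blast
    moreover from this have "poly (charpoly A) z = 0" by (simp add: r(1))
    then have "z = 0" by (rule root)
    ultimately show False using r(2) by simp
  qed
  then have "degree r = 0" by (simp add: constant_degree)
  then obtain c where c: "r = [:c:]" by (rule degree_eq_zeroE)
  then have "charpoly A = monom c k" unfolding r(1) by (simp add: mult_monom flip: monom_0)
  moreover have "c \<noteq> 0" using r(2) c by simp
  ultimately have "k = CARD('m)" using charpoly_monic(1)[of A] by (simp add: degree_monom_eq)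
  then show "\<forall>k<CARD('m). coeff (charpoly A) k = 0" using \<open>charpoly A = monom c k\<close> by simp
qed

text \<open>As \<open>det (mat t - A) = t ^ CARD('m)\<close>, a polynomial in \<open>A\<close> with
  nonzero constant term is a product of injective factors. Removing it from an annihilating
  polynomial leaves a power of \<open>A\<close> that is 0.\<close>

lemma charpoly_imp_nilpotent:
  fixes A :: "complex^'m^'m::finite"
  assumes zero: "\<forall>k<CARD('m). coeff (charpoly A) k = 0"
  shows "nilpotent_matrix A"
proof -
  have "charpoly A = monom 1 CARD('m)"
  proof (rule poly_eqI)
    fix k show "coeff (charpoly A) k = coeff (monom 1 CARD('m)) k"
      using zero charpoly_monic[of A] coeff_eq_0[of "charpoly A" k]
      by (cases k "CARD('m)" rule: linorder_cases) auto
  qed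
  then have det: "det (mat t - A) = t ^ CARD('m)" for t
    unfolding poly_charpoly[symmetric] by (simp add: poly_monom)
  have inj: "mpoly r A *v v = 0 ==> v = 0" if "r \<noteq> 0" "poly r 0 \<noteq> 0" for r v
    using that
  proof (induction "degree r" arbitrary: r v rule: less_induct)
    case less
    show ?case
    proof (cases "degree r = 0")
      case True
      then obtain c where "r = [:c:]" by (rule degree_eq_zeroE)
      with less.prems show ?thesis by (simp add: mat_mult_vec vec_eq_iff)
    next
      case False
      then have "\<not> constant (poly r)" by (simp add: constant_degree)
      then obtain z where "poly r z = 0" using fundamental_theorem_of_algebra by blast
      then obtain r' where r': "r = [:-z, 1:] * r'" by (auto simp: poly_eq_0_iff_dvd elim: dvdE)
      have z: "z \<noteq> 0" using \<open>poly r z = 0\<close> less.prems by auto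
      have r'0: "r' \<noteq> 0" "poly r' 0 \<noteq> 0" using less.prems r' by auto
      have "degree r' < degree r" unfolding r' using r'0 by (subst degree_mult_eq) auto
      have "mat (- z) = - (mat z :: complex^'m^'m)" by (simp add: mat_def vec_eq_iff)
      then have "mpoly [:-z, 1:] A = A - mat z" by simp
      then have "mpoly r A = (A - mat z) ** mpoly r' A" unfolding r' mpoly_mult by simp
      then have "(mat z - A) *v (mpoly r' A *v v) = - (mpoly r A *v v)"
        by (simp add: matrix_vector_mult_diff_rdistrib flip: matrix_vector_mul_assoc)
      then have "(mat z - A) *v (mpoly r' A *v v) = 0" using less.prems by simp
      then have "mpoly r' A *v v = 0" using det[of z] z det_eq_0_iff[of "mat z - A"] by auto
      then show ?thesis using less.hyps[OF \<open>degree r' < degree r\<close> _ r'0] by blast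
    qed
  qed
  obtain q where "q \<noteq> 0" "mpoly q A = 0" using mpoly_annihilator by blast
  then obtain k r where r: "q = monom 1 k * r" "poly r 0 \<noteq> 0" using X_power_factor by blast
  have "mpoly r A ** mpow k A = mpoly q A" unfolding mpow_def r(1) mpoly_mult[symmetric] by (simp only: mult.commute)
  then have "mpoly r A *v (mpow k A *v v) = 0" for v
    using \<open>mpoly q A = 0\<close> by (simp add: matrix_vector_mul_assoc)
  moreover have "r \<noteq> 0" using r(2) by auto
  ultimately have "mpow k A *v v = 0 *v v" for v using inj[of r] r(2) by simp
  then have "mpow k A = 0" by (simp add: matrix_eq)
  then show "nilpotent_matrix A" unfolding nilpotent_matrix_iff by blast
qed

theorem nilpotent_iff_charpoly:
  fixes A :: "complex^'m^'m::finite"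
  shows "nilpotent_matrix A \<longleftrightarrow> (\<forall>k<CARD('m). coeff (charpoly A) k = 0)"
  using nilpotent_imp_charpoly charpoly_imp_nilpotent by blast

section \<open>Jordan bases of nilpotent matrices\<close>

text \<open>Jordan chains \<open>b r j\<close> with \<open>r < R\<close> and \<open>j < l r\<close>.\<close>

definition comb :: "nat => (nat => nat) => (nat => nat => complex) => (nat => nat => complex^'m) => complex^'m" where
  "comb R l c b = (\<Sum>r<R. \<Sum>j<l r. c r j *s b r j)"

definition chains :: "complex^'m^'m::finite => nat => (nat => nat) => (nat => nat => complex^'m) => bool" where
  "chains y R l b \<longleftrightarrow> (\<forall>r<R. 0 < l r \<and> y *v b r 0 = 0 \<and> (\<forall>j. Suc j < l r --> y *v b r (Suc j) = b r j)) \<and>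
     (\<forall>c. comb R l c b = 0 --> (\<forall>r<R. \<forall>j<l r. c r j = 0))"

lemma comb_cong: "(\<And>r j. r < R ==> j < l r ==> c r j *s b r j = c' r j *s b' r j) ==> comb R l c b = comb R l c' b'"
  unfolding comb_def by (intro sum.cong) auto

lemma matrix_vector_sum: "A *v (\<Sum>i\<in>I. f i) = (\<Sum>i\<in>I. A *v (f i :: complex^'m::finite))"
  by (induction I rule: infinite_finite_induct) (auto simp: matrix_vector_right_distrib)

lemma sum_lessThan_add: "(\<Sum>r<(a + b :: nat). f r) = (\<Sum>r<a. f r) + (\<Sum>s<b. f (a + s) :: 'a::comm_monoid_add)"
  by (induction b) (simp_all add: add.assoc)

lemma family_independent:
  fixes f :: "'i => complex^'m::finite"
  assumes "finite I"
  shows "inj_on f I \<and> vec.independent (f ` I) \<longleftrightarrow> (\<forall>c. (\<Sum>i\<in>I. c i *s f i) = 0 --> (\<forall>i\<in>I. c i = 0))"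
proof
  assume *: "inj_on f I \<and> vec.independent (f ` I)"
  show "\<forall>c. (\<Sum>i\<in>I. c i *s f i) = 0 --> (\<forall>i\<in>I. c i = 0)"
  proof (intro allI impI ballI)
    fix c i assume c: "(\<Sum>i\<in>I. c i *s f i) = 0" and i: "i \<in> I"
    define u where "u v = c (inv_into I f v)" for v
    have "(\<Sum>v\<in>f ` I. u v *s v) = (\<Sum>i\<in>I. c i *s f i)"
      using * by (subst sum.reindex) (auto simp: u_def)
    then have "u (f i) = 0" using vec.independentD[of "f ` I" "f ` I" u "f i"] * c i assms by auto
    then show "c i = 0" using * i by (simp add: u_def)
  qed
next
  assume ind: "\<forall>c. (\<Sum>i\<in>I. c i *s f i) = 0 --> (\<forall>i\<in>I. c i = 0)"
  have inj: "inj_on f I"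
  proof (rule inj_onI, rule ccontr)
    fix i j assume ij: "i \<in> I" "j \<in> I" "f i = f j" "i \<noteq> j"
    define c where "c k = (if k = i then 1 else if k = j then -1 else (0::complex))" for k
    have "(\<Sum>k\<in>I. c k *s f k) = (\<Sum>k\<in>{i, j}. c k *s f k)"
      using ij assms by (intro sum.mono_neutral_right) (auto simp: c_def)
    also have "\<dots> = 0" using ij by (simp add: c_def)
    finally have "c i = 0" using ind ij by blast
    then show False by (simp add: c_def)
  qed
  moreover have "vec.independent (f ` I)"
  proof (rule vec.independent_if_scalars_zero)
    fix u v assume u: "(\<Sum>v\<in>f ` I. u v *s v) = 0" and v: "v \<in> f ` I"
    have "(\<Sum>i\<in>I. u (f i) *s f i) = 0" using u inj by (subst (asm) sum.reindex) auto
    then show "u v = 0" using ind[rule_format, of "\<lambda>i. u (f i)"] v by auto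
  qed (use assms in simp)
  ultimately show "inj_on f I \<and> vec.independent (f ` I)" by blast
qed

lemma independent_extend:
  fixes f :: "nat => complex^'m::finite"
  assumes ind: "\<And>c. (\<Sum>r<R. c r *s f r) = 0 ==> \<forall>r<R. c r = 0"
    and K: "vec.subspace K" "\<And>r. r < R ==> f r \<in> K"
  shows "\<exists>(m::nat) g. (\<forall>s<m. g s \<in> K) \<and> (\<forall>c d. (\<Sum>r<R. c r *s f r) + (\<Sum>s<m. d s *s g s) = 0 --> (\<forall>r<R. c r = 0) \<and> (\<forall>s<m. d s = 0)) \<and>
    (\<forall>v\<in>K. \<exists>c d. v = (\<Sum>r<R. c r *s f r) + (\<Sum>s<m. d s *s g s))"
proof -
  have f: "inj_on f {..<R}" "vec.independent (f ` {..<R})"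
    using family_independent[of "{..<R}" f] ind by auto
  have "f ` {..<R} \<subseteq> K" using K(2) by auto
  from vec.maximal_independent_subset_extend[OF this f(2)] obtain B where
    B: "f ` {..<R} \<subseteq> B" "B \<subseteq> K" "vec.independent B" "K \<subseteq> vec.span B" by blast
  have finB: "finite B" using B(3) vec.finiteI_independent by blast
  define C where "C = B - f ` {..<R}"
  obtain g where g: "bij_betw g {..<card C} C"
    using ex_bij_betw_nat_finite[of C] finB by (auto simp: C_def atLeast0LessThan)
  have gC: "g ` {..<card C} = C" and injg: "inj_on g {..<card C}" using g by (auto simp: bij_betw_def)
  have sumB: "(\<Sum>v\<in>B. u v *s v) = (\<Sum>r<R. u (f r) *s f r) + (\<Sum>s<card C. u (g s) *s g s)" for u
  proof -
    have "(\<Sum>v\<in>B. u v *s v) = (\<Sum>v\<in>f ` {..<R}. u v *s v) + (\<Sum>v\<in>C. u v *s v)"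
      unfolding C_def using B(1) finB by (simp add: sum.subset_diff add.commute)
    moreover have "(\<Sum>v\<in>f ` {..<R}. u v *s v) = (\<Sum>r<R. u (f r) *s f r)"
      by (simp add: sum.reindex[OF f(1)])
    moreover have "(\<Sum>v\<in>C. u v *s v) = (\<Sum>s<card C. u (g s) *s g s)"
      by (rule sum.reindex_bij_betw[OF g, symmetric])
    ultimately show ?thesis by simp
  qed
  show ?thesis
  proof (intro exI[of _ "card C"] exI[of _ g] conjI allI impI ballI)
    fix s assume "s < card C"
    then show "g s \<in> K" using gC B(2) unfolding C_def by blast
  next
    fix c d assume eq: "(\<Sum>r<R. c r *s f r) + (\<Sum>s<card C. d s *s g s) = 0"
    define u where "u v = (if v \<in> C then d (inv_into {..<card C} g v) else c (inv_into {..<R} f v))" for v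
    have uf: "u (f r) = c r" if "r < R" for r
      using that f(1) by (simp add: u_def C_def)
    have ug: "u (g s) = d s" if "s < card C" for s
      using that injg gC by (auto simp: u_def)
    have "(\<Sum>v\<in>B. u v *s v) = 0" unfolding sumB using eq uf ug by simp
    then have u0: "u v = 0" if "v \<in> B" for v
      using vec.independentD[OF B(3) finB _ _ that] by blast
    fix r
    show "c r = 0" if "r < R" using u0[of "f r"] uf[OF that] B(1) that by auto
    show "d r = 0" if "r < card C" using u0[of "g r"] ug[OF that] gC that unfolding C_def by auto
  next
    fix v assume "v \<in> K"
    then have "v \<in> vec.span B" using B(4) by blast
    then obtain u where "v = (\<Sum>v\<in>B. u v *s v)" using vec.span_finite[OF finB] by auto
    then show "\<exists>c d. v = (\<Sum>r<R. c r *s f r) + (\<Sum>s<card C. d s *s g s)"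
      unfolding sumB by (intro exI[of _ "\<lambda>r. u (f r)"] exI[of _ "\<lambda>s. u (g s)"]) simp
  qed
qed

lemma vec_linear_matrix: "Vector_Spaces.linear (*s) (*s) (\<lambda>v. (A :: complex^'m^'m::finite) *v v)"
  by (rule matrix_vector_mul_linear_gen)

lemma chains_mult: "chains y R l b ==> y *v comb R l c b = comb R l (\<lambda>r j. if Suc j < l r then c r (Suc j) else 0) b"
proof -
  assume ch: "chains y R l b"
  have "y *v (\<Sum>j<l r. c r j *s b r j) = (\<Sum>j<l r. (if Suc j < l r then c r (Suc j) else 0) *s b r j)" if r: "r < R" for r
  proof -
    obtain n where n: "l r = Suc n" using ch r unfolding chains_def by (metis gr0_conv_Suc)
    have "y *v (\<Sum>j<l r. c r j *s b r j) = (\<Sum>j<l r. c r j *s (y *v b r j))"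
      by (simp add: matrix_vector_sum vector_scalar_commute)
    also have "\<dots> = (\<Sum>j<n. c r (Suc j) *s (y *v b r (Suc j)))"
      using ch r unfolding n sum.lessThan_Suc_shift chains_def by simp
    also have "\<dots> = (\<Sum>j<n. c r (Suc j) *s b r j)"
      using ch r n unfolding chains_def by (intro sum.cong) auto
    also have "\<dots> = (\<Sum>j<l r. (if Suc j < l r then c r (Suc j) else 0) *s b r j)"
      unfolding n by simp
    finally show ?thesis .
  qed
  then show ?thesis unfolding comb_def by (simp add: matrix_vector_sum)
qed

text \<open>Induction on \<open>dim U\<close> through the proper subspace \<open>U' = y U\<close>:
  each chain of \<open>U'\<close> is lengthened by a preimage of its top vector, and its bottom
  vectors are completed to a basis of the kernel of \<open>y\<close> on \<open>U\<close> by chains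
  of length 1.\<close>

theorem jordan_chains_exist:
  fixes y :: "complex^'m^'m::finite"
  assumes nil: "mpow k y = 0" and U: "vec.subspace U" "\<And>u. u \<in> U ==> y *v u \<in> U"
  shows "\<exists>R l b. chains y R l b \<and> (\<forall>r<R. \<forall>j<l r. b r j \<in> U) \<and> (\<forall>u\<in>U. \<exists>c. u = comb R l c b)"
  using U
proof (induction "vec.dim U" arbitrary: U rule: less_induct)
  case less
  show ?case
  proof (cases "U = {0}")
    case True
    then show ?thesis
      by (intro exI[of _ 0] exI[of _ "\<lambda>_. 0"] exI[of _ "\<lambda>_ _. 0"]) (auto simp: chains_def comb_def)
  next
    case False
    define U' where "U' = (\<lambda>u. y *v u) ` U"
    have sub': "vec.subspace U'" unfolding U'_def by (rule vec.linear_subspace_image[OF vec_linear_matrix less.prems(1)])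
    have U'U: "U' \<subseteq> U" using less.prems(2) by (auto simp: U'_def)
    have "U' \<noteq> U"
    proof
      assume eq: "U' = U"
      have "(\<lambda>v. mpow j y *v v) ` U = U" for j
      proof (induction j)
        case (Suc j)
        have "(\<lambda>v. mpow (Suc j) y *v v) ` U = (\<lambda>v. y *v v) ` ((\<lambda>v. mpow j y *v v) ` U)"
          by (simp add: mpow_Suc image_image flip: matrix_vector_mul_assoc)
        then show ?case using Suc eq by (simp add: U'_def)
      qed simp
      from this[of k] show False using nil False less.prems(1) vec.subspace_0 by auto
    qed
    then have "U' \<subset> U" using U'U by blast
    then have "vec.dim U' < vec.dim U"
      by (intro vec.dim_psubset) (simp add: vec.span_eq_iff[THEN iffD2] sub' less.prems(1))
    moreover have "\<And>u. u \<in> U' ==> y *v u \<in> U'" using U'U by (auto simp: U'_def)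
    ultimately obtain R l b where ch: "chains y R l b" "\<And>r j. r < R ==> j < l r ==> b r j \<in> U'"
      and span: "\<And>u. u \<in> U' ==> \<exists>c. u = comb R l c b"
      using less.hyps[OF _ sub'] by blast
    have lpos: "0 < l r" if "r < R" for r using ch(1) that by (auto simp: chains_def)
    have "\<forall>r<R. \<exists>e. e \<in> U \<and> y *v e = b r (l r - 1)"
    proof (intro allI impI)
      fix r assume "r < R"
      then have "b r (l r - 1) \<in> U'" using ch(2) lpos by simp
      then show "\<exists>e. e \<in> U \<and> y *v e = b r (l r - 1)" unfolding U'_def by auto
    qed
    then obtain e where e: "\<And>r. r < R ==> e r \<in> U" "\<And>r. r < R ==> y *v e r = b r (l r - 1)" by metis
    define K where "K = {u \<in> U. y *v u = 0}"
    have subK: "vec.subspace K"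
      using less.prems(1) unfolding K_def vec.subspace_def
      by (auto simp: matrix_vector_right_distrib vector_scalar_commute)
    have ind0: "\<forall>r<R. c r = 0" if "(\<Sum>r<R. c r *s b r 0) = 0" for c
    proof -
      have "(\<Sum>j<l r. (if j = 0 then c r else 0) *s b r j) = c r *s b r 0" if "r < R" for r
      proof -
        have "(\<Sum>j<l r. (if j = 0 then c r else 0) *s b r j) = (\<Sum>j<l r. if j = 0 then c r *s b r j else 0)"
          by (intro sum.cong) auto
        then show ?thesis using lpos[OF that] by simp
      qed
      then have "comb R l (\<lambda>r j. if j = 0 then c r else 0) b = 0" using that by (simp add: comb_def)
      then have "\<forall>r<R. \<forall>j<l r. (if j = 0 then c r else 0) = 0" using ch(1) unfolding chains_def by blast
      then show ?thesis using lpos by force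
    qed
    have bK: "b r 0 \<in> K" if "r < R" for r
      using ch that lpos U'U unfolding K_def chains_def by auto
    have "\<exists>(m::nat) g. (\<forall>s<m. g s \<in> K) \<and> (\<forall>c d. (\<Sum>r<R. c r *s b r 0) + (\<Sum>s<m. d s *s g s) = 0 -->
        (\<forall>r<R. c r = 0) \<and> (\<forall>s<m. d s = 0)) \<and>
      (\<forall>v\<in>K. \<exists>c d. v = (\<Sum>r<R. c r *s b r 0) + (\<Sum>s<m. d s *s g s))"
      by (rule independent_extend[OF ind0 subK bK])
    then obtain m :: nat and g where *: "(\<forall>s<m. g s \<in> K) \<and> (\<forall>c d. (\<Sum>r<R. c r *s b r 0) + (\<Sum>s<m. d s *s g s) = 0 -->
        (\<forall>r<R. c r = 0) \<and> (\<forall>s<m. d s = 0)) \<and>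
      (\<forall>v\<in>K. \<exists>c d. v = (\<Sum>r<R. c r *s b r 0) + (\<Sum>s<m. d s *s g s))" by (elim exE)
    have g: "g s \<in> K" if "s < m" for s using * that by simp
    have gind: "(\<forall>r<R. c r = 0) \<and> (\<forall>s<m. d s = 0)"
      if "(\<Sum>r<R. c r *s b r 0) + (\<Sum>s<m. d s *s g s) = 0" for c d
      by (rule *[THEN conjunct2, THEN conjunct1, rule_format, OF that])
    have gspan: "\<exists>c d. v = (\<Sum>r<R. c r *s b r 0) + (\<Sum>s<m. d s *s g s)" if "v \<in> K" for v
      using * that by simp
    define l' where "l' r = (if r < R then Suc (l r) else 1)" for r
    define b' where "b' r j = (if r < R then (if j < l r then b r j else e r) else g (r - R))" for r j
    have b'0: "b' r 0 = b r 0" if "r < R" for r using that lpos by (simp add: b'_def)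
    have yb': "y *v b' r (Suc j) = b r j" if "r < R" "j < l r" for r j
    proof (cases "Suc j < l r")
      case True
      then show ?thesis using ch(1) that by (simp add: b'_def chains_def)
    next
      case False
      then have "j = l r - 1" using that by simp
      then show ?thesis using e(2) that False by (simp add: b'_def)
    qed
    \<comment> \<open>A combination splits into the old bottom vectors, the lifted rest of the old
      chains, and the new vectors. \<open>y\<close> kills the first and the last summand and maps
      the middle one to the chains of \<open>U'\<close>.\<close>
    have comb': "comb (R + m) l' c b' = (\<Sum>r<R. c r 0 *s b r 0) + comb R l (\<lambda>r j. c r (Suc j)) (\<lambda>r j. b' r (Suc j)) +
      (\<Sum>s<m. c (R + s) 0 *s g s)" for c
    proof -
      have "(\<Sum>j<l' r. c r j *s b' r j) = c r 0 *s b r 0 + (\<Sum>j<l r. c r (Suc j) *s b' r (Suc j))" if "r < R" for r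
        using that b'0 by (simp add: l'_def sum.lessThan_Suc_shift del: sum.lessThan_Suc)
      then show ?thesis
        unfolding comb_def sum_lessThan_add by (simp add: sum.distrib l'_def b'_def)
    qed
    have ycomb: "y *v comb R l a (\<lambda>r j. b' r (Suc j)) = comb R l a b" for a
      unfolding comb_def by (simp add: matrix_vector_sum vector_scalar_commute yb')
    have y0: "y *v (\<Sum>r<R. a r *s b r 0) = 0" for a
      using bK by (simp add: matrix_vector_sum vector_scalar_commute K_def)
    have yg: "y *v (\<Sum>s<m. a s *s g s) = 0" for a
      using g by (simp add: matrix_vector_sum vector_scalar_commute K_def)
    have ch': "chains y (R + m) l' b'" unfolding chains_def
    proof (intro conjI allI impI)
      fix r assume r: "r < R + m"
      show "0 < l' r" by (simp add: l'_def)
      show "y *v b' r 0 = 0"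
      proof (cases "r < R")
        case True
        then show ?thesis using b'0 bK by (simp add: K_def)
      next
        case False
        then show ?thesis using g[of "r - R"] r by (simp add: b'_def K_def)
      qed
      fix j assume j: "Suc j < l' r"
      then show "y *v b' r (Suc j) = b' r j"
        by (cases "r < R") (auto simp: l'_def yb' b'_def[of r j])
    next
      fix c assume c: "comb (R + m) l' c b' = 0"
      have "comb R l (\<lambda>r j. c r (Suc j)) b = y *v comb (R + m) l' c b'"
        unfolding comb' matrix_vector_right_distrib ycomb y0 yg by simp
      then have c1: "comb R l (\<lambda>r j. c r (Suc j)) b = 0" using c by simp
      have cS: "c r (Suc j) = 0" if "r < R" "j < l r" for r j
        using ch(1)[unfolded chains_def, THEN conjunct2, THEN spec[of _ "\<lambda>r j. c r (Suc j)"]] c1 that by simp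
      then have "comb R l (\<lambda>r j. c r (Suc j)) (\<lambda>r j. b' r (Suc j)) = 0" unfolding comb_def by simp
      then have "(\<Sum>r<R. c r 0 *s b r 0) + (\<Sum>s<m. c (R + s) 0 *s g s) = 0" using c unfolding comb' by simp
      from gind[OF this] have c0: "\<forall>r<R. c r 0 = 0" "\<forall>s<m. c (R + s) 0 = 0" by blast+
      fix r j assume rj: "r < R + m" "j < l' r"
      show "c r j = 0"
      proof (cases "r < R")
        case True
        then show ?thesis using rj cS c0(1) by (cases j) (auto simp: l'_def)
      next
        case False
        then show ?thesis using rj c0(2)[rule_format, of "r - R"] by (simp add: l'_def)
      qed
    qed
    have b'U: "b' r j \<in> U" if "r < R + m" "j < l' r" for r j
      using that ch(2)[of r j] U'U e(1)[of r] g[of "r - R"] by (auto simp: b'_def K_def l'_def)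
    have "\<exists>c. u = comb (R + m) l' c b'" if u: "u \<in> U" for u
    proof -
      have "y *v u \<in> U'" using u by (auto simp: U'_def)
      then obtain a where a: "y *v u = comb R l a b" using span by blast
      define w where "w = comb R l a (\<lambda>r j. b' r (Suc j))"
      have "w \<in> U" unfolding w_def comb_def
        using less.prems(1) b'U by (intro vec.subspace_sum vec.subspace_scale) (auto simp: l'_def)
      then have "u - w \<in> K" using u a less.prems(1) ycomb[of a]
        by (simp add: K_def vec.subspace_diff matrix_vector_mult_diff_distrib w_def)
      then obtain c d where cd: "u - w = (\<Sum>r<R. c r *s b r 0) + (\<Sum>s<m. d s *s g s)" using gspan by blast
      define f where "f r j = (if r < R then (case j of 0 => c r | Suc i => a r i) else d (r - R))" for r j
      have "comb R l (\<lambda>r j. f r (Suc j)) (\<lambda>r j. b' r (Suc j)) = w"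
        unfolding w_def by (intro comb_cong) (simp add: f_def)
      then have "comb (R + m) l' f b' = u" unfolding comb' using cd by (simp add: f_def algebra_simps)
      then show ?thesis by (intro exI[of _ f]) (rule sym)
    qed
    then show ?thesis
      by (intro exI[of _ "R + m"] exI[of _ l'] exI[of _ b'] conjI ch' allI impI ballI b'U)
  qed
qed

definition jordan_basis :: "complex^'m^'m::finite => nat => (nat => nat) => (nat => nat => complex^'m) => bool" where
  "jordan_basis y R l b \<longleftrightarrow> chains y R l b \<and> (\<forall>u. \<exists>c. u = comb R l c b)"

lemma comb_Sigma: "comb R l c b = (\<Sum>i\<in>(SIGMA r:{..<R}. {..<l r}). (case i of (r, j) => c r j) *s (case i of (r, j) => b r j))"
  unfolding comb_def by (subst sum.Sigma) (auto intro!: sum.cong)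

lemma comb_independent:
  "(\<forall>c. comb R l c b = 0 --> (\<forall>r<R. \<forall>j<l r. c r j = 0)) \<longleftrightarrow>
    inj_on (\<lambda>(r, j). b r j) (SIGMA r:{..<R}. {..<l r}) \<and>
    vec.independent ((\<lambda>(r, j). b r j) ` (SIGMA r:{..<R}. {..<l r} :: (nat \<times> nat) set) :: (complex^'m::finite) set)"
  (is "?L \<longleftrightarrow> ?R")
proof -
  let ?I = "SIGMA r:{..<R}. {..<l r}"
  have fin: "finite ?I" by auto
  have "?R \<longleftrightarrow> (\<forall>c. (\<Sum>i\<in>?I. c i *s (case i of (r, j) => b r j)) = 0 --> (\<forall>i\<in>?I. c i = 0))"
    by (rule family_independent[OF fin])
  also have "\<dots> \<longleftrightarrow> ?L"
  proof
    assume h: "\<forall>c. (\<Sum>i\<in>?I. c i *s (case i of (r, j) => b r j)) = 0 --> (\<forall>i\<in>?I. c i = 0)"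
    show ?L unfolding comb_Sigma
    proof (intro allI impI)
      fix c r j assume "(\<Sum>i\<in>?I. (case i of (r, j) => c r j) *s (case i of (r, j) => b r j)) = 0" "r < R" "j < l r"
      then show "c r j = 0" using h[THEN spec[of _ "\<lambda>i. case i of (r, j) => c r j"]] by auto
    qed
  next
    assume h: ?L
    show "\<forall>c. (\<Sum>i\<in>?I. c i *s (case i of (r, j) => b r j)) = 0 --> (\<forall>i\<in>?I. c i = 0)"
    proof (intro allI impI ballI)
      fix c i assume c: "(\<Sum>i\<in>?I. c i *s (case i of (r, j) => b r j)) = 0" and i: "i \<in> ?I"
      have "comb R l (\<lambda>r j. c (r, j)) b = 0" unfolding comb_Sigma using c by (simp add: split_def)
      then show "c i = 0" using h[THEN spec[of _ "\<lambda>r j. c (r, j)"]] i by auto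
    qed
  qed
  finally show ?thesis by blast
qed

lemma comb_span:
  "(\<forall>u. \<exists>c. u = comb R l c b) \<longleftrightarrow> vec.span ((\<lambda>(r, j). b r j) ` (SIGMA r:{..<R}. {..<l r} :: (nat \<times> nat) set)) = (UNIV :: (complex^'m::finite) set)"
  if "inj_on (\<lambda>(r, j). b r j) (SIGMA r:{..<R}. {..<l r})"
proof
  let ?I = "SIGMA r:{..<R}. {..<l r}"
  assume "\<forall>u. \<exists>c. u = comb R l c b"
  have "comb R l c b \<in> vec.span ((\<lambda>(r, j). b r j) ` ?I)" for c
    unfolding comb_Sigma by (intro vec.span_sum vec.span_scale vec.span_base) auto
  then show "vec.span ((\<lambda>(r, j). b r j) ` ?I) = UNIV" using \<open>\<forall>u. \<exists>c. u = comb R l c b\<close> by (metis UNIV_eq_I)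
next
  let ?I = "SIGMA r:{..<R}. {..<l r}"
  assume span: "vec.span ((\<lambda>(r, j). b r j) ` ?I) = UNIV"
  show "\<forall>u. \<exists>c. u = comb R l c b"
  proof
    fix u :: "complex^'m"
    have fin: "finite ((\<lambda>(r, j). b r j) ` ?I)" by auto
    have "u \<in> vec.span ((\<lambda>(r, j). b r j) ` ?I)" using span by simp
    then obtain f where "u = (\<Sum>v\<in>(\<lambda>(r, j). b r j) ` ?I. f v *s v)"
      unfolding vec.span_finite[OF fin] by blast
    also have "\<dots> = comb R l (\<lambda>r j. f (b r j)) b"
      unfolding comb_Sigma by (subst sum.reindex[OF that]) (auto intro!: sum.cong)
    finally show "\<exists>c. u = comb R l c b" by blast
  qed
qed

lemma jordan_type_iff:
  "jordan_type y p \<longleftrightarrow> (\<exists>R l b. jordan_basis y R l b \<and> p = image_mset l (mset_set {..<R}))"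
proof
  assume jt: "jordan_type y p"
  then obtain l b where lb: "mset l = p" "0 \<notin># p"
    "inj_on (\<lambda>(r, j). b r j) (SIGMA r:{..<length l}. {..<l ! r})"
    "vec.independent ((\<lambda>(r, j). b r j) ` (SIGMA r:{..<length l}. {..<l ! r}))"
    "vec.span ((\<lambda>(r, j). b r j) ` (SIGMA r:{..<length l}. {..<l ! r})) = UNIV"
    "\<forall>r<length l. y *v b r 0 = 0 \<and> (\<forall>j. Suc j < l ! r --> y *v b r (Suc j) = b r j)"
    unfolding jordan_type_def Let_def by (elim conjE exE)
  have pos: "0 < l ! r" if "r < length l" for r
    using lb(1,2) nth_mem[OF that] by (metis gr0I set_mset_mset)
  have ind: "\<forall>c. comb (length l) ((!) l) c b = 0 --> (\<forall>r<length l. \<forall>j<l ! r. c r j = 0)"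
    unfolding comb_independent using lb(3,4) by simp
  have span: "\<forall>u. \<exists>c. u = comb (length l) ((!) l) c b"
    unfolding comb_span[OF lb(3)] by (rule lb(5))
  have "jordan_basis y (length l) ((!) l) b"
    unfolding jordan_basis_def chains_def by (intro conjI ind span) (use lb(6) pos in simp)
  moreover have "p = image_mset ((!) l) (mset_set {..<length l})"
    unfolding lb(1)[symmetric] by (metis atLeast0LessThan map_nth mset_map mset_upt)
  ultimately show "\<exists>R l b. jordan_basis y R l b \<and> p = image_mset l (mset_set {..<R})" by blast
next
  assume "\<exists>R l b. jordan_basis y R l b \<and> p = image_mset l (mset_set {..<R})"
  then obtain R l b where jb: "jordan_basis y R l b" and p: "p = image_mset l (mset_set {..<R})" by blast
  define L where "L = map l [0..<R]"
  have L: "length L = R" "\<And>r. r < R ==> L ! r = l r" by (auto simp: L_def)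
  have I: "(SIGMA r:{..<length L}. {..<L ! r}) = (SIGMA r:{..<R}. {..<l r})"
    using L by (intro Sigma_cong) auto
  have ind: "\<forall>c. comb R l c b = 0 --> (\<forall>r<R. \<forall>j<l r. c r j = 0)"
    using jb unfolding jordan_basis_def chains_def by blast
  note inj = ind[unfolded comb_independent]
  have "mset L = p" unfolding L_def p by (simp add: atLeast0LessThan)
  moreover have "0 \<notin># p" using jb unfolding p jordan_basis_def chains_def by auto
  moreover have "vec.span ((\<lambda>(r, j). b r j) ` (SIGMA r:{..<R}. {..<l r})) = UNIV"
    unfolding comb_span[OF inj[THEN conjunct1], symmetric] using jb unfolding jordan_basis_def by simp
  moreover have "\<forall>r<length L. y *v b r 0 = 0 \<and> (\<forall>j. Suc j < L ! r --> y *v b r (Suc j) = b r j)"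
    using jb L unfolding jordan_basis_def chains_def by auto
  ultimately show "jordan_type y p"
    unfolding jordan_type_def Let_def
    by (intro conjI exI[of _ L] exI[of _ b]) (use inj in "simp_all add: I")
qed

lemma jordan_type_exists:
  assumes "nilpotent_matrix y"
  shows "\<exists>p. jordan_type y p"
proof -
  obtain k where "mpow k y = 0" using assms unfolding nilpotent_matrix_iff ..
  from jordan_chains_exist[OF this vec.subspace_UNIV] have "\<exists>R l b. jordan_basis y R l b"
    unfolding jordan_basis_def by blast
  then show ?thesis unfolding jordan_type_iff by blast
qed

lemma jordan_basis_card:
  fixes y :: "complex^'m^'m::finite"
  assumes "jordan_basis y R l b"
  shows "(\<Sum>r<R. l r) = CARD('m)"
proof -
  let ?I = "SIGMA r:{..<R}. {..<l r}"
  have ind: "\<forall>c. comb R l c b = 0 --> (\<forall>r<R. \<forall>j<l r. c r j = 0)"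
    using assms unfolding jordan_basis_def chains_def by blast
  note inj = ind[unfolded comb_independent]
  have span: "vec.span ((\<lambda>(r, j). b r j) ` ?I) = UNIV"
    unfolding comb_span[OF inj[THEN conjunct1], symmetric] using assms unfolding jordan_basis_def by simp
  have "(\<Sum>r<R. l r) = card ?I" by simp
  also have "\<dots> = card ((\<lambda>(r, j). b r j) ` ?I)" using inj card_image by metis
  also have "\<dots> = vec.dim (UNIV :: (complex^'m) set)"
    by (rule vec.dim_eq_card[symmetric]) (use span inj in simp_all)
  also have "\<dots> = CARD('m)" by (simp add: vec.dim_UNIV card_cart_basis)
  finally show ?thesis .
qed

lemma jordan_type_sum:
  fixes y :: "complex^'m^'m::finite"
  assumes "jordan_type y p"
  shows "sum_mset p = CARD('m)" "0 \<notin># p"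
proof -
  obtain R l b where jb: "jordan_basis y R l b" and p: "p = image_mset l (mset_set {..<R})"
    using assms unfolding jordan_type_iff by blast
  show "sum_mset p = CARD('m)" using jordan_basis_card[OF jb] unfolding p by (simp add: sum_unfold_sum_mset)
  show "0 \<notin># p" using assms unfolding jordan_type_def by blast
qed

lemma jordan_type_nilpotent:
  assumes "jordan_type y p"
  shows "nilpotent_matrix y"
proof -
  obtain R l b where jb: "jordan_basis y R l b"
    using assms unfolding jordan_type_iff by blast
  then have ch: "chains y R l b" by (simp add: jordan_basis_def)
  have pow: "\<exists>c'. mpow k y *v comb R l c b = comb R l c' b \<and> (\<forall>r<R. \<forall>j<l r. l r \<le> j + k --> c' r j = 0)" for k c
  proof (induction k)
    case (Suc k)
    then obtain c' where c': "mpow k y *v comb R l c b = comb R l c' b" "\<forall>r<R. \<forall>j<l r. l r \<le> j + k --> c' r j = 0" by blast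
    then have "mpow (Suc k) y *v comb R l c b = comb R l (\<lambda>r j. if Suc j < l r then c' r (Suc j) else 0) b"
      using chains_mult[OF ch, of c'] by (simp add: mpow_Suc flip: matrix_vector_mul_assoc)
    moreover have "\<forall>r<R. \<forall>j<l r. l r \<le> j + Suc k --> (if Suc j < l r then c' r (Suc j) else 0) = 0"
      using c'(2) by auto
    ultimately show ?case by blast
  qed (intro exI[of _ c], auto)
  define K where "K = (\<Sum>r<R. l r)"
  have "mpow K y *v v = 0 *v v" for v
  proof -
    obtain c where "v = comb R l c b" using jb unfolding jordan_basis_def by blast
    moreover obtain c' where "mpow K y *v comb R l c b = comb R l c' b" "\<forall>r<R. \<forall>j<l r. l r \<le> j + K --> c' r j = 0"
      using pow by blast
    moreover have "l r \<le> j + K" if "r < R" for r j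
      unfolding K_def using that by (intro trans_le_add2 member_le_sum) auto
    ultimately show ?thesis by (simp add: comb_def)
  qed
  then have "mpow K y = 0" by (simp add: matrix_eq)
  then show ?thesis unfolding nilpotent_matrix_iff by blast
qed

lemma jordan_basis_linear:
  fixes b :: "nat => nat => complex^'m::finite"
  assumes "jordan_basis y R l b"
  shows "\<exists>A. \<forall>r<R. \<forall>j<l r. A *v b r j = h r j"
proof -
  let ?I = "SIGMA r:{..<R}. {..<l r}" and ?f = "\<lambda>(r, j). b r j"
  have ind: "\<forall>c. comb R l c b = 0 --> (\<forall>r<R. \<forall>j<l r. c r j = 0)"
    using assms unfolding jordan_basis_def chains_def by blast
  note inj = ind[unfolded comb_independent]
  define g where "g v = (\<lambda>(r, j). h r j) (inv_into ?I ?f v)" for v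
  obtain F where F: "Vector_Spaces.linear (*s) (*s) F" "\<And>v. v \<in> ?f ` ?I ==> F v = g v"
    using vec.linear_independent_extend[of "?f ` ?I" g] inj by blast
  have "matrix F *v b r j = h r j" if "r < R" "j < l r" for r j
  proof -
    have i: "(r, j) \<in> ?I" using that by simp
    then have "F (?f (r, j)) = g (?f (r, j))" using F(2) by blast
    also have "\<dots> = h r j" unfolding g_def using inv_into_f_f[OF inj[THEN conjunct1] i] by simp
    finally show ?thesis using matrix_works[OF F(1)] by simp
  qed
  then show ?thesis by blast
qed

lemma jordan_basis_eqI:
  assumes "jordan_basis y R l b" "\<And>r j. r < R ==> j < l r ==> A *v b r j = B *v b r j"
  shows "A = B"
proof -
  have "A *v v = B *v v" for v
  proof -
    obtain c where "v = comb R l c b" using assms(1) unfolding jordan_basis_def by blast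
    then show ?thesis using assms(2) by (simp add: comb_def matrix_vector_sum vector_scalar_commute)
  qed
  then show ?thesis by (simp add: matrix_eq)
qed

lemma jordan_basis_mpow:
  assumes "jordan_basis y R l b" "r < R" "j < l r"
  shows "mpow k y *v b r j = (if k \<le> j then b r (j - k) else 0)"
proof (induction k)
  case (Suc k)
  have step: "y *v b r 0 = 0" "\<And>i. Suc i < l r ==> y *v b r (Suc i) = b r i"
    using assms unfolding jordan_basis_def chains_def by blast+
  have "mpow (Suc k) y *v b r j = y *v (mpow k y *v b r j)"
    by (simp add: mpow_Suc flip: matrix_vector_mul_assoc)
  also have "\<dots> = (if Suc k \<le> j then b r (j - Suc k) else 0)"
  proof (cases "Suc k \<le> j")
    case True
    then have "j - k = Suc (j - Suc k)" "j - k < l r" using assms by auto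
    then show ?thesis using Suc True step(2)[of "j - Suc k"] by simp
  next
    case False
    then show ?thesis using Suc step(1) by (cases "j = k") auto
  qed
  finally show ?case .
qed simp

lemma mpow_1: "mpow 1 A = A"
  using mpow_Suc[of 0 A] by simp

text \<open>Equal multisets of lengths give a permutation of the chains that preserves length;
  \<open>g\<close> sends one Jordan basis to the other along it.\<close>

theorem jordan_type_conjugate:
  fixes y y' :: "complex^'m^'m::finite"
  assumes "jordan_type y p" "jordan_type y' p"
  shows "\<exists>g. g ** y = y' ** g \<and> (\<forall>v. g *v v = 0 --> v = 0)"
proof -
  obtain R l b R' l' b' where jb: "jordan_basis y R l b" "jordan_basis y' R' l' b'"
    and p: "image_mset l (mset_set {..<R}) = image_mset l' (mset_set {..<R'})"
    using assms unfolding jordan_type_iff by metis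
  have "size (image_mset l (mset_set {..<R})) = size (image_mset l' (mset_set {..<R'}))" unfolding p ..
  then have R: "R' = R" by simp
  have "mset (map l [0..<R]) = mset (map l' [0..<R])" using p R by (simp add: atLeast0LessThan)
  then obtain t where t: "t permutes {..<length (map l' [0..<R])}" "permute_list t (map l' [0..<R]) = map l [0..<R]"
    by (rule mset_eq_permutation)
  have perm: "t permutes {..<R}" using t(1) by simp
  have \<pi>R: "t r < R" if "r < R" for r using permutes_in_image[OF perm, of r] that by simp
  have l\<pi>: "l' (t r) = l r" if "r < R" for r
    using arg_cong[OF t(2), of "\<lambda>xs. xs ! r"] that \<pi>R[OF that] by (simp add: permute_list_nth[OF t(1)])
  obtain g where g: "\<And>r j. r < R ==> j < l r ==> g *v b r j = b' (t r) j"
    using jordan_basis_linear[OF jb(1), of "\<lambda>r j. b' (t r) j"] by blast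
  have "g ** y = y' ** g"
  proof (rule jordan_basis_eqI[OF jb(1)])
    fix r j assume rj: "r < R" "j < l r"
    have "y *v b r j = (if 1 \<le> j then b r (j - 1) else 0)" "y' *v b' (t r) j = (if 1 \<le> j then b' (t r) (j - 1) else 0)"
      using jordan_basis_mpow[OF jb(1) rj, of 1] jordan_basis_mpow[OF jb(2), of "t r" j 1] \<pi>R[OF rj(1)] l\<pi>[OF rj(1)] rj R
      unfolding mpow_1 by simp_all
    then show "(g ** y) *v b r j = (y' ** g) *v b r j"
      using g rj by (simp flip: matrix_vector_mul_assoc)
  qed
  moreover have "v = 0" if "g *v v = 0" for v
  proof -
    obtain c where c: "v = comb R l c b" using jb(1) unfolding jordan_basis_def by blast
    have "0 = comb R l c (\<lambda>r j. b' (t r) j)"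
      using that g unfolding c comb_def by (simp add: matrix_vector_sum vector_scalar_commute)
    also have "\<dots> = (\<Sum>r<R. (\<lambda>r. \<Sum>j<l' r. c (inv_into UNIV t r) j *s b' r j) (t r))"
      unfolding comb_def using l\<pi> permutes_inverses(2)[OF perm] by (intro sum.cong) auto
    also have "\<dots> = comb R l' (\<lambda>r. c (inv_into UNIV t r)) b'"
      unfolding comb_def by (rule sum.reindex_bij_betw[OF permutes_imp_bij[OF perm]])
    finally have "comb R' l' (\<lambda>r. c (inv_into UNIV t r)) b' = 0" using R by simp
    then have z: "\<forall>r<R. \<forall>j<l' r. c (inv_into UNIV t r) j = 0"
      using jb(2) R unfolding jordan_basis_def chains_def by blast
    have "c r j = 0" if "r < R" "j < l r" for r j
      using z[rule_format, of "t r" j] \<pi>R[OF that(1)] l\<pi>[OF that(1)] that permutes_inverses(2)[OF perm] by simp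
    then show ?thesis unfolding c comb_def by simp
  qed
  ultimately show ?thesis by blast
qed

text \<open>The rank of the \<open>k\<close>-th power of a nilpotent matrix of type
  \<open>p\<close>: a block of size \<open>x\<close> contributes \<open>x - k\<close>, in truncated
  subtraction.\<close>

definition rank_at :: "nat multiset => nat => nat" where
  "rank_at p k = (\<Sum>x\<in>#p. x - k)"

text \<open>First differences of \<open>rank_at\<close> count the parts greater than
  \<open>k\<close>, second differences the parts equal to \<open>Suc k\<close>.\<close>

lemma rank_at_inj:
  assumes "0 \<notin># p" "0 \<notin># q" "\<And>k. rank_at p k = rank_at q k"
  shows "p = q"
proof -
  have step: "rank_at p k = rank_at p (Suc k) + size (filter_mset (\<lambda>x. k < x) p)" for p k
    unfolding rank_at_def by (induction p) auto
  have gt: "size (filter_mset (\<lambda>x. k < x) p) = size (filter_mset (\<lambda>x. k < x) q)" for k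
    using step[of p k] step[of q k] assms(3) by simp
  have cnt: "size (filter_mset (\<lambda>x. k < x) p) = size (filter_mset (\<lambda>x. Suc k < x) p) + count p (Suc k)" for p k
    by (induction p) auto
  have "count p k = count q k" for k
  proof (cases k)
    case 0
    then show ?thesis using assms(1,2) by (simp add: count_eq_zero_iff[THEN iffD2])
  next
    case (Suc i)
    then show ?thesis using cnt[of i p] cnt[of i q] gt[of i] gt[of "Suc i"] by simp
  qed
  then show ?thesis by (rule multiset_eqI)
qed

text \<open>The condition \<open>rank (y ^ k) < rank_at p k\<close> is closed: it is detected by \<open>det (y ^ k + D)\<close>, where
  \<open>D\<close> maps the kernel of a power of type \<open>p\<close> onto a complement of its image.\<close>

lemma rank_separation:
  fixes y :: "complex^'m^'m::finite"
  assumes "jordan_type y p"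
  shows "\<exists>D. det (mpow k y + D) \<noteq> 0 \<and>
    (\<forall>y' q. jordan_type y' q --> rank_at q k < rank_at p k --> det (mpow k y' + D) = 0)"
proof -
  obtain R l b where jb: "jordan_basis y R l b" and p: "p = image_mset l (mset_set {..<R})"
    using assms unfolding jordan_type_iff by blast
  \<comment> \<open>The vectors \<open>b r j\<close> with \<open>j < k\<close> are those killed by
    \<open>y ^ k\<close>. Its image is spanned by the \<open>b r i\<close> with
    \<open>i + k < l r\<close>, and \<open>D\<close> sends the killed vectors, in reversed order, to
    exactly the basis vectors outside that image.\<close>
  obtain D where D: "\<And>r j. r < R ==> j < l r ==> D *v b r j = (if j < k then b r (l r - 1 - j) else 0)"
    using jordan_basis_linear[OF jb, of "\<lambda>r j. if j < k then b r (l r - 1 - j) else 0"] by blast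
  have rk: "rank_at p k = (\<Sum>r<R. l r - k)" unfolding rank_at_def p by (simp add: sum_unfold_sum_mset image_mset.compositionality o_def)
  have surj: "\<exists>w. (mpow k y + D) *v w = v" for v
  proof -
    obtain c where c: "v = comb R l c b" using jb unfolding jordan_basis_def by blast
    define s where "s r i = (if i + k < l r then i + k else l r - 1 - i)" for r i
    have "(mpow k y + D) *v b r (s r i) = b r i" if "r < R" "i < l r" for r i
    proof (cases "i + k < l r")
      case True
      then show ?thesis using jordan_basis_mpow[OF jb that(1), of "i + k" k] D[OF that(1), of "i + k"]
        by (simp add: s_def matrix_vector_mult_add_rdistrib)
    next
      case False
      then have "l r - 1 - i < k" "l r - 1 - i < l r" "l r - 1 - (l r - 1 - i) = i" using that by auto
      then show ?thesis using jordan_basis_mpow[OF jb that(1), of "l r - 1 - i" k] D[OF that(1), of "l r - 1 - i"] False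
        by (simp add: s_def matrix_vector_mult_add_rdistrib)
    qed
    then have "(mpow k y + D) *v comb R l c (\<lambda>r i. b r (s r i)) = v"
      unfolding c comb_def by (simp add: matrix_vector_sum vector_scalar_commute)
    then show ?thesis by blast
  qed
  then have "invertible (mpow k y + D)"
    unfolding invertible_right_inverse matrix_right_invertible_surjective surj_def by metis
  then have 1: "det (mpow k y + D) \<noteq> 0" using invertible_det_nz by blast
  have 2: "det (mpow k y' + D) = 0" if jt: "jordan_type y' q" and less: "rank_at q k < rank_at p k" for y' q
  proof (rule ccontr)
    assume "det (mpow k y' + D) \<noteq> 0"
    then have "invertible (mpow k y' + D)" using invertible_det_nz by blast
    then have onto: "\<exists>w. (mpow k y' + D) *v w = v" for v
      unfolding invertible_right_inverse matrix_right_invertible_surjective surj_def by metis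
    obtain R' l' b' where jb': "jordan_basis y' R' l' b'" and q: "q = image_mset l' (mset_set {..<R'})"
      using jt unfolding jordan_type_iff by blast
    have rk': "rank_at q k = (\<Sum>r<R'. l' r - k)" unfolding rank_at_def q by (simp add: sum_unfold_sum_mset image_mset.compositionality o_def)
    \<comment> \<open>\<open>S1\<close> spans the image of the power of \<open>y'\<close> and
      \<open>S2\<close> that of \<open>D\<close>. Together they have fewer than
      \<open>CARD('m)\<close> vectors, so the sum of the two maps is not onto.\<close>
    define S1 where "S1 = (\<lambda>(r, j). b' r j) ` (SIGMA r:{..<R'}. {..<l' r - k})"
    define S2 where "S2 = (\<lambda>(r, j). b r (l r - 1 - j)) ` (SIGMA r:{..<R}. {..<min k (l r)})"
    have "card S1 \<le> card (SIGMA r:{..<R'}. {..<l' r - k})" unfolding S1_def by (intro card_image_le) auto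
    then have c1: "card S1 \<le> rank_at q k" unfolding rk' by simp
    have "card S2 \<le> card (SIGMA r:{..<R}. {..<min k (l r)})" unfolding S2_def by (intro card_image_le) auto
    then have c2: "card S2 \<le> (\<Sum>r<R. min k (l r))" by simp
    have "(mpow k y' + D) *v w \<in> vec.span (S1 \<union> S2)" for w
    proof -
      obtain c' where c': "w = comb R' l' c' b'" using jb' unfolding jordan_basis_def by blast
      obtain c where c: "w = comb R l c b" using jb unfolding jordan_basis_def by blast
      have "mpow k y' *v w \<in> vec.span (S1 \<union> S2)"
        unfolding c' comb_def matrix_vector_sum vector_scalar_commute
      proof (intro vec.span_sum vec.span_scale)
        fix r j assume rj: "r \<in> {..<R'}" "j \<in> {..<l' r}"
        then have "mpow k y' *v b' r j = (if k \<le> j then b' r (j - k) else 0)"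
          using jordan_basis_mpow[OF jb'] by simp
        moreover have "b' r (j - k) \<in> S1" if "k \<le> j"
          unfolding S1_def using rj that by (intro image_eqI[of _ _ "(r, j - k)"]) auto
        ultimately show "mpow k y' *v b' r j \<in> vec.span (S1 \<union> S2)"
          by (auto intro: vec.span_base vec.span_zero)
      qed
      moreover have "D *v w \<in> vec.span (S1 \<union> S2)"
        unfolding c comb_def matrix_vector_sum vector_scalar_commute
      proof (intro vec.span_sum vec.span_scale)
        fix r j assume rj: "r \<in> {..<R}" "j \<in> {..<l r}"
        have "b r (l r - 1 - j) \<in> S2" if "j < k"
          unfolding S2_def using rj that by (intro image_eqI[of _ _ "(r, j)"]) auto
        then show "D *v b r j \<in> vec.span (S1 \<union> S2)" using D rj
          by (auto intro: vec.span_base vec.span_zero)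
      qed
      ultimately show ?thesis by (simp add: matrix_vector_mult_add_rdistrib vec.span_add)
    qed
    then have "v \<in> vec.span (S1 \<union> S2)" for v using onto[of v] by blast
    then have "UNIV \<subseteq> vec.span (S1 \<union> S2)" by blast
    then have "vec.dim (UNIV :: (complex^'m) set) \<le> card (S1 \<union> S2)"
      by (rule vec.dim_le_card) (auto simp: S1_def S2_def)
    also have "\<dots> \<le> card S1 + card S2" by (rule card_Un_le)
    also have "\<dots> < (\<Sum>r<R. l r - k) + (\<Sum>r<R. min k (l r))" using c1 c2 less rk by linarith
    also have "\<dots> = (\<Sum>r<R. l r)" unfolding sum.distrib[symmetric] by (intro sum.cong) auto
    also have "\<dots> = CARD('m)" by (rule jordan_basis_card[OF jb])
    finally show False by (simp add: vec.dim_UNIV card_cart_basis)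
  qed
  show ?thesis by (intro exI[of _ D] conjI allI impI 1 2)
qed

section \<open>Orthogonal complements\<close>

context finite_dimensional_vector_space
begin

text \<open>Built one vector at a time: \<open>pr\<close> removes the pairings with the earlier
  vectors, and if \<open>u0\<close> were orthogonal to every \<open>pr w\<close>, nondegeneracy
  would put it into the span of the others. The form is just bilinear, so that the lemma serves
  \<open>\<omega>\<close>, the trace form and the phase form.\<close>

lemma dual_vectors:
  assumes W: "subspace W"
    and lin: "\<And>v. Vector_Spaces.linear scale (*) (B v)" "\<And>w. Vector_Spaces.linear scale (*) (\<lambda>v. B v w)"
    and nondeg: "\<And>v. v \<in> W ==> (\<And>w. w \<in> W ==> B v w = 0) ==> v = 0"
    and C: "finite C" "independent C" "C \<subseteq> W"
  shows "\<exists>d. \<forall>u\<in>C. d u \<in> W \<and> (\<forall>u'\<in>C. B u' (d u) = (if u' = u then 1 else 0))"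
  using C
proof (induction C rule: finite_induct)
  case (insert u0 C)
  note r = module_hom.add[OF module_hom_iff_linear[THEN iffD2, OF lin(1)]]
    module_hom.scale[OF module_hom_iff_linear[THEN iffD2, OF lin(1)]]
    module_hom.sum[OF module_hom_iff_linear[THEN iffD2, OF lin(1)]]
    module_hom.diff[OF module_hom_iff_linear[THEN iffD2, OF lin(1)]]
  note l = module_hom.add[OF module_hom_iff_linear[THEN iffD2, OF lin(2)]]
    module_hom.scale[OF module_hom_iff_linear[THEN iffD2, OF lin(2)]]
    module_hom.sum[OF module_hom_iff_linear[THEN iffD2, OF lin(2)]]
    module_hom.diff[OF module_hom_iff_linear[THEN iffD2, OF lin(2)]]
  have ind: "independent C" "u0 \<notin> span C" using insert.prems(1) insert.hyps(2) independent_insert by auto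
  from insert.IH[OF ind(1)] insert.prems obtain d where d: "\<And>u. u \<in> C ==> d u \<in> W"
    "\<And>u u'. u \<in> C ==> u' \<in> C ==> B u' (d u) = (if u' = u then 1 else 0)" by auto
  define pr where "pr w = w - (\<Sum>u\<in>C. scale (B u w) (d u))" for w
  have prW: "pr w \<in> W" if "w \<in> W" for w
    unfolding pr_def using d(1) that by (intro subspace_diff[OF W] subspace_sum[OF W] subspace_scale[OF W])
  have pr0: "B u (pr w) = 0" if "u \<in> C" for u w
  proof -
    have "(\<Sum>v\<in>C. B v w * B u (d v)) = (\<Sum>v\<in>C. if v = u then B v w else 0)"
      using d(2) that by (intro sum.cong) auto
    then show ?thesis unfolding pr_def r using that insert.hyps(1) by simp
  qed
  have "\<exists>w\<in>W. B u0 (pr w) \<noteq> 0"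
  proof (rule ccontr)
    assume neg: "\<not> (\<exists>w\<in>W. B u0 (pr w) \<noteq> 0)"
    define v where "v = u0 - (\<Sum>u\<in>C. scale (B u0 (d u)) u)"
    have "v = 0"
    proof (rule nondeg)
      show "v \<in> W" unfolding v_def using insert.prems
        by (intro subspace_diff[OF W] subspace_sum[OF W] subspace_scale[OF W]) auto
      fix w assume "w \<in> W"
      then have "B u0 (pr w) = 0" using neg by blast
      then show "B v w = 0" unfolding pr_def v_def r l by (simp add: mult.commute)
    qed
    then have "u0 = (\<Sum>u\<in>C. scale (B u0 (d u)) u)" by (simp add: v_def)
    also have "\<dots> \<in> span C" by (intro span_sum span_scale span_base)
    finally have "u0 \<in> span C" .
    with ind(2) show False by blast
  qed
  then obtain w where w: "w \<in> W" "B u0 (pr w) \<noteq> 0" by blast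
  define w1 where "w1 = scale (inverse (B u0 (pr w))) (pr w)"
  have w1: "w1 \<in> W" "B u0 w1 = 1" "\<And>u. u \<in> C ==> B u w1 = 0"
    unfolding w1_def using w prW pr0 by (auto simp: r intro: subspace_scale[OF W])
  define d' where "d' u = (if u = u0 then w1 else d u - scale (B u0 (d u)) w1)" for u
  show ?case
  proof (intro exI[of _ d'] ballI conjI)
    fix u assume u: "u \<in> insert u0 C"
    show "d' u \<in> W" unfolding d'_def using u w1(1) d(1) by (auto intro: subspace_diff[OF W] subspace_scale[OF W])
    fix u' assume u': "u' \<in> insert u0 C"
    show "B u' (d' u) = (if u' = u then 1 else 0)"
      using u u' w1 d(2) insert.hyps(2) by (auto simp: d'_def r)
  qed
qed auto

text \<open>Subtracting the pairings with a dual family of a basis of \<open>U\<close> projects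
  \<open>W\<close> onto the right orthogonal of \<open>U\<close>. Both facts are read off from this
  projection.\<close>

lemma
  assumes W: "subspace W" and U: "subspace U" "U \<subseteq> W"
    and lin: "\<And>v. Vector_Spaces.linear scale (*) (B v)" "\<And>w. Vector_Spaces.linear scale (*) (\<lambda>v. B v w)"
    and nondeg: "\<And>v. v \<in> W ==> (\<And>w. w \<in> W ==> B v w = 0) ==> v = 0"
  shows double_perp: "x \<in> W ==> (\<And>w. w \<in> W ==> (\<And>u. u \<in> U ==> B u w = 0) ==> B x w = 0) ==> x \<in> U"
    and dim_perp: "dim W \<le> dim U + dim {w \<in> W. \<forall>u\<in>U. B u w = 0}"
proof -
  note r = module_hom.add[OF module_hom_iff_linear[THEN iffD2, OF lin(1)]]
    module_hom.scale[OF module_hom_iff_linear[THEN iffD2, OF lin(1)]]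
    module_hom.sum[OF module_hom_iff_linear[THEN iffD2, OF lin(1)]]
    module_hom.diff[OF module_hom_iff_linear[THEN iffD2, OF lin(1)]]
    module_hom.zero[OF module_hom_iff_linear[THEN iffD2, OF lin(1)]]
  note l = module_hom.add[OF module_hom_iff_linear[THEN iffD2, OF lin(2)]]
    module_hom.scale[OF module_hom_iff_linear[THEN iffD2, OF lin(2)]]
    module_hom.sum[OF module_hom_iff_linear[THEN iffD2, OF lin(2)]]
    module_hom.diff[OF module_hom_iff_linear[THEN iffD2, OF lin(2)]]
  obtain C where C: "C \<subseteq> U" "independent C" "U \<subseteq> span C" "card C = dim U" using basis_exists by blast
  have fin: "finite C" using C(2) finiteI_independent by blast
  have "C \<subseteq> W" using C(1) U(2) by blast
  from dual_vectors[OF W lin nondeg fin C(2) this] obtain d where d: "\<And>u. u \<in> C ==> d u \<in> W"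
    "\<And>u u'. u \<in> C ==> u' \<in> C ==> B u' (d u) = (if u' = u then 1 else 0)" by blast
  define pr where "pr w = w - (\<Sum>u\<in>C. scale (B u w) (d u))" for w
  have prW: "pr w \<in> W" if "w \<in> W" for w
    unfolding pr_def using d(1) that by (intro subspace_diff[OF W] subspace_sum[OF W] subspace_scale[OF W])
  have pr0: "B u (pr w) = 0" if "u \<in> U" for u w
  proof -
    have "B u (pr w) = 0" if "u \<in> C" for u
    proof -
      have "(\<Sum>v\<in>C. B v w * B u (d v)) = (\<Sum>v\<in>C. if v = u then B v w else 0)"
        using d(2) that by (intro sum.cong) auto
      then show ?thesis unfolding pr_def r using that fin by simp
    qed
    moreover have "u \<in> span C" using that C(3) by blast
    then obtain f where "u = (\<Sum>v\<in>C. scale (f v) v)" unfolding span_finite[OF fin] by blast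
    ultimately show ?thesis by (simp add: l)
  qed
  show "x \<in> U" if x: "x \<in> W" "\<And>w. w \<in> W ==> (\<And>u. u \<in> U ==> B u w = 0) ==> B x w = 0"
  proof -
    define v where "v = x - (\<Sum>u\<in>C. scale (B x (d u)) u)"
    have "v = 0"
    proof (rule nondeg)
      show "v \<in> W" unfolding v_def using x(1) \<open>C \<subseteq> W\<close>
        by (intro subspace_diff[OF W] subspace_sum[OF W] subspace_scale[OF W]) auto
      fix w assume "w \<in> W"
      then have "B x (pr w) = 0" using x(2) prW pr0 by blast
      then show "B v w = 0" unfolding pr_def v_def r l by (simp add: mult.commute)
    qed
    then have "x = (\<Sum>u\<in>C. scale (B x (d u)) u)" by (simp add: v_def)
    moreover have "(\<Sum>u\<in>C. scale (B x (d u)) u) \<in> U"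
      using C(1) by (intro subspace_sum[OF U(1)] subspace_scale[OF U(1)]) auto
    ultimately show ?thesis by simp
  qed
  define P where "P = {w \<in> W. \<forall>u\<in>U. B u w = 0}"
  obtain E where E: "E \<subseteq> P" "independent E" "P \<subseteq> span E" "card E = dim P" using basis_exists by blast
  have finE: "finite E" using E(2) finiteI_independent by blast
  have "W \<subseteq> span (d ` C \<union> E)"
  proof
    fix w assume w: "w \<in> W"
    have "pr w \<in> P" unfolding P_def using prW[OF w] pr0 by blast
    then have "pr w \<in> span (d ` C \<union> E)" using E(3) span_mono[of E "d ` C \<union> E"] by blast
    moreover have "(\<Sum>u\<in>C. scale (B u w) (d u)) \<in> span (d ` C \<union> E)"
      by (intro span_sum span_scale span_base) auto
    ultimately have "pr w + (\<Sum>u\<in>C. scale (B u w) (d u)) \<in> span (d ` C \<union> E)" by (rule span_add)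
    then show "w \<in> span (d ` C \<union> E)" by (simp add: pr_def)
  qed
  then have "dim W \<le> card (d ` C \<union> E)" using fin finE by (intro dim_le_card) auto
  also have "\<dots> \<le> card C + card E"
    using card_Un_le[of "d ` C" E] card_image_le[OF fin, of d] by linarith
  finally show "dim W \<le> dim U + dim {w \<in> W. \<forall>u\<in>U. B u w = 0}" using C(4) E(4) by (simp add: P_def)
qed

end

section \<open>The symplectic group\<close>

lemma matrix_vector_mult_minus_left: "(- A) *v v = - (A *v v)" for A :: "'a::ring_1^'n^'m"
  by (simp add: matrix_vector_mult_def vec_eq_iff sum_negf)

lemma matrix_mul_minus_left: "(- A) ** B = - (A ** B)" for A :: "'a::ring_1^'n^'m"
  by (simp add: matrix_matrix_mult_def vec_eq_iff sum_negf)

lemma matrix_mul_minus_right: "A ** (- B) = - (A ** B)" for A :: "'a::ring_1^'n^'m"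
  by (simp add: matrix_matrix_mult_def vec_eq_iff sum_negf)

lemma matrix_diff_ldistrib: "A ** (B - C) = A ** B - A ** C" for A :: "'a::ring_1^'n^'m"
  by (simp add: matrix_matrix_mult_def vec_eq_iff sum_subtractf algebra_simps)

lemma matrix_diff_rdistrib: "(A - B) ** C = A ** C - B ** C" for A :: "'a::ring_1^'n^'m"
  by (simp add: matrix_matrix_mult_def vec_eq_iff sum_subtractf algebra_simps)

locale symp =
  fixes \<omega> :: "complex^'m::finite => complex^'m => complex"
  assumes form: "symplectic_form \<omega>"
begin

lemmas \<omega>_simps = symplectic_formD(1-4)[OF form]
lemmas \<omega>_self [simp] = symplectic_formD(5)[OF form]
lemmas \<omega>_skew = symplectic_formD(6)[OF form]

lemma \<omega>_linear: "functional (*s) (\<omega> v)" "functional (*s) (\<lambda>v. \<omega> v w)"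
  and nondeg: "(\<And>w. \<omega> v w = 0) ==> v = 0"
  using form unfolding symplectic_form_def by blast+

lemma nondeg': "(\<And>w. \<omega> w v = 0) ==> v = 0"
  using nondeg[of v] \<omega>_skew[of v] by simp

lemma \<omega>_zero [simp]: "\<omega> v 0 = 0" "\<omega> 0 v = 0"
  using \<omega>_simps(3)[of v 0 0] \<omega>_simps(4)[of 0 0 v] by auto

lemma \<omega>_minus [simp]: "\<omega> v (- w) = - \<omega> v w" "\<omega> (- v) w = - \<omega> v w"
  using \<omega>_simps(3)[of v "-1" w] \<omega>_simps(4)[of "-1" v w] by (simp_all add: vector_smult_lneg)

lemma \<omega>_diff: "\<omega> v (u - w) = \<omega> v u - \<omega> v w" "\<omega> (u - w) v = \<omega> u v - \<omega> w v"
  using \<omega>_simps(1)[of v u "-w"] \<omega>_simps(2)[of u "-w" v] by simp_all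

lemma \<omega>_sum: "\<omega> v (\<Sum>i\<in>I. f i) = (\<Sum>i\<in>I. \<omega> v (f i))" "\<omega> (\<Sum>i\<in>I. f i) v = (\<Sum>i\<in>I. \<omega> (f i) v)"
  by (induction I rule: infinite_finite_induct) (auto simp: \<omega>_simps)

definition J :: "complex^'m^'m" where
  "J = (\<chi> a b. \<omega> (axis a 1) (axis b 1))"

lemma \<omega>_J: "\<omega> v w = (\<Sum>a\<in>UNIV. v $ a * (J *v w) $ a)"
proof -
  have v: "v = (\<Sum>a\<in>UNIV. v $ a *s axis a 1)" and w: "w = (\<Sum>a\<in>UNIV. w $ a *s axis a 1)"
    by (simp_all add: basis_expansion)
  have "\<omega> v w = (\<Sum>a\<in>UNIV. v $ a * \<omega> (axis a 1) w)"
    by (subst v) (simp add: \<omega>_sum \<omega>_simps)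
  also have "\<dots> = (\<Sum>a\<in>UNIV. v $ a * (J *v w) $ a)"
  proof (intro sum.cong refl arg_cong2[where f = "(*)"])
    fix a show "\<omega> (axis a 1) w = (J *v w) $ a"
      by (subst w) (simp add: \<omega>_sum \<omega>_simps J_def matrix_vector_mult_def mult.commute)
  qed
  finally show ?thesis .
qed

lemma J_invertible: "invertible J"
proof (rule matrix_inj_invertible)
  fix v assume "J *v v = 0"
  then show "v = 0" by (intro nondeg') (simp add: \<omega>_J)
qed

lemma J_inv: "J ** matrix_inv J = mat 1" "matrix_inv J ** J = mat 1"
  using someI_ex[OF J_invertible[unfolded invertible_def]] unfolding matrix_inv_def by blast+

text \<open>The adjoint with respect to \<open>\<omega>\<close>, whose Gram matrix is
  \<open>J\<close>. In these terms \<open>sp\<close> is the set of skew-adjoint matrices and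
  \<open>Sp\<close> that of the \<open>g\<close> with \<open>adj g\<close> as inverse.\<close>

definition adj :: "complex^'m^'m => complex^'m^'m" where
  "adj A = matrix_inv J ** transpose A ** J"

lemma sum_transpose: "(\<Sum>a\<in>UNIV. (A *v v) $ a * w $ a) = (\<Sum>a\<in>UNIV. v $ a * (transpose A *v w) $ a)"
  for A :: "complex^'m^'m"
  unfolding matrix_vector_mult_def transpose_def
  by (simp add: sum_distrib_left sum_distrib_right mult_ac) (rule sum.swap)

lemma adj: "\<omega> (A *v v) w = \<omega> v (adj A *v w)"
proof -
  have "J *v (adj A *v w) = transpose A *v (J *v w)"
    unfolding adj_def matrix_vector_mul_assoc by (simp add: matrix_mul_assoc J_inv)
  then show ?thesis unfolding \<omega>_J[of "A *v v"] \<omega>_J[of v] sum_transpose by simp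
qed

lemma adj': "\<omega> v (A *v w) = \<omega> (adj A *v v) w"
  using adj[of A w v] \<omega>_skew[of v] \<omega>_skew[of _ w] by (metis \<omega>_skew)

lemma matrix_eq_\<omega>: "(\<And>v w. \<omega> v (A *v w) = \<omega> v (B *v w)) ==> A = B"
proof -
  assume h: "\<And>v w. \<omega> v (A *v w) = \<omega> v (B *v w)"
  have "A *v w - B *v w = 0" for w by (rule nondeg') (simp add: \<omega>_diff h)
  then show "A = B" by (simp add: matrix_eq)
qed

lemma adj_mult: "adj (A ** B) = adj B ** adj A"
  by (rule matrix_eq_\<omega>) (simp add: adj[symmetric] flip: matrix_vector_mul_assoc)

lemma adj_add: "adj (A + B) = adj A + adj B"
  by (rule matrix_eq_\<omega>) (simp add: adj[symmetric] matrix_vector_mult_add_rdistrib \<omega>_simps)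

lemma adj_mat: "adj (mat c) = mat c"
  by (rule matrix_eq_\<omega>) (simp add: adj[symmetric] mat_mult_vec \<omega>_simps)

lemma adj_minus: "adj (- A) = - adj A"
  by (rule matrix_eq_\<omega>) (simp add: adj[symmetric] matrix_vector_mult_minus_left)

lemma adj_adj: "adj (adj A) = A"
  by (rule matrix_eq_\<omega>) (simp add: adj[symmetric] adj'[symmetric])

lemma sp_iff: "A \<in> sp \<omega> \<longleftrightarrow> adj A = - A"
proof
  assume A: "A \<in> sp \<omega>"
  then have "\<omega> (A *v v) w + \<omega> v (A *v w) = 0" for v w by (simp add: sp_def)
  then show "adj A = - A"
    by (intro matrix_eq_\<omega>) (simp add: adj[symmetric] matrix_vector_mult_minus_left eq_neg_iff_add_eq_0)
next
  assume "adj A = - A"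
  then show "A \<in> sp \<omega>" unfolding sp_def by (simp add: adj matrix_vector_mult_minus_left)
qed

lemma spD: "A \<in> sp \<omega> ==> \<omega> (A *v v) w = - \<omega> v (A *v w)"
  unfolding sp_def by (simp add: eq_neg_iff_add_eq_0)

definition Sp :: "(complex^'m^'m) set" where
  "Sp = {g. \<forall>v w. \<omega> (g *v v) (g *v w) = \<omega> v w}"

lemma Sp_iff: "g \<in> Sp \<longleftrightarrow> adj g ** g = mat 1"
proof
  assume g: "g \<in> Sp"
  show "adj g ** g = mat 1"
    by (rule matrix_eq_\<omega>) (use g in "simp add: adj[symmetric] Sp_def flip: matrix_vector_mul_assoc")
next
  assume "adj g ** g = mat 1"
  then show "g \<in> Sp" unfolding Sp_def by (simp add: adj matrix_vector_mul_assoc)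
qed

lemma Sp_inv: "g \<in> Sp ==> adj g ** g = mat 1" "g \<in> Sp ==> g ** adj g = mat 1"
  using Sp_iff matrix_left_right_inverse by blast+

lemma Sp_mult: "g \<in> Sp ==> h \<in> Sp ==> g ** h \<in> Sp"
  unfolding Sp_def by (simp flip: matrix_vector_mul_assoc)

lemma Sp_adj: "g \<in> Sp ==> adj g \<in> Sp"
  using Sp_inv Sp_iff adj_adj by simp

lemma Sp_1: "mat 1 \<in> Sp"
  by (simp add: Sp_def)

lemma Sp_conj_sp: "g \<in> Sp ==> A \<in> sp \<omega> ==> g ** A ** adj g \<in> sp \<omega>"
  unfolding sp_iff adj_mult adj_adj
  by (simp add: matrix_mul_assoc matrix_vector_mult_minus_left matrix_mul_minus_left matrix_mul_minus_right)

end

section \<open>The symplectic group is generated by transvections\<close>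

context symp
begin

abbreviation sq :: "complex^'m => complex^'m^'m" where
  "sq \<equiv> sym_square \<omega>"

lemmas sq_mult = sym_square_mult[OF form]

text \<open>The symplectic transvection along \<open>u\<close>. Since \<open>sq u\<close> has square
  0, it is the exponential of \<open>t\<close> times \<open>sq u\<close>, and it is polynomial in
  \<open>t\<close>.\<close>

definition tv :: "complex => complex^'m => complex^'m^'m" where
  "tv t u = mat 1 + map_matrix ((*) t) (sq u)"

lemma map_matrix_mult_vec: "map_matrix ((*) c) A *v v = c *s (A *v v)" for A :: "complex^'m^'m"
  by (simp add: map_matrix_def matrix_vector_mult_def vec_eq_iff sum_distrib_left mult.assoc)

lemma tv_mult: "tv t u *v v = v + (t * \<omega> u v / 2) *s u"
  by (simp add: tv_def matrix_vector_mult_add_rdistrib map_matrix_mult_vec sq_mult)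

lemma tv_Sp: "tv t u \<in> Sp"
  unfolding Sp_def
proof (intro CollectI allI)
  fix v w
  have "\<omega> v u = - \<omega> u v" by (rule \<omega>_skew)
  then show "\<omega> (tv t u *v v) (tv t u *v w) = \<omega> v w"
    by (simp add: tv_mult \<omega>_simps algebra_simps)
qed

fun tvs :: "(complex \<times> (complex^'m)) list => complex^'m^'m" where
  "tvs [] = mat 1"
| "tvs ((t, u) # xs) = tv t u ** tvs xs"

lemma tvs_Sp: "tvs xs \<in> Sp"
  by (induction xs rule: tvs.induct) (auto intro: Sp_1 Sp_mult tv_Sp)

lemma tvs_append: "tvs (xs @ ys) = tvs xs ** tvs ys"
  by (induction xs rule: tvs.induct) (auto simp: matrix_mul_assoc)

definition Fix :: "complex^'m^'m => (complex^'m) set" where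
  "Fix g = {v. g *v v = v}"

lemma subspace_Fix: "vec.subspace (Fix g)"
  unfolding Fix_def vec.subspace_def by (auto simp: matrix_vector_right_distrib vector_scalar_commute)

text \<open>A vector fixed by the symplectic \<open>g\<close> is orthogonal to every
  \<open>g *v w - w\<close>, and the transvection along \<open>u\<close> fixes whatever is
  orthogonal to \<open>u\<close>.\<close>

lemma Fix_tv:
  assumes "g \<in> Sp" "u = g *v w - w"
  shows "Fix g \<subseteq> Fix (tv t u ** g)"
proof
  fix v assume "v \<in> Fix g"
  then have v: "g *v v = v" by (simp add: Fix_def)
  have "\<omega> (g *v w) (g *v v) = \<omega> w v" using assms(1) by (simp add: Sp_def)
  then have "\<omega> (g *v w) v = \<omega> w v" unfolding v .
  then have "\<omega> u v = 0" by (simp add: assms(2) \<omega>_diff)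
  then show "v \<in> Fix (tv t u ** g)" using v by (simp add: Fix_def tv_mult flip: matrix_vector_mul_assoc)
qed

lemma Fix_increase:
  assumes g: "g \<in> Sp" and v: "\<omega> (g *v v) v \<noteq> 0"
  shows "\<exists>xs. Fix g \<subset> Fix (tvs xs ** g)"
proof -
  define u where "u = g *v v - v"
  have u: "\<omega> u (g *v v) \<noteq> 0" using v \<omega>_skew[of v "g *v v"] by (simp add: u_def \<omega>_diff)
  \<comment> \<open>Chosen so that the transvection along \<open>g *v v - v\<close> takes
    \<open>g *v v\<close> back to \<open>v\<close>.\<close>
  define t where "t = - 2 / \<omega> u (g *v v)"
  have "tv t u *v (g *v v) = v" using u by (simp add: tv_mult t_def) (simp add: u_def)
  then have "v \<in> Fix (tv t u ** g)" by (simp add: Fix_def flip: matrix_vector_mul_assoc)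
  moreover have "v \<notin> Fix g" using v by (auto simp: Fix_def)
  moreover have "Fix g \<subseteq> Fix (tv t u ** g)" by (rule Fix_tv[OF g u_def])
  ultimately show ?thesis by (intro exI[of _ "[(t, u)]"]) auto
qed

lemma exists_both_nonzero:
  assumes "\<omega> u v \<noteq> 0" "\<omega> u' w \<noteq> 0"
  shows "\<exists>z. \<omega> u z \<noteq> 0 \<and> \<omega> u' z \<noteq> 0"
proof (cases "\<omega> u' v = 0 \<and> \<omega> u w = 0")
  case True
  then show ?thesis using assms by (intro exI[of _ "v + w"]) (simp add: \<omega>_simps)
next
  case False
  then show ?thesis using assms by blast
qed

text \<open>Induction on the codimension of the fixed space. One transvection enlarges it if
  \<open>\<omega> (g *v v) v \<noteq> 0\<close> for some \<open>v\<close>; otherwise another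
  transvection, which loses no fixed vector, first produces such a \<open>v\<close>.\<close>

theorem Sp_generated:
  assumes "g \<in> Sp"
  shows "\<exists>xs. g = tvs xs"
proof -
  have "\<exists>xs. tvs xs ** g = mat 1" if "g \<in> Sp" for g
    using that
  proof (induction "CARD('m) - vec.dim (Fix g)" arbitrary: g rule: less_induct)
    case less
    show ?case
    proof (cases "g = mat 1")
      case True
      then show ?thesis by (intro exI[of _ "[]"]) simp
    next
      case False
      have "\<exists>xs. Fix g \<subset> Fix (tvs xs ** g)"
      proof (cases "\<exists>v. \<omega> (g *v v) v \<noteq> 0")
        case True
        then show ?thesis using Fix_increase[OF less.prems] by blast
      next
        case no: False
        obtain w where w: "g *v w \<noteq> w" using False by (metis matrix_eq matrix_vector_mul_lid)
        define u where "u = g *v w - w"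
        have "u \<noteq> 0" using w by (simp add: u_def)
        then obtain v1 where v1: "\<omega> u v1 \<noteq> 0" using nondeg by blast
        have "\<omega> (adj g *v u) z = \<omega> u (g *v z)" for z by (rule adj'[symmetric])
        moreover have "\<omega> u (g *v (adj g *v v1)) \<noteq> 0"
          using v1 Sp_inv(2)[OF less.prems] by (simp add: matrix_vector_mul_assoc)
        ultimately obtain v where v: "\<omega> u v \<noteq> 0" "\<omega> u (g *v v) \<noteq> 0"
          using exists_both_nonzero[OF v1, of "adj g *v u" "adj g *v v1"] by auto
        \<comment> \<open>With all \<open>\<omega> (g *v v) v\<close> equal to 0, this factor makes
          the value at \<open>v\<close> equal to \<open>\<omega> u (g *v v) * \<omega> u v\<close>.
          The parameter 2 cancels the factor 1/2 in \<open>sq\<close>.\<close>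
        define g' where "g' = tv 2 u ** g"
        have g': "g' \<in> Sp" unfolding g'_def by (intro Sp_mult tv_Sp less.prems)
        have "g' *v v = g *v v + \<omega> u (g *v v) *s u" by (simp add: g'_def tv_mult flip: matrix_vector_mul_assoc)
        then have "\<omega> (g' *v v) v = \<omega> (g *v v) v + \<omega> u (g *v v) * \<omega> u v" by (simp add: \<omega>_simps)
        moreover have "\<omega> (g *v v) v = 0" using no by blast
        ultimately have "\<omega> (g' *v v) v \<noteq> 0" using v by simp
        then obtain xs where xs: "Fix g' \<subset> Fix (tvs xs ** g')" using Fix_increase[OF g'] by blast
        have "Fix g \<subseteq> Fix g'" unfolding g'_def by (rule Fix_tv[OF less.prems u_def])
        then have "Fix g \<subset> Fix (tvs (xs @ [(2, u)]) ** g)"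
          using xs unfolding tvs_append g'_def by (simp add: matrix_mul_assoc psubset_eq) blast
        then show ?thesis by blast
      qed
      then obtain xs where xs: "Fix g \<subset> Fix (tvs xs ** g)" by blast
      have "vec.dim (Fix g) < vec.dim (Fix (tvs xs ** g))"
        using xs by (intro vec.dim_psubset) (simp add: vec.span_eq_iff[THEN iffD2] subspace_Fix)
      moreover have "vec.dim (Fix (tvs xs ** g)) \<le> CARD('m)"
        using vec.dim_subset[OF subset_UNIV, of "Fix (tvs xs ** g)"] by (simp add: vec.dim_UNIV card_cart_basis)
      ultimately have "CARD('m) - vec.dim (Fix (tvs xs ** g)) < CARD('m) - vec.dim (Fix g)" by simp
      from less.hyps[OF this Sp_mult[OF tvs_Sp less.prems]] obtain ys where "tvs ys ** (tvs xs ** g) = mat 1" by blast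
      then have "tvs (ys @ xs) ** g = mat 1" by (simp add: tvs_append matrix_mul_assoc)
      then show ?thesis by blast
    qed
  qed
  from this[OF Sp_adj[OF assms]] obtain xs where "tvs xs ** adj g = mat 1" by blast
  then have "tvs xs ** (adj g ** g) = g" by (simp add: matrix_mul_assoc)
  then show ?thesis using Sp_inv(1)[OF assms] by auto
qed

section \<open>Traces against squares, and the subspace \<open>L y\<close>\<close>

lemma sq_component: "sq i $ a $ b = \<omega> i (axis b 1) / 2 * i $ a"
proof -
  have "(\<Sum>k\<in>UNIV. sq i $ a $ k * axis b 1 $ k) = (\<Sum>k\<in>UNIV. if k = b then sq i $ a $ k else 0)"
    by (intro sum.cong) (auto simp: axis_def)
  then have "(sq i *v axis b 1) $ a = sq i $ a $ b" by (simp add: matrix_vector_mult_def)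
  then show ?thesis by (simp add: sq_mult)
qed

lemma trace_sq: "trace (sq i ** T) = \<omega> i (T *v i) / 2"
proof -
  have "trace (sq i ** T) = (\<Sum>a\<in>UNIV. \<Sum>b\<in>UNIV. (\<omega> i (axis b 1) / 2 * i $ a) * T $ b $ a)"
    by (simp add: trace_def matrix_matrix_mult_def sq_component)
  also have "\<dots> = (\<Sum>b\<in>UNIV. \<omega> i (axis b 1) / 2 * (T *v i) $ b)"
    by (subst sum.swap) (simp add: matrix_vector_mult_def sum_distrib_left mult_ac)
  also have "\<dots> = \<omega> i (\<Sum>b\<in>UNIV. (T *v i) $ b *s axis b 1) / 2"
    by (simp add: \<omega>_sum \<omega>_simps sum_divide_distrib mult.commute)
  finally show ?thesis by (simp only: basis_expansion)
qed

lemma trace_diff: "trace (A - B) = trace A - trace (B :: complex^'m^'m)"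
  by (simp add: trace_def sum_subtractf)

lemma trace_commutator: "y ** T = T ** y ==> trace (commutator x y ** T) = 0" for x y T :: "complex^'m^'m"
proof -
  assume yT: "y ** T = T ** y"
  have "trace (commutator x y ** T) = trace (x ** (y ** T)) - trace (y ** (x ** T))"
    unfolding commutator_def matrix_diff_rdistrib trace_diff matrix_mul_assoc ..
  also have "trace (y ** (x ** T)) = trace (x ** T ** y)" by (rule trace_mul_sym)
  finally show ?thesis using yT by (simp add: matrix_mul_assoc[symmetric])
qed

text \<open>The vectors \<open>i\<close> for which \<open>i\<^sup>2\<close> is in the image of \<open>ad y\<close>.\<close>

definition L :: "complex^'m^'m => (complex^'m) set" where
  "L y = {i. \<forall>s a. mpow (2 * s + 1) y *v a = 0 --> \<omega> (mpow s y *v a) i = 0}"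

lemma mpow_Suc_vec: "mpow (Suc k) y *v v = y *v (mpow k y *v v)"
  by (simp add: mpow_Suc flip: matrix_vector_mul_assoc)

lemma mpow_add_vec: "mpow j y *v (mpow k y *v v) = mpow (j + k) y *v v"
  by (simp add: mpow_add matrix_vector_mul_assoc)

text \<open>If \<open>y ^ (2 * s + 1)\<close> kills \<open>a\<close>, then the operator
  \<open>T = \<Sum>j\<le>2*s. (-1)^j \<omega>(y^j a, \<cdot>) y^(2*s-j) a\<close> commutes with \<open>y\<close>, and the trace of its product with
  \<open>i\<^sup>2\<close> reduces to \<open>\<omega>(y^s a, i)\<^sup>2\<close> by induction on \<open>s\<close>.\<close>

lemma fibre_L:
  assumes y: "y \<in> sp \<omega>" and eq: "commutator x y + sq i = 0"
  shows "i \<in> L y"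
proof -
  have "\<omega> (mpow s y *v a) i = 0" if "mpow (2 * s + 1) y *v a = 0" for s a
    using that
  proof (induction s arbitrary: a rule: less_induct)
    case (less s)
    define T where "T = matrix (\<lambda>w. \<Sum>j\<le>2 * s. ((-1) ^ j * \<omega> (mpow j y *v a) w) *s (mpow (2 * s - j) y *v a))"
    have lin: "Vector_Spaces.linear (*s) (*s) (\<lambda>w. \<Sum>j\<le>2 * s. ((-1) ^ j * \<omega> (mpow j y *v a) w) *s (mpow (2 * s - j) y *v a))"
      by (simp add: Vector_Spaces.linear_iff vec.vector_space_axioms \<omega>_simps distrib_left vec.scale_left_distrib
          sum.distrib vec.scale_sum_right mult_ac)
    have T: "T *v w = (\<Sum>j\<le>2 * s. ((-1) ^ j * \<omega> (mpow j y *v a) w) *s (mpow (2 * s - j) y *v a))" for w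
      unfolding T_def by (rule matrix_works[OF lin])
    have "(y ** T) *v w = (T ** y) *v w" for w
    proof -
      define F where "F j = ((-1) ^ j * \<omega> (mpow j y *v a) w) *s (mpow (2 * s + 1 - j) y *v a)" for j
      have "(y ** T) *v w = (\<Sum>j\<le>2 * s. F j)"
        by (simp add: T F_def matrix_vector_sum vector_scalar_commute Suc_diff_le flip: matrix_vector_mul_assoc mpow_Suc_vec)
      also have "\<dots> = (\<Sum>j\<le>Suc (2 * s). F j)" using less.prems by (simp add: F_def)
      also have "\<dots> = (\<Sum>j\<le>2 * s. F (Suc j))" using less.prems by (subst sum.atMost_Suc_shift) (simp add: F_def)
      also have "\<dots> = (T ** y) *v w"
        unfolding matrix_vector_mul_assoc[symmetric] T
        by (intro sum.cong refl) (simp add: F_def mpow_Suc_vec spD[OF y])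
      finally show ?thesis .
    qed
    then have "y ** T = T ** y" by (simp add: matrix_eq)
    from trace_commutator[OF this] have "trace (commutator x y ** T) = 0" .
    moreover have "sq i ** T = - (commutator x y ** T)"
      using eq by (simp add: add_eq_0_iff matrix_mul_minus_left)
    ultimately have "trace (sq i ** T) = 0" by (simp add: trace_def sum_negf)
    then have "\<omega> i (T *v i) = 0" by (simp add: trace_sq)
    then have sum0: "(\<Sum>j\<le>2 * s. (-1) ^ j * \<omega> (mpow j y *v a) i * \<omega> i (mpow (2 * s - j) y *v a)) = 0"
      by (simp add: T \<omega>_sum \<omega>_simps)
    \<comment> \<open>The induction hypothesis for \<open>j\<close> applies to
      \<open>mpow (2 * s - 2 * j) y *v a\<close>, which is killed by the power
      \<open>2 * j + 1\<close>; its image under the \<open>j\<close>-th power is the vector in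
      question.\<close>
    have c: "\<omega> (mpow (2 * s - j) y *v a) i = 0" if "j < s" for j
    proof -
      have "mpow (2 * j + 1) y *v (mpow (2 * s - 2 * j) y *v a) = 0"
        unfolding mpow_add_vec using less.prems that by (simp add: add.commute)
      from less.IH[OF that this] show ?thesis
        unfolding mpow_add_vec using that by (simp add: add.commute mult_2)
    qed
    have "(-1) ^ j * \<omega> (mpow j y *v a) i * \<omega> i (mpow (2 * s - j) y *v a)
        = (if j = s then (-1) ^ s * \<omega> (mpow s y *v a) i * \<omega> i (mpow s y *v a) else 0)" if "j \<le> 2 * s" for j
    proof (cases j s rule: linorder_cases)
      case less
      then show ?thesis using c[OF less] \<omega>_skew[of i "mpow (2 * s - j) y *v a"] by simp
    next
      case equal
      then show ?thesis by (simp add: mult_2)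
    next
      case greater
      then have "2 * s - j < s" "2 * s - (2 * s - j) = j" using that by auto
      then have "\<omega> (mpow j y *v a) i = 0" using c[of "2 * s - j"] by simp
      then show ?thesis using greater by simp
    qed
    then have "(\<Sum>j\<le>2 * s. (-1) ^ j * \<omega> (mpow j y *v a) i * \<omega> i (mpow (2 * s - j) y *v a)) =
      (\<Sum>j\<le>2 * s. if j = s then (-1) ^ s * \<omega> (mpow s y *v a) i * \<omega> i (mpow s y *v a) else 0)"
      by (intro sum.cong) auto
    then have "(-1) ^ s * \<omega> (mpow s y *v a) i * \<omega> i (mpow s y *v a) = 0"
      using sum0 by simp
    then show ?case using \<omega>_skew[of i "mpow s y *v a"] by auto
  qed
  then show ?thesis unfolding L_def by blast
qed

lemma subspace_L: "vec.subspace (L y)"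
  unfolding vec.subspace_def L_def by (auto simp: \<omega>_simps)

lemma mpow_commute: "A ** y = y ** A ==> A ** mpow k y = mpow k y ** A"
  unfolding mpow_def by (rule mpoly_commute[symmetric]) simp

lemma L_commute:
  assumes i: "i \<in> L y" and A: "A \<in> sp \<omega>" "A ** y = y ** A"
  shows "A *v i \<in> L y"
proof -
  have comm: "mpow k y *v (A *v v) = A *v (mpow k y *v v)" for k v
    using mpow_commute[OF A(2)] by (simp add: matrix_vector_mul_assoc)
  have "\<omega> (mpow s y *v a) (A *v i) = 0" if a: "mpow (2 * s + 1) y *v a = 0" for s a
  proof -
    have "mpow (2 * s + 1) y *v (A *v a) = 0" unfolding comm a by simp
    then have "\<omega> (mpow s y *v (A *v a)) i = 0" using i unfolding L_def by blast
    then show ?thesis using spD[OF A(1)] by (simp add: comm)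
  qed
  then show ?thesis unfolding L_def by blast
qed

text \<open>The basis \<open>d\<close> dual to a Jordan basis under \<open>\<omega>\<close>. Since
  \<open>y\<close> is skew, it runs through the dual chains in the opposite direction, with a sign
  at each step.\<close>

lemma jordan_dual_basis:
  assumes y: "y \<in> sp \<omega>" and jb: "jordan_basis y R l b"
  obtains d where "\<And>r j r' j'. r < R ==> j < l r ==> r' < R ==> j' < l r' ==>
      \<omega> (b r' j') (d r j) = (if r' = r \<and> j' = j then 1 else 0)"
    "\<And>k c r j. r < R ==> j < l r ==> \<omega> (mpow k y *v comb R l c b) (d r j) = (if j + k < l r then c r (j + k) else 0)"
    "\<And>v. v = comb R l (\<lambda>r j. \<omega> (b r j) v) d"
    "\<And>k r. r < R ==> mpow k y *v d r 0 = (if k < l r then (-1) ^ k *s d r k else 0)"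
proof -
  let ?I = "SIGMA r:{..<R}. {..<l r}" and ?f = "\<lambda>(r, j). b r j"
  have ind: "\<forall>c. comb R l c b = 0 --> (\<forall>r<R. \<forall>j<l r. c r j = 0)"
    using jb unfolding jordan_basis_def chains_def by blast
  note inj = ind[unfolded comb_independent]
  have "finite (?f ` ?I)" by auto
  from vec.dual_vectors[OF vec.subspace_UNIV \<omega>_linear _ this inj[THEN conjunct2]] nondeg
  obtain D where D: "\<And>u u'. u \<in> ?f ` ?I ==> u' \<in> ?f ` ?I ==> \<omega> u' (D u) = (if u' = u then 1 else 0)" by blast
  define d where "d r j = D (b r j)" for r j
  have d: "\<omega> (b r' j') (d r j) = (if r' = r \<and> j' = j then 1 else 0)"
    if "r < R" "j < l r" "r' < R" "j' < l r'" for r j r' j'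
  proof -
    have "b r' j' = b r j \<longleftrightarrow> r' = r \<and> j' = j"
      using inj_on_eq_iff[OF inj[THEN conjunct1], of "(r', j')" "(r, j)"] that by simp
    moreover have "b r j \<in> ?f ` ?I" "b r' j' \<in> ?f ` ?I" using that by (auto intro!: image_eqI[of _ ?f "(_, _)"])
    ultimately show ?thesis unfolding d_def using D by simp
  qed
  have pair: "\<omega> (mpow k y *v comb R l c b) (d r j) = (if j + k < l r then c r (j + k) else 0)"
    if rj: "r < R" "j < l r" for k c r j
  proof -
    have "\<omega> (mpow k y *v comb R l c b) (d r j) =
      (\<Sum>r'<R. \<Sum>j'<l r'. c r' j' * \<omega> (if k \<le> j' then b r' (j' - k) else 0) (d r j))"
      unfolding comb_def matrix_vector_sum vector_scalar_commute \<omega>_sum \<omega>_simps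
      using jordan_basis_mpow[OF jb] by simp
    also have "\<dots> = (\<Sum>r'<R. \<Sum>j'<l r'. if r' = r then (if j' = j + k then c r' j' else 0) else 0)"
      by (intro sum.cong refl) (use d rj in "auto split: if_splits")
    also have "\<dots> = (\<Sum>r'<R. if r' = r then (\<Sum>j'<l r'. if j' = j + k then c r' j' else 0) else 0)"
      by (intro sum.cong) auto
    also have "\<dots> = (if j + k < l r then c r (j + k) else 0)" using rj by simp
    finally show ?thesis .
  qed
  have eqI: "u = v" if "\<And>r j. r < R ==> j < l r ==> \<omega> (b r j) u = \<omega> (b r j) v" for u v
  proof -
    have "\<omega> w (u - v) = 0" for w
    proof -
      obtain c where "w = comb R l c b" using jb unfolding jordan_basis_def by blast
      then show ?thesis using that by (simp add: comb_def \<omega>_sum \<omega>_simps \<omega>_diff)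
    qed
    then show ?thesis using nondeg'[of "u - v"] by simp
  qed
  have expand: "v = comb R l (\<lambda>r j. \<omega> (b r j) v) d" for v
  proof (rule eqI)
    fix r j assume rj: "r < R" "j < l r"
    have "\<omega> (b r j) (comb R l (\<lambda>r j. \<omega> (b r j) v) d) =
      (\<Sum>r'<R. \<Sum>j'<l r'. if r' = r then (if j' = j then \<omega> (b r' j') v else 0) else 0)"
      unfolding comb_def \<omega>_sum \<omega>_simps by (intro sum.cong refl) (use d rj in auto)
    also have "\<dots> = (\<Sum>r'<R. if r' = r then (\<Sum>j'<l r'. if j' = j then \<omega> (b r' j') v else 0) else 0)"
      by (intro sum.cong) auto
    also have "\<dots> = \<omega> (b r j) v" using rj by simp
    finally show "\<omega> (b r j) v = \<omega> (b r j) (comb R l (\<lambda>r j. \<omega> (b r j) v) d)" by simp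
  qed
  have step: "y *v d r j = (if Suc j < l r then - d r (Suc j) else 0)" if rj: "r < R" "j < l r" for r j
  proof (rule eqI)
    fix r' j' assume rj': "r' < R" "j' < l r'"
    have "\<omega> (b r' j') (y *v d r j) = - \<omega> (y *v b r' j') (d r j)" by (simp add: spD[OF y])
    also have "y *v b r' j' = (if 1 \<le> j' then b r' (j' - 1) else 0)"
      using jordan_basis_mpow[OF jb rj', of 1] unfolding mpow_1 .
    also have "- \<omega> (if 1 \<le> j' then b r' (j' - 1) else 0) (d r j) =
      \<omega> (b r' j') (if Suc j < l r then - d r (Suc j) else 0)"
      using d[OF rj, of r' "j' - 1"] d[OF rj(1), of "Suc j" r' j'] rj rj' by auto
    finally show "\<omega> (b r' j') (y *v d r j) = \<omega> (b r' j') (if Suc j < l r then - d r (Suc j) else 0)" .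
  qed
  have pow: "mpow k y *v d r 0 = (if k < l r then (-1) ^ k *s d r k else 0)" if r: "r < R" for k r
  proof (induction k)
    case 0
    have "0 < l r" using jb r unfolding jordan_basis_def chains_def by blast
    then show ?case by simp
  next
    case (Suc k)
    show ?case
    proof (cases "k < l r")
      case True
      then show ?thesis unfolding mpow_Suc_vec Suc using step[OF r True]
        by (simp add: vector_scalar_commute vector_smult_lneg vector_smult_rneg)
    qed (use Suc in "simp add: mpow_Suc_vec")
  qed
  show thesis by (rule that[OF d pair expand pow])
qed

text \<open>Each chain contributes the upper half of its dual chain, the \<open>d r j\<close> with
  \<open>l r \<le> 2 * j\<close>, which are \<open>l r div 2\<close> vectors. Vectors of
  \<open>L y\<close> are orthogonal to the lower halves of the chains \<open>b\<close>, so only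
  these \<open>d r j\<close> occur in their expansion; they are also orthogonal to these
  \<open>d r j\<close>, which gives isotropy.\<close>

lemma L_basis:
  assumes y: "y \<in> sp \<omega>" and jt: "jordan_type y p"
  shows "\<exists>B. finite B \<and> vec.independent B \<and> vec.span B = L y \<and> card B = (\<Sum>x\<in>#p. x div 2)"
    and L_isotropic: "u \<in> L y ==> v \<in> L y ==> \<omega> u v = 0"
proof -
  obtain R l b where jb: "jordan_basis y R l b" and p: "p = image_mset l (mset_set {..<R})"
    using jt unfolding jordan_type_iff by blast
  obtain d where d: "\<And>r j r' j'. r < R ==> j < l r ==> r' < R ==> j' < l r' ==>
      \<omega> (b r' j') (d r j) = (if r' = r \<and> j' = j then 1 else 0)"
    and pair: "\<And>k c r j. r < R ==> j < l r ==> \<omega> (mpow k y *v comb R l c b) (d r j) = (if j + k < l r then c r (j + k) else 0)"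
    and expand: "\<And>v. v = comb R l (\<lambda>r j. \<omega> (b r j) v) d"
    and pow: "\<And>k r. r < R ==> mpow k y *v d r 0 = (if k < l r then (-1) ^ k *s d r k else 0)"
    by (rule jordan_dual_basis[OF y jb]) blast
  define I where "I = (SIGMA r:{..<R}. {j. j < l r \<and> l r \<le> 2 * j})"
  define f where "f = (\<lambda>(r, j). d r j)"
  have finI: "finite I" unfolding I_def by auto
  have dL: "d r j \<in> L y" if rj: "r < R" "j < l r" "l r \<le> 2 * j" for r j
    unfolding L_def
  proof (intro CollectI allI impI)
    fix s a assume a: "mpow (2 * s + 1) y *v a = 0"
    obtain c where c: "a = comb R l c b" using jb unfolding jordan_basis_def by blast
    show "\<omega> (mpow s y *v a) (d r j) = 0"
    proof (cases "j + s < l r")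
      case True
      \<comment> \<open>Here \<open>s < j\<close>, because \<open>j + s < l r \<le> 2 * j\<close>.
        Hence the index is \<open>j - s - 1\<close>, and the pairing of the vanishing vector reads
        off the coefficient \<open>c r (j + s)\<close>.\<close>
      have "\<omega> (mpow (2 * s + 1) y *v a) (d r (j + s - (2 * s + 1))) = c r (j + s - (2 * s + 1) + (2 * s + 1))"
        unfolding c using pair[OF rj(1), of "j + s - (2 * s + 1)"] True rj by simp
      moreover have "j + s - (2 * s + 1) + (2 * s + 1) = j + s" using True rj by linarith
      ultimately have "c r (j + s) = 0" using a by (simp only: \<omega>_zero)
      then show ?thesis unfolding c using pair[OF rj(1,2)] by simp
    next
      case False
      then show ?thesis unfolding c using pair[OF rj(1,2)] by simp
    qed
  qed
  have b0: "\<omega> (b r j) v = 0" if v: "v \<in> L y" and rj: "r < R" "2 * j < l r" for v r j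
  proof -
    have "mpow (2 * j + 1) y *v b r (2 * j) = 0" using jordan_basis_mpow[OF jb rj] by simp
    then have "\<omega> (mpow j y *v b r (2 * j)) v = 0" using v unfolding L_def by blast
    then show ?thesis using jordan_basis_mpow[OF jb rj] by simp
  qed
  have d0: "\<omega> (d r j) v = 0" if v: "v \<in> L y" and rj: "r < R" "j < l r" "l r \<le> 2 * j" for v r j
  proof -
    have "mpow (2 * j + 1) y *v d r 0 = 0" using pow[OF rj(1)] rj by simp
    then have "\<omega> (mpow j y *v d r 0) v = 0" using v unfolding L_def by blast
    then show ?thesis using pow[OF rj(1)] rj by (simp add: \<omega>_simps)
  qed
  have expL: "v = (\<Sum>i\<in>I. \<omega> (b (fst i) (snd i)) v *s f i)" if v: "v \<in> L y" for v
  proof -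
    have "v = (\<Sum>r<R. \<Sum>j<l r. \<omega> (b r j) v *s d r j)" using expand[of v] by (simp add: comb_def)
    also have "\<dots> = (\<Sum>r<R. \<Sum>j\<in>{j. j < l r \<and> l r \<le> 2 * j}. \<omega> (b r j) v *s d r j)"
      by (intro sum.cong refl sum.mono_neutral_right) (auto simp: b0[OF v] not_le)
    also have "\<dots> = (\<Sum>i\<in>I. \<omega> (b (fst i) (snd i)) v *s f i)"
      unfolding I_def by (subst sum.Sigma) (auto simp: f_def intro!: sum.cong)
    finally show ?thesis .
  qed
  show "\<omega> u v = 0" if "u \<in> L y" "v \<in> L y" for u v
  proof -
    have "\<omega> u v = (\<Sum>i\<in>I. \<omega> (b (fst i) (snd i)) u * \<omega> (f i) v)"
      by (subst expL[OF that(1)]) (simp add: \<omega>_sum \<omega>_simps)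
    also have "\<dots> = 0" using d0[OF that(2)] by (intro sum.neutral) (auto simp: I_def f_def)
    finally show ?thesis .
  qed
  have "\<forall>i\<in>I. c i = 0" if c: "(\<Sum>i\<in>I. c i *s f i) = 0" for c
  proof
    fix i assume i: "i \<in> I"
    obtain r j where rj: "i = (r, j)" "r < R" "j < l r" using i unfolding I_def by auto
    have "0 = \<omega> (b r j) (\<Sum>i\<in>I. c i *s f i)" using c by simp
    also have "\<dots> = (\<Sum>i'\<in>I. if i' = i then c i' else 0)"
      unfolding \<omega>_sum \<omega>_simps by (intro sum.cong) (auto simp: d rj I_def f_def split: if_splits)
    also have "\<dots> = c i" using i finI by simp
    finally show "c i = 0" by simp
  qed
  then have ind: "inj_on f I" "vec.independent (f ` I)" using family_independent[OF finI, of f] by blast+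
  have "vec.span (f ` I) = L y"
  proof
    show "vec.span (f ` I) \<subseteq> L y"
      by (rule vec.span_minimal[OF _ subspace_L]) (auto simp: I_def f_def dL)
    show "L y \<subseteq> vec.span (f ` I)"
    proof
      fix v assume "v \<in> L y"
      from expL[OF this] show "v \<in> vec.span (f ` I)"
        by (rule ssubst) (intro vec.span_sum vec.span_scale vec.span_base imageI)
    qed
  qed
  moreover have "card (f ` I) = (\<Sum>x\<in>#p. x div 2)"
  proof -
    have "card {j. j < k \<and> k \<le> 2 * j} = k div 2" for k :: nat
    proof -
      have "{j. j < k \<and> k \<le> 2 * j} = {(k + 1) div 2..<k}" by auto
      then show ?thesis by simp
    qed
    then have "card I = (\<Sum>r<R. l r div 2)" unfolding I_def by (subst card_SigmaI) auto
    then show ?thesis using card_image[OF ind(1)] unfolding p by (simp add: sum_unfold_sum_mset image_mset.compositionality o_def)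
  qed
  ultimately show "\<exists>B. finite B \<and> vec.independent B \<and> vec.span B = L y \<and> card B = (\<Sum>x\<in>#p. x div 2)"
    using ind(2) finI by (intro exI[of _ "f ` I"]) simp
qed

end

section \<open>Conjugacy in the symplectic group\<close>

context symp
begin

lemma adj_mpoly: "adj (mpoly p A) = mpoly p (adj A)"
proof (induction p)
  case 0
  then show ?case using adj_mat[of 0] by simp
next
  case (pCons a p)
  then show ?case
    by (simp add: adj_add adj_mat adj_mult mpoly_commute)
qed

lemma selfadjoint_sqrt:
  assumes "adj t = t" and inj: "\<And>v. t *v v = 0 ==> v = 0"
  obtains s si where "s ** s = t" "adj s = s" "s ** si = mat 1" "si ** s = mat 1"
    "\<forall>A. t ** A = A ** t --> si ** A = A ** si"
proof -
  obtain p where p: "mpoly p t ** mpoly p t = t" using matrix_sqrt[OF inj] by blast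
  define s where "s = mpoly p t"
  have "v = 0" if "s *v v = 0" for v
  proof -
    have "t *v v = s *v (s *v v)" using p by (simp add: s_def matrix_vector_mul_assoc)
    then show ?thesis using that inj by simp
  qed
  then have "invertible s" by (rule matrix_inj_invertible)
  then obtain si where si: "s ** si = mat 1" "si ** s = mat 1" unfolding invertible_def by blast
  have comm: "s ** A = A ** s" if "t ** A = A ** t" for A unfolding s_def by (rule mpoly_commute[OF that])
  have comm': "si ** A = A ** si" if "t ** A = A ** t" for A
  proof -
    have "si ** A = si ** (A ** s) ** si" using si by (simp add: matrix_mul_assoc[symmetric])
    also have "\<dots> = (si ** s) ** A ** si" unfolding comm[OF that, symmetric] by (simp add: matrix_mul_assoc)
    finally show ?thesis using si by simp
  qed
  show thesis
  proof (rule that[OF _ _ si])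
    show "\<forall>A. t ** A = A ** t --> si ** A = A ** si" using comm' by blast
    show "s ** s = t" using p by (simp add: s_def)
    show "adj s = s" using assms(1) by (simp add: s_def adj_mpoly)
  qed
qed

text \<open>Polar decomposition: for an intertwiner \<open>g\<close>, the self-adjoint
  \<open>h = adj g ** g\<close> commutes with \<open>y\<close>. Dividing \<open>g\<close> by a
  self-adjoint square root of \<open>h\<close> that is a polynomial in \<open>h\<close> makes it
  symplectic and keeps it an intertwiner.\<close>

theorem Sp_conjugate:
  assumes y: "y \<in> sp \<omega>" "y' \<in> sp \<omega>" and jt: "jordan_type y p" "jordan_type y' p"
  shows "\<exists>k\<in>Sp. k ** y = y' ** k"
proof -
  obtain g where g: "g ** y = y' ** g" "\<And>v. g *v v = 0 ==> v = 0" using jordan_type_conjugate[OF jt] by blast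
  define h where "h = adj g ** g"
  have "adj (g ** y) = adj (y' ** g)" using g(1) by simp
  then have yg: "y ** adj g = adj g ** y'"
    using y unfolding adj_mult sp_iff by (simp add: matrix_mul_minus_left matrix_mul_minus_right)
  have hy: "h ** y = y ** h"
    unfolding h_def using g(1) yg by (metis matrix_mul_assoc)
  have "adj h = h" by (simp add: h_def adj_mult adj_adj)
  moreover have "v = 0" if "h *v v = 0" for v
  proof (rule g(2), rule nondeg)
    fix w
    obtain w' where w': "w = g *v w'"
      using matrix_inj_invertible[OF g(2)] unfolding invertible_def by (metis matrix_vector_mul_assoc matrix_vector_mul_lid)
    have "\<omega> (g *v v) (g *v w') = \<omega> (h *v v) w'" unfolding h_def matrix_vector_mul_assoc[symmetric] by (rule adj')
    then show "\<omega> (g *v v) w = 0" using that w' by simp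
  qed
  ultimately obtain s si where s: "s ** s = h" "adj s = s" "s ** si = mat 1" "si ** s = mat 1"
    and comm: "\<forall>A. h ** A = A ** h --> si ** A = A ** si"
    by (rule selfadjoint_sqrt)
  define k where "k = g ** si"
  have "adj si ** s = mat 1" using arg_cong[OF s(3), of adj] s(2) by (simp add: adj_mult adj_mat)
  then have "adj si ** (s ** s) ** si = mat 1" using s(3) by (simp add: matrix_mul_assoc)
  then have "adj k ** k = mat 1" unfolding k_def adj_mult s(1) h_def by (simp add: matrix_mul_assoc)
  then have "k \<in> Sp" by (simp add: Sp_iff)
  moreover have "k ** y = y' ** k"
  proof -
    have "k ** y = g ** (si ** y)" by (simp add: k_def matrix_mul_assoc)
    also have "\<dots> = g ** y ** si" unfolding comm[rule_format, OF hy] by (simp add: matrix_mul_assoc)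
    finally show ?thesis unfolding g(1) k_def by (simp add: matrix_mul_assoc)
  qed
  ultimately show ?thesis by blast
qed

lemma jordan_basis_conj:
  fixes s si :: "complex^'m^'m"
  assumes jb: "jordan_basis y R l b" and s: "s ** si = mat 1" "si ** s = mat 1"
  shows "jordan_basis (s ** y ** si) R l (\<lambda>r j. s *v b r j)"
proof -
  have comb: "comb R l c (\<lambda>r j. s *v b r j) = s *v comb R l c b" for c
    by (simp add: comb_def matrix_vector_sum vector_scalar_commute)
  have si: "si *v (s *v v) = v" "s *v (si *v v) = v" for v using s by (simp_all add: matrix_vector_mul_assoc)
  have act: "(s ** y ** si) *v (s *v v) = s *v (y *v v)" for v
    using si(1)[of v] by (simp flip: matrix_vector_mul_assoc)
  have ch: "\<And>r. r < R ==> 0 < l r" "\<And>r. r < R ==> y *v b r 0 = 0" "\<And>r j. r < R ==> Suc j < l r ==> y *v b r (Suc j) = b r j"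
    "\<And>c. comb R l c b = 0 ==> \<forall>r<R. \<forall>j<l r. c r j = 0" "\<And>u. \<exists>c. u = comb R l c b"
    using jb unfolding jordan_basis_def chains_def by blast+
  have "\<exists>c. u = comb R l c (\<lambda>r j. s *v b r j)" for u
    using ch(5)[of "si *v u"] si(2)[of u] unfolding comb by metis
  moreover have "\<forall>r<R. \<forall>j<l r. c r j = 0" if "comb R l c (\<lambda>r j. s *v b r j) = 0" for c
    using si(1)[of "comb R l c b"] that unfolding comb by (intro ch(4)) simp
  ultimately show ?thesis unfolding jordan_basis_def chains_def act using ch(1-3) by simp
qed

lemma matrix_of_form: "\<omega> (transpose (S ** matrix_inv J) *v v) w = (\<Sum>a\<in>UNIV. v $ a * (S *v w) $ a)"
  for S :: "complex^'m^'m"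
proof -
  have "\<omega> (transpose (S ** matrix_inv J) *v v) w = (\<Sum>a\<in>UNIV. (transpose (S ** matrix_inv J) *v v) $ a * (J *v w) $ a)"
    by (rule \<omega>_J)
  also have "\<dots> = (\<Sum>a\<in>UNIV. v $ a * (transpose (transpose (S ** matrix_inv J)) *v (J *v w)) $ a)"
    by (rule sum_transpose)
  also have "transpose (transpose (S ** matrix_inv J)) *v (J *v w) = S *v w"
    unfolding transpose_transpose matrix_vector_mul_assoc matrix_mul_assoc[symmetric] J_inv by simp
  finally show ?thesis .
qed

text \<open>A standard nilpotent \<open>y0\<close> preserves, infinitesimally, an alternating form
  with matrix \<open>S\<close>. That form is \<open>\<omega> (h *v v) w\<close> for a self-adjoint
  injective \<open>h\<close>; a self-adjoint square root \<open>s\<close> of \<open>h\<close>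
  carries it to \<open>\<omega>\<close>, so conjugation by \<open>s\<close> moves \<open>y0\<close>
  into \<open>sp \<omega>\<close>.\<close>

theorem even_type_exists:
  assumes even: "\<And>k. k \<in># p ==> even k" "0 \<notin># p" and sum: "sum_mset p = CARD('m)"
  shows "\<exists>y\<in>sp \<omega>. jordan_type y p"
proof -
  obtain xs where xs: "p = mset xs" using ex_mset by metis
  define R where "R = length xs"
  define l where "l r = xs ! r" for r
  have l: "even (l r)" "0 < l r" if "r < R" for r
  proof -
    have "l r \<in># p" using that nth_mem[of r xs] unfolding R_def l_def xs by simp
    then show "even (l r)" "0 < l r" using even by (auto intro: gr0I)
  qed
  have p: "p = image_mset l (mset_set {..<R})"
    unfolding xs l_def R_def by (metis atLeast0LessThan map_nth mset_map mset_upt)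
  define I where "I = (SIGMA r:{..<R}. {..<l r})"
  have "card I = (\<Sum>r<R. l r)" unfolding I_def by simp
  also have "\<dots> = CARD('m)" using sum unfolding p by (simp add: sum_unfold_sum_mset)
  finally have cardI: "card I = CARD('m)" .
  have "finite I" unfolding I_def by auto
  then obtain t :: "nat \<times> nat => 'm" where t: "bij_betw t I UNIV"
    using cardI finite_same_card_bij[of I "UNIV :: 'm set"] by auto
  define \<psi> where "\<psi> = inv_into I t"
  have \<psi>\<phi>: "\<psi> (t i) = i" if "i \<in> I" for i unfolding \<psi>_def using t that by (simp add: bij_betw_inv_into_left)
  have \<phi>\<psi>: "t (\<psi> a) = a" "\<psi> a \<in> I" for a unfolding \<psi>_def using t
    by (auto simp: bij_betw_inv_into_right bij_betw_def inv_into_into)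
  have I: "(r, j) \<in> I \<longleftrightarrow> r < R \<and> j < l r" for r j unfolding I_def by simp
  have sumI: "(\<Sum>a\<in>UNIV. f a) = (\<Sum>r<R. \<Sum>j<l r. f (t (r, j)))" for f :: "'m => complex"
    unfolding sum.reindex_bij_betw[OF t, symmetric] I_def by (subst sum.Sigma) (auto intro!: sum.cong)
  define y0 :: "complex^'m^'m" where
    "y0 = (\<chi> a c. case \<psi> a of (r, j) => if Suc j < l r \<and> c = t (r, Suc j) then 1 else 0)"
  have y0: "(y0 *v v) $ t (r, j) = (if Suc j < l r then v $ t (r, Suc j) else 0)" if "r < R" "j < l r" for v r j
  proof -
    have "(y0 *v v) $ t (r, j) = (\<Sum>c\<in>UNIV. if c = t (r, Suc j) then (if Suc j < l r then v $ c else 0) else 0)"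
      unfolding matrix_vector_mult_def y0_def vec_lambda_beta
      by (intro sum.cong refl) (use \<psi>\<phi>[of "(r, j)"] that I in auto)
    then show ?thesis by simp
  qed
  \<comment> \<open>Pairs the position \<open>j\<close> of a block with the position
    \<open>l r - Suc j\<close>, with sign alternating in \<open>j\<close>. The signs make
    \<open>y0\<close> skew, and the even block lengths make the form alternating.\<close>
  define S :: "complex^'m^'m" where
    "S = (\<chi> a c. case \<psi> a of (r, j) => if c = t (r, l r - Suc j) then (-1) ^ j else 0)"
  have S: "(S *v w) $ t (r, j) = (-1) ^ j * w $ t (r, l r - Suc j)" if "r < R" "j < l r" for w r j
  proof -
    have "(S *v w) $ t (r, j) = (\<Sum>c\<in>UNIV. if c = t (r, l r - Suc j) then (-1) ^ j * w $ c else 0)"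
      unfolding matrix_vector_mult_def S_def vec_lambda_beta
      by (intro sum.cong refl) (use \<psi>\<phi>[of "(r, j)"] that I in auto)
    then show ?thesis by simp
  qed
  define h where "h = transpose (S ** matrix_inv J)"
  have h: "\<omega> (h *v v) w = (\<Sum>r<R. \<Sum>j<l r. (-1) ^ j * v $ t (r, j) * w $ t (r, l r - Suc j))" for v w
    unfolding h_def matrix_of_form sumI by (intro sum.cong refl) (simp add: S)
  have \<theta>_skew: "\<omega> (h *v v) w = - \<omega> (h *v w) v" for v w
  proof -
    have "(\<Sum>j<l r. (-1) ^ j * v $ t (r, j) * w $ t (r, l r - Suc j)) =
      - (\<Sum>j<l r. (-1) ^ j * w $ t (r, j) * v $ t (r, l r - Suc j))" if r: "r < R" for r
    proof -
      have "(\<Sum>j<l r. (-1) ^ j * v $ t (r, j) * w $ t (r, l r - Suc j)) =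
        (\<Sum>j<l r. (-1) ^ (l r - Suc j) * v $ t (r, l r - Suc j) * w $ t (r, l r - Suc (l r - Suc j)))"
        by (rule sum.nat_diff_reindex[symmetric])
      also have "\<dots> = (\<Sum>j<l r. - ((-1) ^ j * w $ t (r, j) * v $ t (r, l r - Suc j)))"
      proof (intro sum.cong refl)
        fix j assume j: "j \<in> {..<l r}"
        then have "l r - Suc (l r - Suc j) = j" by auto
        moreover have "(-1) ^ (l r - Suc j) = - ((-1 :: complex) ^ j)"
          using j l(1)[OF r] by (auto simp: minus_one_power_iff)
        ultimately show "(-1) ^ (l r - Suc j) * v $ t (r, l r - Suc j) * w $ t (r, l r - Suc (l r - Suc j)) =
          - ((-1) ^ j * w $ t (r, j) * v $ t (r, l r - Suc j))" by simp
      qed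
      finally show ?thesis by (simp add: sum_negf)
    qed
    then show ?thesis unfolding h by (simp add: sum_negf)
  qed
  have "adj h = h"
  proof (rule matrix_eq_\<omega>)
    fix v w show "\<omega> v (adj h *v w) = \<omega> v (h *v w)"
      unfolding adj[symmetric] using \<theta>_skew[of v w] \<omega>_skew[of v "h *v w"] by simp
  qed
  moreover have "v = 0" if "h *v v = 0" for v
  proof -
    have "v $ a = 0" for a
    proof -
      obtain r j where a: "\<psi> a = (r, j)" by (cases "\<psi> a")
      then have rj: "r < R" "j < l r" "a = t (r, j)" using \<phi>\<psi>[of a] I by auto
      have ax: "axis (t (r, l r - Suc j)) (1::complex) $ t (r', l r' - Suc j') = (if r' = r \<and> j' = j then 1 else 0)"
        if "r' < R" "j' < l r'" for r' j'
      proof -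
        have "t (r', l r' - Suc j') = t (r, l r - Suc j) \<longleftrightarrow> (r', l r' - Suc j') = (r, l r - Suc j)"
          using \<psi>\<phi>[of "(r', l r' - Suc j')"] \<psi>\<phi>[of "(r, l r - Suc j)"] I that rj by (metis diff_Suc_less gr_implies_not0 not_gr_zero)
        also have "\<dots> \<longleftrightarrow> r' = r \<and> j' = j" using that rj by auto
        finally show ?thesis by (simp add: axis_def)
      qed
      have "\<omega> (h *v v) (axis (t (r, l r - Suc j)) 1) =
        (\<Sum>r'<R. \<Sum>j'<l r'. if r' = r then (if j' = j then (-1) ^ j' * v $ t (r', j') else 0) else 0)"
        unfolding h by (intro sum.cong refl) (auto simp: ax)
      also have "\<dots> = (\<Sum>r'<R. if r' = r then (\<Sum>j'<l r'. if j' = j then (-1) ^ j' * v $ t (r', j') else 0) else 0)"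
        by (intro sum.cong) auto
      also have "\<dots> = (-1) ^ j * v $ a" using rj by simp
      finally show ?thesis using that by simp
    qed
    then show ?thesis by (simp add: vec_eq_iff)
  qed
  ultimately obtain s si where s: "s ** s = h" "adj s = s" "s ** si = mat 1" "si ** s = mat 1"
    and "\<forall>A. h ** A = A ** h --> si ** A = A ** si"
    by (rule selfadjoint_sqrt)
  define y where "y = s ** y0 ** si"
  have y0_skew: "\<omega> (h *v (y0 *v v)) w + \<omega> (h *v v) (y0 *v w) = 0" for v w
  proof -
    have "(\<Sum>j<l r. (-1) ^ j * (y0 *v v) $ t (r, j) * w $ t (r, l r - Suc j)) +
        (\<Sum>j<l r. (-1) ^ j * v $ t (r, j) * (y0 *v w) $ t (r, l r - Suc j)) = 0" if r: "r < R" for r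
    proof -
      obtain n where n: "l r = Suc n" using l(2)[OF r] by (cases "l r") auto
      have "(\<Sum>j<l r. (-1) ^ j * (y0 *v v) $ t (r, j) * w $ t (r, l r - Suc j)) =
        (\<Sum>j<n. (-1) ^ j * v $ t (r, Suc j) * w $ t (r, n - j))"
        using y0[OF r] n by simp
      moreover have "(\<Sum>j<l r. (-1) ^ j * v $ t (r, j) * (y0 *v w) $ t (r, l r - Suc j)) =
        (\<Sum>j<n. - ((-1) ^ j * v $ t (r, Suc j) * w $ t (r, n - j)))"
        unfolding n sum.lessThan_Suc_shift using y0[OF r] n
        by (auto intro!: sum.cong simp: Suc_diff_Suc)
      ultimately show ?thesis by (simp add: sum_negf)
    qed
    then show ?thesis unfolding h by (simp flip: sum.distrib)
  qed
  have "y \<in> sp \<omega>"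
    unfolding sp_def
  proof (intro CollectI allI)
    fix v w
    define v' w' where "v' = si *v v" and "w' = si *v w"
    have v': "v = s *v v'" "w = s *v w'" unfolding v'_def w'_def using s(3) by (simp_all add: matrix_vector_mul_assoc)
    have ys: "y *v (s *v u) = s *v (y0 *v u)" for u
      unfolding y_def using s(4) by (simp add: matrix_vector_mul_assoc matrix_mul_assoc[symmetric])
    have ss: "\<omega> (s *v u) (s *v u') = \<omega> (h *v u) u'" for u u'
      using adj'[of "s *v u" s u'] s(1,2) by (simp add: matrix_vector_mul_assoc)
    show "\<omega> (y *v v) w + \<omega> v (y *v w) = 0"
      unfolding v' ys ss by (rule y0_skew)
  qed
  moreover have "jordan_basis y0 R l (\<lambda>r j. axis (t (r, j)) 1)"
  proof -
    have ax: "axis (t (r, j)) (1::complex) $ t (r', j') = (if r' = r \<and> j' = j then 1 else 0)"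
      if "r < R" "j < l r" "r' < R" "j' < l r'" for r j r' j'
      using \<psi>\<phi>[of "(r, j)"] \<psi>\<phi>[of "(r', j')"] I that by (auto simp: axis_def)
    have vecI: "v = w" if "\<And>r j. r < R ==> j < l r ==> v $ t (r, j) = w $ t (r, j)" for v w :: "complex^'m"
      unfolding vec_eq_iff
    proof
      fix a obtain r j where "\<psi> a = (r, j)" by (cases "\<psi> a")
      then show "v $ a = w $ a" using \<phi>\<psi>[of a] I that[of r j] by auto
    qed
    have comp: "comb R l c (\<lambda>r j. axis (t (r, j)) 1) $ t (r, j) = c r j" if rj: "r < R" "j < l r" for c r j
    proof -
      have "comb R l c (\<lambda>r j. axis (t (r, j)) 1) $ t (r, j) =
        (\<Sum>r'<R. \<Sum>j'<l r'. if r' = r then (if j' = j then c r' j' else 0) else 0)"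
        unfolding comb_def sum_component by (intro sum.cong refl) (use ax rj in auto)
      also have "\<dots> = (\<Sum>r'<R. if r' = r then (\<Sum>j'<l r'. if j' = j then c r' j' else 0) else 0)"
        by (intro sum.cong) auto
      finally show ?thesis using rj by simp
    qed
    have "y0 *v axis (t (r, 0)) 1 = 0" if "r < R" for r
      by (rule vecI) (use y0 ax that l(2) in auto)
    moreover have "y0 *v axis (t (r, Suc j)) 1 = axis (t (r, j)) 1" if "r < R" "Suc j < l r" for r j
      by (rule vecI) (use y0 ax that in auto)
    moreover have "\<forall>r<R. \<forall>j<l r. c r j = 0" if "comb R l c (\<lambda>r j. axis (t (r, j)) 1) = 0" for c
    proof (intro allI impI)
      fix r j assume "r < R" "j < l r"
      from comp[OF this, of c] show "c r j = 0" unfolding that by simp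
    qed
    moreover have "\<exists>c. u = comb R l c (\<lambda>r j. axis (t (r, j)) 1)" for u
      by (intro exI[of _ "\<lambda>r j. u $ t (r, j)"] vecI) (simp add: comp)
    ultimately show ?thesis unfolding jordan_basis_def chains_def using l(2) by simp
  qed
  from jordan_basis_conj[OF this s(3,4)] have "jordan_type y p"
    unfolding jordan_type_iff y_def using p by blast
  ultimately show ?thesis by blast
qed

end

section \<open>Linear coordinates on the phase space\<close>

context affine_chart
begin

lemma chart_basis: "inj_on e {..<N}" "independent (e ` {..<N})" "span (e ` {..<N}) = W"
proof -
  have ind: "\<forall>k<N. t k = 0" if "(\<Sum>k<N. sc (t k) (e k)) = 0" for t
  proof (intro allI impI)
    fix k assume k: "k < N"
    have "t k = x k 0" using x_pt[OF k, of t] that by simp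
    also have "\<dots> = 0" using linear_scale[OF linear_x[OF k], of 0 0] by simp
    finally show "t k = 0" .
  qed
  show inj: "inj_on e {..<N}"
  proof (rule inj_onI, rule ccontr)
    fix i j assume ij: "i \<in> {..<N}" "j \<in> {..<N}" "e i = e j" "i \<noteq> j"
    define t :: "nat => complex" where "t k = (if k = i then 1 else if k = j then - 1 else 0)" for k
    have "(\<Sum>k<N. sc (t k) (e k)) = (\<Sum>k\<in>{i, j}. sc (t k) (e k))"
      using ij by (intro sum.mono_neutral_right) (auto simp: t_def)
    also have "\<dots> = 0" using ij by (simp add: t_def)
    finally have "t i = 0" using ind ij by blast
    then show False by (simp add: t_def)
  qed
  show "independent (e ` {..<N})"
  proof (rule independent_if_scalars_zero)
    fix f v assume f: "(\<Sum>v\<in>e ` {..<N}. sc (f v) v) = 0" and v: "v \<in> e ` {..<N}"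
    have "(\<Sum>k<N. sc (f (e k)) (e k)) = 0" using f inj by (simp add: sum.reindex)
    then show "f v = 0" using ind[of "\<lambda>k. f (e k)"] v by auto
  qed simp
  show "span (e ` {..<N}) = W"
  proof
    have e: "e k \<in> W" if "k < N" for k
    proof -
      have "(\<Sum>i<N. sc (if i = k then 1 else 0) (e i)) = (\<Sum>i<N. if i = k then e i else 0)"
        by (intro sum.cong) auto
      then show ?thesis using pt_in[of "\<lambda>i. if i = k then 1 else 0"] that by simp
    qed
    have "subspace W"
    proof (rule subspaceI)
      show "0 \<in> W" using pt_in[of "\<lambda>_. 0"] by simp
      fix p q assume "p \<in> W" "q \<in> W"
      then show "p + q \<in> W" using line_W[of p q 1] by simp
    next
      fix c p assume p: "p \<in> W"
      have "0 \<in> W" using pt_in[of "\<lambda>_. 0"] by simp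
      then show "sc c p \<in> W" using line_W[OF _ p, of 0 c] by simp
    qed
    then show "span (e ` {..<N}) \<subseteq> W" using e by (intro span_minimal) auto
    show "W \<subseteq> span (e ` {..<N})"
    proof
      fix p assume "p \<in> W"
      have "(\<Sum>k<N. sc (x k p) (e k)) \<in> span (e ` {..<N})" by (intro span_sum span_scale span_base) auto
      then show "p \<in> span (e ` {..<N})" using pt_x[OF \<open>p \<in> W\<close>] by simp
    qed
  qed
qed

lemma chart_dim: "dim W = N"
  using dim_eq_card[of "e ` {..<N}" W] chart_basis card_image[of e "{..<N}"] span_span
  by (metis card_lessThan)

lemma chart_subspace: "subspace W"
  using chart_basis(3) subspace_span by metis

lemma chart_finite_dimensional: "W = UNIV ==> finite_dimensional_vector_space sc (e ` {..<N})"
  by unfold_locales (use chart_basis in auto)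

end

abbreviation mscale :: "complex => complex^'m^'m => complex^'m^'m" where
  "mscale c A \<equiv> map_matrix ((*) c) A"

lemma mscale_component [simp]: "mscale c A $ a $ b = c * A $ a $ b"
  by (simp add: map_matrix_def)

lemma vector_space_mscale: "vector_space (mscale :: complex => complex^'m^'m => _)"
  by unfold_locales (simp_all add: vec_eq_iff algebra_simps)

lemma linear_mscaleI:
  assumes "\<And>A B. f (A + B) = f A + f B" "\<And>c A. f (mscale c A) = c * f A"
  shows "Vector_Spaces.linear (mscale :: complex => complex^'m^'m => _) (*) f"
  by (simp add: Vector_Spaces.linear_iff vector_space_mscale assms vector_space_over_itself.vector_space_axioms)

lemma linear_cscaleI:
  assumes "\<And>p q. f (p + q) = f p + f q" "\<And>c p. f (cscale c p) = c * f p"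
  shows "functional cscale f"
  by (simp add: Vector_Spaces.linear_iff vector_space_cscale assms vector_space_over_itself.vector_space_axioms)

lemma mscale_mult: "mscale c A ** B = mscale c (A ** B)" "A ** mscale c B = mscale c (A ** B)"
  for A B :: "complex^'m^'m::finite"
  by (simp_all add: vec_eq_iff matrix_matrix_mult_def sum_distrib_left mult_ac)

lemma mscale_mult_vec: "mscale c A *v v = c *s (A *v v)" for A :: "complex^'m^'m::finite"
  by (simp add: map_matrix_def matrix_vector_mult_def vec_eq_iff sum_distrib_left mult.assoc)

lemma trace_mscale: "trace (mscale c A) = c * trace (A :: complex^'m^'m::finite)"
  by (simp add: trace_def sum_distrib_left)

lemma trace_plus: "trace (A + B) = trace A + trace (B :: complex^'m^'m::finite)"
  by (simp add: trace_def sum.distrib)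

lemma matrix_chart: "\<exists>N e x. affine_chart (mscale :: complex => complex^'m^'m::finite => _) UNIV N e x"
proof -
  define N where "N = card (UNIV :: ('m \<times> 'm) set)"
  obtain s where s: "bij_betw s {..<N} (UNIV :: ('m \<times> 'm) set)"
    using ex_bij_betw_nat_finite[of "UNIV :: ('m \<times> 'm) set"] by (auto simp: N_def atLeast0LessThan)
  define e :: "nat => complex^'m^'m" where "e k = (\<chi> a b. if (a, b) = s k then 1 else 0)" for k
  define x where "x k A = A $ fst (s k) $ snd (s k)" for k and A :: "complex^'m^'m"
  have comp: "(\<Sum>k<N. mscale (t k) (e k)) $ a $ b = (\<Sum>k<N. if s k = (a, b) then t k else 0)" for t a b
    by (simp add: sum_component e_def) (intro sum.cong, auto)
  have x_pt: "x k (\<Sum>k<N. mscale (t k) (e k)) = t k" if "k < N" for t k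
  proof -
    have "x k (\<Sum>k<N. mscale (t k) (e k)) = (\<Sum>j<N. if j = k then t j else 0)"
      unfolding x_def comp using s that by (intro sum.cong) (auto simp: bij_betw_def inj_on_def)
    then show ?thesis using that by simp
  qed
  have pt_x: "(\<Sum>k<N. mscale (x k A) (e k)) = A" for A
  proof -
    have "(\<Sum>k<N. if s k = (a, b) then x k A else 0) = A $ a $ b" for a b
    proof -
      obtain k0 where k0: "k0 < N" "s k0 = (a, b)" using s by (metis UNIV_I bij_betw_iff_bijections lessThan_iff)
      have "(\<Sum>k<N. if s k = (a, b) then x k A else 0) = (\<Sum>k<N. if k = k0 then x k A else 0)"
        using s k0 by (intro sum.cong) (auto simp: bij_betw_def inj_on_def)
      then show ?thesis using k0 by (simp add: x_def)
    qed
    then show ?thesis unfolding vec_eq_iff comp by blast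
  qed
  have "affine_chart mscale UNIV N e x"
  proof (intro affine_chart.intro affine_chart_axioms.intro vector_space_mscale linear_mscaleI)
    show "x k (\<Sum>k<N. mscale (t k) (e k)) = t k" if "k < N" for k t
      by (rule x_pt[OF that])
    show "(\<Sum>k<N. mscale (x k A) (e k)) = A" for A
      by (rule pt_x)
  qed (simp_all add: x_def)
  then show ?thesis by blast
qed

lemma sum_triple: "(\<Sum>k\<in>K. (f k, g k, h k)) = (\<Sum>k\<in>K. f k, \<Sum>k\<in>K. g k, \<Sum>k\<in>K. h k)"
  by (induction K rule: infinite_finite_induct) (auto simp: zero_prod_def)

lemma triple_chart:
  fixes W1 :: "(complex^'m^'m::finite) set"
  assumes "affine_chart mscale W1 N1 e1 x1"
  shows "\<exists>e x. affine_chart (cscale :: complex => 'm triple => _) (W1 \<times> W1 \<times> UNIV) (N1 + N1 + CARD('m)) e x"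
proof -
  interpret C: affine_chart mscale W1 N1 e1 x1 by (rule assms)
  obtain r where r: "bij_betw r {..<CARD('m)} (UNIV :: 'm set)"
    using ex_bij_betw_nat_finite[of "UNIV :: 'm set"] by (auto simp: atLeast0LessThan)
  define N where "N = N1 + N1 + CARD('m)"
  define e :: "nat => 'm triple" where "e k = (if k < N1 then (e1 k, 0, 0) else if k < N1 + N1 then (0, e1 (k - N1), 0)
    else (0, 0, axis (r (k - (N1 + N1))) 1))" for k
  define x :: "nat => 'm triple => complex" where "x k p = (if k < N1 then x1 k (fst p) else if k < N1 + N1 then x1 (k - N1) (fst (snd p))
    else snd (snd p) $ r (k - (N1 + N1)))" for k p
  have mz: "mscale c 0 = 0" for c by (simp add: vec_eq_iff)
  have comp: "(\<Sum>k<N. cscale (t k) (e k)) = (\<Sum>k<N1. mscale (t k) (e1 k), \<Sum>k<N1. mscale (t (N1 + k)) (e1 k),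
      \<Sum>k<CARD('m). t (N1 + N1 + k) *s axis (r k) 1)" for t
    unfolding N_def sum_lessThan_add
    by (simp add: e_def cscale_def sum_triple mz)
  have ax: "(\<Sum>k<CARD('m). u k *s axis (r k) 1) $ r j = u j" if "j < CARD('m)" for u :: "nat => complex" and j
  proof -
    have "(\<Sum>k<CARD('m). u k *s axis (r k) 1) $ r j = (\<Sum>k<CARD('m). if k = j then u k else 0)"
      unfolding sum_component using r that by (intro sum.cong) (auto simp: bij_betw_def inj_on_def axis_def)
    then show ?thesis using that by simp
  qed
  have "affine_chart cscale (W1 \<times> W1 \<times> UNIV) N e x"
  proof (intro affine_chart.intro affine_chart_axioms.intro vector_space_cscale linear_cscaleI)
    show "x k (p + q) = x k p + x k q" if "k < N" for k p q
      using that by (auto simp: x_def C.linear_add[OF C.linear_x])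
    show "x k (cscale c p) = c * x k p" if "k < N" for k c p
      using that by (auto simp: x_def cscale_def split_beta C.linear_scale[OF C.linear_x])
    show "(\<Sum>k<N. cscale (t k) (e k)) \<in> W1 \<times> W1 \<times> UNIV" for t
      unfolding comp by (simp add: C.pt_in)
    show "x k (\<Sum>k<N. cscale (t k) (e k)) = t k" if k: "k < N" for k t
    proof -
      consider "k < N1" | "\<not> k < N1" "k < N1 + N1" | "\<not> k < N1 + N1" by blast
      then show ?thesis
      proof cases
        case 1
        then show ?thesis unfolding comp x_def by (simp add: C.x_pt)
      next
        case 2
        then show ?thesis unfolding comp x_def using C.x_pt[of "k - N1" "\<lambda>k. t (N1 + k)"] by simp
      next
        case 3
        then show ?thesis unfolding comp x_def using k ax[of "k - (N1 + N1)" "\<lambda>k. t (N1 + N1 + k)"] by (simp add: N_def)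
      qed
    qed
    show "(\<Sum>k<N. cscale (x k p) (e k)) = p" if p: "p \<in> W1 \<times> W1 \<times> UNIV" for p
    proof -
      obtain A B i where p': "p = (A, B, i)" "A \<in> W1" "B \<in> W1" using p by auto
      have "(\<Sum>k<CARD('m). i $ r k *s axis (r k) 1) = i"
        using sum.reindex_bij_betw[OF r, of "\<lambda>a. i $ a *s axis a 1"] by (simp add: basis_expansion)
      then show ?thesis unfolding comp p' using C.pt_x[OF p'(2)] C.pt_x[OF p'(3)] by (simp add: x_def)
    qed
  qed
  then show ?thesis unfolding N_def by blast
qed

section \<open>Trace duality on \<open>sp\<close> and its dimension\<close>

context symp
begin

lemma sp_closed: "A \<in> sp \<omega> ==> B \<in> sp \<omega> ==> A + B \<in> sp \<omega>" "A \<in> sp \<omega> ==> mscale c A \<in> sp \<omega>" "0 \<in> sp \<omega>"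
  "A \<in> sp \<omega> ==> - A \<in> sp \<omega>"
proof -
  note simps = matrix_vector_mult_add_rdistrib mscale_mult_vec \<omega>_simps matrix_vector_mult_minus_left
  show "A + B \<in> sp \<omega>" if A: "A \<in> sp \<omega>" and B: "B \<in> sp \<omega>"
    unfolding sp_def by (simp add: simps spD[OF A] spD[OF B])
  show "mscale c A \<in> sp \<omega>" if A: "A \<in> sp \<omega>"
    unfolding sp_def by (simp add: simps spD[OF A])
  show "0 \<in> sp \<omega>"
    unfolding sp_def by (simp add: simps)
  show "- A \<in> sp \<omega>" if A: "A \<in> sp \<omega>"
    unfolding sp_def by (simp add: simps spD[OF A])
qed

lemma sq_sp: "sq i \<in> sp \<omega>"
  by (rule sym_square_in_sp[OF form])

lemma commutator_sp:
  assumes A: "A \<in> sp \<omega>" and B: "B \<in> sp \<omega>"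
  shows "commutator A B \<in> sp \<omega>"
  unfolding sp_def commutator_def
  by (simp add: matrix_vector_mult_diff_rdistrib \<omega>_diff spD[OF A] spD[OF B] flip: matrix_vector_mul_assoc)

lemma subspace_sp: "module.subspace mscale (sp \<omega>)"
proof -
  interpret vector_space "mscale :: complex => complex^'m^'m => _" by (rule vector_space_mscale)
  show ?thesis by (intro subspaceI sp_closed)
qed

text \<open>Testing against squares gives \<open>\<omega> u (v *v u) = 0\<close> for all
  \<open>u\<close>. For \<open>v \<in> sp \<omega>\<close> the form
  \<open>\<omega> u (v *v w)\<close> is symmetric, so it vanishes by polarization.\<close>

lemma trace_sp_nondeg:
  assumes v: "v \<in> sp \<omega>" and tr: "\<And>w. w \<in> sp \<omega> ==> trace (v ** w) = 0"
  shows "v = 0"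
proof -
  have q: "\<omega> u (v *v u) = 0" for u
    using tr[OF sq_sp[of u]] trace_sq[of u v] trace_mul_sym[of v "sq u"] by simp
  have "\<omega> u (v *v w) = 0" for u w
  proof -
    have "\<omega> (u + w) (v *v (u + w)) = \<omega> u (v *v w) + \<omega> w (v *v u)"
      by (simp add: matrix_vector_right_distrib \<omega>_simps q)
    moreover have "\<omega> w (v *v u) = \<omega> u (v *v w)"
      using spD[OF v, of w u] \<omega>_skew[of u "v *v w"] by simp
    ultimately show ?thesis using q[of "u + w"] by simp
  qed
  then have "v *v w = 0 *v w" for w using nondeg'[of "v *v w"] by simp
  then show ?thesis by (simp add: matrix_eq)
qed

lemma trace_linear:
  "Vector_Spaces.linear (mscale :: complex => complex^'m^'m => _) (*) (\<lambda>w. trace (v ** w))"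
  "Vector_Spaces.linear (mscale :: complex => complex^'m^'m => _) (*) (\<lambda>v. trace (v ** w))"
  by (intro linear_mscaleI; simp add: matrix_add_ldistrib matrix_add_rdistrib mscale_mult trace_mscale trace_plus)+

text \<open>Trace duality: the image of \<open>ad y\<close> is the orthogonal complement of its kernel.\<close>

lemma sp_image_ad:
  assumes y: "y \<in> sp \<omega>" and u: "u \<in> sp \<omega>"
    and tr: "\<And>z. z \<in> sp \<omega> ==> z ** y = y ** z ==> trace (u ** z) = 0"
  shows "\<exists>x\<in>sp \<omega>. commutator x y = u"
proof -
  obtain N e x where ch: "affine_chart (mscale :: complex => complex^'m^'m => _) UNIV N e x" using matrix_chart by blast
  interpret fd: finite_dimensional_vector_space "mscale :: complex => complex^'m^'m => _" "e ` {..<N}"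
    by (rule affine_chart.chart_finite_dimensional[OF ch refl])
  define U where "U = (\<lambda>x. commutator x y) ` sp \<omega>"
  have subU: "fd.subspace U"
  proof (rule fd.subspaceI)
    show "0 \<in> U" unfolding U_def using sp_closed(3) by (intro image_eqI[of _ _ 0]) (auto simp: commutator_def)
    fix A B assume "A \<in> U" "B \<in> U"
    then obtain a b where "a \<in> sp \<omega>" "b \<in> sp \<omega>" "A = commutator a y" "B = commutator b y" unfolding U_def by blast
    then show "A + B \<in> U" unfolding U_def
      by (intro image_eqI[of _ _ "a + b"] sp_closed) (auto simp: commutator_def matrix_add_ldistrib matrix_add_rdistrib)
  next
    fix c A assume "A \<in> U"
    then obtain a where "a \<in> sp \<omega>" "A = commutator a y" unfolding U_def by blast
    then show "mscale c A \<in> U" unfolding U_def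
      by (intro image_eqI[of _ _ "mscale c a"] sp_closed) (auto simp: commutator_def mscale_mult vec_eq_iff right_diff_distrib)
  qed
  have "u \<in> U"
  proof (rule fd.double_perp[OF subspace_sp subU _ trace_linear trace_sp_nondeg u])
    show "U \<subseteq> sp \<omega>" unfolding U_def using commutator_sp y by blast
    fix w assume w: "w \<in> sp \<omega>" "\<And>u. u \<in> U ==> trace (u ** w) = 0"
    have "commutator y w = 0"
    proof (rule trace_sp_nondeg[OF commutator_sp[OF y w(1)]])
      fix s assume s: "s \<in> sp \<omega>"
      have "trace (commutator s y ** w) = 0" using w(2) s unfolding U_def by blast
      also have "trace (commutator s y ** w) = trace (s ** (y ** w)) - trace (y ** (s ** w))"
        unfolding commutator_def matrix_diff_rdistrib trace_diff matrix_mul_assoc ..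
      also have "trace (y ** (s ** w)) = trace (s ** (w ** y))"
        by (subst trace_mul_sym) (simp only: matrix_mul_assoc)
      also have "trace (s ** (y ** w)) - trace (s ** (w ** y)) = trace (commutator y w ** s)"
        unfolding commutator_def trace_diff[symmetric] matrix_diff_ldistrib[symmetric] by (rule trace_mul_sym)
      finally show "trace (commutator y w ** s) = 0" by simp
    qed
    then have "w ** y = y ** w" by (simp add: commutator_def)
    then show "trace (u ** w) = 0" using tr w(1) by blast
  qed
  then show ?thesis unfolding U_def by blast
qed

text \<open>By trace duality it suffices that \<open>trace (sq i ** z) = 0\<close> for
  \<open>z\<close> centralizing \<open>y\<close>. This trace is half of
  \<open>\<omega> i (z *v i)\<close>, where \<open>z *v i\<close> lies in the isotropic space
  \<open>L y\<close> along with \<open>i\<close>.\<close>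

lemma fibre_exists:
  assumes y: "y \<in> sp \<omega>" "jordan_type y p" and i: "i \<in> L y"
  shows "\<exists>x\<in>sp \<omega>. commutator x y + sq i = 0"
proof -
  have "trace (- sq i ** z) = 0" if z: "z \<in> sp \<omega>" "z ** y = y ** z" for z
  proof -
    have "\<omega> i (z *v i) = 0" by (rule L_isotropic[OF y i L_commute[OF i z]])
    then have "trace (sq i ** z) = 0" by (simp add: trace_sq)
    then show ?thesis by (simp add: matrix_mul_minus_left trace_def sum_negf)
  qed
  then obtain x where "x \<in> sp \<omega>" "commutator x y = - sq i"
    using sp_image_ad[OF y(1) sp_closed(4)[OF sq_sp]] by blast
  then show ?thesis by (intro bexI[of _ x]) simp_all
qed

text \<open>Unordered pairs, the singletons \<open>{a, a}\<close> included; they index the entries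
  of a symmetric matrix.\<close>

definition pairs :: "'m set set" where
  "pairs = {{a, b} |a b. True}"

lemma card_pairs:
  assumes "CARD('m) = 2 * n"
  shows "card pairs = 2 * n\<^sup>2 + n"
proof -
  have "pairs = {P. P \<subseteq> UNIV \<and> card P = 1} \<union> {P. P \<subseteq> UNIV \<and> card P = 2}"
    unfolding pairs_def by (auto simp: card_1_singleton_iff card_2_iff)
  moreover have "card ({P. P \<subseteq> UNIV \<and> card P = 1} \<union> {P. P \<subseteq> (UNIV :: 'm set) \<and> card P = 2})
      = card {P. P \<subseteq> (UNIV :: 'm set) \<and> card P = 1} + card {P. P \<subseteq> (UNIV :: 'm set) \<and> card P = 2}"
    by (rule card_Un_disjoint) auto
  ultimately have "card pairs = (CARD('m) choose 1) + (CARD('m) choose 2)"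
    by (simp only: n_subsets[OF finite])
  also have "\<dots> = 2 * n + (2 * n) * (2 * n - 1) div 2" by (simp add: assms choose_two)
  also have "(2 * n) * (2 * n - 1) div 2 = n * (2 * n - 1)" by (simp add: mult.assoc)
  also have "2 * n + n * (2 * n - 1) = 2 * n\<^sup>2 + n"
    by (cases n) (simp_all add: power2_eq_square)
  finally show ?thesis .
qed

text \<open>Sending \<open>A\<close> to the form \<open>\<omega> (A *v v) w\<close> identifies
  \<open>sp\<close> with the symmetric forms. The basis vector \<open>e k\<close> belongs to the
  symmetric matrix with ones at the positions of the \<open>k\<close>-th pair, and
  \<open>x k\<close> reads off that entry.\<close>

lemma sp_chart: "\<exists>e x. affine_chart mscale (sp \<omega>) (card pairs) e x"
proof -
  define D where "D = card pairs"
  have "finite pairs" by (rule finite_subset[of _ UNIV]) auto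
  then obtain r where r: "bij_betw r {..<D} pairs"
    using ex_bij_betw_nat_finite[of pairs] by (auto simp: D_def atLeast0LessThan)
  have "\<forall>k. \<exists>ab. k < D --> r k = {fst ab, snd ab}"
  proof
    fix k show "\<exists>ab. k < D --> r k = {fst ab, snd ab}"
    proof (cases "k < D")
      case True
      then have "r k \<in> pairs" using bij_betwE[OF r] by simp
      then obtain a b where "r k = {a, b}" unfolding pairs_def by blast
      then show ?thesis by (intro exI[of _ "(a, b)"]) simp
    qed simp
  qed
  then have "\<exists>ab. \<forall>k. k < D --> r k = {fst (ab k), snd (ab k)}" by (rule choice)
  then obtain ab where ab: "\<forall>k. k < D --> r k = {fst (ab k), snd (ab k)}" by (elim exE)
  define S :: "nat => complex^'m^'m" where "S k = (\<chi> a b. if {a, b} = r k then 1 else 0)" for k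
  define e where "e k = transpose (S k ** matrix_inv J)" for k
  define x where "x k A = \<omega> (A *v axis (fst (ab k)) 1) (axis (snd (ab k)) 1)" for k A
  have eS: "\<omega> (e k *v v) w = (\<Sum>a\<in>UNIV. v $ a * (S k *v w) $ a)" for k v w
    unfolding e_def by (rule matrix_of_form)
  have eS': "\<omega> (e k *v axis a 1) (axis b 1) = (if {a, b} = r k then 1 else 0)" for k a b
  proof -
    have 1: "(\<Sum>c\<in>UNIV. axis a 1 $ c * z $ c) = z $ a" for z :: "complex^'m"
    proof -
      have "(\<Sum>c\<in>UNIV. axis a 1 $ c * z $ c) = (\<Sum>c\<in>UNIV. if c = a then z $ c else 0)"
        by (intro sum.cong) (auto simp: axis_def)
      then show ?thesis by simp
    qed
    have "(\<Sum>c\<in>UNIV. S k $ a $ c * axis b 1 $ c) = (\<Sum>c\<in>UNIV. if c = b then S k $ a $ c else 0)"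
      by (intro sum.cong) (auto simp: axis_def)
    then show ?thesis unfolding eS 1 by (simp add: matrix_vector_mult_def S_def)
  qed
  have e_sp: "e k \<in> sp \<omega>" for k
    unfolding sp_def
  proof (intro CollectI allI)
    fix v w
    have "transpose (S k) = S k" by (simp add: S_def transpose_def vec_eq_iff insert_commute)
    then have "(\<Sum>a\<in>UNIV. v $ a * (S k *v w) $ a) = (\<Sum>a\<in>UNIV. w $ a * (S k *v v) $ a)"
      using sum_transpose[of "S k" v w] by (simp add: mult.commute)
    then show "\<omega> (e k *v v) w + \<omega> v (e k *v w) = 0"
      using \<omega>_skew[of v "e k *v w"] by (simp add: eS)
  qed
  have sum_sp: "(\<Sum>k<D. mscale (t k) (e k)) \<in> sp \<omega>" for t
  proof -
    interpret vector_space "mscale :: complex => complex^'m^'m => _" by (rule vector_space_mscale)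
    show ?thesis by (intro subspace_sum[OF subspace_sp] sp_closed e_sp)
  qed
  have sum_mult: "(\<Sum>k\<in>K. f k) *v v = (\<Sum>k\<in>K. f k *v v)" for K :: "nat set" and f :: "nat => complex^'m^'m" and v
    by (induction K rule: infinite_finite_induct) (auto simp: matrix_vector_mult_add_rdistrib)
  have comp: "\<omega> ((\<Sum>k<D. mscale (t k) (e k)) *v axis a 1) (axis b 1) = (\<Sum>k<D. if r k = {a, b} then t k else 0)" for t a b
    unfolding sum_mult \<omega>_sum mscale_mult_vec \<omega>_simps eS' by (intro sum.cong) auto
  have inj: "r j = r k \<longleftrightarrow> j = k" if "j < D" "k < D" for j k
    using r that by (auto simp: bij_betw_def inj_on_def)
  have x_pt: "x k (\<Sum>k<D. mscale (t k) (e k)) = t k" if "k < D" for t k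
  proof -
    have "x k (\<Sum>k<D. mscale (t k) (e k)) = (\<Sum>j<D. if j = k then t j else 0)"
      unfolding x_def comp ab[rule_format, OF that, symmetric] using inj that by (intro sum.cong) auto
    then show ?thesis using that by simp
  qed
  have pt_x: "(\<Sum>k<D. mscale (x k A) (e k)) = A" if A: "A \<in> sp \<omega>" for A
  proof -
    have sym: "\<omega> (A *v v) w = \<omega> (A *v w) v" for v w
      using spD[OF A, of v w] \<omega>_skew[of v "A *v w"] by simp
    have eq: "\<omega> ((\<Sum>k<D. mscale (x k A) (e k)) *v axis a 1) (axis b 1) = \<omega> (A *v axis a 1) (axis b 1)" for a b
    proof -
      have "{a, b} \<in> pairs" unfolding pairs_def by blast
      then obtain k0 where k0: "k0 < D" "r k0 = {a, b}" using r unfolding bij_betw_def by (metis (no_types) imageE lessThan_iff)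
      have "(\<Sum>k<D. if r k = {a, b} then x k A else 0) = (\<Sum>k<D. if k = k0 then x k A else 0)"
        using inj k0 by (intro sum.cong) auto
      also have "\<dots> = x k0 A" using k0 by simp
      also have "\<dots> = \<omega> (A *v axis a 1) (axis b 1)"
      proof -
        have "{fst (ab k0), snd (ab k0)} = {a, b}" using ab k0 by simp
        then show ?thesis unfolding x_def doubleton_eq_iff using sym by auto
      qed
      finally show ?thesis unfolding comp .
    qed
    define B where "B = (\<Sum>k<D. mscale (x k A) (e k))"
    have "\<omega> (B *v v) w = \<omega> (A *v v) w" for v w
    proof -
      have v: "v = (\<Sum>a\<in>UNIV. v $ a *s axis a 1)" and w: "w = (\<Sum>a\<in>UNIV. w $ a *s axis a 1)"
        by (simp_all add: basis_expansion)
      show ?thesis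
        by (subst (1 2) v, subst (1 2) w) (simp add: matrix_vector_sum vector_scalar_commute \<omega>_sum \<omega>_simps eq[folded B_def])
    qed
    then have "B *v v = A *v v" for v using nondeg[of "B *v v - A *v v"] by (simp add: \<omega>_diff)
    then show ?thesis unfolding B_def by (simp add: matrix_eq)
  qed
  have "affine_chart mscale (sp \<omega>) D e x"
  proof (intro affine_chart.intro affine_chart_axioms.intro vector_space_mscale linear_mscaleI sum_sp)
    show "x k (\<Sum>k<D. mscale (t k) (e k)) = t k" if "k < D" for k t
      by (rule x_pt[OF that])
    show "(\<Sum>k<D. mscale (x k A) (e k)) = A" if "A \<in> sp \<omega>" for A
      by (rule pt_x[OF that])
  qed (simp_all add: x_def matrix_vector_mult_add_rdistrib mscale_mult_vec \<omega>_simps)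
  then show ?thesis unfolding D_def by blast
qed

end

section \<open>Polynomial matrices\<close>

definition matpoly :: "('a => complex) set => ('a => complex^'m^'m::finite) => bool" where
  "matpoly X M \<longleftrightarrow> (\<forall>a b. ispoly X (\<lambda>t. M t $ a $ b))"

definition vecpoly :: "('a => complex) set => ('a => complex^'m::finite) => bool" where
  "vecpoly X v \<longleftrightarrow> (\<forall>a. ispoly X (\<lambda>t. v t $ a))"

lemma matpoly_component: "matpoly X M ==> ispoly X (\<lambda>t. M t $ a $ b)"
  and vecpoly_component: "vecpoly X v ==> ispoly X (\<lambda>t. v t $ a)"
  by (simp_all add: matpoly_def vecpoly_def)

lemma matpoly_const: "matpoly X (\<lambda>_. A)"
  and matpoly_add: "matpoly X M ==> matpoly X M' ==> matpoly X (\<lambda>t. M t + M' t)"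
  and matpoly_diff: "matpoly X M ==> matpoly X M' ==> matpoly X (\<lambda>t. M t - M' t)"
  and matpoly_scale: "ispoly X f ==> matpoly X M ==> matpoly X (\<lambda>t. mscale (f t) (M t))"
  and matpoly_mult: "matpoly X M ==> matpoly X M' ==> matpoly X (\<lambda>t. M t ** M' t)"
  and matpoly_transpose: "matpoly X M ==> matpoly X (\<lambda>t. transpose (M t))"
  unfolding matpoly_def by (auto simp: matrix_matrix_mult_def transpose_def intro!: ispoly_intros)

lemma matpoly_sum: "(\<And>i. i \<in> I ==> matpoly X (M i)) ==> matpoly X (\<lambda>t. \<Sum>i\<in>I. M i t)"
  unfolding matpoly_def by (auto simp: sum_component intro!: ispoly_intros)

lemma matpoly_mpow: "matpoly X M ==> matpoly X (\<lambda>t. mpow k (M t))"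
  by (induction k) (simp_all add: mpow_Suc matpoly_const matpoly_mult)

lemma vecpoly_const: "vecpoly X (\<lambda>_. w)"
  and vecpoly_add: "vecpoly X v ==> vecpoly X v' ==> vecpoly X (\<lambda>t. v t + v' t)"
  and vecpoly_scale: "ispoly X f ==> vecpoly X v ==> vecpoly X (\<lambda>t. f t *s v t)"
  and vecpoly_mult: "matpoly X M ==> vecpoly X v ==> vecpoly X (\<lambda>t. M t *v v t)"
  unfolding vecpoly_def matpoly_def by (auto simp: matrix_vector_mult_def intro!: ispoly_intros)

lemma vecpoly_sum: "(\<And>i. i \<in> I ==> vecpoly X (M i)) ==> vecpoly X (\<lambda>t. \<Sum>i\<in>I. M i t)"
  unfolding vecpoly_def by (auto simp: sum_component intro!: ispoly_intros)

lemma mscale_linear_expand: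
  fixes l :: "complex^'m^'m::finite => complex"
  assumes "functional mscale l"
  obtains c where "\<And>A. l A = (\<Sum>ab\<in>UNIV. c ab * A $ fst ab $ snd ab)"
proof -
  interpret l: Vector_Spaces.linear "mscale :: complex => complex^'m^'m => _" "(*)" l by (rule assms)
  define E :: "'m \<times> 'm => complex^'m^'m" where "E ab = (\<chi> a b. if (a, b) = ab then 1 else 0)" for ab
  have "l A = (\<Sum>ab\<in>UNIV. l (E ab) * A $ fst ab $ snd ab)" for A
  proof -
    have "(\<Sum>ab\<in>UNIV. mscale (A $ fst ab $ snd ab) (E ab)) $ a $ b = A $ a $ b" for a b
    proof -
      have "(\<Sum>ab\<in>UNIV. mscale (A $ fst ab $ snd ab) (E ab)) $ a $ b
          = (\<Sum>ab\<in>UNIV. if ab = (a, b) then A $ a $ b else 0)"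
        unfolding sum_component by (intro sum.cong) (auto simp: E_def)
      then show ?thesis by simp
    qed
    then have "A = (\<Sum>ab\<in>UNIV. mscale (A $ fst ab $ snd ab) (E ab))" by (simp only: vec_eq_iff simp_thms)
    then have "l A = l (\<Sum>ab\<in>UNIV. mscale (A $ fst ab $ snd ab) (E ab))" by simp
    also have "\<dots> = (\<Sum>ab\<in>UNIV. l (E ab) * A $ fst ab $ snd ab)"
      unfolding l.sum l.scale by (simp add: mult.commute)
    finally show ?thesis .
  qed
  then show ?thesis by (rule that)
qed

lemma ispoly_linear:
  assumes "functional mscale l" "matpoly X M"
  shows "ispoly X (\<lambda>t. l (M t))"
proof -
  obtain c where c: "\<And>A. l A = (\<Sum>ab\<in>UNIV. c ab * A $ fst ab $ snd ab)" using mscale_linear_expand[OF assms(1)] by blast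
  show ?thesis unfolding c using assms(2) by (intro ispoly_sum ispoly_mult ispoly_const matpoly_component)
qed

lemma ispoly_det: "matpoly X M ==> ispoly X (\<lambda>t. det (M t))"
  unfolding det_def matpoly_def by (auto intro!: ispoly_intros)

lemma ispoly_coeff_mult:
  "(\<And>k. ispoly X (\<lambda>t. coeff (P t) k)) ==> (\<And>k. ispoly X (\<lambda>t. coeff (Q t) k)) ==> ispoly X (\<lambda>t. coeff (P t * Q t) k)"
  unfolding coeff_mult by (auto intro!: ispoly_intros)

lemma ispoly_coeff_prod:
  "(\<And>i k. i \<in> I ==> ispoly X (\<lambda>t. coeff (P i t) k)) ==> ispoly X (\<lambda>t. coeff (\<Prod>i\<in>I. P i t) k)"
proof (induction I arbitrary: k rule: infinite_finite_induct)
  case (insert i I)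
  then show ?case by (simp add: ispoly_coeff_mult)
qed (auto intro: ispoly_const)

lemma ispoly_charpoly:
  assumes "matpoly X M"
  shows "ispoly X (\<lambda>t. coeff (charpoly (M t)) k)"
proof -
  have c: "ispoly X (\<lambda>t. coeff ((mat [:0, 1:] - map_matrix (\<lambda>c. [:c:]) (M t)) $ a $ b) k)" for a b k
  proof -
    have "ispoly X (\<lambda>t. coeff (mat [:0, 1:] $ a $ b) k - (if k = 0 then M t $ a $ b else 0))"
      using matpoly_component[OF assms] by (cases "k = 0") (auto intro!: ispoly_diff ispoly_const)
    moreover have "coeff [:c:] k = (if k = 0 then c else 0)" for c :: complex by (cases k) simp_all
    ultimately show ?thesis by (simp add: map_matrix_def)
  qed
  have s: "coeff (of_int (sign p) * Q) k = of_int (sign p) * coeff Q k" for p :: "'b => 'b" and Q :: "complex poly" and k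
    by (auto simp: sign_def)
  show ?thesis unfolding charpoly_def det_def coeff_sum s
    by (intro ispoly_sum ispoly_mult ispoly_const ispoly_coeff_prod c)
qed

context symp
begin

abbreviation "PS \<equiv> phase_space \<omega>"
abbreviation "XP \<equiv> Xpart \<omega>"

lemma ispoly_\<omega>:
  assumes "vecpoly X u" "vecpoly X v"
  shows "ispoly X (\<lambda>t. \<omega> (u t) (v t))"
proof -
  have "ispoly X (\<lambda>t. \<Sum>a\<in>UNIV. u t $ a * (J *v v t) $ a)"
    by (intro ispoly_sum ispoly_mult vecpoly_component assms vecpoly_mult matpoly_const)
  then show ?thesis by (simp add: \<omega>_J)
qed

lemma matpoly_sq: "vecpoly X v ==> matpoly X (\<lambda>t. sq (v t))"
  unfolding matpoly_def sq_component divide_inverse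
  by (intro allI ispoly_mult ispoly_\<omega> vecpoly_const ispoly_const vecpoly_component)

lemma matpoly_adj: "matpoly X M ==> matpoly X (\<lambda>t. adj (M t))"
  unfolding adj_def by (intro matpoly_mult matpoly_transpose matpoly_const)

lemma matpoly_tv: "ispoly X f ==> matpoly X (\<lambda>t. tv (f t) u)"
  unfolding tv_def by (intro matpoly_add matpoly_scale matpoly_const)

lemma det_adj: "det (adj A) = det A"
proof -
  have "det (matrix_inv J) * det J = 1" using det_mul[of "matrix_inv J" J] by (simp add: J_inv)
  then show ?thesis unfolding adj_def det_mul det_transpose by (simp add: mult.commute mult.left_commute)
qed

text \<open>Taking adjoints does not change determinants and turns \<open>t - y\<close> into
  \<open>t + y\<close>, so in even dimension the characteristic polynomial is an even
  function.\<close>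

lemma charpoly_sp_odd:
  assumes y: "y \<in> sp \<omega>" and even: "even CARD('m)" and k: "odd k"
  shows "coeff (charpoly y) k = 0"
proof -
  have "poly (charpoly y) t = poly (pcompose (charpoly y) [:0, -1:]) t" for t
  proof -
    have "det (mat t - y) = det (adj (mat t + - y))" by (simp add: det_adj)
    also have "adj (mat t + - y) = mat t + y" using y unfolding adj_add adj_minus adj_mat sp_iff by simp
    also have "mat t + y = mat (-1) ** (mat (- t) - y)"
      unfolding mat_mult_left by (simp add: vec_eq_iff mat_def)
    also have "det \<dots> = det (mat (- t) - y)"
      unfolding det_mul using even by (simp add: det_diagonal mat_def)
    finally show ?thesis by (simp add: poly_charpoly poly_pcompose)
  qed
  then have "charpoly y = pcompose (charpoly y) [:0, -1:]" by (rule poly_eqI2)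
  then have "coeff (charpoly y) k = (- 1) ^ k * coeff (charpoly y) k"
    by (metis coeff_pcompose_linear)
  then show ?thesis using k by simp
qed

end

section \<open>The defining equations\<close>

lemma coord_ring_simps:
  "mult (coord_ring sc W) = (\<lambda>f g. restrict (\<lambda>p. f p * g p) W)" "one (coord_ring sc W) = restrict (\<lambda>_. 1) W"
  "ring.add (coord_ring sc W) = (\<lambda>f g. restrict (\<lambda>p. f p + g p) W)" "ring.zero (coord_ring sc W) = restrict (\<lambda>_. 0) W"
  by (simp_all add: coord_ring_def)

lemma ideal_lincomb:
  assumes I: "ideal I (coord_ring sc W)" and f: "\<And>a. a \<in> A ==> restrict (f a) W \<in> I"
  shows "restrict (\<lambda>p. \<Sum>a\<in>A. c a * f a p) W \<in> I"
proof -
  interpret I: ideal I "coord_ring sc W" by (rule I)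
  show ?thesis using f
  proof (induction A rule: infinite_finite_induct)
    case (insert a A)
    have "(restrict (\<lambda>_. c a) W \<otimes>\<^bsub>coord_ring sc W\<^esub> restrict (f a) W) \<oplus>\<^bsub>coord_ring sc W\<^esub>
        restrict (\<lambda>p. \<Sum>a\<in>A. c a * f a p) W \<in> I"
    proof (rule additive_subgroup.a_closed[OF I.additive_subgroup_axioms I.I_l_closed[OF _ carrier_coord_ring_const]])
      show "restrict (f a) W \<in> I" using insert.prems by blast
      show "restrict (\<lambda>p. \<Sum>a\<in>A. c a * f a p) W \<in> I" by (rule insert.IH) (use insert.prems in blast)
    qed
    also have "(restrict (\<lambda>_. c a) W \<otimes>\<^bsub>coord_ring sc W\<^esub> restrict (f a) W) \<oplus>\<^bsub>coord_ring sc W\<^esub>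
        restrict (\<lambda>p. \<Sum>a\<in>A. c a * f a p) W = restrict (\<lambda>p. \<Sum>a\<in>insert a A. c a * f a p) W"
      using insert by (auto simp: restrict_def coord_ring_simps)
    finally show ?case .
  qed (use additive_subgroup.zero_closed[OF I.additive_subgroup_axioms] in "auto simp: coord_ring_simps")
qed

lemma ideal_vanishing: "ideal (vanishing_ideal sc W Z) (coord_ring sc W)" if "Z \<subseteq> W"
proof -
  interpret R: cring "coord_ring sc W" by (rule cring_coord_ring)
  have Z: "p \<in> W" if "p \<in> Z" for p using \<open>Z \<subseteq> W\<close> that by blast
  show ?thesis
  proof (rule idealI)
    show "ring (coord_ring sc W)" by unfold_locales
    show "subgroup (vanishing_ideal sc W Z) (add_monoid (coord_ring sc W))"
    proof (rule R.add.subgroupI)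
      have "restrict (\<lambda>_. 0) W \<in> vanishing_ideal sc W Z"
        using carrier_coord_ring_const[of 0 W sc] Z unfolding vanishing_ideal_def by simp
      then show "vanishing_ideal sc W Z \<noteq> {}" by blast
      show "vanishing_ideal sc W Z \<subseteq> carrier (coord_ring sc W)" by (auto simp: vanishing_ideal_def)
      fix a assume a: "a \<in> vanishing_ideal sc W Z"
      then have ac: "a \<in> carrier (coord_ring sc W)" by (simp add: vanishing_ideal_def)
      have "restrict (\<lambda>p. (\<ominus>\<^bsub>coord_ring sc W\<^esub> a) p + a p) W = restrict (\<lambda>_. 0) W"
        using R.l_neg[OF ac] by (simp add: coord_ring_simps)
      then have eq: "restrict (\<lambda>p. (\<ominus>\<^bsub>coord_ring sc W\<^esub> a) p + a p) W p = restrict (\<lambda>_. 0) W p" for p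
        by (rule fun_cong)
      have "(\<ominus>\<^bsub>coord_ring sc W\<^esub> a) p = 0" if p: "p \<in> Z" for p
      proof -
        have "a p = 0" using a p by (simp add: vanishing_ideal_def)
        then show ?thesis using eq[of p] Z[OF p] by simp
      qed
      then show "\<ominus>\<^bsub>coord_ring sc W\<^esub> a \<in> vanishing_ideal sc W Z"
        using R.a_inv_closed[OF ac] unfolding vanishing_ideal_def by blast
    next
      fix a b assume "a \<in> vanishing_ideal sc W Z" "b \<in> vanishing_ideal sc W Z"
      then show "a \<oplus>\<^bsub>coord_ring sc W\<^esub> b \<in> vanishing_ideal sc W Z"
        using Z carrier_coord_ring_add by (auto simp: vanishing_ideal_def coord_ring_simps)
    qed
    fix a b assume "a \<in> vanishing_ideal sc W Z" "b \<in> carrier (coord_ring sc W)"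
    then show "b \<otimes>\<^bsub>coord_ring sc W\<^esub> a \<in> vanishing_ideal sc W Z" "a \<otimes>\<^bsub>coord_ring sc W\<^esub> b \<in> vanishing_ideal sc W Z"
      using Z carrier_coord_ring_mult by (auto simp: vanishing_ideal_def coord_ring_simps)
  qed
qed

lemma zero_locus_genideal:
  assumes "F \<subseteq> carrier (coord_ring sc W)"
  shows "zero_locus W (genideal (coord_ring sc W) F) = zero_locus W F"
proof -
  interpret R: cring "coord_ring sc W" by (rule cring_coord_ring)
  have "genideal (coord_ring sc W) F \<subseteq> vanishing_ideal sc W (zero_locus W F)"
    using assms by (intro R.genideal_minimal ideal_vanishing) (auto simp: vanishing_ideal_def zero_locus_def)
  then show ?thesis using R.genideal_self[OF assms] by (auto simp: zero_locus_def vanishing_ideal_def)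
qed

lemma matpoly_fst: "matpoly (linfuns cscale) (fst :: 'm::finite triple => _)"
  and matpoly_snd: "matpoly (linfuns cscale) (\<lambda>p :: 'm triple. fst (snd p))"
  and vecpoly_snd: "vecpoly (linfuns cscale) (\<lambda>p :: 'm triple. snd (snd p))"
  unfolding matpoly_def vecpoly_def
  by (intro allI ispoly_gen CollectI linear_cscaleI; simp add: cscale_def split_beta)+

locale phase = symp \<omega> + ch: affine_chart cscale "phase_space \<omega>" N e x + spc: affine_chart mscale "sp \<omega>" D es xs
  for \<omega> :: "complex^'m::finite => complex^'m => complex" and N e x D es xs +
  fixes n :: nat
  assumes card: "CARD('m) = 2 * n" and D: "D = 2 * n\<^sup>2 + n" and N: "N = D + D + 2 * n"
begin

lemma n_pos: "0 < n"
  using card zero_less_card_finite[where 'a = 'm] by simp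

definition moment :: "'m triple => complex^'m^'m" where
  "moment p = commutator (fst p) (fst (snd p)) + sq (snd (snd p))"

lemma matpoly_moment: "matpoly (linfuns cscale) moment"
  unfolding moment_def[abs_def] commutator_def
  by (intro matpoly_add matpoly_diff matpoly_mult matpoly_sq matpoly_fst matpoly_snd vecpoly_snd)

lemma moment_sp: "p \<in> PS ==> moment p \<in> sp \<omega>"
  unfolding moment_def phase_space_def by (auto intro!: sp_closed(1) commutator_sp sq_sp)

text \<open>The moment takes values in \<open>sp\<close>, so its \<open>D\<close> coordinates there
  replace the matrix entries. On \<open>sp\<close> the coefficients of odd degree vanish, so
  \<open>n\<close> coefficients express nilpotency; in all there are
  \<open>2 * n\<^sup>2 + 2 * n\<close> equations.\<close>

definition gens :: "('m triple => complex) set" where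
  "gens = (\<lambda>k p. xs k (moment p)) ` {..<D} \<union> (\<lambda>j p. coeff (charpoly (fst (snd p))) (2 * j)) ` {..<n}"

lemma finite_gens: "finite gens" and card_gens: "card gens \<le> 2 * n\<^sup>2 + 2 * n"
proof -
  show "finite gens" unfolding gens_def by simp
  have "card gens \<le> D + n" unfolding gens_def
    by (rule order_trans[OF card_Un_le add_mono[OF order_trans[OF card_image_le] order_trans[OF card_image_le]]]) auto
  then show "card gens \<le> 2 * n\<^sup>2 + 2 * n" by (simp add: D)
qed

lemma ispoly_xs: "k < D ==> matpoly X M ==> ispoly X (\<lambda>t. xs k (M t))"
  by (rule ispoly_linear[OF spc.linear_x])

lemma poly_gens: "f \<in> gens ==> ispoly (linfuns cscale) f"
  unfolding gens_def by (auto intro: ispoly_xs matpoly_moment ispoly_charpoly matpoly_snd)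

lemma xs_zero: "A \<in> sp \<omega> ==> (\<And>k. k < D ==> xs k A = 0) ==> A = 0"
proof -
  assume A: "A \<in> sp \<omega>" and z: "\<And>k. k < D ==> xs k A = 0"
  have "(\<Sum>k<D. mscale (xs k A) (es k)) = (\<Sum>k<D. 0)"
    by (intro sum.cong) (auto simp: z vec_eq_iff)
  then show "A = 0" using spc.pt_x[OF A] by simp
qed

lemma xs_0: "k < D ==> xs k 0 = 0"
  using spc.linear_scale[OF spc.linear_x, of k 0 0] by (simp add: vec_eq_iff map_matrix_def zero_vec_def)

lemma Xnil_gens: "Xnil \<omega> = {p \<in> PS. \<forall>f\<in>gens. f p = 0}"
proof -
  have "moment p = 0 \<and> nilpotent_matrix (fst (snd p)) \<longleftrightarrow> (\<forall>f\<in>gens. f p = 0)" if p: "p \<in> PS" for p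
  proof -
    have "moment p = 0 \<longleftrightarrow> (\<forall>k<D. xs k (moment p) = 0)"
      using xs_zero[OF moment_sp[OF p]] xs_0 by metis
    moreover have "nilpotent_matrix (fst (snd p)) \<longleftrightarrow> (\<forall>j<n. coeff (charpoly (fst (snd p))) (2 * j) = 0)"
    proof -
      have y: "fst (snd p) \<in> sp \<omega>" using p by (auto simp: phase_space_def)
      have "coeff (charpoly (fst (snd p))) k = 0" if "\<forall>j<n. coeff (charpoly (fst (snd p))) (2 * j) = 0" "k < 2 * n" for k
      proof (cases "odd k")
        case True
        then show ?thesis using charpoly_sp_odd[OF y] card by simp
      next
        case False
        then obtain j where "k = 2 * j" by (auto elim: evenE)
        then show ?thesis using that by simp
      qed
      then show ?thesis unfolding nilpotent_iff_charpoly card by auto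
    qed
    ultimately show ?thesis unfolding gens_def by auto
  qed
  moreover have "p \<in> Xnil \<omega> \<longleftrightarrow> p \<in> PS \<and> moment p = 0 \<and> nilpotent_matrix (fst (snd p))" for p
    by (cases p) (auto simp: Xnil_def moment_def)
  ultimately show ?thesis by blast
qed

lemma Xnil_sub: "Xnil \<omega> \<subseteq> PS" and Xnil_closed: "ch.zcl (Xnil \<omega>) = Xnil \<omega>"
  unfolding Xnil_gens using ch.zcl_vanishing_set[of gens] poly_gens by auto

abbreviation "R \<equiv> phase_ring \<omega>"

definition gens' :: "('m triple => complex) set" where
  "gens' = (\<lambda>f. restrict f PS) ` gens"

lemma carrierI: "ispoly (linfuns cscale) f ==> restrict f PS \<in> carrier R"
  unfolding carrier_coord_ring using ch.poly_fun_iff by blast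

lemma gens'_carrier: "gens' \<subseteq> carrier R"
  unfolding gens'_def using carrierI poly_gens by auto

lemma moment_entries_eq: "moment_entries \<omega> = {restrict (\<lambda>p. moment p $ a $ b) PS | a b. True}"
  and charpoly_coeffs_eq: "charpoly_coeffs \<omega> = {restrict (\<lambda>p. coeff (charpoly (fst (snd p))) k) PS | k. k < 2 * n}"
  unfolding moment_entries_def charpoly_coeffs_def moment_def card case_prod_unfold by simp_all

lemma entries_carrier: "moment_entries \<omega> \<subseteq> carrier R" "charpoly_coeffs \<omega> \<subseteq> carrier R"
  unfolding moment_entries_eq charpoly_coeffs_eq
  by (auto intro!: carrierI matpoly_component[OF matpoly_moment] ispoly_charpoly matpoly_snd)

text \<open>On the phase space the matrix entries of the moment and its coordinates in
  \<open>sp\<close> are linear combinations of each other, and the omitted coefficients of the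
  characteristic polynomial restrict to 0.\<close>

lemma nil_ideal_gens: "nil_ideal \<omega> = genideal R gens'"
proof
  interpret R: cring R by (rule cring_coord_ring)
  have I: "ideal (genideal R gens') R" by (rule R.genideal_ideal[OF gens'_carrier])
  have g: "restrict f PS \<in> genideal R gens'" if "f \<in> gens" for f
    using R.genideal_self[OF gens'_carrier] that unfolding gens'_def by blast
  have "moment_entries \<omega> \<subseteq> genideal R gens'"
  proof -
    have "restrict (\<lambda>p. moment p $ a $ b) PS \<in> genideal R gens'" for a b
    proof -
      have "restrict (\<lambda>p. \<Sum>k<D. es k $ a $ b * xs k (moment p)) PS \<in> genideal R gens'"
        by (intro ideal_lincomb[OF I] g) (auto simp: gens_def)
      also have "restrict (\<lambda>p. \<Sum>k<D. es k $ a $ b * xs k (moment p)) PS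
          = restrict (\<lambda>p. moment p $ a $ b) PS"
      proof (rule restrict_ext)
        fix p assume "p \<in> PS"
        then have "moment p $ a $ b = (\<Sum>k<D. mscale (xs k (moment p)) (es k)) $ a $ b"
          using spc.pt_x[OF moment_sp] by simp
        then show "(\<Sum>k<D. es k $ a $ b * xs k (moment p)) = moment p $ a $ b"
          by (simp add: sum_component mult.commute)
      qed
      finally show ?thesis .
    qed
    then show ?thesis unfolding moment_entries_eq by blast
  qed
  then have 1: "almost_commuting_ideal \<omega> \<subseteq> genideal R gens'"
    unfolding almost_commuting_ideal_def by (intro R.genideal_minimal[OF I])
  have "charpoly_coeffs \<omega> \<subseteq> genideal R gens'"
  proof -
    have "restrict (\<lambda>p. coeff (charpoly (fst (snd p))) k) PS \<in> genideal R gens'" if k: "k < 2 * n" for k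
    proof (cases "odd k")
      case True
      have "restrict (\<lambda>p. coeff (charpoly (fst (snd p))) k) PS = restrict (\<lambda>_. 0) PS"
        using charpoly_sp_odd[OF _ _ True] card by (intro restrict_ext) (auto simp: phase_space_def)
      moreover have "restrict (\<lambda>_. 0) PS \<in> genideal R gens'"
        using additive_subgroup.zero_closed[OF ideal.axioms(1)[OF I]] by (simp add: coord_ring_simps)
      ultimately show ?thesis by simp
    next
      case False
      then obtain j where "k = 2 * j" by (auto elim: evenE)
      then show ?thesis using k by (intro g) (auto simp: gens_def)
    qed
    then show ?thesis unfolding charpoly_coeffs_eq by blast
  qed
  with 1 show "nil_ideal \<omega> \<subseteq> genideal R gens'"
    unfolding nil_ideal_def by (intro R.genideal_minimal[OF I]) blast
  have A: "almost_commuting_ideal \<omega> \<subseteq> carrier R"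
    unfolding almost_commuting_ideal_def using R.genideal_ideal[OF entries_carrier(1)]
    by (auto dest: ideal.Icarr)
  have AC: "almost_commuting_ideal \<omega> \<union> charpoly_coeffs \<omega> \<subseteq> carrier R" using A entries_carrier(2) by blast
  have I': "ideal (nil_ideal \<omega>) R" unfolding nil_ideal_def by (rule R.genideal_ideal[OF AC])
  have m: "almost_commuting_ideal \<omega> \<union> charpoly_coeffs \<omega> \<subseteq> nil_ideal \<omega>"
    unfolding nil_ideal_def by (rule R.genideal_self[OF AC])
  have m1: "moment_entries \<omega> \<subseteq> nil_ideal \<omega>"
    using R.genideal_self[OF entries_carrier(1)] m unfolding almost_commuting_ideal_def by blast
  have "restrict f PS \<in> nil_ideal \<omega>" if "f \<in> gens" for f
    using that unfolding gens_def
  proof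
    assume "f \<in> (\<lambda>k p. xs k (moment p)) ` {..<D}"
    then obtain k where k: "k < D" "f = (\<lambda>p. xs k (moment p))" by blast
    obtain c where c: "\<And>A. xs k A = (\<Sum>ab\<in>UNIV. c ab * A $ fst ab $ snd ab)" using mscale_linear_expand[OF spc.linear_x[OF k(1)]] by blast
    show ?thesis unfolding k(2) c
      by (intro ideal_lincomb[OF I']) (use m1 in "auto simp: moment_entries_eq")
  next
    assume "f \<in> (\<lambda>j p. coeff (charpoly (fst (snd p))) (2 * j)) ` {..<n}"
    then obtain j where "j < n" "f = (\<lambda>p. coeff (charpoly (fst (snd p))) (2 * j))" by blast
    then have "restrict f PS \<in> charpoly_coeffs \<omega>"
      unfolding charpoly_coeffs_eq by (intro CollectI exI[of _ "2 * j"]) simp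
    then show ?thesis using m by blast
  qed
  then show "genideal R gens' \<subseteq> nil_ideal \<omega>"
    unfolding gens'_def by (intro R.genideal_minimal[OF I']) blast
qed

lemma zero_locus_nil: "zero_locus PS (nil_ideal \<omega>) = Xnil \<omega>"
  unfolding nil_ideal_gens zero_locus_genideal[OF gens'_carrier] Xnil_gens
  by (auto simp: zero_locus_def gens'_def)

lemma zero_Xnil: "(0, 0, 0) \<in> Xnil \<omega>"
proof -
  have "sq 0 = 0" by (simp add: vec_eq_iff sq_component)
  moreover have "nilpotent_matrix (0 :: complex^'m^'m)"
    unfolding nilpotent_matrix_def by (intro exI[of _ 1]) simp
  ultimately show ?thesis by (simp add: Xnil_def phase_space_def sp_closed commutator_def)
qed

text \<open>A set of exactly as many generators as the codimension is called for, whereas different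
  indices in \<open>gens'\<close> might give the same function. The set is therefore padded with
  further elements of the ideal, which is infinite.\<close>

lemma complete_intersection_nil:
  assumes dim: "krull_dim (Xnil_top \<omega>) = enat (2 * n\<^sup>2 + 2 * n)"
  shows "complete_intersection cscale PS (nil_ideal \<omega>)"
proof -
  interpret R: cring R by (rule cring_coord_ring)
  let ?W = "PS" and ?J = "nil_ideal \<omega>"
  have I: "ideal ?J R" unfolding nil_ideal_gens by (rule R.genideal_ideal[OF gens'_carrier])
  have Jc: "?J \<subseteq> carrier R" using ideal.Icarr[OF I] by blast
  have sub: "gens' \<subseteq> ?J" unfolding nil_ideal_gens by (rule R.genideal_self[OF gens'_carrier])
  obtain i :: "complex^'m" where "i \<noteq> 0" using axis_eq_0_iff[of undefined "1 :: complex"] by blast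
  define p0 :: "'m triple" where "p0 = (0, 0, i)"
  have p0: "p0 \<in> ?W" by (simp add: p0_def phase_space_def sp_closed)
  have "moment p0 \<noteq> 0"
  proof
    assume "moment p0 = 0"
    then have sq0: "sq i = 0" by (simp add: moment_def p0_def commutator_def)
    obtain w where "\<omega> i w \<noteq> 0" using nondeg[of i] \<open>i \<noteq> 0\<close> by blast
    then show False using sq_mult[of i w] \<open>i \<noteq> 0\<close> by (simp add: sq0 vec.scale_eq_0_iff)
  qed
  then obtain k where k: "k < D" "xs k (moment p0) \<noteq> 0" using xs_zero[OF moment_sp[OF p0]] by blast
  \<comment> \<open>The constant multiples of one coordinate of the moment that is nonzero at
    \<open>p0\<close> supply infinitely many elements; the sum over a single index has the form
    required by \<open>ideal_lincomb\<close>.\<close>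
  define h where "h c = restrict (\<lambda>p. \<Sum>a\<in>{()}. c * xs k (moment p)) ?W" for c
  have "h c \<in> ?J" for c
    unfolding h_def using k sub by (intro ideal_lincomb[OF I]) (auto simp: gens'_def gens_def)
  moreover have "inj h"
  proof (rule injI)
    fix a b assume "h a = h b"
    then have "h a p0 = h b p0" by simp
    then show "a = b" using k p0 by (simp add: h_def)
  qed
  ultimately have "infinite ?J"
    using infinite_UNIV_char_0[where 'a = complex] by (meson finite_imageD finite_subset image_subsetI)
  moreover have "finite gens'" unfolding gens'_def using finite_gens by simp
  ultimately have "infinite (?J - gens')" by simp
  then obtain S where S: "finite S" "card S = 2 * n\<^sup>2 + 2 * n - card gens'" "S \<subseteq> ?J - gens'"
    using infinite_arbitrarily_large by blast
  have c: "card gens' \<le> 2 * n\<^sup>2 + 2 * n"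
    unfolding gens'_def using card_image_le[OF finite_gens] card_gens by (rule order_trans)
  define F where "F = gens' \<union> S"
  have "card F = 2 * n\<^sup>2 + 2 * n"
    unfolding F_def using S c \<open>finite gens'\<close> by (subst card_Un_disjoint) auto
  moreover have FJ: "F \<subseteq> ?J" using S sub unfolding F_def by blast
  moreover have "?J = genideal R F"
  proof
    show "genideal R F \<subseteq> ?J" by (rule R.genideal_minimal[OF I FJ])
    have "F \<subseteq> genideal R F" "ideal (genideal R F) R"
      using R.genideal_self R.genideal_ideal FJ Jc by auto
    then show "?J \<subseteq> genideal R F" unfolding nil_ideal_gens
      by (intro R.genideal_minimal) (auto simp: F_def)
  qed
  moreover have "zero_locus ?W ?J \<noteq> {}"
    unfolding zero_locus_nil using zero_Xnil by blast
  moreover have "krull_dim (subtopology (zariski cscale ?W) (zero_locus ?W ?J)) + enat (2 * n\<^sup>2 + 2 * n)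
      = enat (vector_space.dim cscale ?W)"
    unfolding zero_locus_nil ch.chart_dim N D using dim unfolding Xnil_top_def by (simp add: mult_2)
  ultimately show ?thesis unfolding complete_intersection_def
    using S(1) \<open>finite gens'\<close> Jc by (intro conjI exI[of _ F]) (auto simp: F_def)
qed

end

section \<open>Parametrization of the pieces\<close>

lemma basis_chart:
  fixes scale :: "complex => 'p::ab_group_add => 'p"
  assumes vs: "vector_space scale" and inj: "inj_on f {..<N}"
    and ind: "\<not> module.dependent scale (f ` {..<N})" and span: "module.span scale (f ` {..<N}) = W"
  shows "\<exists>x. affine_chart scale W N f x"
proof -
  interpret vector_space scale by (rule vs)
  interpret p: vector_space_pair scale "(*) :: complex => complex => complex" by unfold_locales
  have "\<forall>k. \<exists>g. Vector_Spaces.linear scale (*) g \<and> (\<forall>v\<in>f ` {..<N}. g v = (if v = f k then 1 else 0))"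
  proof
    fix k show "\<exists>g. Vector_Spaces.linear scale (*) g \<and> (\<forall>v\<in>f ` {..<N}. g v = (if v = f k then 1 else 0))"
      by (rule p.linear_independent_extend[OF ind])
  qed
  then have "\<exists>x. \<forall>k. Vector_Spaces.linear scale (*) (x k) \<and> (\<forall>v\<in>f ` {..<N}. x k v = (if v = f k then 1 else 0))"
    by (rule choice)
  then obtain x where x: "\<And>k. Vector_Spaces.linear scale (*) (x k)"
    "\<And>k j. j < N ==> x k (f j) = (if f j = f k then 1 else 0)" by (elim exE) blast
  have xf: "x k (f j) = (if j = k then 1 else 0)" if "j < N" "k < N" for j k
    using x(2)[of j k] inj that by (auto simp: inj_on_def)
  have x_pt: "x k (\<Sum>j<N. scale (t j) (f j)) = t k" if k: "k < N" for t k
  proof -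
    interpret xk: Vector_Spaces.linear scale "(*)" "x k" by (rule x(1))
    have "x k (\<Sum>j<N. scale (t j) (f j)) = (\<Sum>j<N. if j = k then t j else 0)"
      unfolding xk.sum xk.scale using xf k by (intro sum.cong) auto
    then show ?thesis using k by simp
  qed
  have "(\<Sum>k<N. scale (x k v) (f k)) = v" if "v \<in> W" for v
  proof -
    have "v \<in> span (f ` {..<N})" using that span by simp
    then obtain u where "v = (\<Sum>w\<in>f ` {..<N}. scale (u w) w)" using span_finite[of "f ` {..<N}"] by auto
    then have v: "v = (\<Sum>j<N. scale (u (f j)) (f j))" by (simp add: sum.reindex[OF inj])
    show ?thesis by (subst (2) v, intro sum.cong refl) (simp add: x_pt[of _ "\<lambda>j. u (f j)", folded v])
  qed
  moreover have "(\<Sum>k<N. scale (t k) (f k)) \<in> W" for t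
    unfolding span[symmetric] by (intro span_sum span_scale span_base) auto
  ultimately have "affine_chart scale W N f x"
    by (intro affine_chart.intro affine_chart_axioms.intro vector_space_axioms x(1) x_pt)
  then show ?thesis by blast
qed

lemma mscale_zero [simp]: "mscale c 0 = 0" "mscale 0 A = 0"
  by (simp_all add: vec_eq_iff)

lemma triple_linear_poly:
  fixes \<psi> :: "'a => 'm::finite triple"
  assumes l: "functional cscale l"
    and p: "matpoly Y (\<lambda>t. fst (\<psi> t))" "matpoly Y (\<lambda>t. fst (snd (\<psi> t)))" "vecpoly Y (\<lambda>t. snd (snd (\<psi> t)))"
  shows "ispoly Y (\<lambda>t. l (\<psi> t))"
proof -
  interpret l: Vector_Spaces.linear cscale "(*)" l by (rule l)
  have add: "l (a + b) = l a + l b" for a b by (rule l.add)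
  have 1: "functional mscale (\<lambda>A. l (A, 0, 0))"
    by (intro linear_mscaleI) (simp_all add: add[symmetric] l.scale[symmetric] cscale_def)
  have 2: "functional mscale (\<lambda>A. l (0, A, 0))"
    by (intro linear_mscaleI) (simp_all add: add[symmetric] l.scale[symmetric] cscale_def)
  define c where "c a = l (0, 0, axis a 1)" for a
  have 3: "l (0, 0, v) = (\<Sum>a\<in>UNIV. v $ a * c a)" for v
  proof -
    have "(\<Sum>a\<in>UNIV. cscale (v $ a) (0, 0, axis a 1)) = (0, 0, \<Sum>a\<in>UNIV. v $ a *s axis a 1)"
      by (simp add: cscale_def sum_triple vec_eq_iff)
    then have "(0, 0, v) = (\<Sum>a\<in>UNIV. cscale (v $ a) (0, 0, axis a 1))" by (simp add: basis_expansion)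
    then have "l (0, 0, v) = l (\<Sum>a\<in>UNIV. cscale (v $ a) (0, 0, axis a 1))" by simp
    then show ?thesis unfolding l.sum l.scale c_def .
  qed
  have "(\<lambda>t. l (\<psi> t)) = (\<lambda>t. l (fst (\<psi> t), 0, 0) + l (0, fst (snd (\<psi> t)), 0) + l (0, 0, snd (snd (\<psi> t))))"
  proof
    fix t
    have "\<psi> t = (fst (\<psi> t), 0, 0) + (0, fst (snd (\<psi> t)), 0) + (0, 0, snd (snd (\<psi> t)))" by simp
    then have "l (\<psi> t) = l ((fst (\<psi> t), 0, 0) + (0, fst (snd (\<psi> t)), 0) + (0, 0, snd (snd (\<psi> t))))"
      by (rule arg_cong)
    then show "l (\<psi> t) = l (fst (\<psi> t), 0, 0) + l (0, fst (snd (\<psi> t)), 0) + l (0, 0, snd (snd (\<psi> t)))"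
      unfolding add .
  qed
  moreover have "ispoly Y (\<lambda>t. l (fst (\<psi> t), 0, 0) + l (0, fst (snd (\<psi> t)), 0) + l (0, 0, snd (snd (\<psi> t))))"
    unfolding 3 by (intro ispoly_add ispoly_sum ispoly_mult ispoly_const ispoly_linear[OF 1] ispoly_linear[OF 2] vecpoly_component p)
  ultimately show ?thesis by simp
qed

context affine_chart
begin

text \<open>There are infinitely many linear functionals, but on \<open>W\<close> all of them are
  combinations of the \<open>N\<close> coordinates, so the sum of the degrees of the coordinates
  bounds them uniformly.\<close>

lemma growth_param_W:
  fixes \<psi> :: "(nat => complex) => 'p"
  assumes W: "\<And>t. \<psi> t \<in> W"
    and l: "\<And>l. functional sc l ==> ispoly ((\<lambda>k t. t k) ` {..<j}) (\<lambda>t. l (\<psi> t))"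
  shows "growth (linfuns sc) (range \<psi>) j"
proof -
  let ?Y = "(\<lambda>k t. t k) ` {..<j} :: ((nat => complex) => complex) set"
  have "\<forall>k. \<exists>m. k < N --> polydeg ?Y m (\<lambda>t. x k (\<psi> t))"
    using l[OF linear_x] unfolding ispoly_def by blast
  then have "\<exists>m. \<forall>k. k < N --> polydeg ?Y (m k) (\<lambda>t. x k (\<psi> t))" by (rule choice)
  then obtain m where m: "\<And>k. k < N ==> polydeg ?Y (m k) (\<lambda>t. x k (\<psi> t))" by (elim exE) blast
  define e' where "e' = (\<Sum>k<N. m k)"
  have m': "polydeg ?Y e' (\<lambda>t. x k (\<psi> t))" if "k < N" for k
    unfolding e'_def by (rule polydeg.mono[OF m[OF that]]) (use that in "auto intro: member_le_sum")
  show ?thesis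
  proof (rule growth_param)
    fix l assume "l \<in> linfuns sc"
    then have l: "(\<lambda>t. l (\<psi> t)) = (\<lambda>t. \<Sum>k<N. l (e k) * x k (\<psi> t))"
      using linear_W[OF _ W] by (auto simp: mult.commute)
    have "polydeg ?Y e' (\<lambda>t. \<Sum>k<N. l (e k) * x k (\<psi> t))"
      by (intro polydeg_sum polydeg_cmult m') auto
    then show "polydeg ?Y e' (\<lambda>t. l (\<psi> t))" by (simp only: l)
  qed
qed

end

text \<open>If two functions have product 0 on \<open>C\<close>, then along a polynomial curve in
  \<open>C\<close> one of them is the zero polynomial; a curve joining a nonzero of \<open>f\<close>
  to a nonzero of \<open>g\<close> excludes this.\<close>

lemma prime_on_paths:
  assumes ne: "C \<noteq> {}"
    and path: "\<And>p q. p \<in> C ==> q \<in> C ==> \<exists>s. (\<forall>t. s t \<in> C) \<and> s 0 = p \<and> s 1 = q \<and> (\<forall>l\<in>X. ispoly {\<lambda>t::complex. t} (\<lambda>t. l (s t)))"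
  shows "prime_on X C"
  unfolding prime_on_def
proof (intro conjI ne allI impI, rule ccontr)
  fix f g assume fg: "ispoly X f" "ispoly X g" "\<forall>p\<in>C. f p * g p = 0"
    "\<not> ((\<forall>p\<in>C. f p = 0) \<or> (\<forall>p\<in>C. g p = 0))"
  then obtain p q where pq: "p \<in> C" "f p \<noteq> 0" "q \<in> C" "g q \<noteq> 0" by blast
  obtain s where s: "\<And>t. s t \<in> C" "s 0 = p" "s 1 = q" "\<And>l. l \<in> X ==> ispoly {\<lambda>t::complex. t} (\<lambda>t. l (s t))"
    using path[OF pq(1,3)] by blast
  have "ispoly {\<lambda>t::complex. t} (\<lambda>t. f (s t))" by (rule ispoly_compose[OF fg(1)]) (rule s(4))
  then obtain F where F: "\<And>t. f (s t) = poly F t" using ispoly_id_poly by blast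
  have "ispoly {\<lambda>t::complex. t} (\<lambda>t. g (s t))" by (rule ispoly_compose[OF fg(2)]) (rule s(4))
  then obtain G where G: "\<And>t. g (s t) = poly G t" using ispoly_id_poly by blast
  have "poly (F * G) t = 0" for t using fg(3) s(1) by (simp flip: F G)
  then have "F * G = 0" using poly_all_0_iff_0 by blast
  then have "F = 0 \<or> G = 0" by simp
  then show False using F[of 0] G[of 1] s(2,3) pq by auto
qed

section \<open>The group action, and bases adapted to a nilpotent element\<close>

context symp
begin

text \<open>For \<open>g \<in> Sp\<close> this is conjugation on both matrices and application to
  the vector; writing the inverse as \<open>adj g\<close> keeps the action polynomial in
  \<open>g\<close>.\<close>

definition act :: "complex^'m^'m => 'm triple => 'm triple" where
  "act g p = (g ** fst p ** adj g, g ** fst (snd p) ** adj g, g *v snd (snd p))"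

lemma act_act: "act g (act h p) = act (g ** h) p"
  by (simp add: act_def adj_mult matrix_mul_assoc matrix_vector_mul_assoc)

lemma act_1: "act (mat 1) p = p"
  by (simp add: act_def adj_mat)

lemma sq_act: "sq (g *v i) = g ** sq i ** adj g"
proof -
  have "sq (g *v i) *v w = (g ** sq i ** adj g) *v w" for w
    by (simp add: sq_mult adj vector_scalar_commute flip: matrix_vector_mul_assoc)
  then show ?thesis by (simp add: matrix_eq)
qed

lemma commutator_act:
  assumes "g \<in> Sp"
  shows "commutator (g ** x ** adj g) (g ** y ** adj g) = g ** commutator x y ** adj g"
proof -
  have "(g ** x ** adj g) ** (g ** y ** adj g) = g ** (x ** y) ** adj g" for x y
  proof -
    have "(g ** x ** adj g) ** (g ** y ** adj g) = g ** x ** (adj g ** g) ** y ** adj g"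
      by (simp only: matrix_mul_assoc)
    then show ?thesis using Sp_inv(1)[OF assms] by (simp add: matrix_mul_assoc)
  qed
  then show ?thesis unfolding commutator_def by (simp only: matrix_diff_ldistrib matrix_diff_rdistrib)
qed

lemma jordan_type_conj:
  fixes s si :: "complex^'m^'m"
  assumes "jordan_type y p" "s ** si = mat 1" "si ** s = mat 1"
  shows "jordan_type (s ** y ** si) p"
  using assms(1) jordan_basis_conj[OF _ assms(2,3)] unfolding jordan_type_iff by blast

lemma Xpart_iff: "q \<in> XP p \<longleftrightarrow> fst q \<in> sp \<omega> \<and> fst (snd q) \<in> sp \<omega> \<and>
    commutator (fst q) (fst (snd q)) + sq (snd (snd q)) = 0 \<and> jordan_type (fst (snd q)) p"
  by (cases q) (auto simp: Xpart_def Xnil_def phase_space_def nilp_class_def jordan_type_nilpotent)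

lemma Xpart_act:
  assumes g: "g \<in> Sp" and q: "q \<in> XP p"
  shows "act g q \<in> XP p"
  unfolding Xpart_iff
proof (intro conjI)
  note q = q[unfolded Xpart_iff]
  show "fst (act g q) \<in> sp \<omega>" "fst (snd (act g q)) \<in> sp \<omega>"
    using q Sp_conj_sp[OF g] by (auto simp: act_def)
  show "jordan_type (fst (snd (act g q))) p"
    using q jordan_type_conj[OF _ Sp_inv(2,1)[OF g]] by (simp add: act_def)
  have "commutator (fst (act g q)) (fst (snd (act g q))) + sq (snd (snd (act g q)))
      = g ** (commutator (fst q) (fst (snd q)) + sq (snd (snd q))) ** adj g"
    unfolding act_def by (simp add: commutator_act[OF g] sq_act matrix_add_ldistrib matrix_add_rdistrib)
  then show "commutator (fst (act g q)) (fst (snd (act g q))) + sq (snd (snd (act g q))) = 0"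
    using q by simp
qed

lemma matpoly_act:
  assumes "matpoly Y g" "matpoly Y (\<lambda>t. fst (\<psi> t))" "matpoly Y (\<lambda>t. fst (snd (\<psi> t)))" "vecpoly Y (\<lambda>t. snd (snd (\<psi> t)))"
  shows "matpoly Y (\<lambda>t. fst (act (g t) (\<psi> t)))" "matpoly Y (\<lambda>t. fst (snd (act (g t) (\<psi> t))))"
    "vecpoly Y (\<lambda>t. snd (snd (act (g t) (\<psi> t))))"
  unfolding act_def fst_conv snd_conv by (intro matpoly_mult vecpoly_mult matpoly_adj assms)+

text \<open>Scaling all transvection parameters gives a polynomial path in the group from the
  identity to \<open>tvs us\<close>.\<close>

definition stvs :: "(complex \<times> (complex^'m)) list => complex => complex^'m^'m" where
  "stvs us \<tau> = tvs (map (\<lambda>(t, u). (\<tau> * t, u)) us)"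

lemma stvs_Sp: "stvs us t \<in> Sp" and stvs_1: "stvs us 1 = tvs us"
  by (simp_all add: stvs_def tvs_Sp)

lemma tv_0: "tv 0 u = mat 1"
  by (simp add: tv_def vec_eq_iff)

lemma stvs_0: "stvs us 0 = mat 1"
  unfolding stvs_def by (induction us) (auto simp: tv_0)

lemma matpoly_stvs: "ispoly Y f ==> matpoly Y (\<lambda>t. stvs us (f t))"
  unfolding stvs_def by (induction us) (auto intro!: matpoly_const matpoly_mult matpoly_tv ispoly_mult ispoly_const)

lemma sp_span_squares: "sp \<omega> \<subseteq> module.span mscale (range sq)"
proof -
  obtain N' e' x' where ch: "affine_chart (mscale :: complex => complex^'m^'m => _) UNIV N' e' x'" using matrix_chart by blast
  interpret fd: finite_dimensional_vector_space "mscale :: complex => complex^'m^'m => _" "e' ` {..<N'}"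
    by (rule affine_chart.chart_finite_dimensional[OF ch refl])
  show ?thesis
  proof
    fix u assume u: "u \<in> sp \<omega>"
    show "u \<in> fd.span (range sq)"
    proof (rule fd.double_perp[OF subspace_sp fd.subspace_span _ trace_linear trace_sp_nondeg u])
      show "fd.span (range sq) \<subseteq> sp \<omega>" by (intro fd.span_minimal subspace_sp) (auto intro: sq_sp)
      fix w assume w: "w \<in> sp \<omega>" and z: "\<And>u. u \<in> fd.span (range sq) ==> trace (u ** w) = 0"
      have "w = 0"
      proof (rule trace_sp_nondeg[OF w])
        fix v assume v: "v \<in> sp \<omega>"
        have q: "\<omega> u (w *v u) = 0" for u
          using z[OF fd.span_base[of "sq u"]] trace_sq[of u w] by simp
        have "w = 0"
        proof -
          have "\<omega> u (w *v v) = 0" for u v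
          proof -
            have "\<omega> (u + v) (w *v (u + v)) = \<omega> u (w *v v) + \<omega> v (w *v u)"
              by (simp add: matrix_vector_right_distrib \<omega>_simps q)
            moreover have "\<omega> v (w *v u) = \<omega> u (w *v v)"
              using spD[OF w, of v u] \<omega>_skew[of u "w *v v"] by simp
            ultimately show ?thesis using q[of "u + v"] by simp
          qed
          then have "w *v v = 0 *v v" for v using nondeg'[of "w *v v"] by simp
          then show ?thesis by (simp add: matrix_eq)
        qed
        then show "trace (w ** v) = 0" by (simp add: trace_def)
      qed
      then show "trace (u ** w) = 0" by (simp add: trace_def)
    qed
  qed
qed

text \<open>A basis of the centralizer of \<open>y\<close> is extended by squares, which span
  \<open>sp\<close>. The squares come first: their \<open>a\<close> coordinates vanish exactly on
  the centralizer, and each square is the derivative of a transvection.\<close>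

lemma sp_splitting:
  assumes dim_sp: "vector_space.dim mscale (sp \<omega>) = D"
  obtains a f ck w where "a \<le> D" "affine_chart mscale (sp \<omega>) D f ck" "\<And>k. k < a ==> f k = sq (w k)"
    "\<And>t. t \<in> sp \<omega> ==> t ** y = y ** t \<longleftrightarrow> (\<forall>k<a. ck k t = 0)"
proof -
  obtain N' e' x' where ch: "affine_chart (mscale :: complex => complex^'m^'m => _) UNIV N' e' x'" using matrix_chart by blast
  interpret fd: finite_dimensional_vector_space "mscale :: complex => complex^'m^'m => _" "e' ` {..<N'}"
    by (rule affine_chart.chart_finite_dimensional[OF ch refl])
  define Z where "Z = {t \<in> sp \<omega>. t ** y = y ** t}"
  have Z: "fd.subspace Z"
    by (rule fd.subspaceI) (auto simp: Z_def matrix_add_ldistrib matrix_add_rdistrib mscale_mult intro: sp_closed(1,2,3))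
  obtain Bz where Bz: "Bz \<subseteq> Z" "fd.independent Bz" "Z \<subseteq> fd.span Bz" by (rule fd.maximal_independent_subset)
  obtain B where B: "Bz \<subseteq> B" "B \<subseteq> Bz \<union> range sq" "fd.independent B" "Bz \<union> range sq \<subseteq> fd.span B"
    using fd.maximal_independent_subset_extend[of Bz "Bz \<union> range sq"] Bz(2) by blast
  have "B \<subseteq> sp \<omega>" using B(2) Bz(1) sq_sp unfolding Z_def by blast
  moreover have "sp \<omega> \<subseteq> fd.span B"
    using sp_span_squares fd.span_minimal[OF _ fd.subspace_span, of "range sq" B] B(4) by blast
  ultimately have spanB: "fd.span B = sp \<omega>" using fd.span_minimal[OF _ subspace_sp] by blast
  have finB: "finite B" by (rule fd.finiteI_independent[OF B(3)])
  have cardB: "card B = D" using fd.dim_eq_card[OF _ B(3), of "sp \<omega>"] spanB dim_sp by (metis fd.span_span)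
  define a where "a = card (B - Bz)"
  have fin: "finite (B - Bz)" "finite Bz" using finB B(1) finite_subset by auto
  have ac: "D = a + card Bz" using cardB B(1) fin by (metis a_def card_Diff_subset card_mono finB le_add_diff_inverse2)
  obtain s where s: "bij_betw s {..<a} (B - Bz)"
    using ex_bij_betw_nat_finite[OF fin(1)] by (auto simp: a_def atLeast0LessThan)
  obtain z where z: "bij_betw z {..<card Bz} Bz"
    using ex_bij_betw_nat_finite[OF fin(2)] by (auto simp: atLeast0LessThan)
  define f where "f k = (if k < a then s k else z (k - a))" for k
  have f1: "f ` {..<a} = B - Bz"
    using s unfolding bij_betw_def f_def by auto
  have "f ` {a..<D} = Bz"
  proof -
    have "f ` {a..<D} = z ` ((\<lambda>k. k - a) ` {a..<D})" unfolding f_def image_image by (intro image_cong) auto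
    also have "(\<lambda>k. k - a) ` {a..<D} = {..<card Bz}"
    proof
      show "{..<card Bz} \<subseteq> (\<lambda>k. k - a) ` {a..<D}"
      proof
        fix k assume "k \<in> {..<card Bz}"
        then show "k \<in> (\<lambda>k. k - a) ` {a..<D}" using ac by (intro image_eqI[of _ _ "k + a"]) auto
      qed
    qed (use ac in auto)
    finally show ?thesis using z unfolding bij_betw_def by simp
  qed
  moreover have "{..<D} = {..<a} \<union> {a..<D}" using ac by auto
  ultimately have img: "f ` {..<D} = B" using f1 B(1) by (auto simp: image_Un)
  have inj: "inj_on f {..<D}" using img cardB by (intro eq_card_imp_inj_on) auto
  obtain ck where ck: "affine_chart mscale (sp \<omega>) D f ck"
    using basis_chart[OF vector_space_mscale inj] img B(3) spanB by auto
  interpret c: affine_chart mscale "sp \<omega>" D f ck by (rule ck)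
  have "\<forall>k<a. \<exists>w. f k = sq w" using f1 B(2) by blast
  then obtain w where w: "\<And>k. k < a ==> f k = sq (w k)" by metis
  have aD: "a \<le> D" using ac by simp
  have fe: "ck k (f j) = (if j = k then 1 else 0)" if "j < D" "k < D" for j k
  proof -
    have "(\<Sum>i<D. mscale (if i = j then 1 else 0) (f i)) = (\<Sum>i<D. if i = j then f i else 0)"
      by (intro sum.cong) (auto simp: vec_eq_iff)
    then show ?thesis using c.x_pt[OF that(2), of "\<lambda>i. if i = j then 1 else 0"] that by auto
  qed
  have fz: "f k \<in> Z" if "a \<le> k" "k < D" for k
    using \<open>f ` {a..<D} = Bz\<close> Bz(1) that by auto
  have zc: "t ** y = y ** t \<longleftrightarrow> (\<forall>k<a. ck k t = 0)" if t: "t \<in> sp \<omega>" for t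
  proof
    assume "t ** y = y ** t"
    then have zs: "t \<in> fd.span Bz" using Bz(3) t unfolding Z_def by blast
    show "\<forall>k<a. ck k t = 0"
    proof (intro allI impI)
      fix k assume k: "k < a"
      have lin: "functional mscale (ck k)" using c.linear_x k aD by simp
      show "ck k t = 0" using zs
      proof (induction rule: fd.span_induct_alt)
        case base
        then show ?case using c.linear_scale[OF lin, of 0 0] by (simp add: vec_eq_iff zero_vec_def map_matrix_def)
      next
        case (step c u v)
        obtain j where "a \<le> j" "j < D" "u = f j" using step \<open>f ` {a..<D} = Bz\<close> by auto
        then show ?case using step k aD fe[of j k] by (simp add: c.linear_add[OF lin] c.linear_scale[OF lin])
      qed
    qed
  next
    assume z: "\<forall>k<a. ck k t = 0"
    have "(\<Sum>k<D. mscale (ck k t) (f k)) \<in> Z"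
    proof (rule fd.subspace_sum[OF Z])
      fix k assume k: "k \<in> {..<D}"
      show "mscale (ck k t) (f k) \<in> Z"
      proof (cases "k < a")
        case True
        then have "ck k t = 0" using z by blast
        then show ?thesis using fd.subspace_0[OF Z] fd.scale_zero_left by simp
      next
        case False
        then show ?thesis using fz k by (intro fd.subspace_scale[OF Z]) auto
      qed
    qed
    then show "t ** y = y ** t" using c.pt_x[OF t] unfolding Z_def by simp
  qed
  show ?thesis by (rule that[OF aD ck w zc])
qed

text \<open>A solution \<open>x\<close> of \<open>[x, y] = u\<close> that depends linearly on
  \<open>u\<close>, so that particular solutions depend polynomially on parameters.\<close>

lemma commutator_right_inverse:
  assumes y: "y \<in> sp \<omega>"
  obtains G where "Vector_Spaces.linear mscale mscale G" "\<And>u. G u \<in> sp \<omega>"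
    "\<And>s. s \<in> sp \<omega> ==> commutator (G (commutator s y)) y = commutator s y"
proof -
  interpret vs: vector_space "mscale :: complex => complex^'m^'m => _" by (rule vector_space_mscale)
  interpret p: vector_space_pair "mscale :: complex => complex^'m^'m => _" "mscale :: complex => complex^'m^'m => _" by unfold_locales
  have "Vector_Spaces.linear mscale mscale (\<lambda>x. commutator x y)"
    unfolding Vector_Spaces.linear_iff
    by (auto simp: vector_space_mscale commutator_def matrix_add_ldistrib matrix_add_rdistrib mscale_mult vec_eq_iff right_diff_distrib)
  from p.linear_exists_right_inverse_on[OF this subspace_sp]
  obtain G where "G ` UNIV \<subseteq> sp \<omega>" "Vector_Spaces.linear mscale mscale G" "\<forall>v\<in>(\<lambda>x. commutator x y) ` sp \<omega>. commutator (G v) y = v"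
    by blast
  then show ?thesis by (intro that) auto
qed

lemma L_chart:
  assumes "y \<in> sp \<omega>" "jordan_type y p"
  obtains l lc where "affine_chart (*s) (L y) (\<Sum>x\<in>#p. x div 2) l lc"
proof -
  obtain B where B: "finite B" "vec.independent B" "vec.span B = L y" "card B = (\<Sum>x\<in>#p. x div 2)"
    using L_basis[OF assms] by blast
  obtain l where l: "bij_betw l {..<card B} B"
    using ex_bij_betw_nat_finite[OF B(1)] by (auto simp: atLeast0LessThan)
  then have "inj_on l {..<card B}" "l ` {..<card B} = B" by (auto simp: bij_betw_def)
  then show ?thesis using basis_chart[OF vec.vector_space_axioms, of l "card B" "L y"] B that by auto
qed

end

section \<open>The local structure of the action\<close>

lemma scaleR_mscale: "r *\<^sub>R A = mscale (of_real r) A" for A :: "complex^'m^'m"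
  unfolding vec_eq_iff vector_scaleR_component mscale_component scaleR_conv_of_real[where 'a = complex] by simp

lemma scaleR_vec: "r *\<^sub>R v = of_real r *s v" for v :: "complex^'m"
  unfolding vec_eq_iff vector_scaleR_component vector_smult_component scaleR_conv_of_real[where 'a = complex] by simp

lemma bounded_bilinear_matmul: "bounded_bilinear ((**) :: complex^'m^'m::finite => complex^'m^'m => _)"
  unfolding bilinear_conv_bounded_bilinear[symmetric] bilinear_def
  by (auto intro!: linearI simp: matrix_add_ldistrib matrix_add_rdistrib scaleR_mscale mscale_mult)

lemma bounded_bilinear_mscale: "bounded_bilinear (mscale :: complex => complex^'m^'m::finite => _)"
  unfolding bilinear_conv_bounded_bilinear[symmetric] bilinear_def
  by (auto intro!: linearI simp: scaleR_mscale scaleR_conv_of_real[where 'a = complex] vec_eq_iff algebra_simps)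

lemma bounded_bilinear_mulvec: "bounded_bilinear ((*v) :: complex^'m^'m::finite => complex^'m => _)"
  unfolding bilinear_conv_bounded_bilinear[symmetric] bilinear_def
  by (auto intro!: linearI simp: matrix_vector_right_distrib matrix_vector_mult_add_rdistrib scaleR_mscale
      scaleR_vec mscale_mult_vec vector_scalar_commute)

lemma bounded_linear_functional:
  fixes l :: "complex^'m^'m::finite => complex"
  assumes "functional mscale l"
  shows "bounded_linear l"
proof -
  interpret l: Vector_Spaces.linear "mscale :: complex => complex^'m^'m => _" "(*)" l by (rule assms)
  show ?thesis unfolding linear_conv_bounded_linear[symmetric]
    by (rule linearI) (simp_all add: l.add l.scale scaleR_mscale scaleR_conv_of_real[where 'a = complex])
qed

lemma matpoly_linear:
  assumes T: "Vector_Spaces.linear mscale mscale T" and M: "matpoly X M"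
  shows "matpoly X (\<lambda>t. T (M t))"
proof -
  interpret T: Vector_Spaces.linear mscale mscale T by (rule T)
  have "functional mscale (\<lambda>A. T A $ a $ b)" for a b
    by (rule linear_mscaleI) (simp_all add: T.add T.scale)
  then show ?thesis using ispoly_linear[OF _ M] unfolding matpoly_def by blast
qed

context symp
begin

lemma adj_mscale: "adj (mscale c A) = mscale c (adj A)"
  using adj_mult[of "mat c" A] unfolding mat_mult_left adj_mat mat_mult_right .

lemma bounded_linear_adj: "bounded_linear adj"
  unfolding linear_conv_bounded_linear[symmetric]
  by (rule linearI) (simp_all add: adj_add scaleR_mscale adj_mscale)

lemma tv_derivative:
  assumes "bounded_linear c"
  shows "((\<lambda>m. tv (c m) u) has_derivative (\<lambda>m. mscale (c m) (sq u))) F"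
  unfolding tv_def
  using bounded_linear_imp_has_derivative[OF bounded_linear_compose[OF bounded_bilinear.bounded_linear_left[OF bounded_bilinear_mscale] assms], of "sq u" F]
  by (auto intro: has_derivative_add_const simp: add.commute[of "mat 1"])

lemma tvs_at_0:
  assumes "\<And>k. k \<in> set ks ==> c k = 0"
  shows "tvs (map (\<lambda>k. (c k, u k)) ks) = mat 1"
  using assms by (induction ks) (auto simp: tv_0)

lemma tvs_derivative:
  assumes "\<And>k. k \<in> set ks ==> bounded_linear (c k)"
  shows "((\<lambda>m. tvs (map (\<lambda>k. (c k m, u k)) ks)) has_derivative
    (\<lambda>m. \<Sum>k\<leftarrow>ks. mscale (c k m) (sq (u k)))) (at 0)"
  using assms
proof (induction ks)
  case (Cons k ks)
  have 0: "c j 0 = 0" if "j \<in> set (k # ks)" for j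
    using bounded_linear.linear[OF Cons.prems[OF that]] linear_0 by blast
  have "((\<lambda>m. tv (c k m) (u k) ** tvs (map (\<lambda>k. (c k m, u k)) ks)) has_derivative
    (\<lambda>m. tv (c k 0) (u k) ** (\<Sum>k\<leftarrow>ks. mscale (c k m) (sq (u k))) +
      mscale (c k m) (sq (u k)) ** tvs (map (\<lambda>k. (c k 0, u k)) ks))) (at 0)"
    using Cons by (intro bounded_bilinear.FDERIV[OF bounded_bilinear_matmul] tv_derivative) auto
  moreover have "tvs (map (\<lambda>k. (c k 0, u k)) ks) = mat 1" using 0 by (intro tvs_at_0) simp
  ultimately show ?case using 0 by (simp add: tv_0 add.commute)
qed simp

lemma tvs_continuous:
  assumes "\<And>k. k \<in> set ks ==> bounded_linear (c k)"
  shows "continuous_on UNIV (\<lambda>m. tvs (map (\<lambda>k. (c k m, u k)) ks))"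
  using assms
proof (induction ks)
  case (Cons k ks)
  have "continuous_on UNIV (\<lambda>m. tv (c k m) (u k))"
    by (rule has_derivative_continuous_on[OF tv_derivative]) (use Cons.prems in simp)
  then show ?case using Cons by (simp add: bounded_bilinear.continuous_on[OF bounded_bilinear_matmul])
qed simp

end

text \<open>The data for one piece: a base point \<open>y\<close> of type \<open>p\<close>, a basis
  \<open>f\<close> of \<open>sp\<close> adapted to its centralizer, coordinates on
  \<open>L y\<close>, and a linear solution operator \<open>G\<close> for the commutator
  equation.\<close>

locale slice = phase \<omega> N e x D es xs n + fc: affine_chart mscale "sp \<omega>" D f ck + lc: affine_chart "(*s)" "L y" b l ln
  for \<omega> :: "complex^'m::finite => complex^'m => complex" and N e x D es xs n f ck y b l ln +
  fixes p a w G
  assumes y: "y \<in> sp \<omega>" and type: "jordan_type y p" and a: "a \<le> D"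
    and f_sq: "\<And>k. k < a ==> f k = sq (w k)"
    and f_comm: "\<And>\<zeta>. \<zeta> \<in> sp \<omega> ==> \<zeta> ** y = y ** \<zeta> \<longleftrightarrow> (\<forall>k<a. ck k \<zeta> = 0)"
    and G: "Vector_Spaces.linear mscale mscale G" "\<And>u. G u \<in> sp \<omega>"
      "\<And>s. s \<in> sp \<omega> ==> commutator (G (commutator s y)) y = commutator s y"
    and b: "b = (\<Sum>x\<in>#p. x div 2)"
begin

text \<open>For \<open>z\<close> in the centralizer and \<open>i \<in> L y\<close>, the general
  point of the piece over \<open>y\<close>: a particular solution of \<open>[x, y] = - sq i\<close>
  plus a homogeneous one.\<close>

definition base :: "complex^'m^'m => complex^'m => 'm triple" where
  "base z i = (G (- sq i) + z, y, i)"

definition C :: "(complex^'m^'m) set" where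
  "C = {z \<in> sp \<omega>. z ** y = y ** z}"

lemma commutator_add: "commutator (u + v) y = commutator u y + commutator v y"
  by (simp add: commutator_def matrix_add_ldistrib matrix_add_rdistrib)

lemma commutator_diff: "commutator (u - v) y = commutator u y - commutator v y"
  by (simp add: commutator_def matrix_diff_ldistrib matrix_diff_rdistrib)

lemma commutator_G:
  assumes "i \<in> L y"
  shows "commutator (G (- sq i)) y = - sq i"
proof -
  obtain x where "x \<in> sp \<omega>" "commutator x y + sq i = 0" using fibre_exists[OF y type assms] by blast
  then have "commutator x y = - sq i" by (simp only: eq_neg_iff_add_eq_0)
  then have "- sq i = commutator x y" by simp
  then show ?thesis using G(3)[OF \<open>x \<in> sp \<omega>\<close>] by simp
qed

lemma base_Xpart:
  assumes "z \<in> C" "i \<in> L y"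
  shows "base z i \<in> XP p"
proof -
  have "commutator z y = 0" using assms(1) by (simp add: C_def commutator_def)
  then show ?thesis using assms y type G(2)
    unfolding Xpart_iff base_def by (simp add: commutator_add commutator_G C_def sp_closed(1))
qed

lemma fibre_base:
  assumes "q \<in> XP p" "fst (snd q) = y"
  shows "\<exists>z\<in>C. \<exists>i\<in>L y. q = base z i"
proof -
  have q: "fst q \<in> sp \<omega>" "commutator (fst q) y + sq (snd (snd q)) = 0" using assms by (auto simp: Xpart_iff)
  define i where "i = snd (snd q)"
  have i: "i \<in> L y" using fibre_L[OF y q(2)] by (simp add: i_def)
  define z where "z = fst q - G (- sq i)"
  have "commutator (fst q) y = - sq i" using q(2) by (simp only: eq_neg_iff_add_eq_0 i_def)
  then have "commutator z y = 0" unfolding z_def commutator_diff commutator_G[OF i] by simp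
  moreover have "z \<in> sp \<omega>" unfolding z_def diff_conv_add_uminus by (intro sp_closed q(1) G(2))
  ultimately have "z \<in> C" by (simp add: C_def commutator_def)
  moreover have "q = base z i" using assms(2) by (simp add: base_def z_def i_def prod_eq_iff)
  ultimately show ?thesis using i by blast
qed

lemma Xpart_orbit:
  assumes q: "q \<in> XP p"
  shows "\<exists>k\<in>Sp. \<exists>z\<in>C. \<exists>i\<in>L y. q = act k (base z i)"
proof -
  have q': "fst (snd q) \<in> sp \<omega>" "jordan_type (fst (snd q)) p" using q by (auto simp: Xpart_iff)
  obtain k where k: "k \<in> Sp" "k ** y = fst (snd q) ** k" using Sp_conjugate[OF y q'(1) type q'(2)] by blast
  have "act (adj k) q \<in> XP p" by (rule Xpart_act[OF Sp_adj[OF k(1)] q])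
  moreover have "fst (snd (act (adj k) q)) = y"
    using k(2) Sp_inv(1)[OF k(1)] by (simp add: act_def adj_adj flip: k(2) matrix_mul_assoc) (simp add: matrix_mul_assoc)
  ultimately obtain z i where "z \<in> C" "i \<in> L y" "act (adj k) q = base z i" using fibre_base by blast
  moreover from this have "q = act k (base z i)"
    using Sp_inv(2)[OF k(1)] by (metis act_act act_1)
  ultimately show ?thesis using k(1) by blast
qed

lemma act_base:
  assumes h: "h \<in> Sp" "h ** y = y ** h" and zi: "z \<in> C" "i \<in> L y"
  shows "\<exists>z'\<in>C. \<exists>i'\<in>L y. act h (base z i) = base z' i'"
proof (rule fibre_base[OF Xpart_act[OF h(1) base_Xpart[OF zi]]])
  show "fst (snd (act h (base z i))) = y"
    using h(2) Sp_inv(2)[OF h(1)] by (simp add: act_def base_def flip: matrix_mul_assoc)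
qed

text \<open>A product of transvections whose derivative at the origin runs through the span of
  \<open>f k\<close> with \<open>k < a\<close>: a polynomial substitute for the exponential map on a
  complement of the centralizer of \<open>y\<close>.\<close>

definition Epr :: "(nat => complex) => complex^'m^'m" where
  "Epr t = tvs (map (\<lambda>k. (t k, w k)) [0..<a])"

lemma Epr_Sp: "Epr t \<in> Sp"
  by (simp add: Epr_def tvs_Sp)

text \<open>Near the identity the factor of \<open>g\<close> complementary to the product of transvections commutes
  with \<open>y\<close>: its part \<open>\<epsilon>\<close> outside \<open>1 + sp\<close> is determined by \<open>2\<epsilon> = \<zeta>\<^sup>2 + \<zeta>\<epsilon> - \<epsilon>\<zeta> - \<epsilon>\<^sup>2\<close>, and taking
  commutators with \<open>y\<close> gives an equation that only \<open>0\<close> can satisfy for small \<open>\<zeta>\<close> and \<open>\<epsilon>\<close>.\<close>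

lemma local_slice:
  obtains q where "0 < q" "\<And>g. g \<in> Sp ==> dist g (mat 1) < q ==> \<exists>t h. g = Epr t ** h \<and> h \<in> Sp \<and> h ** y = y ** h"
proof -
  \<comment> \<open>Every matrix splits as \<open>m = d m + v m + i m\<close>: a part in the span of
    the chosen squares, a part in the centralizer of \<open>y\<close>, and a self-adjoint
    part.\<close>
  define P where "P m = mscale (1 / 2) (m - adj m)" for m
  have P_sp: "P m \<in> sp \<omega>" for m
    unfolding P_def sp_iff adj_mscale diff_conv_add_uminus adj_add adj_minus adj_adj by (simp add: vec_eq_iff algebra_simps)
  have mbl: "bounded_linear (mscale c)" for c by (rule bounded_bilinear.bounded_linear_right[OF bounded_bilinear_mscale])
  have blP: "bounded_linear P"
    unfolding P_def[abs_def] by (intro bounded_linear_compose[OF mbl] bounded_linear_sub bounded_linear_ident bounded_linear_adj)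
  define c where "c k m = ck k (P m)" for k m
  have blc: "bounded_linear (c k)" if "k < a" for k
    unfolding c_def[abs_def] by (intro bounded_linear_compose[OF bounded_linear_functional blP] fc.linear_x) (use that a in simp)
  define d where "d m = (\<Sum>k<a. mscale (c k m) (f k))" for m
  have bl\<pi>: "bounded_linear d"
    unfolding d_def[abs_def]
    by (intro bounded_linear_sum bounded_linear_compose[OF bounded_bilinear.bounded_linear_left[OF bounded_bilinear_mscale] blc]) auto
  define v where "v m = P m - d m" for m
  define i where "i m = m - P m" for m
  have bl: "bounded_linear v" "bounded_linear i"
    unfolding v_def[abs_def] i_def[abs_def] by (intro bounded_linear_sub bounded_linear_ident blP bl\<pi>)+
  have \<epsilon>_adj: "adj (i m) = i m" for m
    unfolding i_def P_def diff_conv_add_uminus adj_add adj_minus adj_mscale adj_adj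
    by (simp add: vec_eq_iff algebra_simps)
  have \<pi>_pt: "d m = fc.pt (\<lambda>k. if k < a then c k m else 0)" for m
  proof -
    have "fc.pt (\<lambda>k. if k < a then c k m else 0) = (\<Sum>k<D. if k < a then mscale (c k m) (f k) else 0)"
      unfolding fc.pt_def by (intro sum.cong) (auto simp: vec_eq_iff)
    also have "\<dots> = d m" unfolding d_def
      using a by (subst sum.inter_filter[symmetric]) (auto intro!: sum.cong)
    finally show ?thesis by simp
  qed
  have \<zeta>_sp: "v m \<in> sp \<omega>" for m
    unfolding v_def diff_conv_add_uminus by (intro sp_closed P_sp) (simp add: \<pi>_pt fc.pt_W)
  have \<zeta>y: "v m ** y = y ** v m" for m
    unfolding f_comm[OF \<zeta>_sp]
  proof (intro allI impI)
    fix k assume k: "k < a"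
    then have "ck k (d m) = c k m" unfolding \<pi>_pt using a by (subst fc.x_of_pt) auto
    then show "ck k (v m) = 0" unfolding v_def using k a by (simp add: fc.linear_diff[OF fc.linear_x] c_def)
  qed
  have "\<exists>K>0. \<forall>A B. norm ((A :: complex^'m^'m) ** (B :: complex^'m^'m)) \<le> norm A * norm B * K"
    by (rule bounded_bilinear.pos_bounded[OF bounded_bilinear_matmul])
  then obtain K0 where K0: "0 < K0 \<and> (\<forall>A B. norm ((A :: complex^'m^'m) ** (B :: complex^'m^'m)) \<le> norm A * norm B * K0)" by (rule exE)
  note K0 = conjunct1[OF K0] conjunct2[OF K0, rule_format]
  obtain K1 where K1: "0 < K1" "\<And>m. norm (v m) \<le> norm m * K1" using bounded_linear.pos_bounded[OF bl(1)] by blast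
  obtain K2 where K2: "0 < K2" "\<And>m. norm (i m) \<le> norm m * K2" using bounded_linear.pos_bounded[OF bl(2)] by blast
  \<comment> \<open>For \<open>norm m < r\<close> the norms of \<open>v m\<close> and
    \<open>i m\<close> together times \<open>K0\<close> stay below 1, which is what the estimate of
    \<open>u\<close> below contradicts.\<close>
  define r where "r = 1 / (K0 * (K1 + K2))"
  have r: "0 < r" using K0(1) K1(1) K2(1) by (simp add: r_def)
  \<comment> \<open>Only \<open>d m\<close> passes into the transvections; the rest stays in the
    second factor. The derivative at 0 is the identity, so the open mapping theorem factors every
    matrix near the identity in this way.\<close>
  define T where "T m = Epr (\<lambda>k. c k m) ** (mat 1 + (m - d m))" for m
  have E: "Epr (\<lambda>k. c k m) = tvs (map (\<lambda>k. (c k m, w k)) [0..<a])" for m by (simp add: Epr_def)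
  have E0: "Epr (\<lambda>k. c k 0) = mat 1"
    unfolding E using blc by (intro tvs_at_0) (simp add: linear_0 bounded_linear.linear)
  have \<pi>0: "d 0 = 0" using bl\<pi> by (simp add: linear_0 bounded_linear.linear)
  have "(T has_derivative (\<lambda>m. Epr (\<lambda>k. c k 0) ** (m - d m) + (\<Sum>k\<leftarrow>[0..<a]. mscale (c k m) (sq (w k))) ** (mat 1 + (0 - d 0)))) (at 0)"
    unfolding T_def[abs_def] E
    by (intro bounded_bilinear.FDERIV[OF bounded_bilinear_matmul] tvs_derivative derivative_eq_intros
        bounded_linear_imp_has_derivative[OF bl\<pi>] refl) (use blc bounded_linear_imp_has_derivative[OF bl\<pi>] in auto)
  moreover have "(\<Sum>k\<leftarrow>[0..<a]. mscale (c k m) (sq (w k))) = d m" for m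
    unfolding d_def interv_sum_list_conv_sum_set_nat by (intro sum.cong) (auto simp: f_sq)
  ultimately have der: "(T has_derivative (\<lambda>m. m)) (at 0)" by (simp add: E0 \<pi>0)
  have cont: "continuous_on UNIV T"
    unfolding T_def[abs_def] E
    by (intro bounded_bilinear.continuous_on[OF bounded_bilinear_matmul] tvs_continuous continuous_intros
        linear_continuous_on bl\<pi>) (use blc in auto)
  have "T 0 \<in> interior (T ` ball 0 r)"
    by (rule sussmann_open_mapping[OF open_UNIV cont UNIV_I der bounded_linear_ident]) (auto simp: r)
  then obtain q where q: "0 < q" "ball (T 0) q \<subseteq> T ` ball 0 r" unfolding mem_interior by blast
  have \<Phi>0: "T 0 = mat 1" by (simp add: T_def E0 \<pi>0)
  have "\<exists>t h. g = Epr t ** h \<and> h \<in> Sp \<and> h ** y = y ** h" if g: "g \<in> Sp" "dist g (mat 1) < q" for g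
  proof -
    have "g \<in> ball (T 0) q" using g(2) by (simp add: \<Phi>0 dist_commute)
    then obtain m where m: "norm m < r" "g = T m" using q(2) by auto
    define h where "h = mat 1 + (m - d m)"
    have gh: "g = Epr (\<lambda>k. c k m) ** h" using m(2) by (simp add: T_def h_def)
    then have "h = adj (Epr (\<lambda>k. c k m)) ** g"
      using Sp_inv(1)[OF Epr_Sp] by (simp add: matrix_mul_assoc)
    then have hSp: "h \<in> Sp" using Sp_mult[OF Sp_adj[OF Epr_Sp] g(1)] by simp
    define z where "z = v m"
    define s where "s = i m"
    have h: "h = mat 1 + z + s" by (simp add: h_def z_def s_def v_def i_def)
    have adjh: "adj h = mat 1 - z + s"
      using \<zeta>_sp[of m] \<epsilon>_adj[of m] unfolding h adj_add adj_mat z_def s_def sp_iff by simp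
    have "(mat 1 - z + s) ** (mat 1 + z + s) = mat 1" using Sp_inv(1)[OF hSp, unfolded adjh] unfolding h .
    then have s2: "s + s = z ** z + z ** s - s ** z - s ** s"
      by (simp add: matrix_add_ldistrib matrix_add_rdistrib matrix_diff_rdistrib algebra_simps)
    \<comment> \<open>Since \<open>z\<close> commutes with \<open>y\<close>, the matrix
      \<open>h\<close> does so exactly when \<open>u\<close> is 0.\<close>
    define u where "u = s ** y - y ** s"
    have zy: "z ** y = y ** z" using \<zeta>y[of m] by (simp add: z_def)
    have zy2: "A ** z ** y = A ** y ** z" for A by (metis matrix_mul_assoc zy)
    have "u + u = (s + s) ** y - y ** (s + s)"
      unfolding u_def matrix_add_ldistrib matrix_add_rdistrib by (simp add: algebra_simps)
    also have "\<dots> = z ** u - u ** z - u ** s - s ** u"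
      unfolding s2 u_def matrix_add_ldistrib matrix_add_rdistrib matrix_diff_ldistrib matrix_diff_rdistrib
        matrix_mul_assoc zy zy2 by (simp add: algebra_simps)
    finally have eq: "u + u = z ** u - u ** z - u ** s - s ** u" .
    have "u = 0"
    proof (rule ccontr)
      assume "u \<noteq> 0"
      then have pos: "0 < norm u" by simp
      have "2 * norm u = norm (u + u)" by (simp flip: scaleR_2)
      also have "\<dots> \<le> norm (z ** u) + norm (u ** z) + norm (u ** s) + norm (s ** u)"
        unfolding eq by (meson norm_triangle_ineq4 order_trans add_right_mono)
      also have "\<dots> \<le> 2 * ((norm z + norm s) * K0 * norm u)"
        using K0(2)[of z u] K0(2)[of u z] K0(2)[of u s] K0(2)[of s u] by (simp add: algebra_simps)
      finally have "1 * norm u \<le> (norm z + norm s) * K0 * norm u" by simp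
      then have "1 \<le> (norm z + norm s) * K0" using pos by (rule mult_right_le_imp_le)
      also have "\<dots> \<le> (norm m * K1 + norm m * K2) * K0"
        using K1(2)[of m] K2(2)[of m] K0(1) by (intro mult_right_mono add_mono) (auto simp: z_def s_def)
      also have "\<dots> = norm m * (K0 * (K1 + K2))" by (simp add: algebra_simps)
      also have "\<dots> < 1" using m(1) K0(1) K1(1) K2(1) by (simp add: r_def pos_less_divide_eq)
      finally show False by simp
    qed
    then have "h ** y = y ** h"
      unfolding h by (simp add: u_def matrix_add_ldistrib matrix_add_rdistrib zy)
    then show ?thesis using gh hSp by blast
  qed
  with q(1) show ?thesis by (rule that)
qed

end

lemma matpoly_uminus: "matpoly X M ==> matpoly X (\<lambda>t. - M t)"
  using matpoly_diff[OF matpoly_const[of X 0]] by simp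

lemma functional_limit:
  fixes M :: "complex => complex^'m^'m::finite"
  assumes M: "(M has_derivative (\<lambda>t. mscale t A)) (at 0)" and l: "functional mscale l"
  shows "((\<lambda>t. (l (M t) - l (M 0)) / t) \<longlongrightarrow> l A) (at 0)"
proof -
  interpret l: Vector_Spaces.linear "mscale :: complex => complex^'m^'m => _" "(*)" l by (rule l)
  have "((\<lambda>t. l (M t)) has_derivative (\<lambda>t. l (mscale t A))) (at 0)"
    by (rule bounded_linear.has_derivative[OF bounded_linear_functional[OF l] M])
  moreover have "(\<lambda>t. l (mscale t A)) = (*) (l A)" by (auto simp: l.scale)
  ultimately have "((\<lambda>t. l (M t)) has_derivative (*) (l A)) (at 0)" by (simp only:)
  then have "((\<lambda>t. l (M t)) has_field_derivative l A) (at 0)" by (simp add: has_field_derivative_def)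
  then show ?thesis by (simp add: DERIV_def)
qed

lemma functional_limit_vec:
  fixes M :: "complex => complex^'m::finite"
  assumes M: "(M has_derivative (\<lambda>t. t *s A)) (at 0)" and l: "functional (*s) l"
  shows "((\<lambda>t. (l (M t) - l (M 0)) / t) \<longlongrightarrow> l A) (at 0)"
proof -
  interpret l: Vector_Spaces.linear "(*s) :: complex => complex^'m => _" "(*)" l by (rule l)
  have "bounded_linear l" unfolding linear_conv_bounded_linear[symmetric]
    by (rule linearI) (simp_all add: l.add l.scale scaleR_vec scaleR_conv_of_real[where 'a = complex])
  then have "((\<lambda>t. l (M t)) has_derivative (\<lambda>t. l (t *s A))) (at 0)"
    by (rule bounded_linear.has_derivative[OF _ M])
  moreover have "(\<lambda>t. l (t *s A)) = (*) (l A)" by (auto simp: l.scale)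
  ultimately have "((\<lambda>t. l (M t)) has_derivative (*) (l A)) (at 0)" by (simp only:)
  then have "((\<lambda>t. l (M t)) has_field_derivative l A) (at 0)" by (simp add: has_field_derivative_def)
  then show ?thesis by (simp add: DERIV_def)
qed

lemma mscale_derivative: "((\<lambda>t. mscale t A) has_derivative (\<lambda>t. mscale t A)) F" for A :: "complex^'m^'m::finite"
  by (rule bounded_linear_imp_has_derivative[OF bounded_bilinear.bounded_linear_left[OF bounded_bilinear_mscale]])

lemma poly_zero_near_0:
  assumes "0 < s" "\<And>t::complex. norm t < s ==> poly P t = 0"
  shows "P = 0"
proof (rule ccontr)
  assume "P \<noteq> 0"
  then have "finite {t. poly P t = 0}" by (rule poly_roots_finite)
  moreover have "ball 0 s \<subseteq> {t. poly P t = 0}" using assms(2) by auto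
  ultimately have "countable (ball (0 :: complex) s)" using countable_finite finite_subset by blast
  then show False using uncountable_ball[OF assms(1)] by blast
qed

context symp
begin

lemma conj_derivative:
  assumes E: "(E has_derivative (\<lambda>t. mscale t s)) (at 0)" and E0: "E 0 = mat 1" and s: "s \<in> sp \<omega>"
    and M: "(M has_derivative (\<lambda>t. mscale t M')) (at 0)"
  shows "((\<lambda>t. E t ** M t ** adj (E t)) has_derivative (\<lambda>t. mscale t (commutator s (M 0) + M'))) (at 0)"
proof -
  have "((\<lambda>t. adj (E t)) has_derivative (\<lambda>t. adj (mscale t s))) (at 0)"
    by (rule bounded_linear.has_derivative[OF bounded_linear_adj E])
  moreover have "adj (mscale t s) = mscale t (- s)" for t using s by (simp add: adj_mscale sp_iff)
  ultimately have adjE: "((\<lambda>t. adj (E t)) has_derivative (\<lambda>t. mscale t (- s))) (at 0)" by simp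
  have "((\<lambda>t. E t ** M t ** adj (E t)) has_derivative
    (\<lambda>t. E 0 ** M 0 ** mscale t (- s) + (E 0 ** mscale t M' + mscale t s ** M 0) ** adj (E 0))) (at 0)"
    by (intro bounded_bilinear.FDERIV[OF bounded_bilinear_matmul] E adjE M)
  moreover have "E 0 ** M 0 ** mscale t (- s) + (E 0 ** mscale t M' + mscale t s ** M 0) ** adj (E 0)
    = mscale t (commutator s (M 0) + M')" for t
    by (simp add: E0 adj_mat mscale_mult commutator_def matrix_mul_minus_right) (simp add: vec_eq_iff algebra_simps)
  ultimately show ?thesis by simp
qed

end

section \<open>Parametrization of a piece: dimension and irreducibility\<close>

context slice
begin

lemma Xpart_phase: "XP p \<subseteq> PS"
  by (auto simp: Xpart_def Xnil_def)

lemma matpoly_tvs: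
  "(\<And>k. k \<in> set ks ==> ispoly Y (\<lambda>s. T s k)) ==> matpoly Y (\<lambda>s. tvs (map (\<lambda>k. (T s k, w k)) ks))"
  by (induction ks) (auto intro!: matpoly_const matpoly_mult matpoly_tv)

lemma base_poly:
  assumes "matpoly Y z" "vecpoly Y i"
  shows "matpoly Y (\<lambda>s. fst (base (z s) (i s)))" "matpoly Y (\<lambda>s. fst (snd (base (z s) (i s))))"
    "vecpoly Y (\<lambda>s. snd (snd (base (z s) (i s))))"
  unfolding base_def fst_conv snd_conv
  by (intro matpoly_add matpoly_linear[OF G(1)] matpoly_uminus matpoly_sq matpoly_const assms)+

definition zz :: "(nat => complex) => complex^'m^'m" where
  "zz t = fc.pt (\<lambda>k. if k < a then 0 else t k)"

definition ii :: "(nat => complex) => complex^'m" where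
  "ii t = lc.pt (\<lambda>k. t (D + k))"

text \<open>Of the \<open>D + b\<close> parameters those with \<open>k < a\<close> move the base
  point by transvections, those with \<open>a \<le> k < D\<close> run through the centralizer, and
  the last \<open>b\<close> through \<open>L y\<close>. At the origin the value is
  \<open>(0, y, 0)\<close>.\<close>

definition \<psi> :: "(nat => complex) => 'm triple" where
  "\<psi> t = act (Epr t) (base (zz t) (ii t))"

lemma zz_C: "zz t \<in> C"
proof -
  have "zz t \<in> sp \<omega>" unfolding zz_def by (rule fc.pt_W)
  moreover have "ck k (zz t) = 0" if "k < a" for k
    unfolding zz_def using that a by (subst fc.x_of_pt) auto
  ultimately show ?thesis using f_comm unfolding C_def by blast
qed

lemma ii_L: "ii t \<in> L y"
  unfolding ii_def by (rule lc.pt_W)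

lemma \<psi>_Xpart: "\<psi> t \<in> XP p"
  unfolding \<psi>_def by (intro Xpart_act Epr_Sp base_Xpart zz_C ii_L)

lemma \<psi>_poly:
  assumes T: "\<And>k. k < D + b ==> ispoly Y (\<lambda>s. T s k)" and t: "functional cscale t"
  shows "ispoly Y (\<lambda>s. t (\<psi> (T s)))"
proof -
  have "matpoly Y (\<lambda>s. Epr (T s))" unfolding Epr_def using T a by (intro matpoly_tvs) auto
  moreover have "ispoly Y (\<lambda>s. if k < a then 0 else T s k)" if "k < D" for k
    using T that by (cases "k < a") (auto intro: ispoly_const)
  then have "matpoly Y (\<lambda>s. zz (T s))"
    unfolding zz_def fc.pt_def by (intro matpoly_sum matpoly_scale matpoly_const) auto
  moreover have "vecpoly Y (\<lambda>s. ii (T s))"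
    unfolding ii_def lc.pt_def using T by (intro vecpoly_sum vecpoly_scale vecpoly_const) auto
  ultimately show ?thesis unfolding \<psi>_def
    by (intro triple_linear_poly[OF t] matpoly_act base_poly)
qed

lemma act_base_poly:
  assumes "matpoly Y g" "matpoly Y z" "vecpoly Y i" "functional cscale t"
  shows "ispoly Y (\<lambda>s. t (act (g s) (base (z s) (i s))))"
  by (intro triple_linear_poly[OF assms(4)] matpoly_act base_poly assms)

lemma \<psi>_surj:
  assumes z: "z \<in> C" and i: "i \<in> L y"
  shows "act (Epr t) (base z i) \<in> range \<psi>"
proof -
  define t' where "t' k = (if k < a then t k else if k < D then ck k z else ln (k - D) i)" for k
  have "Epr t' = Epr t" unfolding Epr_def t'_def by (intro arg_cong[of _ _ tvs] map_cong) auto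
  moreover have "zz t' = z"
  proof -
    have "zz t' = fc.pt (\<lambda>k. ck k z)"
      unfolding zz_def fc.pt_def using z f_comm unfolding C_def by (intro sum.cong) (auto simp: t'_def)
    then show ?thesis using fc.pt_of_x z unfolding C_def by simp
  qed
  moreover have "ii t' = i"
  proof -
    have "ii t' = lc.pt (\<lambda>k. ln k i)"
      unfolding ii_def lc.pt_def using a by (intro sum.cong) (auto simp: t'_def)
    then show ?thesis using lc.pt_of_x[OF i] by simp
  qed
  ultimately have "act (Epr t) (base z i) = \<psi> t'" by (simp add: \<psi>_def)
  then show ?thesis by blast
qed

text \<open>A point of the piece is joined to one over \<open>y\<close> by a polynomial path in the
  group. Near its start the local slice moves the path into the range of \<open>\<psi>\<close>, so
  \<open>v\<close> along the path is a polynomial vanishing near 0, hence also at the end.\<close>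

lemma \<psi>_dense:
  assumes v: "ispoly (linfuns cscale) v" and zero: "\<And>q. q \<in> range \<psi> ==> v q = 0" and q: "q \<in> XP p"
  shows "v q = 0"
proof -
  obtain k z i where k: "k \<in> Sp" and zi: "z \<in> C" "i \<in> L y" and q': "q = act k (base z i)"
    using Xpart_orbit[OF q] by blast
  obtain us where us: "k = tvs us" using Sp_generated[OF k] by blast
  have "ispoly {\<lambda>s::complex. s} (\<lambda>s. v (act (stvs us s) (base z i)))"
  proof (rule ispoly_compose[OF v])
    fix l :: "'m triple => complex" assume "l \<in> linfuns cscale"
    then show "ispoly {\<lambda>s::complex. s} (\<lambda>s. l (act (stvs us s) (base z i)))"
      by (intro act_base_poly matpoly_stvs matpoly_const vecpoly_const ispoly_gen) auto
  qed
  then obtain P where P: "\<And>s. v (act (stvs us s) (base z i)) = poly P s" using ispoly_id_poly by blast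
  obtain d where d: "0 < d" "\<And>g. g \<in> Sp ==> dist g (mat 1) < d ==> \<exists>t h. g = Epr t ** h \<and> h \<in> Sp \<and> h ** y = y ** h"
    by (rule local_slice) blast
  have "continuous_on UNIV (\<lambda>s. tvs (map (\<lambda>u. (s * fst u, snd u)) us))"
    by (rule tvs_continuous) (rule bounded_linear_mult_left)
  moreover have "stvs us = (\<lambda>s. tvs (map (\<lambda>u. (s * fst u, snd u)) us))"
    by (intro ext) (simp add: stvs_def case_prod_unfold)
  ultimately have "continuous_on UNIV (stvs us)" by simp
  then have "continuous (at 0) (stvs us)" by (simp add: continuous_on_eq_continuous_at)
  then obtain r where r: "0 < r" "\<And>s. dist s 0 < r ==> dist (stvs us s) (stvs us 0) < d"
    using d(1) unfolding continuous_at_eps_delta by blast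
  have "P = 0"
  proof (rule poly_zero_near_0[OF r(1)])
    fix s :: complex assume "norm s < r"
    then have "dist (stvs us s) (mat 1) < d" using r(2)[of s] by (simp add: stvs_0)
    then obtain t h where th: "stvs us s = Epr t ** h" "h \<in> Sp" "h ** y = y ** h"
      using d(2)[OF stvs_Sp] by blast
    obtain z' i' where z': "z' \<in> C" "i' \<in> L y" "act h (base z i) = base z' i'"
      using act_base[OF th(2,3) zi] by blast
    have "act (stvs us s) (base z i) = act (Epr t) (base z' i')"
      by (simp add: th(1) z'(3) flip: act_act)
    then show "poly P s = 0" using zero[OF \<psi>_surj[OF z'(1,2), of t]] P[of s] by (simp only:)
  qed
  then show ?thesis using P[of 1] by (simp add: stvs_1 q' us)
qed

definition tr :: "nat => (nat => complex) => nat => complex" where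
  "tr j t k = (if k < j then t k else 0)"

text \<open>The image of the first \<open>j\<close> parameters, the others being 0; the closures of
  these sets supply the chain for the Krull dimension.\<close>

definition S :: "nat => ('m triple) set" where
  "S j = range (\<lambda>t. \<psi> (tr j t))"

lemma S_Xpart: "S j \<subseteq> XP p"
  unfolding S_def using \<psi>_Xpart by blast

lemma S_mono: "S j \<subseteq> S (Suc j)"
proof
  fix q assume "q \<in> S j"
  then obtain t where q: "q = \<psi> (tr j t)" unfolding S_def by blast
  have "\<psi> (tr j t) = \<psi> (tr (Suc j) (tr j t))" by (rule arg_cong[of _ _ \<psi>]) (auto simp: tr_def)
  with q have "q = \<psi> (tr (Suc j) (tr j t))" by (rule trans)
  moreover have "\<psi> (tr (Suc j) (tr j t)) \<in> S (Suc j)" unfolding S_def by blast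
  ultimately show "q \<in> S (Suc j)" by (simp only:)
qed

lemma S_growth: "growth (linfuns cscale) (S j) j"
  unfolding S_def
proof (rule ch.growth_param_W)
  show "\<psi> (tr j t) \<in> PS" for t using \<psi>_Xpart Xpart_phase by blast
  fix l :: "'m triple => complex" assume "functional cscale l"
  moreover have "ispoly ((\<lambda>k t. t k) ` {..<j}) (\<lambda>t. tr j t k)" for k
    by (cases "k < j") (auto simp: tr_def intro: ispoly_const ispoly_gen)
  ultimately show "ispoly ((\<lambda>k t. t k) ` {..<j}) (\<lambda>t. l (\<psi> (tr j t)))"
    by (intro \<psi>_poly)
qed

lemma Xpart_growth: "growth (linfuns cscale) (XP p) (D + b)"
proof (rule growth_dense)
  show "growth (linfuns cscale) (range \<psi>) (D + b)"
  proof (rule ch.growth_param_W)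
    show "\<psi> t \<in> PS" for t using \<psi>_Xpart Xpart_phase by blast
    fix l :: "'m triple => complex" assume "functional cscale l"
    then show "ispoly ((\<lambda>k t. t k) ` {..<D + b}) (\<lambda>t. l (\<psi> t))"
      by (intro \<psi>_poly) (auto intro: ispoly_gen)
  qed
qed (rule \<psi>_dense)

lemma S_prime: "prime_on (linfuns cscale) (S j)"
proof (rule prime_on_paths)
  show "S j \<noteq> {}" unfolding S_def by blast
  fix q q' assume "q \<in> S j" "q' \<in> S j"
  then obtain t t' where t: "q = \<psi> (tr j t)" "q' = \<psi> (tr j t')" unfolding S_def by blast
  define T where "T s k = t k + s * (t' k - t k)" for s k
  show "\<exists>r. (\<forall>s. r s \<in> S j) \<and> r 0 = q \<and> r 1 = q' \<and> (\<forall>l\<in>linfuns cscale. ispoly {\<lambda>s::complex. s} (\<lambda>s. l (r s)))"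
  proof (intro exI[of _ "\<lambda>s. \<psi> (tr j (T s))"] conjI allI ballI)
    show "\<psi> (tr j (T s)) \<in> S j" for s unfolding S_def by blast
    show "\<psi> (tr j (T 0)) = q" "\<psi> (tr j (T 1)) = q'" by (simp_all add: t T_def[abs_def])
    fix l :: "'m triple => complex" assume "l \<in> linfuns cscale"
    then have l: "functional cscale l" by simp
    show "ispoly {\<lambda>s::complex. s} (\<lambda>s. l (\<psi> (tr j (T s))))"
    proof (rule \<psi>_poly[OF _ l])
      fix k
      have "ispoly {\<lambda>s::complex. s} (\<lambda>s. t k + s * (t' k - t k))"
        by (intro ispoly_add ispoly_mult ispoly_const ispoly_gen) simp
      then show "ispoly {\<lambda>s::complex. s} (\<lambda>s. tr j (T s) k)"
        by (cases "k < j") (simp_all add: tr_def T_def ispoly_const)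
    qed
  qed
qed

lemma Xpart_prime: "prime_on (linfuns cscale) (XP p)"
proof (rule prime_on_paths)
  show "XP p \<noteq> {}" using \<psi>_Xpart by blast
  fix q q' assume "q \<in> XP p" "q' \<in> XP p"
  then obtain k z i k' z' i' where k: "k \<in> Sp" "z \<in> C" "i \<in> L y" "q = act k (base z i)"
    and k': "k' \<in> Sp" "z' \<in> C" "i' \<in> L y" "q' = act k' (base z' i')" using Xpart_orbit by meson
  obtain us us' where us: "k = tvs us" "k' = tvs us'" using Sp_generated k(1) k'(1) by meson
  \<comment> \<open>Runs from \<open>k\<close> to \<open>k'\<close>: at \<open>t = 0\<close> the
    second factor is the identity, at \<open>t = 1\<close> the first one is.\<close>
  define g where "g t = stvs us (1 - t) ** stvs us' t" for t
  define zt where "zt t = mscale (1 - t) z + mscale t z'" for t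
  define it where "it t = (1 - t) *s i + t *s i'" for t
  have zt: "zt t \<in> C" for t
    using k(2) k'(2) unfolding C_def zt_def
    by (auto intro!: sp_closed(1,2) simp: matrix_add_ldistrib matrix_add_rdistrib mscale_mult)
  have it: "it t \<in> L y" for t
    unfolding it_def by (intro vec.subspace_add vec.subspace_scale subspace_L k k')
  show "\<exists>r. (\<forall>t. r t \<in> XP p) \<and> r 0 = q \<and> r 1 = q' \<and> (\<forall>l\<in>linfuns cscale. ispoly {\<lambda>t::complex. t} (\<lambda>t. l (r t)))"
  proof (intro exI[of _ "\<lambda>t. act (g t) (base (zt t) (it t))"] conjI allI ballI)
    show "act (g t) (base (zt t) (it t)) \<in> XP p" for t
      unfolding g_def by (intro Xpart_act base_Xpart zt it Sp_mult stvs_Sp)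
    have 1: "mscale 1 A = A" for A :: "complex^'m^'m" by (simp add: vec_eq_iff)
    show "act (g 0) (base (zt 0) (it 0)) = q" "act (g 1) (base (zt 1) (it 1)) = q'"
      by (simp_all add: g_def zt_def it_def stvs_0 stvs_1 k(4) k'(4) us 1)
    fix l :: "'m triple => complex" assume l: "l \<in> linfuns cscale"
    have id: "ispoly {\<lambda>t::complex. t} (\<lambda>t. t)" "ispoly {\<lambda>t::complex. t} (\<lambda>t. 1 - t)"
      by (intro ispoly_diff ispoly_const ispoly_gen; simp)+
    show "ispoly {\<lambda>t::complex. t} (\<lambda>t. l (act (g t) (base (zt t) (it t))))"
      unfolding g_def zt_def it_def using l
      by (intro act_base_poly matpoly_mult matpoly_stvs matpoly_add matpoly_scale matpoly_const
          vecpoly_add vecpoly_scale vecpoly_const id) simp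
  qed
qed

text \<open>Linear functionals that read off the parameters of \<open>\<psi>\<close> to first order
  at the origin. The velocity of the second matrix is \<open>[s, y]\<close>, from which
  \<open>G\<close> recovers \<open>s\<close> up to the centralizer.\<close>

definition xf :: "nat => 'm triple => complex" where
  "xf k q = (if k < a then ck k (G (fst (snd q))) else if k < D then ck k (fst q) else ln (k - D) (snd (snd q)))"

lemma linear_ckG: "k < D ==> functional mscale (\<lambda>A. ck k (G A))"
proof -
  assume k: "k < D"
  interpret G: Vector_Spaces.linear mscale mscale G by (rule G(1))
  show ?thesis
    by (rule linear_mscaleI)
      (simp_all add: G.add G.scale fc.linear_add[OF fc.linear_x[OF k]] fc.linear_scale[OF fc.linear_x[OF k]])
qed

lemma linear_xf: "k < D + b ==> functional cscale (xf k)"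
proof -
  assume k: "k < D + b"
  interpret G: Vector_Spaces.linear mscale mscale G by (rule G(1))
  show ?thesis
  proof (rule linear_cscaleI)
    fix q q' :: "'m triple" and c
    show "xf k (q + q') = xf k q + xf k q'" using k a
      by (auto simp: xf_def G.add fc.linear_add[OF fc.linear_x] lc.linear_add[OF lc.linear_x])
    show "xf k (cscale c q) = c * xf k q" using k a
      by (auto simp: xf_def cscale_def split_beta G.scale fc.linear_scale[OF fc.linear_x] lc.linear_scale[OF lc.linear_x])
  qed
qed

text \<open>At the origin the first matrix and the vector are 0, so the group motion affects them
  only to second order, and \<open>sq\<close> is quadratic as well. To first order the group
  parameters are seen only in the second matrix, the others only in the first matrix and the
  vector.\<close>

lemma \<psi>_velocity:
  assumes k: "k < D + b"
  shows "((\<lambda>t. (xf k (\<psi> (\<lambda>k. t * v k)) - xf k (\<psi> (\<lambda>k. 0 * v k))) / t) \<longlongrightarrow> v k) (at 0)"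
proof -
  define E where "E t = Epr (\<lambda>k. t * v k)" for t
  define s where "s = fc.pt (\<lambda>k. if k < a then v k else 0)"
  have s: "s \<in> sp \<omega>" unfolding s_def by (rule fc.pt_W)
  have s': "(\<Sum>k<a. mscale (t * v k) (f k)) = mscale t s" for t
  proof -
    have "mscale t s = (\<Sum>k<D. if k < a then mscale (t * v k) (f k) else 0)"
      unfolding s_def fc.pt_def
      by (simp only: vec_eq_iff mscale_component sum_component sum_distrib_left) (auto intro!: sum.cong)
    also have "\<dots> = (\<Sum>k<a. mscale (t * v k) (f k))"
      using a by (subst sum.inter_filter[symmetric]) (auto intro!: sum.cong)
    finally show ?thesis by simp
  qed
  have E0: "E 0 = mat 1" unfolding E_def Epr_def by (rule tvs_at_0) simp
  have "(E has_derivative (\<lambda>t. \<Sum>k\<leftarrow>[0..<a]. mscale (t * v k) (sq (w k)))) (at 0)"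
    unfolding E_def Epr_def by (rule tvs_derivative) (rule bounded_linear_mult_left)
  moreover have "(\<Sum>k\<leftarrow>[0..<a]. mscale (t * v k) (sq (w k))) = mscale t s" for t
    unfolding interv_sum_list_conv_sum_set_nat s'[symmetric] by (intro sum.cong) (auto simp: f_sq)
  ultimately have E: "(E has_derivative (\<lambda>t. mscale t s)) (at 0)" by simp
  note conj = conj_derivative[OF E E0 s]
  have q: "fst (\<psi> (\<lambda>k. t * v k)) = E t ** (G (- sq (ii (\<lambda>k. t * v k))) + zz (\<lambda>k. t * v k)) ** adj (E t)"
    "fst (snd (\<psi> (\<lambda>k. t * v k))) = E t ** y ** adj (E t)"
    "snd (snd (\<psi> (\<lambda>k. t * v k))) = E t *v ii (\<lambda>k. t * v k)" for t
    by (simp_all add: \<psi>_def act_def base_def E_def)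
  have zzl: "zz (\<lambda>k. t * v k) = mscale t (zz v)" for t
    unfolding zz_def fc.pt_def
    by (simp only: vec_eq_iff mscale_component sum_component sum_distrib_left) (auto intro!: sum.cong)
  have iil: "ii (\<lambda>k. t * v k) = t *s ii v" for t
    unfolding ii_def lc.pt_def
    by (simp only: vec_eq_iff vector_smult_component sum_component sum_distrib_left) (auto intro!: sum.cong)
  interpret G: Vector_Spaces.linear mscale mscale G by (rule G(1))
  consider "k < a" | "a \<le> k" "k < D" | "D \<le> k" by linarith
  then show ?thesis
  proof cases
    case 1
    have "((\<lambda>t. E t ** y ** adj (E t)) has_derivative (\<lambda>t. mscale t (commutator s y + 0))) (at 0)"
      by (rule conj) simp
    then have "((\<lambda>t. E t ** y ** adj (E t)) has_derivative (\<lambda>t. mscale t (commutator s y))) (at 0)" by simp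
    from functional_limit[OF this linear_ckG, of k] 1 a
    have lim: "((\<lambda>t. (xf k (\<psi> (\<lambda>k. t * v k)) - xf k (\<psi> (\<lambda>k. 0 * v k))) / t) \<longlongrightarrow> ck k (G (commutator s y))) (at 0)"
      unfolding xf_def q by simp
    define u where "u = G (commutator s y)"
    \<comment> \<open>\<open>u\<close> and \<open>s\<close> have the same commutator with
      \<open>y\<close>, so they differ by an element of the centralizer, on which the first
      \<open>a\<close> coordinates vanish.\<close>
    have u: "u \<in> sp \<omega>" "commutator u y = commutator s y" unfolding u_def using G(2,3) s by auto
    have "u - s \<in> sp \<omega>" using u(1) s unfolding diff_conv_add_uminus by (intro sp_closed)
    moreover have "commutator (u - s) y = 0" using u(2) by (simp add: commutator_diff)
    ultimately have "ck k (u - s) = 0" using f_comm 1 unfolding commutator_def by simp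
    then have "ck k u = ck k s" using 1 a by (simp add: fc.linear_diff[OF fc.linear_x])
    also have "\<dots> = v k" unfolding s_def using 1 a by (subst fc.x_of_pt) auto
    finally show ?thesis using lim unfolding u_def by simp
  next
    case 2
    define M where "M t = G (- sq (ii (\<lambda>k. t * v k))) + zz (\<lambda>k. t * v k)" for t
    have sq2: "sq (t *s i) = mscale (t * t) (sq i)" for t i
      by (simp add: vec_eq_iff sq_component \<omega>_simps)
    have M': "M t = mscale (t * t) (G (- sq (ii v))) + mscale t (zz v)" for t
    proof -
      have "- mscale (t * t) (sq (ii v)) = mscale (t * t) (- sq (ii v))" by (simp add: vec_eq_iff)
      then show ?thesis by (simp only: M_def iil zzl sq2 G.scale)
    qed
    have "((\<lambda>t. mscale (t * t) (G (- sq (ii v)))) has_derivative (\<lambda>t. mscale (0 * t + t * 0) (G (- sq (ii v))))) (at 0)"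
      by (rule bounded_linear.has_derivative[OF bounded_bilinear.bounded_linear_left[OF bounded_bilinear_mscale]])
        (auto intro!: derivative_eq_intros)
    then have "(M has_derivative (\<lambda>t. mscale (0 * t + t * 0) (G (- sq (ii v))) + mscale t (zz v))) (at 0)"
      unfolding M' by (rule has_derivative_add[OF _ mscale_derivative])
    then have "(M has_derivative (\<lambda>t. mscale t (zz v))) (at 0)" by simp
    from conj[OF this] have "((\<lambda>t. E t ** M t ** adj (E t)) has_derivative (\<lambda>t. mscale t (zz v))) (at 0)"
      unfolding M' by (simp add: commutator_def)
    from functional_limit[OF this fc.linear_x[OF 2(2)]] 2
    have "((\<lambda>t. (xf k (\<psi> (\<lambda>k. t * v k)) - xf k (\<psi> (\<lambda>k. 0 * v k))) / t) \<longlongrightarrow> ck k (zz v)) (at 0)"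
      unfolding xf_def q M_def[symmetric] by simp
    moreover have "ck k (zz v) = v k" unfolding zz_def using 2 by (subst fc.x_of_pt) auto
    ultimately show ?thesis by simp
  next
    case 3
    have bl: "bounded_linear (\<lambda>t. t *s ii v)"
      unfolding linear_conv_bounded_linear[symmetric]
      by (rule linearI) (simp_all add: scaleR_vec scaleR_conv_of_real[where 'a = complex] vec.scale_left_distrib)
    have "((\<lambda>t. E t *v (t *s ii v)) has_derivative (\<lambda>t. E 0 *v (t *s ii v) + mscale t s *v (0 *s ii v))) (at 0)"
      by (intro bounded_bilinear.FDERIV[OF bounded_bilinear_mulvec] E bounded_linear_imp_has_derivative[OF bl])
    then have "((\<lambda>t. E t *v (t *s ii v)) has_derivative (\<lambda>t. t *s ii v)) (at 0)" by (simp add: E0)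
    from functional_limit_vec[OF this lc.linear_x, of "k - D"] 3 k a
    have "((\<lambda>t. (xf k (\<psi> (\<lambda>k. t * v k)) - xf k (\<psi> (\<lambda>k. 0 * v k))) / t) \<longlongrightarrow> ln (k - D) (ii v)) (at 0)"
      unfolding xf_def q iil by simp
    moreover have "ln (k - D) (ii v) = v k" unfolding ii_def using 3 k by (subst lc.x_of_pt) auto
    ultimately show ?thesis by simp
  qed
qed

lemma S_indep:
  assumes "j \<le> D + b"
  shows "has_indep (linfuns cscale) (S j) (j * K) (K ^ j)"
proof (rule has_indep_velocities[where x = xf and a = "\<lambda>k. xf k (\<psi> (\<lambda>_. 0))"])
  show "xf k \<in> linfuns cscale" if "k < j" for k using linear_xf that assms by simp
  fix v :: "nat => complex"
  show "\<exists>s. (\<forall>t. s t \<in> S j) \<and> (\<forall>k<j. ((\<lambda>t. (xf k (s t) - xf k (\<psi> (\<lambda>_. 0))) / t) \<longlongrightarrow> v k) (at 0))"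
  proof (intro exI[of _ "\<lambda>t. \<psi> (\<lambda>k. t * tr j v k)"] conjI allI impI)
    fix t
    have "(\<lambda>k. t * tr j v k) = tr j (\<lambda>k. t * v k)" by (auto simp: tr_def)
    then show "\<psi> (\<lambda>k. t * tr j v k) \<in> S j" unfolding S_def by auto
  next
    fix k assume "k < j"
    then show "((\<lambda>t. (xf k (\<psi> (\<lambda>k. t * tr j v k)) - xf k (\<psi> (\<lambda>_. 0))) / t) \<longlongrightarrow> v k) (at 0)"
      using \<psi>_velocity[of k "tr j v"] assms by (simp add: tr_def)
  qed
qed

end

section \<open>Dimension and irreducible components\<close>

lemma growth_empty: "growth X {} d"
proof -
  have "h = 0" if indep: "has_indep X {} m h" for m h
  proof -
    have "\<forall>c :: nat => complex. \<forall>i<h. c i = 0" using indep unfolding has_indep_def by blast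
    then have "\<forall>i<h. (1 :: complex) = 0" by (rule spec)
    then have "\<not> 0 < h" by auto
    then show ?thesis by simp
  qed
  then show ?thesis unfolding growth_def by (intro exI[of _ 0]) simp
qed

lemma sum_mset_div_2: "2 * (\<Sum>x\<in>#p. x div 2) + size (filter_mset odd p) = sum_mset p" for p :: "nat multiset"
proof (induction p)
  case (add x p)
  then show ?case by (cases "even x") (auto elim!: evenE oddE)
qed simp

lemma finite_partitions: "finite {p :: nat multiset. 0 \<notin># p \<and> sum_mset p = m}"
proof (rule finite_subset)
  show "finite (mset ` {xs. set xs \<subseteq> {..m} \<and> length xs \<le> m})"
    by (intro finite_imageI finite_lists_length_le) simp
  show "{p :: nat multiset. 0 \<notin># p \<and> sum_mset p = m} \<subseteq> mset ` {xs. set xs \<subseteq> {..m} \<and> length xs \<le> m}"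
  proof
    fix p :: "nat multiset" assume "p \<in> {p. 0 \<notin># p \<and> sum_mset p = m}"
    then have p: "0 \<notin># p" "sum_mset p = m" by auto
    obtain xs where xs: "p = mset xs" using ex_mset by metis
    have "size p \<le> sum_mset p" using p(1)
    proof (induction p)
      case (add x p)
      then have "1 \<le> x" "size p \<le> sum_mset p" by auto
      then show ?case by simp
    qed simp
    moreover have "k \<le> sum_mset p" if "k \<in># p" for k using that by (auto dest!: multi_member_split)
    ultimately show "p \<in> mset ` {xs. set xs \<subseteq> {..m} \<and> length xs \<le> m}"
      using p(2) xs by (intro image_eqI[of _ _ xs]) auto
  qed
qed

context phase
begin

definition dm :: "nat multiset => nat" where
  "dm p = D + (\<Sum>x\<in>#p. x div 2)"

lemma slice_exists:
  assumes y: "y \<in> sp \<omega>" and type: "jordan_type y p"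
  shows "\<exists>f ck l ln a w G. slice \<omega> N e x D es xs n f ck y (\<Sum>x\<in>#p. x div 2) l ln p a w G"
proof -
  obtain a f ck w where f: "a \<le> D" "affine_chart mscale (sp \<omega>) D f ck" "\<And>k. k < a ==> f k = sq (w k)"
    "\<And>t. t \<in> sp \<omega> ==> t ** y = y ** t \<longleftrightarrow> (\<forall>k<a. ck k t = 0)"
    by (rule sp_splitting[where y = y, OF spc.chart_dim]) (rule that)
  obtain G where G: "Vector_Spaces.linear mscale mscale G" "\<And>u. G u \<in> sp \<omega>"
    "\<And>s. s \<in> sp \<omega> ==> commutator (G (commutator s y)) y = commutator s y"
    by (rule commutator_right_inverse[OF y]) (rule that)
  obtain l ln where l: "affine_chart (*s) (L y) (\<Sum>x\<in>#p. x div 2) l ln" by (rule L_chart[OF assms]) (rule that)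
  have "slice \<omega> N e x D es xs n f ck y (\<Sum>x\<in>#p. x div 2) l ln p a w G"
    by (intro slice.intro phase_axioms f(2) l slice_axioms.intro y type f(1,3,4) G refl)
  then show ?thesis by (intro exI)
qed

lemma piece:
  assumes "XP p \<noteq> {}"
  shows "growth (linfuns cscale) (XP p) (dm p)" "prime_on (linfuns cscale) (XP p)"
    and "\<exists>S. \<forall>j. S j \<subseteq> XP p \<and> S j \<subseteq> S (Suc j) \<and> growth (linfuns cscale) (S j) j \<and>
      prime_on (linfuns cscale) (S j) \<and> (\<forall>K. j \<le> dm p --> has_indep (linfuns cscale) (S j) (j * K) (K ^ j))"
proof -
  obtain q where "q \<in> XP p" using assms by blast
  then have y: "fst (snd q) \<in> sp \<omega>" "jordan_type (fst (snd q)) p" by (auto simp: Xpart_iff)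
  obtain f ck l ln a w G where "slice \<omega> N e x D es xs n f ck (fst (snd q)) (\<Sum>x\<in>#p. x div 2) l ln p a w G"
    using slice_exists[OF y] by (elim exE)
  then interpret s: slice \<omega> N e x D es xs n f ck "fst (snd q)" "\<Sum>x\<in>#p. x div 2" l ln p a w G .
  show "growth (linfuns cscale) (XP p) (dm p)" unfolding dm_def by (rule s.Xpart_growth)
  show "prime_on (linfuns cscale) (XP p)" by (rule s.Xpart_prime)
  show "\<exists>S. \<forall>j. S j \<subseteq> XP p \<and> S j \<subseteq> S (Suc j) \<and> growth (linfuns cscale) (S j) j \<and>
      prime_on (linfuns cscale) (S j) \<and> (\<forall>K. j \<le> dm p --> has_indep (linfuns cscale) (S j) (j * K) (K ^ j))"
    unfolding dm_def
    by (intro exI[of _ s.S] allI conjI impI s.S_Xpart s.S_mono s.S_growth s.S_prime s.S_indep)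
qed

definition parts :: "nat multiset set" where
  "parts = {p. 0 \<notin># p \<and> sum_mset p = 2 * n}"

lemma even_parts: "even_partitions n = {p \<in> parts. \<forall>k\<in>#p. even k}"
proof -
  have "even (count p k)" if "\<forall>k\<in>#p. even k" "odd k" for p :: "nat multiset" and k
  proof -
    have "k \<notin># p" using that by blast
    then show ?thesis by (simp add: not_in_iff)
  qed
  then show ?thesis unfolding even_partitions_def nilp_partitions_def parts_def by auto
qed

text \<open>Twice the defect \<open>D + n - dm p\<close> is the number of odd parts of
  \<open>p\<close>.\<close>

lemma dm_parts:
  assumes "p \<in> parts"
  shows "dm p \<le> D + n" "p \<notin> even_partitions n ==> dm p < D + n" "p \<in> even_partitions n ==> dm p = D + n"
proof -
  have s: "2 * (\<Sum>x\<in>#p. x div 2) + size (filter_mset odd p) = 2 * n"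
    using assms sum_mset_div_2[of p] by (simp add: parts_def)
  then show "dm p \<le> D + n" by (simp add: dm_def)
  show "dm p < D + n" if "p \<notin> even_partitions n"
  proof -
    have "\<exists>k\<in>#p. odd k" using that assms unfolding even_parts by blast
    then have "filter_mset odd p \<noteq> {#}" by (auto simp: filter_mset_eq_mempty_iff)
    then have "0 < size (filter_mset odd p)" by (rule nonempty_has_size[THEN iffD1])
    then show ?thesis using s by (simp add: dm_def)
  qed
  show "dm p = D + n" if "p \<in> even_partitions n"
  proof -
    have "filter_mset odd p = {#}" using that unfolding even_parts by (auto simp: filter_mset_eq_mempty_iff)
    then show ?thesis using s unfolding dm_def by (simp only:) simp
  qed
qed

lemma Xnil_Union: "Xnil \<omega> = (\<Union>p\<in>parts. XP p)"
proof -
  have "\<exists>p\<in>parts. jordan_type y p" if y: "nilpotent_matrix y" for y :: "complex^'m^'m"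
  proof -
    obtain p where p: "jordan_type y p" using jordan_type_exists[OF y] by blast
    then show ?thesis using jordan_type_sum[OF p] card unfolding parts_def by auto
  qed
  then show ?thesis unfolding Xpart_def nilp_class_def by (auto simp: Xnil_def phase_space_def)
qed

lemma even_nonempty:
  assumes "p \<in> even_partitions n"
  obtains y where "y \<in> sp \<omega>" "jordan_type y p" "(0, y, 0) \<in> XP p"
proof -
  have "\<exists>y\<in>sp \<omega>. jordan_type y p"
    using assms card unfolding even_parts parts_def by (intro even_type_exists) auto
  then obtain y where y: "y \<in> sp \<omega>" "jordan_type y p" by blast
  have "sq 0 = 0" by (simp add: vec_eq_iff sq_component)
  then have "(0, y, 0) \<in> XP p" using y by (simp add: Xpart_iff sp_closed commutator_def)
  with y show ?thesis by (rule that)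
qed

text \<open>Ranks of powers cannot rise on passing to the closure: the determinant from
  \<open>rank_separation\<close> is polynomial, vanishes on \<open>XP q\<close>, and would be
  nonzero at \<open>q0\<close>.\<close>

lemma closure_separation:
  assumes q: "q0 \<in> XP p" and sub: "q0 \<in> ch.zcl (XP q)"
  shows "rank_at p k \<le> rank_at q k"
proof (rule ccontr)
  assume "\<not> rank_at p k \<le> rank_at q k"
  then have less: "rank_at q k < rank_at p k" by simp
  have type: "jordan_type (fst (snd q0)) p" using q by (simp add: Xpart_iff)
  from rank_separation[OF type, of k] obtain E where "det (mpow k (fst (snd q0)) + E) \<noteq> 0 \<and>
    (\<forall>y' q. jordan_type y' q --> rank_at q k < rank_at p k --> det (mpow k y' + E) = 0)"
    by (elim exE)
  then have E: "det (mpow k (fst (snd q0)) + E) \<noteq> 0"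
    "\<And>y'. jordan_type y' q ==> det (mpow k y' + E) = 0"
    using less by auto
  have "ispoly (linfuns cscale) (\<lambda>r. det (mpow k (fst (snd r)) + E))"
    by (intro ispoly_det matpoly_add matpoly_mpow matpoly_const matpoly_snd)
  then have "det (mpow k (fst (snd q0)) + E) = 0"
    by (rule ch.zcl_vanish[OF _ _ sub]) (use E(2) in "auto simp: Xpart_iff")
  with E(1) show False by blast
qed

lemma closure_inj:
  assumes "p \<in> parts" "q \<in> parts" "XP p \<noteq> {}" "XP q \<noteq> {}" "ch.zcl (XP p) = ch.zcl (XP q)"
  shows "p = q"
proof (rule rank_at_inj)
  have sub: "XP p \<subseteq> ch.zcl (XP p)" for p
    by (rule ch.zcl_subset) (auto simp: Xpart_def Xnil_def)
  obtain a b where ab: "a \<in> XP p" "b \<in> XP q" using assms by blast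
  show "0 \<notin># p" "0 \<notin># q" using assms by (auto simp: parts_def)
  show "rank_at p k = rank_at q k" for k
  proof (rule antisym)
    show "rank_at p k \<le> rank_at q k"
      by (rule closure_separation[OF ab(1)]) (use sub[of p] ab(1) assms(5) in blast)
    show "rank_at q k \<le> rank_at p k"
      by (rule closure_separation[OF ab(2)]) (use sub[of q] ab(2) assms(5) in blast)
  qed
qed

lemma Xpart_Xnil: "XP p \<subseteq> Xnil \<omega>"
  by (auto simp: Xpart_def)

lemma krull_dim_Xnil: "krull_dim (Xnil_top \<omega>) = enat (2 * n\<^sup>2 + 2 * n)"
proof -
  \<comment> \<open>The single block of size \<open>2 * n\<close> has even parts, so its nonempty
    piece of full dimension supplies the chain.\<close>
  define p where "p = {#2 * n#}"
  have p: "p \<in> even_partitions n" using n_pos unfolding even_parts parts_def p_def by auto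
  then have "p \<in> parts" unfolding even_parts by blast
  have dmp: "dm p = D + n" by (rule dm_parts(3)[OF \<open>p \<in> parts\<close> p])
  have "XP p \<noteq> {}" using even_nonempty[OF p] by blast
  from piece(3)[OF this] obtain S where S: "\<forall>j. S j \<subseteq> XP p \<and> S j \<subseteq> S (Suc j) \<and> growth (linfuns cscale) (S j) j \<and>
      prime_on (linfuns cscale) (S j) \<and> (\<forall>K. j \<le> dm p --> has_indep (linfuns cscale) (S j) (j * K) (K ^ j))"
    by (elim exE)
  have gr: "growth (linfuns cscale) (XP q) (D + n)" if q: "q \<in> parts" for q
  proof (cases "XP q = {}")
    case True
    then show ?thesis by (simp add: growth_empty)
  next
    case False
    obtain A where A: "\<And>m h. has_indep (linfuns cscale) (XP q) m h ==> h \<le> A * (m + 1) ^ dm q"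
      using piece(1)[OF False] unfolding growth_def by blast
    have "A * (m + 1) ^ dm q \<le> A * (m + 1) ^ (D + n)" for m
      by (intro mult_left_mono power_increasing dm_parts(1)[OF q]) auto
    then show ?thesis unfolding growth_def using A order_trans by blast
  qed
  have "krull_dim (subtopology (zariski cscale PS) (Xnil \<omega>)) = enat (D + n)"
  proof (rule ch.krull_dim_eq[OF Xnil_sub Xnil_closed finite_partitions[of "2 * n", folded parts_def] Xnil_Union gr])
    fix j
    show "S j \<subseteq> Xnil \<omega>" using S Xpart_Xnil[of p] by blast
    show "prime_on (linfuns cscale) (S j)" "S j \<subseteq> S (Suc j)" "growth (linfuns cscale) (S j) j"
      using S by simp_all
    show "has_indep (linfuns cscale) (S j) (j * K) (K ^ j)" if "j \<le> D + n" for K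
      using S that by (simp add: dmp)
  qed
  then show ?thesis unfolding Xnil_top_def by (simp add: D)
qed

lemma components_Xnil:
  "bij_betw (\<lambda>p. Xnil_top \<omega> closure_of XP p) (even_partitions n) (irreducible_components (Xnil_top \<omega>))"
proof -
  have EP: "even_partitions n \<subseteq> parts" unfolding even_parts by blast
  have dm: "growth (linfuns cscale) (XP q) (dm q)" if q: "q \<in> parts" for q
  proof (cases "XP q = {}")
    case True
    then show ?thesis by (simp add: growth_empty)
  qed (rule piece(1))
  show ?thesis unfolding Xnil_top_def
  proof (rule ch.bij_betw_components[OF finite_gens poly_gens _ Xnil_gens finite_partitions[of "2 * n", folded parts_def] Xnil_Union EP])
    show "card gens + (D + n) \<le> N" using card_gens by (simp add: N D)
    show "prime_on (linfuns cscale) (XP p)" if "XP p \<noteq> {}" for p by (rule piece(2)[OF that])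
    show "growth (linfuns cscale) (XP p) (dm p)" "dm p \<le> D + n" if "p \<in> parts" for p
      using dm that dm_parts(1) by auto
    show "dm p < D + n" if "p \<in> parts - even_partitions n" for p using that dm_parts(2) by blast
    show "p = q" if "p \<in> parts" "q \<in> parts" "XP p \<noteq> {}" "XP q \<noteq> {}"
      "ch.zcl (XP p) = ch.zcl (XP q)" for p q by (rule closure_inj[OF that])
    fix p assume p: "p \<in> even_partitions n"
    show ne: "XP p \<noteq> {}" using even_nonempty[OF p] by blast
    have "dm p = D + n" using dm_parts(3) p EP by blast
    from piece(3)[OF ne] obtain S where "\<forall>j. S j \<subseteq> XP p \<and> S j \<subseteq> S (Suc j) \<and> growth (linfuns cscale) (S j) j \<and>
      prime_on (linfuns cscale) (S j) \<and> (\<forall>K. j \<le> dm p --> has_indep (linfuns cscale) (S j) (j * K) (K ^ j))"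
      by (elim exE)
    then have S: "\<And>j. S j \<subseteq> XP p" "\<And>j K. j \<le> D + n ==> has_indep (linfuns cscale) (S j) (j * K) (K ^ j)"
      by (simp_all add: \<open>dm p = D + n\<close>)
    show "has_indep (linfuns cscale) (XP p) ((D + n) * K) (K ^ (D + n))" for K
      using S(2)[OF order_refl] S(1) by (rule has_indep_subset)
  qed
qed

end

section \<open>The Lagrangian property\<close>

text \<open>The type carries no topology, so the chain rule is stated for curves whose velocity is
  tested by linear functionals. Polynomial dependence on the point is recorded in order to extend
  identities between derivatives to closures.\<close>

definition poly_derivative ::
  "(complex => 'p::ab_group_add => 'p) => ('p => complex) => ('p => 'p => complex) => bool" where
  "poly_derivative sc f Df \<longleftrightarrow> (\<forall>v. ispoly (linfuns sc) (\<lambda>p. Df p v)) \<and> (\<forall>p. functional sc (Df p)) \<and>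
    (\<forall>\<gamma> v. (\<forall>l\<in>linfuns sc. ((\<lambda>\<tau>. l (\<gamma> \<tau>)) has_field_derivative l v) (at 0)) -->
      ((\<lambda>\<tau>. f (\<gamma> \<tau>)) has_field_derivative Df (\<gamma> 0) v) (at 0))"

lemma polyfun_derivative:
  assumes vs: "vector_space sc" and f: "polyfun sc f"
  shows "\<exists>Df. poly_derivative sc f Df"
  using f
proof induction
  case (linear f)
  then show ?case by (intro exI[of _ "\<lambda>p. f"]) (auto simp: poly_derivative_def intro: ispoly_const)
next
  case (const c)
  show ?case
    by (intro exI[of _ "\<lambda>p v. 0"])
      (auto intro: ispoly_const simp: poly_derivative_def Vector_Spaces.linear_iff vs vector_space_over_itself.vector_space_axioms)
next
  case (add f g)
  from add.IH(1) obtain Df where Df: "poly_derivative sc f Df" by (elim exE)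
  from add.IH(2) obtain Dg where Dg: "poly_derivative sc g Dg" by (elim exE)
  show ?case
    by (intro exI[of _ "\<lambda>p v. Df p v + Dg p v"])
      (use Df Dg in "auto intro!: ispoly_add DERIV_add simp: poly_derivative_def Vector_Spaces.linear_iff algebra_simps")
next
  case (mult f g)
  from mult.IH(1) obtain Df where Df: "poly_derivative sc f Df" by (elim exE)
  from mult.IH(2) obtain Dg where Dg: "poly_derivative sc g Dg" by (elim exE)
  have "ispoly (linfuns sc) f" "ispoly (linfuns sc) g"
    using mult.hyps by (simp_all add: polyfun_iff ispoly_def)
  note fg = this
  note Df = Df[unfolded poly_derivative_def] and Dg = Dg[unfolded poly_derivative_def]
  show ?case unfolding poly_derivative_def
  proof (intro exI[of _ "\<lambda>p v. Df p v * g p + Dg p v * f p"] conjI allI impI)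
    show "ispoly (linfuns sc) (\<lambda>p. Df p v * g p + Dg p v * f p)" for v
      using Df Dg by (intro ispoly_add ispoly_mult fg) blast+
    show "functional sc (\<lambda>v. Df p v * g p + Dg p v * f p)" for p
      using Df Dg by (simp add: Vector_Spaces.linear_iff algebra_simps)
    show "((\<lambda>s. f (t s) * g (t s)) has_field_derivative Df (t 0) v * g (t 0) + Dg (t 0) v * f (t 0)) (at 0)"
      if "\<forall>l\<in>linfuns sc. ((\<lambda>s. l (t s)) has_field_derivative l v) (at 0)" for t v
    proof (rule DERIV_mult)
      show "((\<lambda>s. f (t s)) has_field_derivative Df (t 0) v) (at 0)" using Df that by simp
      show "((\<lambda>s. g (t s)) has_field_derivative Dg (t 0) v) (at 0)" using Dg that by simp
    qed
  qed
qed

definition velocity :: "'m::finite triple set => 'm triple => 'm triple => bool" where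
  "velocity Z q v \<longleftrightarrow> (\<exists>\<gamma>. (\<forall>\<tau>. \<gamma> \<tau> \<in> Z) \<and> \<gamma> 0 = q \<and>
    (\<forall>l\<in>linfuns cscale. ((\<lambda>\<tau>::complex. l (\<gamma> \<tau>)) has_field_derivative l v) (at 0)))"

lemma velocityI:
  fixes M1 M2 :: "complex => complex^'m^'m::finite"
  assumes "\<And>t. (M1 t, M2 t, M3 t) \<in> Z" "(M1 0, M2 0, M3 0) = q"
    and der: "(M1 has_derivative (\<lambda>t. mscale t A1)) (at 0)" "(M2 has_derivative (\<lambda>t. mscale t A2)) (at 0)"
      "(M3 has_derivative (\<lambda>t. t *s A3)) (at 0)"
  shows "velocity Z q (A1, A2, A3)"
  unfolding velocity_def
proof (intro exI[of _ "\<lambda>t. (M1 t, M2 t, M3 t)"] conjI allI ballI assms(1,2))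
  fix l :: "'m triple => complex" assume "l \<in> linfuns cscale"
  then have lin: "functional cscale l" by simp
  interpret l: Vector_Spaces.linear cscale "(*)" l by (rule lin)
  have "r *\<^sub>R p = cscale (of_real r) p" for r and p :: "'m triple"
    by (cases p) (simp add: cscale_def scaleR_mscale scaleR_vec)
  then have "bounded_linear l" unfolding linear_conv_bounded_linear[symmetric]
    by (intro linearI) (simp_all add: l.add l.scale scaleR_conv_of_real[where 'a = complex])
  moreover have "((\<lambda>t. (M1 t, M2 t, M3 t)) has_derivative (\<lambda>t. (mscale t A1, mscale t A2, t *s A3))) (at 0)"
    by (intro has_derivative_Pair der)
  ultimately have "((\<lambda>t. l (M1 t, M2 t, M3 t)) has_derivative (\<lambda>t. l (mscale t A1, mscale t A2, t *s A3))) (at 0)"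
    by (rule bounded_linear.has_derivative)
  moreover have "(\<lambda>t. l (mscale t A1, mscale t A2, t *s A3)) = (*) (l (A1, A2, A3))"
  proof
    fix t
    have "(mscale t A1, mscale t A2, t *s A3) = cscale t (A1, A2, A3)" by (simp add: cscale_def)
    then show "l (mscale t A1, mscale t A2, t *s A3) = l (A1, A2, A3) * t"
      by (simp only: l.scale mult.commute)
  qed
  ultimately show "((\<lambda>t. l (M1 t, M2 t, M3 t)) has_field_derivative l (A1, A2, A3)) (at 0)"
    unfolding has_field_derivative_def by (simp only:)
qed

section \<open>The phase form and the moment map\<close>

context symp
begin

abbreviation "\<Omega> \<equiv> phase_form \<omega>"

lemma \<Omega>_eq: "\<Omega> p q = trace (fst (snd p) ** fst q) - trace (fst (snd q) ** fst p) + \<omega> (snd (snd p)) (snd (snd q))"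
  by (simp add: phase_form_def split_beta)

lemma \<Omega>_skew: "\<Omega> u v = - \<Omega> v u"
  using \<omega>_skew[of "snd (snd u)" "snd (snd v)"] by (simp add: \<Omega>_eq)

lemma linear_\<Omega>: "functional cscale (\<Omega> v)" "functional cscale (\<lambda>u. \<Omega> u v)"
  by (intro linear_cscaleI; simp add: \<Omega>_eq cscale_def split_beta matrix_add_ldistrib matrix_add_rdistrib
      trace_plus mscale_mult trace_mscale \<omega>_simps algebra_simps)+

lemma \<Omega>_diff: "\<Omega> (u - u') v = \<Omega> u v - \<Omega> u' v" "\<Omega> v (u - u') = \<Omega> v u - \<Omega> v u'"
  by (simp_all add: \<Omega>_eq matrix_diff_ldistrib matrix_diff_rdistrib trace_diff \<omega>_diff)

lemma \<Omega>_nondeg: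
  assumes v: "v \<in> PS" and z: "\<And>w. w \<in> PS ==> \<Omega> v w = 0"
  shows "v = 0"
proof -
  have "fst (snd v) = 0"
  proof (rule trace_sp_nondeg)
    show "fst (snd v) \<in> sp \<omega>" using v by (auto simp: phase_space_def)
    fix w assume "w \<in> sp \<omega>"
    then show "trace (fst (snd v) ** w) = 0"
      using z[of "(w, 0, 0)"] by (simp add: phase_space_def sp_closed \<Omega>_eq trace_def)
  qed
  moreover have "fst v = 0"
  proof (rule trace_sp_nondeg)
    show "fst v \<in> sp \<omega>" using v by (auto simp: phase_space_def)
    fix w assume "w \<in> sp \<omega>"
    then show "trace (fst v ** w) = 0"
      using z[of "(0, w, 0)"] trace_mul_sym[of w "fst v"] by (simp add: phase_space_def sp_closed \<Omega>_eq trace_def)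
  qed
  moreover have "snd (snd v) = 0"
  proof (rule nondeg)
    show "\<omega> (snd (snd v)) w = 0" for w
      using z[of "(0, 0, w)"] by (simp add: phase_space_def sp_closed \<Omega>_eq trace_def)
  qed
  ultimately show ?thesis by (simp add: prod_eq_iff)
qed

text \<open>The polarization of \<open>sq\<close>, normalized so that \<open>bil i i\<close> is
  twice \<open>sq i\<close>.\<close>

definition bil :: "complex^'m => complex^'m => complex^'m^'m" where
  "bil i j = sq (i + j) - sq i - sq j"

lemma bil_mult: "bil i j *v v = (\<omega> i v / 2) *s j + (\<omega> j v / 2) *s i"
  by (simp add: bil_def matrix_vector_mult_diff_rdistrib sq_mult \<omega>_simps add_divide_distrib
      vec.scale_left_distrib vec.scale_right_distrib)

lemma bil_sp: "bil i j \<in> sp \<omega>"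
  unfolding bil_def diff_conv_add_uminus by (intro sp_closed sq_sp)

lemma bil_diff: "bil i (j - k) = bil i j - bil i k"
proof -
  have "bil i (j - k) *v v = (bil i j - bil i k) *v v" for v
    by (simp add: bil_mult matrix_vector_mult_diff_rdistrib \<omega>_diff diff_divide_distrib vec.scale_left_diff_distrib
        vec.scale_right_diff_distrib)
  then show ?thesis by (simp add: matrix_eq)
qed

lemma trace_bil:
  assumes s: "s \<in> sp \<omega>"
  shows "trace (bil i j ** s) = \<omega> j (s *v i)"
proof -
  have "\<omega> i (s *v j) = \<omega> j (s *v i)" using spD[OF s, of i j] \<omega>_skew[of "s *v i" j] by simp
  then show ?thesis
    unfolding bil_def matrix_diff_rdistrib trace_diff trace_sq
    by (simp add: matrix_vector_right_distrib \<omega>_simps add_divide_distrib)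
qed

text \<open>The differential at \<open>q\<close> of the moment map \<open>[x, y] + i\<^sup>2\<close>
  in the direction \<open>u\<close>.\<close>

definition dmoment :: "'m triple => 'm triple => complex^'m^'m" where
  "dmoment q u = commutator (fst u) (fst (snd q)) + commutator (fst q) (fst (snd u)) + bil (snd (snd q)) (snd (snd u))"

text \<open>The vector field of the infinitesimal action of \<open>s\<close> at
  \<open>q\<close>.\<close>

definition infact :: "complex^'m^'m => 'm triple => 'm triple" where
  "infact s q = (commutator s (fst q), commutator s (fst (snd q)), s *v snd (snd q))"

lemma dmoment_diff: "dmoment q (u - v) = dmoment q u - dmoment q v"
  by (simp add: dmoment_def commutator_def bil_diff matrix_diff_ldistrib matrix_diff_rdistrib)

lemma dmoment_sp: "q \<in> PS ==> u \<in> PS ==> dmoment q u \<in> sp \<omega>"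
  unfolding dmoment_def phase_space_def by (auto intro!: sp_closed(1) commutator_sp bil_sp)

text \<open>\<open>(x, y, i) \<mapsto> [x, y] + i\<^sup>2\<close> is the moment map of the action of the symplectic group.\<close>

lemma \<Omega>_infact:
  assumes s: "s \<in> sp \<omega>"
  shows "\<Omega> (infact s q) u = - trace (s ** dmoment q u)"
proof -
  obtain x y i where q: "q = (x, y, i)" by (cases q) auto
  obtain u1 u2 u3 where u: "u = (u1, u2, u3)" by (cases u) auto
  have 1: "trace (commutator s y ** u1) = - trace (s ** commutator u1 y)"
  proof -
    have "trace (y ** s ** u1) = trace (s ** u1 ** y)"
      using trace_mul_sym[of y "s ** u1"] by (simp add: matrix_mul_assoc)
    then show ?thesis
      unfolding commutator_def matrix_diff_ldistrib matrix_diff_rdistrib trace_diff matrix_mul_assoc by simp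
  qed
  have 2: "trace (u2 ** commutator s x) = trace (s ** commutator x u2)"
  proof -
    have "trace (u2 ** s ** x) = trace (s ** x ** u2)"
      using trace_mul_sym[of u2 "s ** x"] by (simp add: matrix_mul_assoc)
    moreover have "trace (u2 ** x ** s) = trace (s ** u2 ** x)"
      using trace_mul_sym[of "u2 ** x" s] by (simp add: matrix_mul_assoc)
    ultimately show ?thesis
      unfolding commutator_def matrix_diff_ldistrib matrix_diff_rdistrib trace_diff matrix_mul_assoc by simp
  qed
  have 3: "\<omega> (s *v i) u3 = - trace (s ** bil i u3)"
    using trace_bil[OF s, of i u3] trace_mul_sym[of s "bil i u3"] \<omega>_skew[of "s *v i" u3] by simp
  show ?thesis
    unfolding \<Omega>_eq infact_def dmoment_def q u fst_conv snd_conv 1 2 3 matrix_add_ldistrib trace_plus by simp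
qed

text \<open>The derivative of the equivariance of the moment map; at zeros of the moment map the
  right-hand side vanishes, so orbit directions lie in the kernel of \<open>dmoment\<close>.\<close>

lemma dmoment_infact:
  assumes r: "r \<in> sp \<omega>"
  shows "dmoment q (infact r q) = commutator r (commutator (fst q) (fst (snd q)) + sq (snd (snd q)))"
proof -
  obtain x y i where q: "q = (x, y, i)" by (cases q) auto
  have "commutator (commutator r x) y + commutator x (commutator r y) = commutator r (commutator x y)"
    unfolding commutator_def matrix_diff_ldistrib matrix_diff_rdistrib matrix_mul_assoc by (simp add: algebra_simps)
  moreover have "bil i (r *v i) = commutator r (sq i)"
  proof -
    have "bil i (r *v i) *v v = commutator r (sq i) *v v" for v
      unfolding commutator_def
      by (simp add: bil_mult matrix_vector_mult_diff_rdistrib sq_mult spD[OF r] vector_scalar_commute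
          flip: matrix_vector_mul_assoc)
    then show ?thesis by (simp add: matrix_eq)
  qed
  moreover have "commutator r (A + B) = commutator r A + commutator r B" for A B
    by (simp add: commutator_def matrix_add_ldistrib matrix_add_rdistrib)
  ultimately show ?thesis
    by (simp only: dmoment_def infact_def q fst_conv snd_conv)
qed

lemma infact_velocity:
  assumes q: "q \<in> XP p"
  shows "velocity (XP p) q (infact (sq u) q)"
  unfolding infact_def
proof (rule velocityI[where ?M1.0 = "\<lambda>t. fst (act (tv t u) q)" and ?M2.0 = "\<lambda>t. fst (snd (act (tv t u) q))"
    and ?M3.0 = "\<lambda>t. snd (snd (act (tv t u) q))"])
  show "(fst (act (tv t u) q), fst (snd (act (tv t u) q)), snd (snd (act (tv t u) q))) \<in> XP p" for t
    using Xpart_act[OF tv_Sp q] by simp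
  show "(fst (act (tv 0 u) q), fst (snd (act (tv 0 u) q)), snd (snd (act (tv 0 u) q))) = q"
    by (simp add: tv_0 act_1)
  have E: "((\<lambda>t. tv t u) has_derivative (\<lambda>t. mscale t (sq u))) (at 0)"
    by (rule tv_derivative[OF bounded_linear_ident])
  have c: "((\<lambda>t. tv t u ** A ** adj (tv t u)) has_derivative (\<lambda>t. mscale t (commutator (sq u) A))) (at 0)" for A
    using conj_derivative[OF E tv_0 sq_sp, of "\<lambda>_. A" 0] by simp
  show "((\<lambda>t. fst (act (tv t u) q)) has_derivative (\<lambda>t. mscale t (commutator (sq u) (fst q)))) (at 0)"
    "((\<lambda>t. fst (snd (act (tv t u) q))) has_derivative (\<lambda>t. mscale t (commutator (sq u) (fst (snd q))))) (at 0)"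
    unfolding act_def fst_conv snd_conv by (rule c)+
  have "((\<lambda>t. tv t u *v snd (snd q)) has_derivative (\<lambda>t. mscale t (sq u) *v snd (snd q))) (at 0)"
    by (rule bounded_linear.has_derivative[OF bounded_bilinear.bounded_linear_left[OF bounded_bilinear_mulvec] E])
  then show "((\<lambda>t. snd (snd (act (tv t u) q))) has_derivative (\<lambda>t. t *s (sq u *v snd (snd q)))) (at 0)"
    unfolding act_def snd_conv by (simp add: mscale_mult_vec)
qed

end

section \<open>Isotropy along a piece with even parts\<close>

context slice
begin

text \<open>An isotropic subspace of half the dimension is its own orthogonal: a basis of it
  together with dual vectors is a basis of the whole space, and orthogonality to it kills the
  components along the dual vectors. Here the evenness of all parts enters, through the dimension of
  \<open>L y\<close>.\<close>

lemma L_perp: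
  assumes dim: "CARD('m) = 2 * b" and v: "\<And>j. j \<in> L y ==> \<omega> j v = 0"
  shows "v \<in> L y"
proof -
  have lL: "l k \<in> L y" if "k < b" for k
  proof -
    have "(\<Sum>i<b. (if i = k then 1 else 0) *s l i) = (\<Sum>i<b. if i = k then l i else 0)" by (intro sum.cong) auto
    then show ?thesis using lc.pt_in[of "\<lambda>i. if i = k then 1 else 0"] that by simp
  qed
  have indl: "inj_on l {..<b} \<and> vec.independent (l ` {..<b})" using lc.chart_basis by blast
  have "\<exists>d. \<forall>u\<in>l ` {..<b}. d u \<in> UNIV \<and> (\<forall>u'\<in>l ` {..<b}. \<omega> u' (d u) = (if u' = u then 1 else 0))"
    using indl by (intro vec.dual_vectors[OF vec.subspace_UNIV \<omega>_linear nondeg]) auto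
  then obtain d where d: "\<forall>u\<in>l ` {..<b}. d u \<in> UNIV \<and> (\<forall>u'\<in>l ` {..<b}. \<omega> u' (d u) = (if u' = u then 1 else 0))"
    by (elim exE)
  then have dl: "\<omega> (l j) (d (l k)) = (if j = k then 1 else 0)" if "j < b" "k < b" for j k
    using that indl by (auto simp: inj_on_def)
  define g where "g k = (if k < b then l k else d (l (k - b)))" for k
  have sum: "(\<Sum>k<b + b. c k *s g k) = (\<Sum>k<b. c k *s l k) + (\<Sum>k<b. c (b + k) *s d (l k))" for c
    unfolding sum_lessThan_add by (simp add: g_def)
  have pair: "\<omega> (l j) (\<Sum>k<b + b. c k *s g k) = c (b + j)" if j: "j < b" for c j
  proof -
    have "\<omega> (l j) (\<Sum>k<b. c k *s l k) = 0"
      by (rule L_isotropic[OF y type lL[OF j] lc.pt_in])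
    moreover have "\<omega> (l j) (\<Sum>k<b. c (b + k) *s d (l k)) = (\<Sum>k<b. if j = k then c (b + k) else 0)"
      unfolding \<omega>_sum \<omega>_simps using dl j by (intro sum.cong) auto
    ultimately show ?thesis unfolding sum \<omega>_simps(1) using j by simp
  qed
  have "c k = 0" if z: "(\<Sum>k<b + b. c k *s g k) = 0" and k: "k < b + b" for c k
  proof -
    have c2: "c (b + j) = 0" if "j < b" for j using pair[OF that, of c] z by simp
    then have "(\<Sum>k<b. c k *s l k) = 0" using z unfolding sum by simp
    then have "c j = 0" if "j < b" for j using lc.x_pt[OF that, of c] lc.linear_scale[OF lc.linear_x[OF that], of 0 0] by simp
    then show ?thesis using c2[of "k - b"] k by (cases "k < b") auto
  qed
  then have ind: "inj_on g {..<b + b} \<and> vec.independent (g ` {..<b + b})"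
    using family_independent[of "{..<b + b}" g] by blast
  have "UNIV \<subseteq> vec.span (g ` {..<b + b})"
    using ind dim by (intro vec.card_ge_dim_independent) (auto simp: card_image vec.dim_UNIV card_cart_basis)
  then have "v \<in> vec.span (g ` {..<b + b})" by blast
  then obtain u where "v = (\<Sum>w\<in>g ` {..<b + b}. u w *s w)" using vec.span_finite[of "g ` {..<b + b}"] by auto
  then have v': "v = (\<Sum>k<b + b. u (g k) *s g k)" using ind by (simp add: sum.reindex)
  have "u (g (b + j)) = 0" if j: "j < b" for j
    using pair[OF j, of "\<lambda>k. u (g k)"] v[OF lL[OF j]] by (simp flip: v')
  then have "v = (\<Sum>k<b. u (g k) *s l k)" unfolding v' sum[of "\<lambda>k. u (g k)"] by simp
  then show ?thesis using lc.pt_in by simp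
qed

text \<open>Three kinds of velocity are tested. Orbit directions put \<open>u\<close> and
  \<open>v\<close> into the kernel of \<open>dmoment q\<close>; directions \<open>(z, 0, 0)\<close>
  with \<open>z\<close> centralizing \<open>y\<close> allow the second component to be removed by
  the infinitesimal action; directions \<open>(d, 0, j)\<close> with \<open>j \<in> L y\<close> then
  force the vector component into \<open>L y\<close>. What remains pairs to 0 since
  \<open>L y\<close> is isotropic.\<close>

lemma isotropic:
  assumes dim: "CARD('m) = 2 * b" and q: "q \<in> XP p" "fst (snd q) = y"
    and u: "u \<in> PS" "\<And>v. velocity (XP p) q v ==> \<Omega> v u = 0"
    and v: "v \<in> PS" "\<And>w. velocity (XP p) q w ==> \<Omega> w v = 0"
  shows "\<Omega> u v = 0"
proof -
  define x where "x = fst q"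
  define i where "i = snd (snd q)"
  have q': "q = (x, y, i)" using q(2) by (simp add: x_def i_def prod_eq_iff)
  have qW: "q \<in> PS" using q(1) Xpart_phase by blast
  have x: "x \<in> sp \<omega>" and eq: "commutator x y + sq i = 0" using q(1) by (auto simp: Xpart_iff q')
  have i: "i \<in> L y" by (rule fibre_L[OF y eq])
  \<comment> \<open>By the moment map identity, orthogonality to the orbit direction of
    \<open>sq w\<close> kills the trace against \<open>sq w\<close>, and squares span
    \<open>sp\<close>.\<close>
  have dm0: "dmoment q u = 0" if u: "u \<in> PS" "\<And>v. velocity (XP p) q v ==> \<Omega> v u = 0" for u
  proof (rule trace_sp_nondeg[OF dmoment_sp[OF qW u(1)]])
    interpret vs: vector_space "mscale :: complex => complex^'m^'m => _" by (rule vector_space_mscale)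
    fix s assume "s \<in> sp \<omega>"
    then have "s \<in> spc.span (range sq)" using sp_span_squares by blast
    then show "trace (dmoment q u ** s) = 0"
    proof (induction rule: spc.span_induct_alt)
      case base
      then show ?case by (simp add: trace_def)
    next
      case (step c s t)
      then obtain w where "s = sq w" by blast
      then have "trace (dmoment q u ** s) = 0"
        using \<Omega>_infact[OF sq_sp, of w q u] u(2)[OF infact_velocity[OF q(1), of w]] trace_mul_sym[of s "dmoment q u"] by simp
      then show ?case using step by (simp add: matrix_add_ldistrib trace_plus mscale_mult trace_mscale)
    qed
  qed
  have zc: "\<exists>r\<in>sp \<omega>. commutator r y = fst (snd u)"
    if u: "u \<in> PS" "\<And>v. velocity (XP p) q v ==> \<Omega> v u = 0" for u
  proof (rule sp_image_ad[OF y])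
    show "fst (snd u) \<in> sp \<omega>" using u(1) by (auto simp: phase_space_def)
    fix z assume z: "z \<in> sp \<omega>" "z ** y = y ** z"
    have "velocity (XP p) q (z, 0, 0)"
    proof (rule velocityI[where ?M1.0 = "\<lambda>h. x + mscale h z" and ?M2.0 = "\<lambda>_. y" and ?M3.0 = "\<lambda>_. i"])
      have "commutator (mscale h z) y = 0" for h using z(2) by (simp add: commutator_def mscale_mult)
      then show "(x + mscale h z, y, i) \<in> XP p" for h
        using x eq y type sp_closed(2)[OF z(1)] by (simp add: Xpart_iff sp_closed(1) commutator_add)
      show "(x + mscale 0 z, y, i) = q" by (simp add: q')
      show "((\<lambda>h. x + mscale h z) has_derivative (\<lambda>h. mscale h z)) (at 0)"
        using has_derivative_add[OF has_derivative_const mscale_derivative, of x z] by simp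
    qed (simp_all add: vec_eq_iff)
    from u(2)[OF this] show "trace (fst (snd u) ** z) = 0" by (simp add: \<Omega>_eq trace_def)
  qed
  obtain r where r: "r \<in> sp \<omega>" "commutator r y = fst (snd u)" using zc[OF u] by blast
  obtain t where t: "t \<in> sp \<omega>" "commutator t y = fst (snd v)" using zc[OF v] by blast
  \<comment> \<open>Subtracting an orbit direction removes the component along the second matrix and
    leaves the pairings unchanged, since orbit directions are orthogonal to the kernel of
    \<open>dmoment q\<close>.\<close>
  define u' where "u' = u - infact r q"
  define v' where "v' = v - infact t q"
  have yz: "fst (snd u') = 0" "fst (snd v') = 0"
    using r t by (simp_all add: u'_def v'_def infact_def q')
  have dmi: "dmoment q (infact s q) = 0" if "s \<in> sp \<omega>" for s
    using dmoment_infact[OF that, of q] eq by (simp add: q' commutator_def)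
  have perp_inf: "\<Omega> (infact s q) w = 0" if "s \<in> sp \<omega>" "dmoment q w = 0" for s w
    using \<Omega>_infact[OF that(1), of q w] that(2) by (simp add: trace_def)
  have dmu: "dmoment q u = 0" "dmoment q v = 0" using dm0 u v by auto
  have dmu': "dmoment q u' = 0" "dmoment q v' = 0"
    unfolding u'_def v'_def dmoment_diff using dmu dmi r(1) t(1) by auto
  have iL: "snd (snd w - snd (infact s q)) \<in> L y"
    if w: "\<And>v. velocity (XP p) q v ==> \<Omega> v w = 0" and s: "s \<in> sp \<omega>" "commutator s y = fst (snd w)" for w s
  proof (rule L_perp[OF dim])
    fix j assume j: "j \<in> L y"
    have Gsum: "bil i j \<in> sp \<omega>" by (rule bil_sp)
    interpret G: Vector_Spaces.linear mscale mscale G by (rule G(1))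
    define d where "d = G (- bil i j)"
    have Gb: "d = G (- sq (i + j)) - G (- sq i) - G (- sq j)"
      unfolding d_def bil_def G.diff[symmetric] by (rule arg_cong[of _ _ G]) simp
    have com\<xi>: "commutator d y = - bil i j"
    proof -
      have "i + j \<in> L y" using i j subspace_L vec.subspace_add by blast
      then show ?thesis unfolding Gb commutator_diff bil_def using commutator_G i j by simp
    qed
    \<comment> \<open>The vector is moved along \<open>i + h j\<close>, and
      \<open>sq (i + h *s j)\<close> has a linear and a quadratic term in \<open>h\<close>. Their
      corrections in \<open>x\<close> are \<open>d\<close> and \<open>G (- sq j)\<close>, so the
      curve stays in the piece for every \<open>h\<close>.\<close>
    have "velocity (XP p) q (d, 0, j)"
    proof (rule velocityI[where ?M1.0 = "\<lambda>h. x + mscale h d + mscale (h * h) (G (- sq j))" and ?M2.0 = "\<lambda>_. y" and ?M3.0 = "\<lambda>h. i + h *s j"])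
      fix h
      have "sq (i + h *s j) = sq i + mscale h (bil i j) + mscale (h * h) (sq j)"
      proof -
        have "sq (i + h *s j) *v w = (sq i + mscale h (bil i j) + mscale (h * h) (sq j)) *v w" for w
          by (simp add: sq_mult bil_mult matrix_vector_mult_add_rdistrib mscale_mult_vec \<omega>_simps vec_eq_iff field_simps)
        then show ?thesis by (simp add: matrix_eq)
      qed
      moreover have "commutator (mscale c A) y = mscale c (commutator A y)" for c A
        by (simp add: commutator_def mscale_mult vec_eq_iff right_diff_distrib)
      moreover have "mscale c (- A) = - mscale c A" for c and A :: "complex^'m^'m" by (simp add: vec_eq_iff)
      ultimately have "commutator (x + mscale h d + mscale (h * h) (G (- sq j))) y + sq (i + h *s j) = commutator x y + sq i"
        by (simp add: commutator_add com\<xi> commutator_G[OF j])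
      then show "(x + mscale h d + mscale (h * h) (G (- sq j)), y, i + h *s j) \<in> XP p"
        using x eq y type G(2) by (simp add: Xpart_iff d_def sp_closed(1,2))
    next
      show "(x + mscale 0 d + mscale (0 * 0) (G (- sq j)), y, i + 0 *s j) = q" by (simp add: q')
      have "((\<lambda>h. mscale (h * h) (G (- sq j))) has_derivative (\<lambda>h. mscale (0 * h + h * 0) (G (- sq j)))) (at 0)"
        by (rule bounded_linear.has_derivative[OF bounded_bilinear.bounded_linear_left[OF bounded_bilinear_mscale]])
          (auto intro!: derivative_eq_intros)
      from has_derivative_add[OF has_derivative_add[OF has_derivative_const mscale_derivative] this]
      show "((\<lambda>h. x + mscale h d + mscale (h * h) (G (- sq j))) has_derivative (\<lambda>h. mscale h d)) (at 0)"
        by simp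
      have "bounded_linear (\<lambda>h. h *s j)"
        unfolding linear_conv_bounded_linear[symmetric]
        by (rule linearI) (simp_all add: scaleR_vec scaleR_conv_of_real[where 'a = complex] vec.scale_left_distrib)
      from has_derivative_add[OF has_derivative_const bounded_linear_imp_has_derivative[OF this]]
      show "((\<lambda>h. i + h *s j) has_derivative (\<lambda>h. h *s j)) (at 0)" by simp
    qed (simp_all add: vec_eq_iff)
    from w[OF this] have 1: "\<Omega> (d, 0, j) w = 0" .
    have "commutator x 0 = 0" by (simp add: commutator_def)
    then have "dmoment q (d, 0, j) = 0" by (simp add: dmoment_def q' com\<xi>)
    then have "\<Omega> (infact s q) (d, 0, j) = 0" by (rule perp_inf[OF s(1)])
    then have 2: "\<Omega> (d, 0, j) (infact s q) = 0" using \<Omega>_skew[of "(d, 0, j)" "infact s q"] by simp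
    have "\<Omega> (d, 0, j) (w - infact s q) = 0" using 1 2 by (simp add: \<Omega>_diff)
    moreover have "fst (snd (w - infact s q)) = 0" using s(2) by (simp add: infact_def q')
    ultimately show "\<omega> j (snd (snd w - snd (infact s q))) = 0" by (simp add: \<Omega>_eq trace_def)
  qed
  have "snd (snd u') \<in> L y" "snd (snd v') \<in> L y"
    using iL[OF u(2) r] iL[OF v(2) t] by (simp_all add: u'_def v'_def)
  then have "\<omega> (snd (snd u')) (snd (snd v')) = 0" by (rule L_isotropic[OF y type])
  then have "\<Omega> u' v' = 0" by (simp add: \<Omega>_eq yz trace_def)
  moreover have "\<Omega> u' (infact t q) = 0"
    using \<Omega>_skew[of u' "infact t q"] perp_inf[OF t(1) dmu'(1)] by simp
  ultimately have "\<Omega> u' v = 0" by (simp add: v'_def \<Omega>_diff)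
  then show ?thesis using perp_inf[OF r(1) dmu(2)] by (simp add: u'_def \<Omega>_diff)
qed

end

section \<open>From isotropy on even pieces to Lagrangian tangent spaces\<close>

context phase
begin

text \<open>A maximal closure containing the point is an irreducible component, and the components
  are the closures of the even pieces.\<close>

lemma Xnil_even_closure:
  assumes q: "q \<in> Xnil \<omega>"
  shows "\<exists>p\<in>even_partitions n. q \<in> ch.zcl (XP p)"
proof -
  note irr = ch.irreducible_closed_sub[OF Xnil_sub Xnil_closed]
  have XW: "XP r \<subseteq> PS" for r using Xpart_Xnil Xnil_sub by blast
  define F where "F = (\<lambda>r. ch.zcl (XP r)) ` {r \<in> parts. XP r \<noteq> {}}"
  have finF: "finite F" unfolding F_def using finite_partitions[of "2 * n", folded parts_def] by simp
  obtain p where p: "p \<in> parts" "q \<in> XP p" using q unfolding Xnil_Union by blast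
  then have "ch.zcl (XP p) \<in> F" unfolding F_def by blast
  then obtain M where M: "M \<in> F" "ch.zcl (XP p) \<subseteq> M" "\<And>M'. M' \<in> F ==> M \<subseteq> M' ==> M' = M"
    using finite_has_maximal2[OF finF] by metis
  have irrF: "irreducible_closed (Xnil_top \<omega>) M'" if M': "M' \<in> F" for M'
  proof -
    obtain r where r: "XP r \<noteq> {}" "M' = ch.zcl (XP r)" using M' unfolding F_def by blast
    show ?thesis unfolding Xnil_top_def irr r(2)
      using ch.zcl_minimal[OF Xpart_Xnil Xnil_closed] ch.zcl_zcl ch.prime_zcl[OF XW] piece(2)[OF r(1)] by blast
  qed
  have "M \<in> irreducible_components (Xnil_top \<omega>)"
    unfolding irreducible_components_def
  proof (intro CollectI conjI irrF[OF M(1)] allI impI)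
    fix C assume C: "irreducible_closed (Xnil_top \<omega>) C" "M \<subseteq> C"
    then have C': "C \<subseteq> Xnil \<omega>" "ch.prime_set C" unfolding Xnil_top_def irr by auto
    have "C \<subseteq> (\<Union>r\<in>parts. ch.zcl (XP r))"
      using C'(1) ch.zcl_subset[OF XW] unfolding Xnil_Union by blast
    then obtain r where r: "r \<in> parts" "C \<subseteq> ch.zcl (XP r)"
      using ch.prime_subset_Union[OF C'(2) _ finite_partitions[of "2 * n", folded parts_def]] C'(1) Xnil_sub by blast
    have "C \<noteq> {}" using C'(2) by (simp add: prime_on_def)
    have "XP r \<noteq> {}"
    proof
      assume "XP r = {}"
      then have "ch.zcl (XP r) = {}" using ch.zcl_vanish[OF ispoly_const[of _ 1], of "XP r"] by auto
      then show False using r(2) \<open>C \<noteq> {}\<close> by blast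
    qed
    then have "ch.zcl (XP r) = M" using M(3) r C(2) unfolding F_def by blast
    then show "C = M" using r(2) C(2) by blast
  qed
  then obtain r where r: "r \<in> even_partitions n" "M = Xnil_top \<omega> closure_of XP r"
    using components_Xnil unfolding bij_betw_def by blast
  have "M = ch.zcl (XP r)"
    unfolding r(2) Xnil_top_def by (rule ch.closure_of_sub[OF Xnil_sub Xnil_closed Xpart_Xnil])
  then show ?thesis using r(1) p(2) M(2) ch.zcl_subset[OF XW, of p] by blast
qed

lemma isotropic_even:
  assumes p: "p \<in> even_partitions n" and q: "q \<in> XP p"
    and u: "u \<in> PS" "\<And>v. velocity (XP p) q v ==> \<Omega> v u = 0"
    and v: "v \<in> PS" "\<And>w. velocity (XP p) q w ==> \<Omega> w v = 0"
  shows "\<Omega> u v = 0"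
proof -
  have y: "fst (snd q) \<in> sp \<omega>" "jordan_type (fst (snd q)) p" using q by (auto simp: Xpart_iff)
  obtain f ck l ln a w G where "slice \<omega> N e x D es xs n f ck (fst (snd q)) (\<Sum>x\<in>#p. x div 2) l ln p a w G"
    using slice_exists[OF y] by (elim exE)
  then interpret s: slice \<omega> N e x D es xs n f ck "fst (snd q)" "\<Sum>x\<in>#p. x div 2" l ln p a w G .
  have "p \<in> parts" using p unfolding even_parts by blast
  then have "dm p = D + n" using p by (rule dm_parts(3))
  then have "CARD('m) = 2 * (\<Sum>x\<in>#p. x div 2)" using card by (simp add: dm_def)
  then show ?thesis using q refl u v by (rule s.isotropic)
qed

text \<open>A velocity is known only through functionals; for curves in \<open>PS\<close> these see
  it as the point of \<open>PS\<close> with the same coordinates.\<close>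

lemma velocity_linear:
  assumes vel: "velocity Z q v" and Z: "Z \<subseteq> PS" and l: "functional cscale l"
  shows "l v = (\<Sum>k<N. x k v * l (e k))"
proof -
  obtain s where s: "\<And>t. s t \<in> Z" "\<And>l. functional cscale l ==> ((\<lambda>t::complex. l (s t)) has_field_derivative l v) (at 0)"
    using vel unfolding velocity_def by auto
  have "((\<lambda>t. \<Sum>k<N. x k (s t) * l (e k)) has_field_derivative (\<Sum>k<N. x k v * l (e k))) (at 0)"
    by (intro DERIV_sum DERIV_cmult_right s(2) ch.linear_x) auto
  moreover have "(\<lambda>t. \<Sum>k<N. x k (s t) * l (e k)) = (\<lambda>t. l (s t))"
  proof
    fix t
    have "s t \<in> PS" using s(1) Z by blast
    then show "(\<Sum>k<N. x k (s t) * l (e k)) = l (s t)" using ch.linear_W[OF l] by simp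
  qed
  ultimately show ?thesis using DERIV_unique[OF s(2)[OF l]] by simp
qed

text \<open>The orthogonal of the tangent space \<open>T\<close> is spanned by the Hamiltonian
  vectors \<open>U f p\<close> of functions vanishing on \<open>Xnil \<omega>\<close>. Vanishing of
  their Poisson brackets puts these vectors into \<open>T\<close>, so \<open>T\<close> is
  coisotropic; at a smooth point its dimension is at most half that of the phase space, which forces
  equality.\<close>

lemma lagrangian_tangent:
  assumes smooth: "smooth_point cscale PS (Xnil \<omega>) p"
  shows "lagrangian_subspace cscale PS \<Omega> (tangent_space cscale PS (Xnil \<omega>) p)"
proof -
  let ?W = "PS" and ?Z = "Xnil \<omega>"
  define T where "T = tangent_space cscale ?W ?Z p"
  have pZ: "p \<in> ?Z" and dimT: "enat (ch.dim T) = local_dim (Xnil_top \<omega>) p"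
    using smooth unfolding smooth_point_def T_def Xnil_top_def by auto
  then have pW: "p \<in> ?W" using Xnil_sub by blast
  obtain N' e' x' where "affine_chart (mscale :: complex => complex^'m^'m => _) UNIV N' e' x'" using matrix_chart by blast
  from triple_chart[OF this] obtain e'' x'' N'' where ch'': "affine_chart (cscale :: complex => 'm triple => _) UNIV N'' e'' x''"
    by auto
  interpret fd: finite_dimensional_vector_space "cscale :: complex => 'm triple => _" "e'' ` {..<N''}"
    by (rule affine_chart.chart_finite_dimensional[OF ch'' refl])
  have "\<forall>f. \<exists>Df. polyfun cscale f --> poly_derivative cscale f Df"
    using polyfun_derivative[OF vector_space_cscale] by blast
  then have "\<exists>Dd. \<forall>f. polyfun cscale f --> poly_derivative cscale f (Dd f)" by (rule choice)
  then obtain Dd where Dd: "\<forall>f. polyfun cscale f --> poly_derivative cscale f (Dd f :: 'm triple => 'm triple => complex)"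
    by (elim exE)
  define I where "I = {f. polyfun cscale f \<and> (\<forall>q\<in>?Z. f q = 0)}"
  have DI: "poly_derivative cscale f (Dd f)" if "f \<in> I" for f
    using Dd that unfolding I_def by blast
  have Dpoly: "ispoly (linfuns cscale) (\<lambda>p. Dd f p v)" if "f \<in> I" for f v
    using DI[OF that] unfolding poly_derivative_def by (elim conjE) (rule spec)
  have Dlin: "functional cscale (Dd f q)" if "f \<in> I" for f q
    using DI[OF that] unfolding poly_derivative_def by (elim conjE) (rule spec)
  have Dder: "((\<lambda>s. f (z s)) has_field_derivative Dd f (z 0) v) (at 0)"
    if f: "f \<in> I" and z: "\<And>l. functional cscale l ==> ((\<lambda>s. l (z s)) has_field_derivative l v) (at 0)" for f z v
  proof -
    have "\<forall>l\<in>linfuns cscale. ((\<lambda>s. l (z s)) has_field_derivative l v) (at 0)" using z by blast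
    then show ?thesis using DI[OF f] unfolding poly_derivative_def by blast
  qed
  have Dline: "((\<lambda>t. f (p + cscale t v)) has_field_derivative Dd f p v) (at 0)" if f: "f \<in> I" for f v
  proof -
    have "((\<lambda>s. f (p + cscale s v)) has_field_derivative Dd f (p + cscale 0 v) v) (at 0)"
    proof (rule Dder[OF f])
      fix l :: "'m triple => complex" assume l: "functional cscale l"
      show "((\<lambda>s. l (p + cscale s v)) has_field_derivative l v) (at 0)"
        unfolding ch.linear_add[OF l] ch.linear_scale[OF l] by (auto intro!: derivative_eq_intros)
    qed
    then show ?thesis by (simp add: ch.scale_zero_left)
  qed
  have T_eq: "T = {v \<in> ?W. \<forall>f\<in>I. Dd f p v = 0}"
  proof -
    have vi: "vanishing_ideal cscale ?W ?Z = (\<lambda>f. restrict f ?W) ` I"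
    proof
      show "vanishing_ideal cscale ?W ?Z \<subseteq> (\<lambda>f. restrict f ?W) ` I"
      proof
        fix g assume g: "g \<in> vanishing_ideal cscale ?W ?Z"
        then obtain f where f: "g = restrict f ?W" "polyfun cscale f" "\<forall>q\<in>?Z. g q = 0"
          unfolding vanishing_ideal_def carrier_coord_ring by blast
        have "f q = 0" if "q \<in> ?Z" for q using f(1,3) that Xnil_sub by (metis restrict_apply' subsetD)
        then show "g \<in> (\<lambda>f. restrict f ?W) ` I" using f unfolding I_def by blast
      qed
      show "(\<lambda>f. restrict f ?W) ` I \<subseteq> vanishing_ideal cscale ?W ?Z"
      proof
        fix g assume "g \<in> (\<lambda>f. restrict f ?W) ` I"
        then obtain f where f: "g = restrict f ?W" "f \<in> I" by blast
        have "g q = 0" if "q \<in> ?Z" for q using f that Xnil_sub unfolding I_def by auto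
        then show "g \<in> vanishing_ideal cscale ?W ?Z"
          using f unfolding vanishing_ideal_def carrier_coord_ring I_def by blast
      qed
    qed
    have "((\<lambda>t. restrict f ?W (p + cscale t v)) has_field_derivative 0) (at 0) \<longleftrightarrow> Dd f p v = 0"
      if f: "f \<in> I" and v: "v \<in> ?W" for f v
    proof -
      have "(\<lambda>t. restrict f ?W (p + cscale t v)) = (\<lambda>t. f (p + cscale t v))"
        using ch.line_W[OF pW v] by auto
      then show ?thesis using Dline[OF f, of v] DERIV_unique by fastforce
    qed
    then show ?thesis unfolding T_def tangent_space_def vi by auto
  qed
  have subT: "ch.subspace T"
  proof (rule ch.subspaceI)
    have W: "ch.subspace ?W" by (rule ch.chart_subspace)
    show "0 \<in> T" unfolding T_eq using ch.subspace_0[OF W] ch.linear_diff[OF Dlin, of _ p 0 0] by auto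
    fix u v assume "u \<in> T" "v \<in> T"
    then show "u + v \<in> T" unfolding T_eq using ch.subspace_add[OF W] ch.linear_add[OF Dlin, of _ p] by auto
  next
    fix c v assume "v \<in> T"
    then show "cscale c v \<in> T" unfolding T_eq using ch.subspace_scale[OF ch.chart_subspace] ch.linear_scale[OF Dlin, of _ p] by auto
  qed
  have TW: "T \<subseteq> ?W" unfolding T_eq by blast
  have eW: "e k \<in> ?W" if "k < N" for k
  proof -
    have "e k \<in> ch.span (e ` {..<N})" using that by (intro ch.span_base) auto
    then show ?thesis unfolding ch.chart_basis(3) .
  qed
  have "\<exists>d. \<forall>u\<in>e ` {..<N}. d u \<in> ?W \<and> (\<forall>u'\<in>e ` {..<N}. \<Omega> u' (d u) = (if u' = u then 1 else 0))"
    using ch.chart_basis(2) eW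
    by (intro fd.dual_vectors[OF ch.chart_subspace linear_\<Omega> \<Omega>_nondeg]) auto
  then obtain d' where d': "\<forall>u\<in>e ` {..<N}. d' u \<in> ?W \<and> (\<forall>u'\<in>e ` {..<N}. \<Omega> u' (d' u) = (if u' = u then 1 else 0))"
    by (elim exE)
  define d where "d k = d' (e k)" for k
  have d: "d k \<in> ?W" "j < N ==> \<Omega> (e j) (d k) = (if j = k then 1 else 0)" if "k < N" for j k
    using d' that ch.chart_basis(1) unfolding d_def inj_on_def by auto
  \<comment> \<open>The Hamiltonian vector of \<open>f\<close> at \<open>q\<close>, determined by
    \<open>\<Omega> v (U f q) = Dd f q v\<close> for \<open>v\<close> in the phase space.\<close>
  define U where "U f q = (\<Sum>k<N. cscale (Dd f q (e k)) (d k))" for f q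
  have U_W: "U f q \<in> ?W" for f q
    unfolding U_def using d(1) by (intro ch.subspace_sum ch.chart_subspace ch.subspace_scale) auto
  have \<Omega>sum: "\<Omega> v (\<Sum>k<N. cscale (c k) (w k)) = (\<Sum>k<N. c k * \<Omega> v (w k))" for v c w
  proof -
    interpret l: Vector_Spaces.linear cscale "(*)" "\<Omega> v" by (rule linear_\<Omega>(1))
    show ?thesis by (simp add: l.sum l.scale)
  qed
  have U_e: "\<Omega> (e j) (U f q) = Dd f q (e j)" if "j < N" for j f q
  proof -
    have "\<Omega> (e j) (U f q) = (\<Sum>k<N. if k = j then Dd f q (e k) else 0)"
      unfolding U_def \<Omega>sum using d(2) that by (intro sum.cong) auto
    then show ?thesis using that by simp
  qed
  have U_lin: "\<Omega> v (U f q) = Dd f q v" if f: "f \<in> I" and v: "\<And>l. functional cscale l ==> l v = (\<Sum>k<N. x k v * l (e k))" for f q v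
    using v[OF linear_\<Omega>(2), of "U f q"] v[OF Dlin[OF f], of q] U_e by simp
  have U_W': "\<Omega> v (U f q) = Dd f q v" if "f \<in> I" "v \<in> ?W" for f q v
    using ch.linear_W that by (intro U_lin) auto
  \<comment> \<open>The Poisson bracket of \<open>f\<close> and \<open>g\<close> at a point of an
    even piece. Both Hamiltonian vectors are orthogonal to the velocities there, because
    \<open>f\<close> and \<open>g\<close> are constant along curves in the piece.\<close>
  have iso: "Dd g q (U f q) = 0" if fg: "f \<in> I" "g \<in> I" and r: "r \<in> even_partitions n" "q \<in> XP r" for f g q r
  proof -
    have XW: "XP r \<subseteq> ?W" using Xpart_Xnil Xnil_sub by blast
    have vz: "\<Omega> v (U h q) = 0" if h: "h \<in> I" and vel: "velocity (XP r) q v" for h v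
    proof -
      obtain z where z: "\<And>s. z s \<in> XP r" "z 0 = q"
        "\<And>l. functional cscale l ==> ((\<lambda>s::complex. l (z s)) has_field_derivative l v) (at 0)"
        using vel unfolding velocity_def by auto
      have "((\<lambda>s. h (z s)) has_field_derivative Dd h (z 0) v) (at 0)" by (rule Dder[OF h z(3)])
      moreover have "(\<lambda>s. h (z s)) = (\<lambda>_. 0)" using h z(1) Xpart_Xnil unfolding I_def by blast
      ultimately have "Dd h q v = 0" using DERIV_unique[OF _ DERIV_const] z(2) by metis
      then show ?thesis using U_lin[OF h velocity_linear[OF vel XW], of q] by simp
    qed
    have "\<Omega> (U f q) (U g q) = 0"
      by (rule isotropic_even[OF r U_W vz[OF fg(1)] U_W vz[OF fg(2)]])
    then show ?thesis using U_W'[OF fg(2) U_W] by simp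
  qed
  \<comment> \<open>The bracket is polynomial in the point, so its vanishing on an even piece
    extends to the closure, in which \<open>p\<close> lies for a suitable piece.\<close>
  have U_T: "U f p \<in> T" if f: "f \<in> I" for f
    unfolding T_eq
  proof (intro CollectI conjI U_W ballI)
    fix g assume g: "g \<in> I"
    have Dsum: "Dd g q (U f q) = (\<Sum>k<N. Dd f q (e k) * Dd g q (d k))" for q
    proof -
      interpret l: Vector_Spaces.linear cscale "(*)" "Dd g q" by (rule Dlin[OF g])
      show ?thesis unfolding U_def by (simp add: l.sum l.scale)
    qed
    have "ispoly (linfuns cscale) (\<lambda>q. \<Sum>k<N. Dd f q (e k) * Dd g q (d k))"
      by (intro ispoly_sum ispoly_mult Dpoly f g)
    note poly = this
    obtain r where r: "r \<in> even_partitions n" "p \<in> ch.zcl (XP r)" using Xnil_even_closure[OF pZ] by blast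
    have "(\<Sum>k<N. Dd f p (e k) * Dd g p (d k)) = 0"
      by (rule ch.zcl_vanish[OF poly _ r(2)]) (use iso[OF f g r(1)] in "simp add: Dsum")
    then show "Dd g p (U f p) = 0" unfolding Dsum .
  qed
  \<comment> \<open>\<open>T\<close> is the orthogonal of the span of the Hamiltonian vectors, so by
    double orthogonality its own orthogonal is that span.\<close>
  have perp_T: "w \<in> T" if w: "w \<in> ?W" "\<And>v. v \<in> T ==> \<Omega> v w = 0" for w
  proof -
    have "w \<in> ch.span ((\<lambda>f. U f p) ` I)"
    proof (rule fd.double_perp[OF ch.chart_subspace ch.subspace_span _ linear_\<Omega> \<Omega>_nondeg w(1)])
      show "ch.span ((\<lambda>f. U f p) ` I) \<subseteq> ?W" by (intro ch.span_minimal ch.chart_subspace image_subsetI U_W)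
      fix v assume v: "v \<in> ?W" "\<And>u. u \<in> ch.span ((\<lambda>f. U f p) ` I) ==> \<Omega> u v = 0"
      have "Dd f p v = 0" if f: "f \<in> I" for f
      proof -
        have "\<Omega> (U f p) v = 0" using f by (intro v(2) ch.span_base) auto
        then show ?thesis using U_W'[OF f v(1), of p] \<Omega>_skew[of v "U f p"] by simp
      qed
      then have "v \<in> T" unfolding T_eq using v(1) by blast
      then show "\<Omega> w v = 0" using w(2) \<Omega>_skew[of w v] by simp
    qed
    moreover have "ch.span ((\<lambda>f. U f p) ` I) \<subseteq> T" by (intro ch.span_minimal subT image_subsetI U_T)
    ultimately show ?thesis by blast
  qed
  define P where "P = {w \<in> ?W. \<forall>u\<in>T. \<Omega> u w = 0}"
  have PT: "P \<subseteq> T" unfolding P_def using perp_T by blast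
  have subP: "ch.subspace P"
  proof (rule ch.subspaceI)
    have W: "ch.subspace ?W" by (rule ch.chart_subspace)
    show "0 \<in> P" unfolding P_def using ch.subspace_0[OF W] ch.linear_diff[OF linear_\<Omega>(1), of _ 0 0] by auto
    fix u v assume "u \<in> P" "v \<in> P"
    then show "u + v \<in> P" unfolding P_def using ch.subspace_add[OF W] ch.linear_add[OF linear_\<Omega>(1)] by auto
  next
    fix c v assume "v \<in> P"
    then show "cscale c v \<in> P" unfolding P_def using ch.subspace_scale[OF ch.chart_subspace] ch.linear_scale[OF linear_\<Omega>(1)] by auto
  qed
  \<comment> \<open>Smoothness enters here: the dimension of \<open>T\<close> is a local dimension,
    which is bounded by the Krull dimension \<open>D + n\<close>, half of \<open>N\<close>.\<close>
  have "enat (ch.dim T) \<le> krull_dim (Xnil_top \<omega>)"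
    unfolding dimT local_dim_def krull_dim_def by (rule Sup_subset_mono) auto
  then have "ch.dim T \<le> D + n" unfolding krull_dim_Xnil by (simp add: D)
  moreover have "ch.dim ?W \<le> ch.dim T + ch.dim P"
    unfolding P_def by (rule fd.dim_perp[OF ch.chart_subspace subT TW linear_\<Omega> \<Omega>_nondeg])
  ultimately have "ch.dim T \<le> ch.dim P" unfolding ch.chart_dim N by simp
  then have "P = T" by (rule fd.subspace_dim_equal[OF subP subT PT])
  moreover have "\<Omega> u v = 0 \<longleftrightarrow> \<Omega> v u = 0" for u v using \<Omega>_skew[of u v] by simp
  then have "P = {v \<in> ?W. \<forall>u\<in>T. \<Omega> v u = 0}" unfolding P_def by blast
  ultimately have "T = {v \<in> ?W. \<forall>u\<in>T. \<Omega> v u = 0}" by (rule subst)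
  then show ?thesis unfolding lagrangian_subspace_def T_def[symmetric] by (intro conjI subT TW)
qed

theorem lagrangian_Xnil: "lagrangian_subscheme cscale (phase_space \<omega>) \<Omega> (Xnil \<omega>)"
  unfolding lagrangian_subscheme_def ch.closedin_zariski using Xnil_sub Xnil_closed lagrangian_tangent by blast

end

theorem theorem1p1p2:
  fixes \<omega> :: "complex^'m::finite \<Rightarrow> complex^'m \<Rightarrow> complex" and n :: nat
  assumes "symplectic_form \<omega>" and "CARD('m) = 2 * n"
  shows
    "(zero_locus (phase_space \<omega>) (nil_ideal \<omega>) = Xnil \<omega> \<and>
      complete_intersection cscale (phase_space \<omega>) (nil_ideal \<omega>) \<and>
      krull_dim (Xnil_top \<omega>) = enat (2 * n\<^sup>2 + 2 * n) \<and>
      bij_betw (\<lambda>p. Xnil_top \<omega> closure_of Xpart \<omega> p)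
        (even_partitions n) (irreducible_components (Xnil_top \<omega>))) \<and>
     lagrangian_subscheme cscale (phase_space \<omega>) (phase_form \<omega>) (Xnil \<omega>)"
proof -
  interpret symp \<omega> by (rule symp.intro[OF assms(1)])
  obtain es xs where sp: "affine_chart mscale (sp \<omega>) (card pairs) es xs" using sp_chart by blast
  obtain e x where W: "affine_chart cscale (phase_space \<omega>) (card pairs + card pairs + CARD('m)) e x"
    using triple_chart[OF sp] unfolding phase_space_def by blast
  interpret phase \<omega> "card pairs + card pairs + CARD('m)" e x "card pairs" es xs n
    by (intro phase.intro phase_axioms.intro symp_axioms W sp assms(2) card_pairs) (simp add: assms(2))
  show ?thesis
    by (intro conjI zero_locus_nil complete_intersection_nil krull_dim_Xnil components_Xnil lagrangian_Xnil)
qed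

end
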